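(* Let $k$ be a positive integer and $g\in G_k$. There exists a unique $\Theta\in I_0^{k+1}$ such that $\Theta_*g$ is transverse. Further, $\Theta_*g\in G_k$. In particular, if $g\in G_k$ is transverse, the only $\Theta\in I_0^{k+1}$ such that $\Theta_*g$ is again transverse is the identity.
   Context: $\delta$ is the Euclidean metric on $\mathbb R^n$, $\rho(x)=\frac{1-|x|^2}{2}$, $b=\rho^{-2}\delta$ is the hyperbolic metric on $B_1(0)$, $\mathbb S^{n-1}=\partial B_1(0)$. A neighborhood of infinity is an open $U\subset B_1(0)$ containing $B_1(0)\setminus\overline B_{1-\epsilon}(0)$ for some $\epsilon>0$; $\tilde U=U\cup\mathbb S^{n-1}$. $G_k$ is the set of germs at infinity (pairs $(U,g)$, identified if they agree on a smaller neighborhood of infinity) of Riemannian metrics $g$ on $U$ such that $\rho^2g$ extends to a smooth metric on $\tilde U$ with $|g-b|_b=|\rho^2g-\delta|_\delta=O(\rho^k)$. A germ $g$ is transverse if it has a representative $(U,g)$ with $g(P,\cdot)=b(P,\cdot)$ on $U$, where $P=x^i\partial_i$ is the position vector field on $\mathbb R^n$. $I_0^{k+1}$ is the group of germs at infinity of diffeomorphisms $\Theta:\tilde U\to\Theta(\tilde U)$ (smooth up to $\mathbb S^{n-1}$) with $|\Theta(x)-x|_\delta=O(\rho^{k+1})$. *)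

theory Defs
  imports "HOL-Analysis.Analysis" "HOL-Library.Landau_Symbols"
begin

section \<open>Smoothness up to the boundary\<close>

text \<open>Continuous differentiability of order \<open>m\<close>; meaningful for open \<open>V\<close> only.\<close>

primrec Ck_on :: "nat \<Rightarrow> (real^'n) set \<Rightarrow> (real^'n \<Rightarrow> 'b::real_normed_vector) \<Rightarrow> bool" where
  "Ck_on 0 V f \<longleftrightarrow> continuous_on V f"
| "Ck_on (Suc m) V f \<longleftrightarrow>
     (\<forall>x\<in>V. f differentiable (at x)) \<and> (\<forall>v. Ck_on m V (\<lambda>x. frechet_derivative f (at x) v))"

text \<open>On a set that need not be open, smoothness means the existence of local smooth
  extensions, as usual for manifolds with boundary.\<close>

definition smooth_on :: "(real^'n) set \<Rightarrow> (real^'n \<Rightarrow> 'b::real_normed_vector) \<Rightarrow> bool" where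
  "smooth_on S f \<longleftrightarrow>
     (\<forall>x\<in>S. \<exists>V F. open V \<and> x \<in> V \<and> (\<forall>m. Ck_on m V F) \<and> (\<forall>y\<in>V \<inter> S. F y = f y))"


section \<open>Neighborhoods of infinity in the ball model\<close>

definition \<rho> :: "real^'n \<Rightarrow> real" where
  "\<rho> x = (1 - (norm x)\<^sup>2) / 2"

definition nbhd_infinity :: "(real^'n) set \<Rightarrow> bool" where
  "nbhd_infinity U \<longleftrightarrow>
     open U \<and> U \<subseteq> ball 0 1 \<and> (\<exists>\<epsilon>>0. ball 0 1 - cball 0 (1 - \<epsilon>) \<subseteq> U)"

definition tilde :: "(real^'n) set \<Rightarrow> (real^'n) set" where
  "tilde U = U \<union> sphere 0 1"

definition near_infinity :: "(real^'n) filter" where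
  "near_infinity = filtercomap norm (at_left 1)"

lemma eventually_near_infinity:
  "eventually P (near_infinity :: (real^'n) filter) \<longleftrightarrow>
     (\<exists>\<epsilon>>0. \<forall>x\<in>ball 0 1 - cball 0 (1 - \<epsilon>). P x)" (is "?L \<longleftrightarrow> ?R")
proof
  assume ?L
  then obtain Q where Q: "eventually Q (at_left (1::real))" "\<And>x::real^'n. Q (norm x) \<Longrightarrow> P x"
    unfolding near_infinity_def eventually_filtercomap by blast
  from Q(1) obtain b where b: "b < 1" "\<And>y. b < y \<Longrightarrow> y < 1 \<Longrightarrow> Q y"
    unfolding eventually_at_left_field by blast
  show ?R
    by (rule exI[of _ "1 - b"]) (use b Q(2) in auto)
next
  assume ?R
  then obtain \<epsilon> where e: "\<epsilon> > 0" "\<forall>x\<in>ball 0 1 - cball 0 (1 - \<epsilon>). P (x::real^'n)"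
    by blast
  have "eventually (\<lambda>y. 1 - \<epsilon> < y \<and> y < 1) (at_left (1::real))"
    unfolding eventually_at_left_field by (rule exI[of _ "1 - \<epsilon>"]) (use e(1) in auto)
  then show ?L
    unfolding near_infinity_def eventually_filtercomap using e(2) by force
qed


section \<open>Germs at infinity of Riemannian metrics\<close>

type_synonym 'n tensor2 = "real^'n \<Rightarrow> real^'n \<Rightarrow> real"
type_synonym 'n tensor2_field = "real^'n \<Rightarrow> 'n tensor2"
type_synonym 'n metric_germ = "((real^'n) set \<times> 'n tensor2_field) set"

definition riemannian_metric_on :: "(real^'n) set \<Rightarrow> 'n::finite tensor2_field \<Rightarrow> bool" where
  "riemannian_metric_on S g \<longleftrightarrow>
     (\<forall>x\<in>S. bilinear (g x) \<and> (\<forall>v w. g x v w = g x w v) \<and> (\<forall>v. v \<noteq> 0 \<longrightarrow> g x v v > 0)) \<and>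
     (\<forall>v w. smooth_on S (\<lambda>x. g x v w))"

definition euclidean_metric :: "'n::finite tensor2_field" where
  "euclidean_metric x v w = v \<bullet> w"

definition hyperbolic_metric :: "'n::finite tensor2_field" where
  "hyperbolic_metric x v w = euclidean_metric x v w / (\<rho> x)\<^sup>2"

text \<open>The norm on covariant 2-tensors induced by the Euclidean metric.\<close>

definition tensor2_norm :: "'n::finite tensor2 \<Rightarrow> real" where
  "tensor2_norm T = sqrt (\<Sum>u\<in>Basis. \<Sum>v\<in>Basis. (T u v)\<^sup>2)"

definition metric_reps :: "((real^'n) set \<times> 'n::finite tensor2_field) set" where
  "metric_reps = {(U, g). nbhd_infinity U \<and> riemannian_metric_on U g}"

definition metric_germ_rel ::
  "(((real^'n) set \<times> 'n::finite tensor2_field) \<times> ((real^'n) set \<times> 'n::finite tensor2_field)) set" where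
  "metric_germ_rel = {((U, g), (V, h)). (U, g) \<in> metric_reps \<and> (V, h) \<in> metric_reps \<and>
     (\<exists>W. nbhd_infinity W \<and> W \<subseteq> U \<inter> V \<and> (\<forall>x\<in>W. g x = h x))}"

definition metric_germs :: "'n::finite metric_germ set" where
  "metric_germs = metric_reps // metric_germ_rel"

definition G :: "nat \<Rightarrow> 'n::finite metric_germ set" where
  "G k = {\<gamma> \<in> metric_germs. \<exists>(U, g)\<in>\<gamma>. \<exists>h.
     riemannian_metric_on (tilde U) h \<and>
     (\<forall>x\<in>U. \<forall>v w. h x v w = (\<rho> x)\<^sup>2 * g x v w) \<and>
     (\<lambda>x. tensor2_norm (\<lambda>v w. (\<rho> x)\<^sup>2 * g x v w - euclidean_metric x v w))
       \<in> O[near_infinity](\<lambda>x. \<rho> x ^ k)}"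

definition position_field :: "real^'n \<Rightarrow> real^'n" where
  "position_field x = x"

definition transverse :: "'n::finite metric_germ \<Rightarrow> bool" where
  "transverse \<gamma> \<longleftrightarrow> (\<exists>(U, g)\<in>\<gamma>.
     \<forall>x\<in>U. \<forall>v. g x (position_field x) v = hyperbolic_metric x (position_field x) v)"


section \<open>Germs at infinity of diffeomorphisms\<close>

type_synonym 'n diffeo_germ = "((real^'n) set \<times> (real^'n \<Rightarrow> real^'n)) set"

text \<open>The image of \<open>tilde U\<close> is required to be of the form \<open>tilde V\<close> again, so that
  composition and pushforward make sense on germs. For maps at distance \<open>O(\<rho>\<^sup>2)\<close> from the
  identity this can always be achieved by shrinking \<open>U\<close>. The pair \<open>(U, \<theta>)\<close> represents
  the diffeomorphism \<open>\<theta>\<close> of \<open>tilde U\<close>; values of \<open>\<theta>\<close> elsewhere are irrelevant.\<close>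

definition diffeo_reps :: "((real^'n) set \<times> (real^'n \<Rightarrow> real^'n)) set" where
  "diffeo_reps = {(U, \<theta>). nbhd_infinity U \<and>
     (\<exists>V. nbhd_infinity V \<and> \<theta> ` tilde U = tilde V) \<and>
     inj_on \<theta> (tilde U) \<and> smooth_on (tilde U) \<theta> \<and>
     smooth_on (\<theta> ` tilde U) (inv_into (tilde U) \<theta>)}"

definition diffeo_germ_rel ::
  "(((real^'n) set \<times> (real^'n \<Rightarrow> real^'n)) \<times> ((real^'n) set \<times> (real^'n \<Rightarrow> real^'n))) set" where
  "diffeo_germ_rel = {((U, \<theta>), (V, \<eta>)). (U, \<theta>) \<in> diffeo_reps \<and> (V, \<eta>) \<in> diffeo_reps \<and>
     (\<exists>W. nbhd_infinity W \<and> W \<subseteq> U \<inter> V \<and> (\<forall>x\<in>tilde W. \<theta> x = \<eta> x))}"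

definition diffeo_germs :: "'n::finite diffeo_germ set" where
  "diffeo_germs = diffeo_reps // diffeo_germ_rel"

definition I0 :: "nat \<Rightarrow> 'n::finite diffeo_germ set" where
  "I0 m = {\<Theta> \<in> diffeo_germs. \<exists>(U, \<theta>)\<in>\<Theta>.
     (\<lambda>x. norm (\<theta> x - x)) \<in> O[near_infinity](\<lambda>x. \<rho> x ^ m)}"

definition id_germ :: "'n::finite diffeo_germ" where
  "id_germ = diffeo_germ_rel `` {(ball 0 1, \<lambda>x. x)}"

definition pushforward_metric ::
  "(real^'n) set \<Rightarrow> (real^'n \<Rightarrow> real^'n) \<Rightarrow> 'n::finite tensor2_field \<Rightarrow> 'n::finite tensor2_field" where
  "pushforward_metric U \<theta> g = (\<lambda>y v w.
     g (inv_into U \<theta> y)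
       (frechet_derivative (inv_into U \<theta>) (at y) v)
       (frechet_derivative (inv_into U \<theta>) (at y) w))"

text \<open>The germ of \<open>\<theta>\<^sub>* g\<close>, computed from any representatives \<open>\<theta>\<close> and \<open>g\<close> with common
  domain \<open>U\<close>. All such choices give the same class, so the union is that class.\<close>

definition pushforward :: "'n::finite diffeo_germ \<Rightarrow> 'n::finite metric_germ \<Rightarrow> 'n::finite metric_germ" where
  "pushforward \<Theta> \<gamma> =
     (\<Union>{metric_germ_rel `` {(\<theta> ` U, pushforward_metric U \<theta> g)} | U \<theta> g.
        (U, \<theta>) \<in> \<Theta> \<and> (U, g) \<in> \<gamma>})"


section \<open>The germ relations are equivalences\<close>

lemma nbhd_infinity_Int:
  assumes "nbhd_infinity U" "nbhd_infinity V"
  shows "nbhd_infinity (U \<inter> V)"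
proof -
  from assms obtain a b where ab: "a > 0" "ball 0 1 - cball 0 (1 - a) \<subseteq> U"
      "b > 0" "ball 0 1 - cball 0 (1 - b) \<subseteq> V"
    unfolding nbhd_infinity_def by blast
  have "ball 0 1 - cball 0 (1 - min a b) \<subseteq> U \<inter> V"
    using ab(2,4) by (auto simp: subset_iff)
  moreover have "min a b > 0" using ab by simp
  ultimately show ?thesis
    using assms unfolding nbhd_infinity_def by blast
qed

lemma equiv_metric_germ_rel:
  "equiv (metric_reps :: ((real^'n) set \<times> 'n::finite tensor2_field) set) metric_germ_rel"
  (is "equiv _ ?R")
proof (rule equivI)
  show "metric_germ_rel \<subseteq> metric_reps \<times> metric_reps"
    by (auto simp: metric_germ_rel_def)
  show "refl_on metric_reps metric_germ_rel"
    by (auto simp: refl_on_def metric_germ_rel_def metric_reps_def)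
  show "sym metric_germ_rel"
    by (rule symI) (force simp: metric_germ_rel_def)
  show "trans ?R"
  proof (rule transI)
    fix p q r :: "(real^'n) set \<times> 'n tensor2_field"
    assume pq: "(p, q) \<in> metric_germ_rel" and qr: "(q, r) \<in> metric_germ_rel"
    from pq obtain A where A: "nbhd_infinity A" "A \<subseteq> fst p \<inter> fst q" "\<forall>x\<in>A. snd p x = snd q x"
      by (auto simp: metric_germ_rel_def)
    from qr obtain B where B: "nbhd_infinity B" "B \<subseteq> fst q \<inter> fst r" "\<forall>x\<in>B. snd q x = snd r x"
      by (auto simp: metric_germ_rel_def)
    have "A \<inter> B \<subseteq> fst p \<inter> fst r" "\<forall>x\<in>A \<inter> B. snd p x = snd r x"
      using A B by auto
    with nbhd_infinity_Int[OF A(1) B(1)]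
    have "\<exists>W. nbhd_infinity W \<and> W \<subseteq> fst p \<inter> fst r \<and> (\<forall>x\<in>W. snd p x = snd r x)"
      by blast
    moreover from pq qr have "p \<in> metric_reps" "r \<in> metric_reps"
      by (auto simp: metric_germ_rel_def)
    ultimately show "(p, r) \<in> metric_germ_rel"
      by (simp add: metric_germ_rel_def case_prod_beta)
  qed
qed

lemma equiv_diffeo_germ_rel:
  "equiv (diffeo_reps :: ((real^'n) set \<times> (real^'n \<Rightarrow> real^'n)) set) diffeo_germ_rel"
  (is "equiv _ ?R")
proof (rule equivI)
  show "diffeo_germ_rel \<subseteq> diffeo_reps \<times> diffeo_reps"
    by (auto simp: diffeo_germ_rel_def)
  show "refl_on diffeo_reps diffeo_germ_rel"
    by (auto simp: refl_on_def diffeo_germ_rel_def diffeo_reps_def)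
  show "sym diffeo_germ_rel"
    by (rule symI) (force simp: diffeo_germ_rel_def)
  show "trans ?R"
  proof (rule transI)
    fix p q r :: "(real^'n) set \<times> (real^'n \<Rightarrow> real^'n)"
    assume pq: "(p, q) \<in> diffeo_germ_rel" and qr: "(q, r) \<in> diffeo_germ_rel"
    from pq obtain A where A: "nbhd_infinity A" "A \<subseteq> fst p \<inter> fst q"
        "\<forall>x\<in>tilde A. snd p x = snd q x"
      by (auto simp: diffeo_germ_rel_def)
    from qr obtain B where B: "nbhd_infinity B" "B \<subseteq> fst q \<inter> fst r"
        "\<forall>x\<in>tilde B. snd q x = snd r x"
      by (auto simp: diffeo_germ_rel_def)
    have "A \<inter> B \<subseteq> fst p \<inter> fst r" "\<forall>x\<in>tilde (A \<inter> B). snd p x = snd r x"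
      using A B by (auto simp: tilde_def)
    with nbhd_infinity_Int[OF A(1) B(1)]
    have "\<exists>W. nbhd_infinity W \<and> W \<subseteq> fst p \<inter> fst r \<and> (\<forall>x\<in>tilde W. snd p x = snd r x)"
      by blast
    moreover from pq qr have "p \<in> diffeo_reps" "r \<in> diffeo_reps"
      by (auto simp: diffeo_germ_rel_def)
    ultimately show "(p, r) \<in> diffeo_germ_rel"
      by (simp add: diffeo_germ_rel_def case_prod_beta)
  qed
qed

end

theory Submission
  imports Defs
begin

text \<open>Write \<open>Q = (1 - |x|) / (1 + |x|)\<close>, which is \<open>exp (-d)\<close> for the hyperbolic distance \<open>d\<close>
  to the origin. Transverse coordinates for \<open>g\<close> come from a function \<open>Q * exp w\<close>, with \<open>w = 0\<close> at
  infinity, whose logarithm has \<open>g\<close>-gradient of length one. After division by \<open>Q\<close>, which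
  Hadamard's lemma permits, this eikonal equation for \<open>w\<close> is smooth and noncharacteristic at the
  sphere. Its characteristics, parametrized by the radial variable, form a map \<open>\<Psi>\<close> that is smooth
  up to the sphere; the conserved pairing of covectors with the characteristic velocity (the Gauss
  lemma) says that \<open>\<Psi>\<close> pulls \<open>g\<close> back to a transverse metric, so \<open>\<Theta>\<close> is the inverse of \<open>\<Psi>\<close>. Integral
  bounds for \<open>dw\<close> give the order of contact.

  For uniqueness, let \<open>\<Phi>\<close> pull one transverse metric back to another. The Cauchy-Schwarz
  inequality shows that the hyperbolic radius of \<open>\<Phi>\<close> along a ray grows at most as fast as that of
  the ray; both agree in the limit, so \<open>|\<Phi> x| \<ge> |x|\<close>. Applying this also to the inverse gives equality,
  and the equality case of Cauchy-Schwarz forces \<open>\<Phi>\<close> to preserve rays.\<close>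

text \<open>The obstacle is smoothness up to a sphere where \<open>g\<close> itself blows up. So all
  equations are written for quantities that extend across it: the matrix of
  \<open>\<rho>\<^sup>2 g\<close>, continued to an open annulus, and \<open>Q\<close>, whose
  gradient on the sphere is nonzero, in place of the distance \<open>- ln Q\<close>. The
  characteristic through a point has to run only for the time \<open>hradius x\<close>, which tends
  to 0 at the sphere; rescaled to the unit interval, its equation has a right-hand side as small as
  desired. A contraction with the fixed constant 1/2 therefore suffices, and solutions need no
  continuation.

  Orders of vanishing: the defect of \<open>g\<close> has order \<open>k\<close>; division by
  \<open>Q\<close> leaves \<open>k - 1\<close> for the inhomogeneity \<open>a\<close>, hence
  \<open>k - 2\<close> for its gradient. Every integration over a time of length \<open>Q\<close>
  gains one order, so \<open>dw\<close> has order \<open>k - 1\<close>, \<open>w\<close> has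
  \<open>k\<close> and the displacement \<open>k + 1\<close>. Its derivative has order
  \<open>k\<close>, as the pushed-forward metric requires. For uniqueness, displacement of order at
  least 2 makes \<open>Q (\<Phi> x) / Q x\<close> tend to 1.\<close>

section \<open>Parameter families of class \<open>C\<^sup>m\<close>\<close>

text \<open>Differentiability concerns the second argument only; the time \<open>t\<close> in \<open>{0..1}\<close> is a parameter in
  which everything is merely jointly continuous.\<close>

primrec Ck_fam :: "nat \<Rightarrow> 'a::euclidean_space set \<Rightarrow> (real \<Rightarrow> 'a \<Rightarrow> 'b::real_normed_vector) \<Rightarrow> bool" where
  "Ck_fam 0 N f \<longleftrightarrow> continuous_on ({0..1} \<times> N) (\<lambda>p. f (fst p) (snd p))"
| "Ck_fam (Suc m) N f \<longleftrightarrow> continuous_on ({0..1} \<times> N) (\<lambda>p. f (fst p) (snd p)) \<and>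
     (\<forall>t\<in>{0..1}. \<forall>x\<in>N. f t differentiable (at x)) \<and>
     (\<forall>v. Ck_fam m N (\<lambda>t x. frechet_derivative (f t) (at x) v))"

lemma Ck_fam_continuous:
  "Ck_fam m N f \<Longrightarrow> continuous_on ({0..1} \<times> N) (\<lambda>p. f (fst p) (snd p))"
  by (cases m) auto

lemma Ck_fam_differentiable:
  "Ck_fam (Suc m) N f \<Longrightarrow> t \<in> {0..1} \<Longrightarrow> x \<in> N \<Longrightarrow>
    (f t has_derivative frechet_derivative (f t) (at x)) (at x)"
  by (auto simp: frechet_derivative_works)

lemma Ck_fam_derivative:
  "Ck_fam (Suc m) N f \<Longrightarrow> Ck_fam m N (\<lambda>t x. frechet_derivative (f t) (at x) v)"
  by simp

lemma frechet_derivative_eqI: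
  "(f has_derivative f') (at x) \<Longrightarrow> frechet_derivative f (at x) = f'"
  using frechet_derivative_at by metis

text \<open>Since \<open>N\<close> is open, equality on \<open>N\<close> is equality near each of
  its points and carries derivatives along. Its main use is in \<open>Ck_fam_SucI\<close>, where
  \<open>frechet_derivative\<close> gives way to an explicit formula.\<close>

lemma Ck_fam_cong:
  assumes "open N" "\<And>t x. t \<in> {0..1} \<Longrightarrow> x \<in> N \<Longrightarrow> f t x = g t x"
  shows "Ck_fam m N f \<longleftrightarrow> Ck_fam m N g"
  using assms(2)
proof (induction m arbitrary: f g)
  case 0
  then show ?case by (auto intro!: continuous_on_cong)
next
  case (Suc m)
  have d: "(f t has_derivative D) (at x) \<longleftrightarrow> (g t has_derivative D) (at x)"
    if "t \<in> {0..1}" "x \<in> N" for t x D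
    using has_derivative_transform_within_open[OF _ assms(1) that(2)] Suc.prems that by metis
  then have e: "frechet_derivative (f t) (at x) = frechet_derivative (g t) (at x)"
    if "t \<in> {0..1}" "x \<in> N" for t x
    using that by (simp add: frechet_derivative_def)
  have 1: "continuous_on ({0..1} \<times> N) (\<lambda>p. f (fst p) (snd p)) \<longleftrightarrow>
      continuous_on ({0..1} \<times> N) (\<lambda>p. g (fst p) (snd p))"
    by (rule continuous_on_cong) (use Suc.prems in auto)
  have 2: "Ck_fam m N (\<lambda>t x. frechet_derivative (f t) (at x) v) \<longleftrightarrow>
     Ck_fam m N (\<lambda>t x. frechet_derivative (g t) (at x) v)" for v
    by (rule Suc.IH) (use e in auto)
  show ?case unfolding Ck_fam.simps 1 2 using d
    by (auto simp: differentiable_def)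
qed

lemma Ck_fam_SucI:
  assumes "open N" "continuous_on ({0..1} \<times> N) (\<lambda>p. f (fst p) (snd p))"
    and d: "\<And>t x. t \<in> {0..1} \<Longrightarrow> x \<in> N \<Longrightarrow> (f t has_derivative f' t x) (at x)"
    and "\<And>v. Ck_fam m N (\<lambda>t x. f' t x v)"
  shows "Ck_fam (Suc m) N f"
proof -
  have "Ck_fam m N (\<lambda>t x. frechet_derivative (f t) (at x) v)" for v
    using Ck_fam_cong[OF assms(1), of "\<lambda>t x. frechet_derivative (f t) (at x) v" "\<lambda>t x. f' t x v" m]
      frechet_derivative_eqI[OF d] assms(4) by auto
  then show ?thesis using assms(2) d by (auto simp: differentiable_def) blast
qed

lemma Ck_fam_Suc_imp:
  "Ck_fam (Suc m) N f \<Longrightarrow> Ck_fam m N f"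
  by (induction m arbitrary: f) auto

lemma Ck_fam_le: "Ck_fam m N f \<Longrightarrow> l \<le> m \<Longrightarrow> Ck_fam l N f"
proof (induction m)
  case (Suc m)
  then show ?case using Ck_fam_Suc_imp by (metis le_Suc_eq)
qed simp

lemma Ck_fam_subset: "Ck_fam m N f \<Longrightarrow> M \<subseteq> N \<Longrightarrow> Ck_fam m M f"
proof (induction m arbitrary: f)
  case 0
  then show ?case by (auto intro: continuous_on_subset)
next
  case (Suc m)
  then show ?case by (auto intro: continuous_on_subset)
qed

lemma Ck_fam_const_param:
  assumes "Ck_fam m N f" "s \<in> {0..1}"
  shows "Ck_fam m N (\<lambda>_. f s)"
proof -
  have c: "continuous_on ({0..1::real} \<times> N) (\<lambda>p. f s (snd p))"
    if "continuous_on ({0..1} \<times> N) (\<lambda>p. f (fst p) (snd p))" for f :: "real \<Rightarrow> 'a \<Rightarrow> 'b"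
  proof -
    have "continuous_on ({0..1} \<times> N) ((\<lambda>p. f (fst p) (snd p)) \<circ> (\<lambda>p::real\<times>_. (s, snd p)))"
      by (rule continuous_on_compose)
        (use that assms(2) in \<open>auto intro!: continuous_intros elim!: continuous_on_subset\<close>)
    then show ?thesis by (simp add: o_def)
  qed
  show ?thesis using assms(1)
  proof (induction m arbitrary: f)
    case (Suc m)
    have "Ck_fam m N (\<lambda>_ x. frechet_derivative (f s) (at x) v)" for v
      using Suc.IH[OF Ck_fam_derivative[OF Suc.prems]] .
    then show ?case using c[of f] Suc.prems assms(2) by simp
  qed (use c in auto)
qed

text \<open>Whatever \<open>T\<close> is, each \<open>T \<times> N i\<close> is relatively open in
  the product of \<open>T\<close> with the union, so continuity can be tested on one of them at a
  time.\<close>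

lemma continuous_on_times_UN:
  fixes f :: "'c::t2_space \<Rightarrow> 'a::t2_space \<Rightarrow> 'b::topological_space"
  assumes "\<And>i. i \<in> I \<Longrightarrow> open (N i)"
    "\<And>i. i \<in> I \<Longrightarrow> continuous_on (T \<times> N i) (\<lambda>p. f (fst p) (snd p))"
  shows "continuous_on (T \<times> (\<Union>i\<in>I. N i)) (\<lambda>p. f (fst p) (snd p))"
  unfolding continuous_on_eq_continuous_within
proof
  fix p assume "p \<in> T \<times> (\<Union>i\<in>I. N i)"
  then obtain i where i: "i \<in> I" "p \<in> T \<times> N i" by auto
  have "continuous (at p within T \<times> N i) (\<lambda>p. f (fst p) (snd p))"
    using assms(2)[OF i(1)] i(2) unfolding continuous_on_eq_continuous_within by (rule bspec)
  moreover have "at p within T \<times> N i = at p within T \<times> (\<Union>i\<in>I. N i)"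
    by (rule at_within_nhd[of _ "UNIV \<times> N i"]) (use i assms(1) in \<open>auto intro!: open_Times\<close>)
  ultimately show "continuous (at p within T \<times> (\<Union>i\<in>I. N i)) (\<lambda>p. f (fst p) (snd p))"
    by simp
qed

lemma Ck_fam_UN:
  assumes "\<And>i. i \<in> I \<Longrightarrow> open (N i)" "\<And>i. i \<in> I \<Longrightarrow> Ck_fam m (N i) f"
  shows "Ck_fam m (\<Union>i\<in>I. N i) f"
  using assms(2)
proof (induction m arbitrary: f)
  case 0
  then show ?case using assms(1) by (simp add: continuous_on_times_UN del: UN_simps)
next
  case (Suc m)
  have "continuous_on ({0..1} \<times> (\<Union>i\<in>I. N i)) (\<lambda>p. f (fst p) (snd p))"
    by (rule continuous_on_times_UN) (use assms(1) Suc.prems in auto)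
  with Suc show ?case by auto
qed

lemma Ck_fam_Un:
  assumes "open N" "open M" "Ck_fam m N f" "Ck_fam m M f"
  shows "Ck_fam m (N \<union> M) f"
  using Ck_fam_UN[of "{N, M}" "\<lambda>S. S" m f] assms by auto

lemma Ck_fam_const: "Ck_fam m N (\<lambda>_ _. c)"
proof (induction m arbitrary: c)
  case (Suc m)
  then show ?case by (auto simp: frechet_derivative_const)
qed auto

lemma Ck_fam_add:
  assumes "open N" "Ck_fam m N f" "Ck_fam m N g"
  shows "Ck_fam m N (\<lambda>t x. f t x + g t x)"
  using assms(2,3)
proof (induction m arbitrary: f g)
  case 0
  then show ?case by (auto intro!: continuous_intros)
next
  case (Suc m)
  show ?case
  proof (rule Ck_fam_SucI[OF assms(1)])
    show "continuous_on ({0..1} \<times> N) (\<lambda>p. f (fst p) (snd p) + g (fst p) (snd p))"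
      using Suc.prems by (auto intro!: continuous_intros)
    show "((\<lambda>x. f t x + g t x) has_derivative
       (\<lambda>v. frechet_derivative (f t) (at x) v + frechet_derivative (g t) (at x) v)) (at x)"
      if "t \<in> {0..1}" "x \<in> N" for t x
      using that Suc.prems by (auto intro!: has_derivative_add simp: frechet_derivative_works)
    show "Ck_fam m N (\<lambda>t x. frechet_derivative (f t) (at x) v + frechet_derivative (g t) (at x) v)" for v
      using Suc by auto
  qed
qed

lemma Ck_fam_linear:
  assumes "open N" "bounded_linear L" "Ck_fam m N f"
  shows "Ck_fam m N (\<lambda>t x. L (f t x))"
  using assms(3)
proof (induction m arbitrary: f)
  case 0
  then show ?case by (auto intro!: bounded_linear.continuous_on[OF assms(2)])
next
  case (Suc m)
  show ?case
  proof (rule Ck_fam_SucI[OF assms(1)])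
    show "continuous_on ({0..1} \<times> N) (\<lambda>p. L (f (fst p) (snd p)))"
      using Suc.prems by (auto intro!: bounded_linear.continuous_on[OF assms(2)])
    show "((\<lambda>x. L (f t x)) has_derivative (\<lambda>v. L (frechet_derivative (f t) (at x) v))) (at x)"
      if "t \<in> {0..1}" "x \<in> N" for t x
      using that Suc.prems by (auto intro!: bounded_linear.has_derivative[OF assms(2)] simp: frechet_derivative_works)
    show "Ck_fam m N (\<lambda>t x. L (frechet_derivative (f t) (at x) v))" for v
      using Suc by auto
  qed
qed

lemma Ck_fam_bilinear:
  assumes "open N" "bounded_bilinear B" "Ck_fam m N f" "Ck_fam m N g"
  shows "Ck_fam m N (\<lambda>t x. B (f t x) (g t x))"
  using assms(3,4)
proof (induction m arbitrary: f g)
  case 0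
  then show ?case by (auto intro!: bounded_bilinear.continuous_on[OF assms(2)])
next
  case (Suc m)
  show ?case
  proof (rule Ck_fam_SucI[OF assms(1)])
    show "continuous_on ({0..1} \<times> N) (\<lambda>p. B (f (fst p) (snd p)) (g (fst p) (snd p)))"
      using Suc.prems by (auto intro!: bounded_bilinear.continuous_on[OF assms(2)])
    show "((\<lambda>x. B (f t x) (g t x)) has_derivative
       (\<lambda>v. B (f t x) (frechet_derivative (g t) (at x) v) + B (frechet_derivative (f t) (at x) v) (g t x))) (at x)"
      if "t \<in> {0..1}" "x \<in> N" for t x
      using that Suc.prems
      by (auto intro!: bounded_bilinear.FDERIV[OF assms(2)] simp: frechet_derivative_works)
    show "Ck_fam m N (\<lambda>t x. B (f t x) (frechet_derivative (g t) (at x) v) +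
        B (frechet_derivative (f t) (at x) v) (g t x))" for v
      using Suc.prems by (intro Ck_fam_add[OF assms(1)] Suc.IH) (auto intro: Ck_fam_Suc_imp)
  qed
qed

lemma Ck_fam_sum:
  assumes "open N" "\<And>i. i \<in> I \<Longrightarrow> Ck_fam m N (f i)"
  shows "Ck_fam m N (\<lambda>t x. \<Sum>i\<in>I. f i t x)"
  using assms(2)
proof (induction I rule: infinite_finite_induct)
  case (insert i I)
  then show ?case by (auto intro!: Ck_fam_add[OF assms(1)])
qed (auto intro: Ck_fam_const)

lemma Ck_fam_euclidean:
  fixes f :: "real \<Rightarrow> 'a::euclidean_space \<Rightarrow> 'b::euclidean_space"
  assumes "open N"
  shows "Ck_fam m N f \<longleftrightarrow> (\<forall>b\<in>Basis. Ck_fam m N (\<lambda>t x. f t x \<bullet> b))"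
proof
  assume "Ck_fam m N f"
  then show "\<forall>b\<in>Basis. Ck_fam m N (\<lambda>t x. f t x \<bullet> b)"
    by (auto intro: Ck_fam_linear[OF assms bounded_linear_inner_left])
next
  assume *: "\<forall>b\<in>Basis. Ck_fam m N (\<lambda>t x. f t x \<bullet> b)"
  have "Ck_fam m N (\<lambda>t x. \<Sum>b\<in>Basis. (f t x \<bullet> b) *\<^sub>R b)"
    using * by (intro Ck_fam_sum assms Ck_fam_linear[OF assms bounded_linear_scaleR_left]) auto
  then show "Ck_fam m N f" by (simp add: euclidean_representation)
qed

lemma has_derivative_Basis_sum:
  fixes f' :: "'a::euclidean_space \<Rightarrow> 'b::real_normed_vector"
  assumes "(f has_derivative f') F"
  shows "f' v = (\<Sum>b\<in>Basis. (v \<bullet> b) *\<^sub>R f' b)"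
proof -
  have l: "linear f'" using assms has_derivative_linear by blast
  have "f' v = f' (\<Sum>b\<in>Basis. (v \<bullet> b) *\<^sub>R b)" by (simp add: euclidean_representation)
  also have "\<dots> = (\<Sum>b\<in>Basis. (v \<bullet> b) *\<^sub>R f' b)"
    by (simp add: linear_sum[OF l] linear_scale[OF l])
  finally show ?thesis .
qed

text \<open>Expanding the chain rule over \<open>Basis\<close> leaves only derivatives of
  \<open>g\<close> in fixed directions, taken at \<open>\<phi> t x\<close>. Such a map is again a
  composition with \<open>\<phi>\<close>, so the induction hypothesis, which is general in
  \<open>g\<close>, covers it.\<close>

lemma Ck_fam_compose:
  fixes \<phi> :: "real \<Rightarrow> 'a::euclidean_space \<Rightarrow> 'c::euclidean_space"
  assumes "open N" "open M" and m: "\<And>t x. t \<in> {0..1} \<Longrightarrow> x \<in> N \<Longrightarrow> \<phi> t x \<in> M"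
    and "Ck_fam m M g" "Ck_fam m N \<phi>"
  shows "Ck_fam m N (\<lambda>t x. g t (\<phi> t x))"
  using assms(4,5)
proof (induction m arbitrary: g)
  case 0
  have "continuous_on ({0..1} \<times> N) ((\<lambda>p. g (fst p) (snd p)) \<circ> (\<lambda>p. (fst p, \<phi> (fst p) (snd p))))"
    by (rule continuous_on_compose)
      (use 0 m in \<open>auto intro!: continuous_intros elim!: continuous_on_subset\<close>)
  then show ?case by (simp add: o_def)
next
  case (Suc m)
  have c: "continuous_on ({0..1} \<times> N) ((\<lambda>p. g (fst p) (snd p)) \<circ> (\<lambda>p. (fst p, \<phi> (fst p) (snd p))))"
    by (rule continuous_on_compose)
      (use Suc.prems m in \<open>auto intro!: continuous_intros elim!: continuous_on_subset\<close>)
  show ?case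
  proof (rule Ck_fam_SucI[OF assms(1)])
    show "continuous_on ({0..1} \<times> N) (\<lambda>p. g (fst p) (\<phi> (fst p) (snd p)))"
      using c by (simp add: o_def)
    show "((\<lambda>x. g t (\<phi> t x)) has_derivative
       (\<lambda>v. \<Sum>b\<in>Basis. (frechet_derivative (\<phi> t) (at x) v \<bullet> b) *\<^sub>R
          frechet_derivative (g t) (at (\<phi> t x)) b)) (at x)"
      if "t \<in> {0..1}" "x \<in> N" for t x
    proof -
      have 1: "(\<phi> t has_derivative frechet_derivative (\<phi> t) (at x)) (at x)"
        using Ck_fam_differentiable Suc.prems(2) that by blast
      have 2: "(g t has_derivative frechet_derivative (g t) (at (\<phi> t x))) (at (\<phi> t x))"
        using Ck_fam_differentiable[OF Suc.prems(1)] that m by blast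
      have "((\<lambda>x. g t (\<phi> t x)) has_derivative
          (\<lambda>v. frechet_derivative (g t) (at (\<phi> t x)) (frechet_derivative (\<phi> t) (at x) v))) (at x)"
        using has_derivative_compose[OF 1 2] .
      then show ?thesis by (subst (asm) has_derivative_Basis_sum[OF 2])
    qed
    show "Ck_fam m N (\<lambda>t x. \<Sum>b\<in>Basis. (frechet_derivative (\<phi> t) (at x) v \<bullet> b) *\<^sub>R
          frechet_derivative (g t) (at (\<phi> t x)) b)" for v
      by (intro Ck_fam_sum assms Ck_fam_bilinear[OF _ bounded_bilinear_scaleR]
          Ck_fam_linear[OF _ bounded_linear_inner_left] Ck_fam_derivative Suc.prems Suc.IH)
        (use Suc.prems Ck_fam_Suc_imp in auto)
  qed
qed

text \<open>The direction varies with the point as well; its coordinates are split off so that only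
  fixed directions remain inside the derivative.\<close>

lemma Ck_fam_frechet_derivative:
  fixes \<phi> :: "real \<Rightarrow> 'c::euclidean_space \<Rightarrow> 'a::euclidean_space"
  assumes "open N" "open M" "Ck_fam (Suc m) M f" "Ck_fam m N v" "Ck_fam m N \<phi>"
    and M: "\<And>t x. t \<in> {0..1} \<Longrightarrow> x \<in> N \<Longrightarrow> \<phi> t x \<in> M"
  shows "Ck_fam m N (\<lambda>t x. frechet_derivative (f t) (at (\<phi> t x)) (v t x))"
proof -
  have "Ck_fam m N (\<lambda>t x. frechet_derivative (f t) (at (\<phi> t x)) b)" for b
    by (rule Ck_fam_compose[of N M \<phi> m "\<lambda>t x. frechet_derivative (f t) (at x) b"])
      (use assms in auto)
  then have "Ck_fam m N (\<lambda>t x. \<Sum>b\<in>Basis. (v t x \<bullet> b) *\<^sub>R frechet_derivative (f t) (at (\<phi> t x)) b)"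
    by (intro Ck_fam_sum Ck_fam_bilinear[OF _ bounded_bilinear_scaleR]
        Ck_fam_linear[OF _ bounded_linear_inner_left] assms)
  moreover have "(\<Sum>b\<in>Basis. (v t x \<bullet> b) *\<^sub>R frechet_derivative (f t) (at (\<phi> t x)) b) =
     frechet_derivative (f t) (at (\<phi> t x)) (v t x)" if "t \<in> {0..1}" "x \<in> N" for t x
    by (rule has_derivative_Basis_sum[OF Ck_fam_differentiable[OF assms(3) that(1) M[OF that]], symmetric])
  ultimately show ?thesis by (subst (asm) Ck_fam_cong[OF assms(1)])
qed

lemma Ck_fam_id: "Ck_fam m N (\<lambda>_ x. x)"
proof (cases m)
  case (Suc l)
  have "frechet_derivative (\<lambda>x. x) (at x) = (\<lambda>v. v)" for x :: 'a
    by (rule frechet_derivative_eqI) (rule has_derivative_ident)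
  then show ?thesis unfolding Suc by (auto intro!: continuous_intros Ck_fam_const)
qed (auto intro!: continuous_intros)

lemma Ck_fam_Pair:
  assumes "open N" "Ck_fam m N f" "Ck_fam m N g"
  shows "Ck_fam m N (\<lambda>t x. (f t x, g t x))"
proof -
  have "Ck_fam m N (\<lambda>t x. (f t x, 0) + (0, g t x))"
    by (intro Ck_fam_add Ck_fam_linear[of N "\<lambda>a. (a, 0)"] Ck_fam_linear[of N "\<lambda>a. (0, a)"] assms
        bounded_linear_Pair bounded_linear_ident bounded_linear_zero)
  then show ?thesis by simp
qed

text \<open>A bootstrap: if \<open>f'\<close> is an expression in \<open>f\<close> itself, the class
  of \<open>f\<close> passes to \<open>f'\<close>, which raises the class of \<open>f\<close> by
  one. This serves \<open>exp\<close>, \<open>inverse\<close> and \<open>sqrt\<close>.\<close>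

lemma Ck_fam_real:
  assumes N: "open N" "\<And>z. z \<in> N \<Longrightarrow> (f has_real_derivative f' z) (at z)"
    and "\<And>m. Ck_fam m N (\<lambda>_. f) \<Longrightarrow> Ck_fam m N (\<lambda>_. f')"
  shows "Ck_fam m N (\<lambda>_. f :: real \<Rightarrow> real)"
proof (induction m)
  case 0
  have "continuous_on N f"
    using N by (meson DERIV_continuous_on has_field_derivative_at_within)
  then have "continuous_on ({0..1::real} \<times> N) (f \<circ> snd)"
    by (intro continuous_on_compose continuous_intros) (auto elim: continuous_on_subset)
  then show ?case by (simp add: o_def)
next
  case (Suc m)
  show ?case
  proof (rule Ck_fam_SucI[OF N(1) Ck_fam_continuous[OF Suc]])
    show "(f has_derivative (\<lambda>v. f' z * v)) (at z)" if "z \<in> N" for z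
      using N(2)[OF that] by (simp add: has_field_derivative_def)
    show "Ck_fam m N (\<lambda>_ z. f' z * v)" for v
      by (intro Ck_fam_linear[OF N(1) bounded_linear_mult_left] assms Suc)
  qed
qed

lemma Ck_fam_exp: "Ck_fam m UNIV (\<lambda>_. exp :: real \<Rightarrow> real)"
  by (rule Ck_fam_real[of _ _ exp]) (auto intro!: derivative_eq_intros)

lemma Ck_fam_inverse_real: "Ck_fam m (- {0}) (\<lambda>_. inverse :: real \<Rightarrow> real)"
proof (rule Ck_fam_real[of _ _ "\<lambda>z. - 1 * (inverse z * inverse z)"])
  show "Ck_fam m (- {0}) (\<lambda>_ z. - 1 * (inverse z * inverse z :: real))"
    if "Ck_fam m (- {0}) (\<lambda>_. inverse :: real \<Rightarrow> real)" for m
    using that by (intro Ck_fam_linear[OF _ bounded_linear_mult_right]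
        Ck_fam_bilinear[OF _ bounded_bilinear_mult]) auto
qed (auto intro!: derivative_eq_intros simp: power2_eq_square)

lemma Ck_fam_sqrt: "Ck_fam m {0<..} (\<lambda>_. sqrt)"
proof (rule Ck_fam_real[of _ _ "\<lambda>z. inverse (sqrt z) / 2"])
  show "Ck_fam m {0<..} (\<lambda>_ z. inverse (sqrt z) / 2)"
    if "Ck_fam m {0<..} (\<lambda>_. sqrt)" for m
    by (rule Ck_fam_linear[OF _ bounded_linear_divide], simp,
        rule Ck_fam_compose[OF _ _ _ Ck_fam_inverse_real that]) auto
qed (auto intro!: derivative_eq_intros simp: field_simps)

section \<open>Smooth families and their closure properties\<close>

definition smooth_fam :: "'a::euclidean_space set \<Rightarrow> (real \<Rightarrow> 'a \<Rightarrow> 'b::real_normed_vector) \<Rightarrow> bool" where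
  "smooth_fam N f \<longleftrightarrow> open N \<and> (\<forall>m. Ck_fam m N f)"

text \<open>A map without time counts as a constant family, so that a single set of rules serves
  both maps and flows. Openness of \<open>N\<close> is included in \<open>smooth_fam\<close> and
  passed on by the rules.\<close>

abbreviation smooth :: "'a::euclidean_space set \<Rightarrow> ('a \<Rightarrow> 'b::real_normed_vector) \<Rightarrow> bool" where
  "smooth N f \<equiv> smooth_fam N (\<lambda>_. f)"

named_theorems smooth_intros

lemma smooth_fam_open: "smooth_fam N f \<Longrightarrow> open N"
  by (simp add: smooth_fam_def)

lemma smooth_fam_Ck: "smooth_fam N f \<Longrightarrow> Ck_fam m N f"
  by (simp add: smooth_fam_def)

lemma smooth_fam_continuous:
  "smooth_fam N f \<Longrightarrow> continuous_on ({0..1} \<times> N) (\<lambda>p. f (fst p) (snd p))"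
  by (rule Ck_fam_continuous[OF smooth_fam_Ck])

lemma smooth_fam_subset: "smooth_fam N f \<Longrightarrow> open M \<Longrightarrow> M \<subseteq> N \<Longrightarrow> smooth_fam M f"
  by (auto simp: smooth_fam_def intro: Ck_fam_subset)

lemma smooth_fam_cong:
  assumes "\<And>t x. t \<in> {0..1} \<Longrightarrow> x \<in> N \<Longrightarrow> f t x = g t x"
  shows "smooth_fam N f \<longleftrightarrow> smooth_fam N g"
  using Ck_fam_cong[of N f g] assms by (auto simp: smooth_fam_def)

lemma smooth_UN:
  assumes "\<And>i. i \<in> I \<Longrightarrow> smooth_fam (N i) f"
  shows "smooth_fam (\<Union>i\<in>I. N i) f"
  using assms by (auto simp: smooth_fam_def intro!: Ck_fam_UN)

lemma smooth_Un:
  "smooth_fam N f \<Longrightarrow> smooth_fam M f \<Longrightarrow> smooth_fam (N \<union> M) f"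
  by (auto simp: smooth_fam_def intro!: Ck_fam_Un)

lemma smooth_fam_param: "smooth_fam N f \<Longrightarrow> s \<in> {0..1} \<Longrightarrow> smooth N (f s)"
  by (auto simp: smooth_fam_def intro: Ck_fam_const_param)

lemma smooth_const [smooth_intros]: "open N \<Longrightarrow> smooth_fam N (\<lambda>_ _. c)"
  by (simp add: smooth_fam_def Ck_fam_const)

lemma smooth_id [smooth_intros]: "open N \<Longrightarrow> smooth_fam N (\<lambda>_ x. x)"
  by (simp add: smooth_fam_def Ck_fam_id)

lemma smooth_linear:
  "bounded_linear L \<Longrightarrow> smooth_fam N f \<Longrightarrow> smooth_fam N (\<lambda>t x. L (f t x))"
  by (simp add: smooth_fam_def Ck_fam_linear)

lemma smooth_bilinear:
  "bounded_bilinear B \<Longrightarrow> smooth_fam N f \<Longrightarrow> smooth_fam N g \<Longrightarrow> smooth_fam N (\<lambda>t x. B (f t x) (g t x))"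
  by (simp add: smooth_fam_def Ck_fam_bilinear)

lemma smooth_add [smooth_intros]:
  "smooth_fam N f \<Longrightarrow> smooth_fam N g \<Longrightarrow> smooth_fam N (\<lambda>t x. f t x + g t x)"
  by (simp add: smooth_fam_def Ck_fam_add)

lemma smooth_minus [smooth_intros]: "smooth_fam N f \<Longrightarrow> smooth_fam N (\<lambda>t x. - f t x)"
  by (rule smooth_linear) (auto intro: bounded_linear_minus bounded_linear_ident)

lemma smooth_diff [smooth_intros]:
  "smooth_fam N f \<Longrightarrow> smooth_fam N g \<Longrightarrow> smooth_fam N (\<lambda>t x. f t x - g t x)"
  using smooth_add[OF _ smooth_minus, of N f g] by simp

lemmas smooth_scaleR [smooth_intros] = smooth_bilinear[OF bounded_bilinear_scaleR]
  and smooth_inner [smooth_intros] = smooth_bilinear[OF bounded_bilinear_inner]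
  and smooth_fst [smooth_intros] = smooth_linear[OF bounded_linear_fst]
  and smooth_snd [smooth_intros] = smooth_linear[OF bounded_linear_snd]
  and smooth_divide_const = smooth_linear[OF bounded_linear_divide]
  and smooth_vec_nth [smooth_intros] = smooth_linear[OF bounded_linear_vec_nth]

lemma smooth_mult [smooth_intros]:
  "smooth_fam N f \<Longrightarrow> smooth_fam N g \<Longrightarrow> smooth_fam N (\<lambda>t x. f t x * g t x :: real)"
  by (rule smooth_bilinear[OF bounded_bilinear_mult])

lemma smooth_Pair [smooth_intros]:
  "smooth_fam N f \<Longrightarrow> smooth_fam N g \<Longrightarrow> smooth_fam N (\<lambda>t x. (f t x, g t x))"
  by (simp add: smooth_fam_def Ck_fam_Pair)

lemma smooth_sum [smooth_intros]:
  "open N \<Longrightarrow> (\<And>i. i \<in> I \<Longrightarrow> smooth_fam N (f i)) \<Longrightarrow> smooth_fam N (\<lambda>t x. \<Sum>i\<in>I. f i t x)"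
  by (simp add: smooth_fam_def Ck_fam_sum)

lemma smooth_prod [smooth_intros]:
  assumes "open N" "\<And>i. i \<in> I \<Longrightarrow> smooth_fam N (f i)"
  shows "smooth_fam N (\<lambda>t x. \<Prod>i\<in>I. f i t x :: real)"
  using assms(2)
  by (induction I rule: infinite_finite_induct) (auto intro!: smooth_intros assms(1))

lemma smooth_power [smooth_intros]:
  "smooth_fam N f \<Longrightarrow> smooth_fam N (\<lambda>t x. f t x ^ n :: real)"
  by (induction n) (auto intro!: smooth_intros smooth_fam_open)

lemma smooth_compose:
  fixes \<phi> :: "real \<Rightarrow> 'a::euclidean_space \<Rightarrow> 'c::euclidean_space"
  assumes "smooth_fam M g" "smooth_fam N \<phi>" "\<And>t x. t \<in> {0..1} \<Longrightarrow> x \<in> N \<Longrightarrow> \<phi> t x \<in> M"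
  shows "smooth_fam N (\<lambda>t x. g t (\<phi> t x))"
proof -
  have "Ck_fam m N (\<lambda>t x. g t (\<phi> t x))" for m
    by (rule Ck_fam_compose[of N M \<phi> m g, OF _ _ assms(3)])
      (use assms(1,2) in \<open>simp_all add: smooth_fam_def\<close>)
  with assms(2) show ?thesis by (simp add: smooth_fam_def)
qed

lemma smooth_euclidean:
  fixes f :: "real \<Rightarrow> 'a::euclidean_space \<Rightarrow> 'b::euclidean_space"
  shows "smooth_fam N f \<longleftrightarrow> open N \<and> (\<forall>b\<in>Basis. smooth_fam N (\<lambda>t x. f t x \<bullet> b))"
  using Ck_fam_euclidean[of N _ f] by (auto simp: smooth_fam_def)

lemma smooth_exp [smooth_intros]:
  "smooth_fam N f \<Longrightarrow> smooth_fam N (\<lambda>t x. exp (f t x :: real))"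
  by (rule smooth_compose[of UNIV "\<lambda>_. exp"]) (auto simp: smooth_fam_def Ck_fam_exp)

lemma smooth_inverse [smooth_intros]:
  "smooth_fam N f \<Longrightarrow> (\<And>t x. t \<in> {0..1} \<Longrightarrow> x \<in> N \<Longrightarrow> f t x \<noteq> 0) \<Longrightarrow> smooth_fam N (\<lambda>t x. inverse (f t x :: real))"
  by (rule smooth_compose[of "- {0}" "\<lambda>_. inverse"]) (auto simp: smooth_fam_def Ck_fam_inverse_real)

lemma smooth_divide [smooth_intros]:
  "smooth_fam N f \<Longrightarrow> smooth_fam N g \<Longrightarrow> (\<And>t x. t \<in> {0..1} \<Longrightarrow> x \<in> N \<Longrightarrow> g t x \<noteq> 0) \<Longrightarrow>
    smooth_fam N (\<lambda>t x. f t x / g t x :: real)"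
  unfolding divide_inverse by (intro smooth_intros)

lemma smooth_sqrt [smooth_intros]:
  "smooth_fam N f \<Longrightarrow> (\<And>t x. t \<in> {0..1} \<Longrightarrow> x \<in> N \<Longrightarrow> f t x > 0) \<Longrightarrow> smooth_fam N (\<lambda>t x. sqrt (f t x))"
  by (rule smooth_compose[of "{0<..}" "\<lambda>_. sqrt"]) (auto simp: smooth_fam_def Ck_fam_sqrt)

lemma smooth_norm [smooth_intros]:
  fixes f :: "real \<Rightarrow> 'a::euclidean_space \<Rightarrow> 'b::euclidean_space"
  shows "smooth_fam N f \<Longrightarrow> (\<And>t x. t \<in> {0..1} \<Longrightarrow> x \<in> N \<Longrightarrow> f t x \<noteq> 0) \<Longrightarrow> smooth_fam N (\<lambda>t x. norm (f t x))"
  unfolding norm_eq_sqrt_inner by (intro smooth_intros) auto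

lemma smooth_det [smooth_intros]:
  assumes "open N" "\<And>i j. smooth_fam N (\<lambda>t x. A t x $ i $ j)"
  shows "smooth_fam N (\<lambda>t x. det (A t x :: real^'n^'n))"
  unfolding det_def by (intro smooth_intros assms)

lemma smooth_has_derivative:
  "smooth N f \<Longrightarrow> x \<in> N \<Longrightarrow> (f has_derivative frechet_derivative f (at x)) (at x)"
  using Ck_fam_differentiable[of 0 N "\<lambda>_. f" 0 x] by (simp add: smooth_fam_def del: Ck_fam.simps)

lemma smooth_fam_has_derivative:
  "smooth_fam N f \<Longrightarrow> t \<in> {0..1} \<Longrightarrow> x \<in> N \<Longrightarrow> (f t has_derivative frechet_derivative (f t) (at x)) (at x)"
  using Ck_fam_differentiable[of 0 N f t x] by (simp add: smooth_fam_def del: Ck_fam.simps)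

lemma smooth_frechet_derivative [smooth_intros]:
  fixes \<phi> :: "real \<Rightarrow> 'c::euclidean_space \<Rightarrow> 'a::euclidean_space"
  assumes "smooth_fam M f" "smooth_fam N v" "smooth_fam N \<phi>"
    and "\<And>t x. t \<in> {0..1} \<Longrightarrow> x \<in> N \<Longrightarrow> \<phi> t x \<in> M"
  shows "smooth_fam N (\<lambda>t x. frechet_derivative (f t) (at (\<phi> t x)) (v t x))"
proof -
  have "Ck_fam m N (\<lambda>t x. frechet_derivative (f t) (at (\<phi> t x)) (v t x))" for m
    by (rule Ck_fam_frechet_derivative[of N M m f v \<phi>])
      (use assms in \<open>simp_all add: smooth_fam_def del: Ck_fam.simps\<close>)
  then show ?thesis using assms(2) by (simp add: smooth_fam_def)
qed

lemma smooth_continuous_on: "smooth N f \<Longrightarrow> continuous_on N f"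
  by (rule continuous_at_imp_continuous_on) (blast intro: has_derivative_continuous smooth_has_derivative)

section \<open>Comparison with smoothness on arbitrary sets\<close>

lemma Ck_on_iff_Ck_fam:
  assumes "open V"
  shows "Ck_on m V f \<longleftrightarrow> Ck_fam m V (\<lambda>_. f)"
proof (induction m arbitrary: f)
  case 0
  have "continuous_on V f" if "continuous_on ({0..1::real} \<times> V) (\<lambda>p. f (snd p))"
  proof -
    have "continuous_on V ((\<lambda>p. f (snd p)) \<circ> (\<lambda>x. (0::real, x)))"
      by (rule continuous_on_compose)
        (use that in \<open>auto intro!: continuous_intros elim!: continuous_on_subset\<close>)
    then show ?thesis by (simp add: o_def)
  qed
  moreover have "continuous_on ({0..1::real} \<times> V) (f \<circ> snd)" if "continuous_on V f"
    by (intro continuous_on_compose continuous_intros) (use that in \<open>auto elim: continuous_on_subset\<close>)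
  ultimately show ?case by (auto simp: o_def)
next
  case (Suc m)
  have "continuous_on ({0..1::real} \<times> V) (\<lambda>p. f (snd p))" if "\<forall>x\<in>V. f differentiable (at x)"
  proof -
    have "continuous_on V f"
      using that by (meson continuous_at_imp_continuous_on differentiable_imp_continuous_within)
    then have "continuous_on ({0..1::real} \<times> V) (f \<circ> snd)"
      by (intro continuous_on_compose continuous_intros) (auto elim: continuous_on_subset)
    then show ?thesis by (simp add: o_def)
  qed
  then show ?case using Suc by auto
qed

lemma smooth_iff_Ck_on: "open V \<Longrightarrow> smooth V f \<longleftrightarrow> (\<forall>m. Ck_on m V f)"
  by (simp add: smooth_fam_def Ck_on_iff_Ck_fam)

lemma smooth_on_iff:
  "smooth_on S f \<longleftrightarrow> (\<forall>x\<in>S. \<exists>V F. x \<in> V \<and> smooth V F \<and> (\<forall>y\<in>V \<inter> S. F y = f y))"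
proof -
  have "open V \<and> x \<in> V \<and> (\<forall>m. Ck_on m V F) \<and> R \<longleftrightarrow> x \<in> V \<and> smooth V F \<and> R"
    for V x R and F :: "(real, 'a) vec \<Rightarrow> 'b"
    using smooth_iff_Ck_on[of V F] smooth_fam_open[of V "\<lambda>_. F"] by blast
  then show ?thesis unfolding smooth_on_def by simp
qed

text \<open>The local extensions coincide with \<open>f\<close> on the open sets
  \<open>V x \<inter> S\<close>, and these sets cover \<open>S\<close>.\<close>

lemma smooth_on_open:
  assumes "open S" shows "smooth_on S f \<longleftrightarrow> smooth S f"
proof
  assume "smooth S f"
  then show "smooth_on S f" unfolding smooth_on_iff by blast
next
  assume "smooth_on S f"
  then obtain V F where VF: "\<And>x. x \<in> S \<Longrightarrow> x \<in> V x" "\<And>x. x \<in> S \<Longrightarrow> smooth (V x) (F x)"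
     "\<And>x y. x \<in> S \<Longrightarrow> y \<in> V x \<inter> S \<Longrightarrow> F x y = f y"
    unfolding smooth_on_iff by metis
  have "smooth (\<Union>x\<in>S. V x \<inter> S) f"
  proof (rule smooth_UN)
    fix x assume "x \<in> S"
    have "smooth (V x \<inter> S) (F x)"
      using VF(2)[OF \<open>x \<in> S\<close>] assms smooth_fam_open by (blast intro: smooth_fam_subset)
    then show "smooth (V x \<inter> S) f"
      by (subst (asm) smooth_fam_cong) (use VF(3)[OF \<open>x \<in> S\<close>] in auto)
  qed
  moreover have "(\<Union>x\<in>S. V x \<inter> S) = S" using VF(1) by auto
  ultimately show "smooth S f" by simp
qed

lemma smooth_on_smooth: "smooth V F \<Longrightarrow> S \<subseteq> V \<Longrightarrow> (\<And>x. x \<in> S \<Longrightarrow> F x = f x) \<Longrightarrow> smooth_on S f"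
  unfolding smooth_on_iff by blast

section \<open>Smooth dependence on parameters for ordinary differential equations\<close>

text \<open>A substitute for Gronwall's inequality on the unit interval. The maximum
  \<open>M\<close> of \<open>u\<close> is attained and satisfies \<open>M \<le> c + q * M\<close>;
  as \<open>q < 1\<close>, the last term is absorbed on the left. It is applied with
  \<open>q = 1/2\<close> and \<open>q = 3/4\<close>.\<close>

lemma half_bound:
  fixes u :: "real \<Rightarrow> real"
  assumes "continuous_on {0..1} u"
    and *: "\<And>t M. t \<in> {0..1} \<Longrightarrow> (\<And>s. s \<in> {0..1} \<Longrightarrow> u s \<le> M) \<Longrightarrow> u t \<le> c + q * M"
    and "q < 1" "t \<in> {0..1}"
  shows "u t \<le> c / (1 - q)"
proof -
  obtain t0 where t0: "t0 \<in> {0..1}" "\<And>s. s \<in> {0..1} \<Longrightarrow> u s \<le> u t0"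
    using continuous_attains_sup[of "{0..1::real}" u] assms(1) by auto
  from *[OF t0] have "u t0 * (1 - q) \<le> c" by (simp add: algebra_simps)
  then have "u t0 \<le> c / (1 - q)" using \<open>q < 1\<close> by (simp add: pos_le_divide_eq)
  with t0(2)[OF assms(4)] show ?thesis by simp
qed

lemma integral_bound_01:
  fixes h :: "real \<Rightarrow> 'a::banach"
  assumes "continuous_on {0..1} h" "t \<in> {0..1}" "\<And>s. s \<in> {0..1} \<Longrightarrow> norm (h s) \<le> B"
  shows "norm (integral {0..t} h) \<le> B"
proof -
  have "norm (integral {0..t} h) \<le> B * (t - 0)"
    by (rule integral_bound) (use assms in \<open>auto elim: continuous_on_subset\<close>)
  moreover have "B * t \<le> B * 1"
  proof (rule mult_left_mono)
    show "0 \<le> B" using order_trans[OF norm_ge_zero assms(3)[of 0]] by simp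
  qed (use assms in auto)
  ultimately show ?thesis by simp
qed

text \<open>The initial value problem in integral form, which avoids one-sided derivatives at the
  ends of the interval and is convenient for differences of solutions.\<close>

definition solves :: "(real \<Rightarrow> 'e::banach \<Rightarrow> 'e) \<Rightarrow> 'e \<Rightarrow> (real \<Rightarrow> 'e) \<Rightarrow> bool" where
  "solves f y0 y \<longleftrightarrow> continuous_on {0..1} y \<and>
     (\<forall>t\<in>{0..1}. y t = y0 + integral {0..t} (\<lambda>s. f s (y s)))"

lemma solves_continuous: "solves f a y \<Longrightarrow> continuous_on {0..1} y"
  by (simp add: solves_def)

lemma solves_eq: "solves f a y \<Longrightarrow> t \<in> {0..1} \<Longrightarrow> y t = a + integral {0..t} (\<lambda>s. f s (y s))"
  by (simp add: solves_def)

lemma continuous_on_superpos: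
  assumes "continuous_on ({0..1::real} \<times> S) (\<lambda>p. f (fst p) (snd p))" "continuous_on {0..1} y"
    "\<And>s. s \<in> {0..1} \<Longrightarrow> y s \<in> S"
  shows "continuous_on {0..1} (\<lambda>s. f s (y s))"
proof -
  have "continuous_on {0..1} ((\<lambda>p. f (fst p) (snd p)) \<circ> (\<lambda>s. (s, y s)))"
    by (rule continuous_on_compose)
      (use assms in \<open>auto intro!: continuous_intros elim!: continuous_on_subset\<close>)
  then show ?thesis by (simp add: o_def)
qed

text \<open>On the unit time interval the constant \<open>1/2\<close> already makes the Picard operator a contraction.\<close>

definition half_lipschitz :: "(real \<Rightarrow> 'e::real_normed_vector \<Rightarrow> 'e) \<Rightarrow> bool" where
  "half_lipschitz f \<longleftrightarrow> (\<forall>t\<in>{0..1}. \<forall>y z. norm (f t y - f t z) \<le> norm (y - z) / 2)"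

lemma half_lipschitzD:
  "half_lipschitz f \<Longrightarrow> t \<in> {0..1} \<Longrightarrow> norm (f t y - f t z) \<le> norm (y - z) / 2"
  by (simp add: half_lipschitz_def)

lemma picard_existence:
  fixes f :: "real \<Rightarrow> 'e::banach \<Rightarrow> 'e"
  assumes c: "continuous_on ({0..1} \<times> UNIV) (\<lambda>p. f (fst p) (snd p))" and h: "half_lipschitz f"
  shows "\<exists>y. solves f y0 y"
proof -
  \<comment> \<open>Clamping time to the unit interval turns every candidate into a bounded
    continuous function on the whole line, so that the contraction acts on the complete space
    \<open>bcontfun\<close>.\<close>
  define \<pi> where "\<pi> = (\<lambda>t::real. min 1 (max 0 t))"
  have \<pi>: "\<pi> t \<in> {0..1}" "continuous_on UNIV \<pi>" for t
    by (auto simp: \<pi>_def intro!: continuous_intros)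
  have \<pi>_id: "\<pi> t = t" if "t \<in> {0..1}" for t using that by (auto simp: \<pi>_def)
  have cf: "continuous_on {0..1} (\<lambda>s. f s (apply_bcontfun u s))" for u
    by (rule continuous_on_superpos[OF c]) (auto intro: continuous_intros)
  define g where "g u t = y0 + integral {0..t} (\<lambda>s. f s (apply_bcontfun u s))" for u t
  have cg: "continuous_on {0..1} (g u)" for u
    unfolding g_def using cf[of u]
    by (intro continuous_intros indefinite_integral_continuous_1 integrable_continuous_interval)
  define P where "P u = Bcontfun (\<lambda>t. g u (\<pi> t))" for u
  have "(\<lambda>t. g u (\<pi> t)) \<in> bcontfun" for u
    unfolding bcontfun_def
  proof (intro CollectI conjI)
    show "continuous_on UNIV (\<lambda>t. g u (\<pi> t))"
      by (rule continuous_on_compose2[OF cg \<pi>(2)]) (use \<pi>(1) in auto)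
    have "bounded (g u ` {0..1})"
      by (intro compact_imp_bounded compact_continuous_image cg) simp
    moreover have "range (\<lambda>t. g u (\<pi> t)) \<subseteq> g u ` {0..1}" using \<pi>(1) by blast
    ultimately show "bounded (range (\<lambda>t. g u (\<pi> t)))" by (rule bounded_subset)
  qed
  then have P: "apply_bcontfun (P u) t = g u (\<pi> t)" for u t
    unfolding P_def by (simp add: Bcontfun_inverse)
  have "dist (P u) (P v) \<le> 1/2 * dist u v" for u v
  proof (rule dist_bound)
    fix t
    have "g u (\<pi> t) - g v (\<pi> t) =
        integral {0..\<pi> t} (\<lambda>s. f s (apply_bcontfun u s) - f s (apply_bcontfun v s))"
      unfolding g_def
      by (subst integral_diff)
        (use \<pi>(1)[of t] in \<open>auto intro!: integrable_continuous_interval continuous_on_subset[OF cf]\<close>)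
    moreover have "norm \<dots> \<le> 1/2 * dist u v"
    proof (rule integral_bound_01)
      show "continuous_on {0..1} (\<lambda>s. f s (apply_bcontfun u s) - f s (apply_bcontfun v s))"
        by (intro continuous_intros cf)
      fix s :: real assume "s \<in> {0..1}"
      then have "norm (f s (apply_bcontfun u s) - f s (apply_bcontfun v s))
          \<le> dist (apply_bcontfun u s) (apply_bcontfun v s) / 2"
        using half_lipschitzD[OF h] by (simp add: dist_norm)
      also have "\<dots> \<le> 1/2 * dist u v" using dist_bounded[of u s v] by simp
      finally show "norm (f s (apply_bcontfun u s) - f s (apply_bcontfun v s)) \<le> 1/2 * dist u v" .
    qed (rule \<pi>)
    ultimately show "dist (apply_bcontfun (P u) t) (apply_bcontfun (P v) t) \<le> 1/2 * dist u v"
      by (simp add: P dist_norm)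
  qed
  then obtain u where u: "P u = u"
    using banach_fix_type[of "1/2" P] by auto
  have "solves f y0 (apply_bcontfun u)"
    unfolding solves_def
  proof (intro conjI ballI)
    fix t :: real assume "t \<in> {0..1}"
    then show "apply_bcontfun u t = y0 + integral {0..t} (\<lambda>s. f s (apply_bcontfun u s))"
      using P[of u t] by (simp add: u \<pi>_id g_def)
  qed (auto intro: continuous_intros)
  then show ?thesis by blast
qed

text \<open>The \<open>1/2\<close> of the Lipschitz bound is absorbed by \<open>half_bound\<close>,
  which doubles the error \<open>norm (a - b) + \<epsilon>\<close>. The two fields have to be close
  only along the one solution \<open>z\<close>, so the result also compares solutions for different
  parameters.\<close>

lemma solves_stability:
  fixes f g :: "real \<Rightarrow> 'e::banach \<Rightarrow> 'e"
  assumes y: "solves f a y" and z: "solves g b z"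
    and f: "continuous_on ({0..1} \<times> UNIV) (\<lambda>p. f (fst p) (snd p))"
    and cg: "continuous_on {0..1} (\<lambda>s. g s (z s))"
    and h: "half_lipschitz f"
    and e: "\<And>s. s \<in> {0..1} \<Longrightarrow> norm (f s (z s) - g s (z s)) \<le> \<epsilon>"
    and t: "t \<in> {0..1}"
  shows "norm (y t - z t) \<le> 2 * (norm (a - b) + \<epsilon>)"
proof -
  have cf: "continuous_on {0..1} (\<lambda>s. f s (y s))"
    by (rule continuous_on_superpos[OF f solves_continuous[OF y]]) auto
  have "norm (y t - z t) \<le> (norm (a - b) + \<epsilon>) / (1 - 1/2)"
  proof (rule half_bound[where q = "1/2", OF _ _ _ t])
    show "continuous_on {0..1} (\<lambda>t. norm (y t - z t))"
      using solves_continuous[OF y] solves_continuous[OF z] by (intro continuous_intros)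
    fix t M assume t: "t \<in> {0..1::real}" and M: "\<And>s. s \<in> {0..1} \<Longrightarrow> norm (y s - z s) \<le> M"
    have "y t - z t = (a - b) + integral {0..t} (\<lambda>s. f s (y s) - g s (z s))"
      unfolding solves_eq[OF y t] solves_eq[OF z t]
      by (subst integral_diff)
        (use t in \<open>auto intro!: integrable_continuous_interval continuous_on_subset[OF cf] continuous_on_subset[OF cg]\<close>)
    also have "norm \<dots> \<le> norm (a - b) + (M / 2 + \<epsilon>)"
    proof (rule norm_triangle_mono[OF order_refl integral_bound_01])
      show "continuous_on {0..1} (\<lambda>s. f s (y s) - g s (z s))"
        by (intro continuous_intros cf cg)
      fix s :: real assume s: "s \<in> {0..1}"
      have "norm (f s (y s) - g s (z s)) \<le> norm (f s (y s) - f s (z s)) + norm (f s (z s) - g s (z s))"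
        by norm
      also have "\<dots> \<le> M / 2 + \<epsilon>"
        using half_lipschitzD[OF h s, of "y s" "z s"] e[OF s] M[OF s] by linarith
      finally show "norm (f s (y s) - g s (z s)) \<le> M / 2 + \<epsilon>" .
    qed (rule t)
    finally show "norm (y t - z t) \<le> norm (a - b) + \<epsilon> + 1/2 * M" by simp
  qed simp
  then show ?thesis by simp
qed

lemma solves_unique:
  fixes f :: "real \<Rightarrow> 'e::banach \<Rightarrow> 'e"
  assumes "solves f a y" "solves f a z"
    and f: "continuous_on ({0..1} \<times> UNIV) (\<lambda>p. f (fst p) (snd p))" "half_lipschitz f" "t \<in> {0..1}"
  shows "y t = z t"
proof -
  have "continuous_on {0..1} (\<lambda>s. f s (z s))"
    by (rule continuous_on_superpos[OF f(1) solves_continuous[OF assms(2)]]) auto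
  from solves_stability[OF assms(1,2) f(1) this f(2) _ f(3), of 0] show ?thesis by simp
qed

text \<open>Pointwise differentiability gives no uniformity in \<open>s\<close>. It comes from joint
  continuity of the derivative and compactness of the time interval: there is one radius within
  which the derivative varies by at most \<open>\<eta>\<close>, and the mean value inequality on
  balls bounds the remainder.\<close>

lemma uniform_first_order:
  fixes F :: "real \<Rightarrow> 'p::euclidean_space \<Rightarrow> 'e::real_normed_vector"
  assumes M: "open M" and F: "Ck_fam (Suc 0) M F" and c: "continuous_on {0..1} c"
    and cM: "\<And>s. s \<in> {0..1} \<Longrightarrow> c s \<in> M" and \<eta>: "\<eta> > 0"
  shows "\<exists>\<delta>>0. \<forall>s\<in>{0..1}. \<forall>h. norm h < \<delta> \<longrightarrow> c s + h \<in> M \<and>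
    norm (F s (c s + h) - F s (c s) - frechet_derivative (F s) (at (c s)) h) \<le> \<eta> * norm h"
proof -
  have "compact (c ` {0..1})" by (intro compact_continuous_image c) simp
  then obtain r where r: "r > 0" "(\<Union>x\<in>c ` {0..1}. ball x r) \<subseteq> M"
    using compact_subset_open_imp_ball_epsilon_subset[of "c ` {0..1}" M] M cM by blast
  define D where "D b s x = frechet_derivative (F s) (at x) b" for b s x
  \<comment> \<open>Each of the \<open>DIM('p)\<close> basis directions may contribute
    \<open>\<kappa>\<close>, so the derivatives differ by at most \<open>\<eta>\<close> in operator
    norm.\<close>
  define \<kappa> where "\<kappa> = \<eta> / real DIM('p)"
  have \<kappa>: "\<kappa> > 0" using \<eta> by (simp add: \<kappa>_def)
  have "\<exists>d>0. \<forall>h. norm h < d \<longrightarrow> (\<forall>s\<in>{0..1}. norm (D b s (c s + h) - D b s (c s)) \<le> \<kappa>)" for b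
  proof -
    have cD: "continuous_on ({0..1} \<times> M) (\<lambda>p. D b (fst p) (snd p))"
      using F by (simp add: D_def)
    have "continuous_on (ball 0 r \<times> {0..1}) ((\<lambda>p. D b (fst p) (snd p)) \<circ> (\<lambda>q. (snd q, c (snd q) + fst q)))"
    proof (rule continuous_on_compose)
      show "continuous_on (ball 0 r \<times> {0..1}) (\<lambda>q. (snd q, c (snd q) + fst q))"
        by (intro continuous_intros continuous_on_compose2[OF c]) auto
      have "c s + h \<in> M" if "norm h < r" "s \<in> {0..1}" for s h
        using r(2) that by (force simp: dist_norm)
      then show "continuous_on ((\<lambda>q. (snd q, c (snd q) + fst q)) ` (ball 0 r \<times> {0..1}))
          (\<lambda>p. D b (fst p) (snd p))"
        by (intro continuous_on_subset[OF cD]) auto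
    qed
    then have cE: "continuous_on (ball 0 r \<times> {0..1}) (\<lambda>q. D b (snd q) (c (snd q) + fst q))"
      by (simp add: o_def)
    have zero: "(0::'p) \<in> ball 0 r" using r(1) by simp
    obtain X where X: "0 \<in> X" "open X" "\<forall>h\<in>X \<inter> ball 0 r. \<forall>s\<in>{0..1}.
        dist (D b (snd (h, s)) (c (snd (h, s)) + fst (h, s))) (D b (snd (0::'p, s)) (c (snd (0::'p, s)) + fst (0, s))) \<le> \<kappa>"
      by (rule continuous_on_prod_compactE[OF cE compact_Icc zero \<kappa>])
    then have "open (X \<inter> ball 0 r)" "0 \<in> X \<inter> ball 0 r" using r(1) by auto
    then obtain d where "d > 0" "ball 0 d \<subseteq> X \<inter> ball 0 r" by (meson openE)
    then show ?thesis using X(3) by (intro exI[of _ d]) (simp add: dist_norm subset_iff)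
  qed
  then obtain d where d: "\<And>b. d b > 0"
      "\<And>b h s. norm h < d b \<Longrightarrow> s \<in> {0..1} \<Longrightarrow> norm (D b s (c s + h) - D b s (c s)) \<le> \<kappa>"
    by metis
  define \<delta> where "\<delta> = Min (insert r (d ` Basis))"
  have \<delta>: "\<delta> > 0" "\<delta> \<le> r" "\<And>b. b \<in> Basis \<Longrightarrow> \<delta> \<le> d b"
    using d(1) r(1) by (auto simp: \<delta>_def intro: min.coboundedI2 Min_le)
  show ?thesis
  proof (intro exI[of _ \<delta>] conjI ballI allI impI \<delta>(1))
    fix s :: real and h :: 'p assume s: "s \<in> {0..1}" and h: "norm h < \<delta>"
    have sub: "ball (c s) \<delta> \<subseteq> M" using r(2) \<delta>(2) s by force
    then show "c s + h \<in> M" using h by (force simp: dist_norm)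
    have dF: "(F s has_derivative frechet_derivative (F s) (at x)) (at x)" if "x \<in> M" for x
      using Ck_fam_differentiable[OF F s that] .
    have "norm (F s (c s + h) - F s (c s) - frechet_derivative (F s) (at (c s)) (c s + h - c s))
        \<le> norm (c s + h - c s) * \<eta>"
    proof (rule differentiable_bound_linearization[where S = "ball (c s) \<delta>" and f' = "\<lambda>x. frechet_derivative (F s) (at x)"])
      show "c s + t *\<^sub>R (c s + h - c s) \<in> ball (c s) \<delta>" if "t \<in> {0..1}" for t
      proof -
        have "norm (t *\<^sub>R h) \<le> norm h" using that by (auto intro: mult_left_le_one_le)
        then show ?thesis using h by (simp add: dist_norm)
      qed
      show "(F s has_derivative frechet_derivative (F s) (at x)) (at x within ball (c s) \<delta>)"
        if "x \<in> ball (c s) \<delta>" for x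
        using dF sub that by (blast intro: has_derivative_at_withinI)
      show "onorm (frechet_derivative (F s) (at x) - frechet_derivative (F s) (at (c s))) \<le> \<eta>"
        if x: "x \<in> ball (c s) \<delta>" for x
        unfolding fun_diff_def
      proof (rule onorm_le)
        fix i :: 'p
        have "frechet_derivative (F s) (at x) i - frechet_derivative (F s) (at (c s)) i =
            (\<Sum>b\<in>Basis. (i \<bullet> b) *\<^sub>R (D b s x - D b s (c s)))"
          using sub x cM s
          by (subst (1 2) has_derivative_Basis_sum[OF dF])
            (auto simp: D_def sum_subtractf algebra_simps)
        also have "norm \<dots> \<le> (\<Sum>b\<in>(Basis::'p set). norm i * \<kappa>)"
        proof (rule sum_norm_le)
          fix b :: 'p assume b: "b \<in> Basis"
          have "norm (D b s (c s + (x - c s)) - D b s (c s)) \<le> \<kappa>"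
            by (rule d(2)) (use x \<delta>(3)[OF b] s in \<open>auto simp: dist_norm norm_minus_commute\<close>)
          then show "norm ((i \<bullet> b) *\<^sub>R (D b s x - D b s (c s))) \<le> norm i * \<kappa>"
            using Basis_le_norm[OF b, of i] by (simp add: mult_mono)
        qed
        also have "\<dots> = \<eta> * norm i" by (simp add: \<kappa>_def)
        finally show "norm (frechet_derivative (F s) (at x) i - frechet_derivative (F s) (at (c s)) i)
            \<le> \<eta> * norm i" .
      qed
    qed (use \<delta>(1) in auto)
    then show "norm (F s (c s + h) - F s (c s) - frechet_derivative (F s) (at (c s)) h) \<le> \<eta> * norm h"
      by (simp add: mult.commute)
  qed
qed

text \<open>The Lipschitz bound is asked for along the single direction \<open>v\<close>, because
  the field of a differential equation is controlled in the unknown and not in the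
  parameter.\<close>

lemma lipschitz_derivative_bound:
  fixes f :: "'a::real_normed_vector \<Rightarrow> 'b::real_normed_vector"
  assumes f: "(f has_derivative f') (at x)" and L: "\<And>h. norm (f (x + h *\<^sub>R v) - f x) \<le> L * norm (h *\<^sub>R v)"
  shows "norm (f' v) \<le> L * norm v"
proof (cases "v = 0")
  case True
  then show ?thesis using linear_0[OF has_derivative_linear[OF f]] by simp
next
  case False
  have l: "f' (h *\<^sub>R v) = h *\<^sub>R f' v" for h
    using linear_scale[OF has_derivative_linear[OF f]] .
  have "norm (f' v) / norm v \<le> L + e" if "e > 0" for e
  proof -
    obtain d where d: "d > 0"
      "\<And>y. norm (y - x) < d \<Longrightarrow> norm (f y - f x - f' (y - x)) \<le> e * norm (y - x)"
      using f \<open>e > 0\<close> unfolding has_derivative_at_alt by blast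
    define h where "h = d / (2 * norm v)"
    have h: "h > 0" "norm (h *\<^sub>R v) < d" using d(1) False by (simp_all add: h_def)
    have "norm (f (x + h *\<^sub>R v) - f x - f' (h *\<^sub>R v)) \<le> e * norm (h *\<^sub>R v)"
      using d(2)[of "x + h *\<^sub>R v"] h(2) by simp
    with L[of h] norm_triangle_ineq2[of "f' (h *\<^sub>R v)" "f (x + h *\<^sub>R v) - f x"]
    have "norm (f' (h *\<^sub>R v)) \<le> L * norm (h *\<^sub>R v) + e * norm (h *\<^sub>R v)"
      by (simp add: norm_minus_commute)
    then have "h * norm (f' v) \<le> h * ((L + e) * norm v)"
      using h(1) by (simp add: l algebra_simps)
    then have "norm (f' v) \<le> (L + e) * norm v" using h(1) by simp
    then show ?thesis using False by (simp add: pos_divide_le_eq)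
  qed
  then have "norm (f' v) / norm v \<le> L" by (rule field_le_epsilon)
  then show ?thesis using False by (simp add: pos_divide_le_eq)
qed

section \<open>Dependence of solutions on a parameter\<close>

text \<open>The solution family \<open>y\<close> is given and not constructed here, so that the
  locale can be entered with flows, with plain integrals, and with the solutions \<open>z\<close> of
  the linearised equation.\<close>

locale param_ode =
  fixes N :: "'a::euclidean_space set" and f :: "real \<Rightarrow> 'a \<times> 'e::euclidean_space \<Rightarrow> 'e"
    and y0 :: "'a \<Rightarrow> 'e" and y :: "real \<Rightarrow> 'a \<Rightarrow> 'e"
  assumes open_N: "open N"
    and f_cont: "continuous_on ({0..1} \<times> (N \<times> UNIV)) (\<lambda>p. f (fst p) (snd p))"
    and f_lip: "\<And>x. x \<in> N \<Longrightarrow> half_lipschitz (\<lambda>t u. f t (x, u))"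
    and y0_cont: "continuous_on N y0"
    and sol: "\<And>x. x \<in> N \<Longrightarrow> solves (\<lambda>t u. f t (x, u)) (y0 x) (\<lambda>t. y t x)"
begin

lemma f_cont_slice:
  assumes "x \<in> N" shows "continuous_on ({0..1} \<times> UNIV) (\<lambda>p. f (fst p) (x, snd p))"
proof -
  have "continuous_on ({0..1} \<times> UNIV) ((\<lambda>p. f (fst p) (snd p)) \<circ> (\<lambda>p. (fst p, (x, snd p))))"
    by (rule continuous_on_compose)
      (use assms in \<open>auto intro!: continuous_intros continuous_on_subset[OF f_cont]\<close>)
  then show ?thesis by (simp add: o_def)
qed

lemma y_cont: "x \<in> N \<Longrightarrow> continuous_on {0..1} (\<lambda>t. y t x)"
  using sol solves_continuous by blast

text \<open>Along the curve \<open>y t x0\<close> the fields for \<open>x\<close> and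
  \<open>x0\<close> differ little, uniformly in time by compactness of \<open>{0..1}\<close>, so
  \<open>solves_stability\<close> compares the two solutions.\<close>

lemma equicontinuous:
  assumes x0: "x0 \<in> N" and \<epsilon>: "\<epsilon> > 0"
  shows "\<exists>d>0. \<forall>x. dist x x0 < d \<longrightarrow> x \<in> N \<and> (\<forall>t\<in>{0..1}. norm (y t x - y t x0) \<le> \<epsilon>)"
proof -
  have "continuous_on (N \<times> {0..1}) ((\<lambda>p. f (fst p) (snd p)) \<circ> (\<lambda>q. (snd q, (fst q, y (snd q) x0))))"
    by (rule continuous_on_compose)
      (auto intro!: continuous_intros continuous_on_subset[OF f_cont] continuous_on_compose2[OF y_cont[OF x0]])
  then have c: "continuous_on (N \<times> {0..1}) (\<lambda>q. f (snd q) (fst q, y (snd q) x0))"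
    by (simp add: o_def)
  \<comment> \<open>Two errors of \<open>\<epsilon> / 4\<close>, one from the initial value and one
    from the field, are doubled by \<open>solves_stability\<close>.\<close>
  have \<epsilon>4: "\<epsilon> / 4 > 0" using \<epsilon> by simp
  obtain X where X: "x0 \<in> X" "open X" "\<forall>x\<in>X \<inter> N. \<forall>s\<in>{0..1}.
      dist (f (snd (x, s)) (fst (x, s), y (snd (x, s)) x0)) (f (snd (x0, s)) (fst (x0, s), y (snd (x0, s)) x0)) \<le> \<epsilon> / 4"
    by (rule continuous_on_prod_compactE[OF c compact_Icc x0 \<epsilon>4])
  obtain d1 where d1: "d1 > 0" "\<And>x. x \<in> N \<Longrightarrow> dist x x0 < d1 \<Longrightarrow> dist (y0 x) (y0 x0) < \<epsilon> / 4"
    using y0_cont x0 \<epsilon>4 unfolding continuous_on_iff by meson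
  have "open (X \<inter> N)" "x0 \<in> X \<inter> N" using X x0 open_N by auto
  then obtain d2 where d2: "d2 > 0" "ball x0 d2 \<subseteq> X \<inter> N" by (meson openE)
  show ?thesis
  proof (intro exI[of _ "min d1 d2"] conjI allI impI ballI)
    fix x assume "dist x x0 < min d1 d2"
    then have x: "x \<in> X \<inter> N" and xd: "dist x x0 < d1" using d2(2) by (auto simp: dist_commute)
    then show "x \<in> N" by simp
    fix t :: real assume t: "t \<in> {0..1}"
    have cg: "continuous_on {0..1} (\<lambda>s. f s (x0, y s x0))"
      by (rule continuous_on_superpos[OF f_cont_slice[OF x0] y_cont[OF x0]]) auto
    have "norm (y t x - y t x0) \<le> 2 * (norm (y0 x - y0 x0) + \<epsilon> / 4)"
      by (rule solves_stability[OF sol sol f_cont_slice cg f_lip _ t])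
        (use x x0 X(3) in \<open>auto simp: dist_norm\<close>)
    also have "\<dots> \<le> \<epsilon>" using d1(2)[OF _ xd] x by (simp add: dist_norm)
    finally show "norm (y t x - y t x0) \<le> \<epsilon>" .
  qed (use d1(1) d2(1) in auto)
qed

lemma y_Ck_0: "continuous_on ({0..1} \<times> N) (\<lambda>p. y (fst p) (snd p))"
  unfolding continuous_on_iff
proof (intro ballI allI impI)
  fix p :: "real \<times> 'a" and e assume p: "p \<in> {0..1} \<times> N" and e: "e > (0::real)"
  obtain d1 where d1: "d1 > 0" "\<And>x t. dist x (snd p) < d1 \<Longrightarrow> t \<in> {0..1} \<Longrightarrow> norm (y t x - y t (snd p)) \<le> e / 3"
    using equicontinuous[of "snd p" "e / 3"] p e by auto
  obtain d2 where d2: "d2 > 0" "\<And>t. t \<in> {0..1} \<Longrightarrow> dist t (fst p) < d2 \<Longrightarrow> dist (y t (snd p)) (y (fst p) (snd p)) < e / 3"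
  proof -
    have "snd p \<in> N" "fst p \<in> {0..1}" "e / 3 > 0" using p e by auto
    then show ?thesis using that y_cont[of "snd p"] unfolding continuous_on_iff by blast
  qed
  show "\<exists>d>0. \<forall>p'\<in>{0..1} \<times> N. dist p' p < d \<longrightarrow> dist (y (fst p') (snd p')) (y (fst p) (snd p)) < e"
  proof (intro exI[of _ "min d1 d2"] conjI ballI impI)
    fix p' assume p': "p' \<in> {0..1} \<times> N" "dist p' p < min d1 d2"
    then have "dist (snd p') (snd p) < d1" "dist (fst p') (fst p) < d2"
      using dist_snd_le[of p' p] dist_fst_le[of p' p] by linarith+
    then have "dist (y (fst p') (snd p')) (y (fst p') (snd p)) \<le> e / 3"
      "dist (y (fst p') (snd p)) (y (fst p) (snd p)) < e / 3"
      using d1(2) d2(2) p' by (auto simp: dist_norm)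
    with e dist_triangle[of "y (fst p') (snd p')" "y (fst p) (snd p)" "y (fst p') (snd p)"]
    show "dist (y (fst p') (snd p')) (y (fst p) (snd p)) < e" by linarith
  qed (use d1(1) d2(1) in auto)
qed

end

text \<open>The right-hand side of the equation of first variation along \<open>y\<close> in
  direction \<open>v\<close>. It is a function of the pair of parameter and unknown, the shape
  required by \<open>param_ode\<close>, so that it can take the place of \<open>f\<close> when the
  argument is repeated.\<close>

definition variation :: "(real \<Rightarrow> 'a \<times> 'e \<Rightarrow> 'e) \<Rightarrow> (real \<Rightarrow> 'a \<Rightarrow> 'e) \<Rightarrow> 'a \<Rightarrow>
    real \<Rightarrow> 'a::euclidean_space \<times> 'e::euclidean_space \<Rightarrow> 'e" where
  "variation f y v t q = frechet_derivative (f t) (at (fst q, y t (fst q))) (v, snd q)"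

locale param_ode_C1 = param_ode N f y0 y
  for N :: "'a::euclidean_space set" and f :: "real \<Rightarrow> 'a \<times> 'e::euclidean_space \<Rightarrow> 'e"
    and y0 :: "'a \<Rightarrow> 'e" and y :: "real \<Rightarrow> 'a \<Rightarrow> 'e" +
  assumes f_C1: "Ck_fam (Suc 0) (N \<times> UNIV) f"
    and y0_diff: "\<And>x. x \<in> N \<Longrightarrow> y0 differentiable (at x)"
begin

lemma f_deriv: "t \<in> {0..1} \<Longrightarrow> x \<in> N \<Longrightarrow>
    (f t has_derivative frechet_derivative (f t) (at (x, u))) (at (x, u))"
  using Ck_fam_differentiable[OF f_C1] by simp

lemma open_NU: "open (N \<times> UNIV)" using open_N by (intro open_Times) auto

text \<open>One derivative is spent on \<open>f\<close> but none on \<open>y\<close>: with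
  \<open>y\<close> of class \<open>m\<close> the linearised equation is of class \<open>m\<close> as
  well. This asymmetry lets the induction on the order close.\<close>

lemma variation_Ck:
  assumes "Ck_fam (Suc m) (N \<times> UNIV) f" "Ck_fam m N y"
  shows "Ck_fam m (N \<times> UNIV) (variation f y v)"
proof -
  have y: "Ck_fam m (N \<times> UNIV) (\<lambda>t q. y t (fst q))"
    by (rule Ck_fam_compose[of _ N "\<lambda>_ q. fst q", OF open_NU open_N _ assms(2)
        Ck_fam_linear[OF open_NU bounded_linear_fst Ck_fam_id]]) auto
  have "Ck_fam m (N \<times> UNIV) (\<lambda>t q. frechet_derivative (f t) (at (fst q, y t (fst q))) (v, snd q))"
    by (rule Ck_fam_frechet_derivative[OF open_NU open_NU assms(1)];
        (intro Ck_fam_Pair open_NU y Ck_fam_const Ck_fam_linear[OF open_NU bounded_linear_fst Ck_fam_id]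
         Ck_fam_linear[OF open_NU bounded_linear_snd Ck_fam_id])?) auto
  then show ?thesis by (simp add: variation_def[abs_def])
qed

lemma variation_cont: "continuous_on ({0..1} \<times> (N \<times> UNIV)) (\<lambda>p. variation f y v (fst p) (snd p))"
  by (rule Ck_fam_continuous, rule variation_Ck[where m = 0]) (use f_C1 y_Ck_0 in auto)

text \<open>The derivative in the unknown inherits the constant 1/2, so the linearised equation is
  half Lipschitz too and can be solved on the same time interval.\<close>

lemma deriv_half:
  assumes "t \<in> {0..1}" "x \<in> N"
  shows "norm (frechet_derivative (f t) (at (x, u)) (0, w)) \<le> norm w / 2"
proof -
  have "norm (frechet_derivative (f t) (at (x, u)) (0, w)) \<le> (1/2) * norm (0::'a, w)"
  proof (rule lipschitz_derivative_bound[OF f_deriv[OF assms]])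
    show "norm (f t ((x, u) + h *\<^sub>R (0, w)) - f t (x, u)) \<le> (1/2) * norm (h *\<^sub>R (0::'a, w))" for h
      using half_lipschitzD[OF f_lip[OF assms(2)] assms(1), of "u + h *\<^sub>R w" u]
      by (simp add: norm_Pair)
  qed
  then show ?thesis by (simp add: norm_Pair)
qed

lemma deriv_split:
  assumes "t \<in> {0..1}" "x \<in> N"
  shows "frechet_derivative (f t) (at (x, u)) (v, w) =
    frechet_derivative (f t) (at (x, u)) (v, w') + frechet_derivative (f t) (at (x, u)) (0, w - w')"
  using linear_add[OF has_derivative_linear[OF f_deriv[OF assms]], of u "(v, w')" "(0, w - w')"] by simp

lemma variation_lip:
  assumes "x \<in> N" shows "half_lipschitz (\<lambda>t u. variation f y v t (x, u))"
  unfolding half_lipschitz_def variation_def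
proof (intro ballI allI)
  fix t :: real and u u' assume t: "t \<in> {0..1}"
  show "norm (frechet_derivative (f t) (at (fst (x, u), y t (fst (x, u)))) (v, snd (x, u)) -
      frechet_derivative (f t) (at (fst (x, u'), y t (fst (x, u')))) (v, snd (x, u'))) \<le> norm (u - u') / 2"
    using deriv_split[OF t assms, of "y t x" v u u'] deriv_half[OF t assms] by simp
qed

text \<open>The candidate for the derivative of \<open>y t\<close> at \<open>x\<close> in direction
  \<open>v\<close>, chosen as a solution of the linearised equation, which is uniquely
  solvable.\<close>

definition z :: "'a \<Rightarrow> real \<Rightarrow> 'a \<Rightarrow> 'e" where
  "z v t x = (SOME u. solves (\<lambda>t u. variation f y v t (x, u)) (frechet_derivative y0 (at x) v) u) t"

lemma variation_cont_slice:
  assumes "x \<in> N"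
  shows "continuous_on ({0..1} \<times> UNIV) (\<lambda>p. variation f y v (fst p) (x, snd p))"
proof -
  have "continuous_on ({0..1} \<times> UNIV) ((\<lambda>p. variation f y v (fst p) (snd p)) \<circ> (\<lambda>p. (fst p, (x, snd p))))"
    by (rule continuous_on_compose)
      (use assms in \<open>auto intro!: continuous_intros continuous_on_subset[OF variation_cont]\<close>)
  then show ?thesis by (simp add: o_def)
qed

lemma z_solves:
  assumes "x \<in> N"
  shows "solves (\<lambda>t u. variation f y v t (x, u)) (frechet_derivative y0 (at x) v) (\<lambda>t. z v t x)"
proof -
  have "\<exists>u. solves (\<lambda>t u. variation f y v t (x, u)) (frechet_derivative y0 (at x) v) u"
    by (rule picard_existence) (use variation_cont_slice variation_lip assms in auto)
  from someI_ex[OF this] show ?thesis unfolding z_def by simp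
qed

lemma z_superpos: "x \<in> N \<Longrightarrow> continuous_on {0..1} (\<lambda>s. variation f y v s (x, z v s x))"
  by (rule continuous_on_superpos[OF variation_cont_slice solves_continuous[OF z_solves]]) auto

text \<open>Both sides of each identity solve the same initial value problem, so linearity is a
  matter of uniqueness.\<close>

lemma z_linear:
  assumes x: "x \<in> N" and t: "t \<in> {0..1}"
  shows "linear (\<lambda>v. z v t x)"
proof (rule linearI)
  have l0: "linear (frechet_derivative y0 (at x))"
    using y0_diff[OF x] by (simp add: linear_frechet_derivative)
  have lf: "linear (frechet_derivative (f s) (at (x, y s x)))" if "s \<in> {0..1}" for s
    using has_derivative_linear[OF f_deriv[OF that x]] .
  have int: "(\<lambda>s. variation f y v s (x, z v s x)) integrable_on {0..t}" if "t \<in> {0..1}" for v t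
    using that by (intro integrable_continuous_interval continuous_on_subset[OF z_superpos[OF x]]) auto
  show "z (v + w) t x = z v t x + z w t x" for v w
  proof (rule solves_unique[OF z_solves[OF x] _ variation_cont_slice[OF x] variation_lip[OF x] t])
    show "solves (\<lambda>t u. variation f y (v + w) t (x, u)) (frechet_derivative y0 (at x) (v + w)) (\<lambda>t. z v t x + z w t x)"
      unfolding solves_def
    proof (intro conjI ballI)
      show "continuous_on {0..1} (\<lambda>t. z v t x + z w t x)"
        by (intro continuous_intros solves_continuous[OF z_solves[OF x]])
      fix t :: real assume t: "t \<in> {0..1}"
      have "integral {0..t} (\<lambda>s. variation f y (v + w) s (x, z v s x + z w s x)) =
          integral {0..t} (\<lambda>s. variation f y v s (x, z v s x) + variation f y w s (x, z w s x))"
      proof (rule integral_cong)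
        fix s assume "s \<in> {0..t}"
        then have "linear (frechet_derivative (f s) (at (x, y s x)))" using lf t by auto
        from linear_add[OF this, of "(v, z v s x)" "(w, z w s x)"]
        show "variation f y (v + w) s (x, z v s x + z w s x) =
          variation f y v s (x, z v s x) + variation f y w s (x, z w s x)"
          by (simp add: variation_def)
      qed
      also have "\<dots> = integral {0..t} (\<lambda>s. variation f y v s (x, z v s x)) + integral {0..t} (\<lambda>s. variation f y w s (x, z w s x))"
        by (rule integral_add[OF int[OF t] int[OF t]])
      finally show "z v t x + z w t x = frechet_derivative y0 (at x) (v + w) +
          integral {0..t} (\<lambda>s. variation f y (v + w) s (x, z v s x + z w s x))"
        unfolding solves_eq[OF z_solves[OF x] t, of v] solves_eq[OF z_solves[OF x] t, of w]
        by (simp add: linear_add[OF l0])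
    qed
  qed
  show "z (r *\<^sub>R v) t x = r *\<^sub>R z v t x" for r v
  proof (rule solves_unique[OF z_solves[OF x] _ variation_cont_slice[OF x] variation_lip[OF x] t])
    show "solves (\<lambda>t u. variation f y (r *\<^sub>R v) t (x, u)) (frechet_derivative y0 (at x) (r *\<^sub>R v)) (\<lambda>t. r *\<^sub>R z v t x)"
      unfolding solves_def
    proof (intro conjI ballI)
      show "continuous_on {0..1} (\<lambda>t. r *\<^sub>R z v t x)"
        by (intro continuous_intros solves_continuous[OF z_solves[OF x]])
      fix t :: real assume t: "t \<in> {0..1}"
      have "integral {0..t} (\<lambda>s. variation f y (r *\<^sub>R v) s (x, r *\<^sub>R z v s x)) =
          integral {0..t} (\<lambda>s. r *\<^sub>R variation f y v s (x, z v s x))"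
      proof (rule integral_cong)
        fix s assume "s \<in> {0..t}"
        then have "linear (frechet_derivative (f s) (at (x, y s x)))" using lf t by auto
        from linear_scale[OF this, of r "(v, z v s x)"]
        show "variation f y (r *\<^sub>R v) s (x, r *\<^sub>R z v s x) = r *\<^sub>R variation f y v s (x, z v s x)"
          by (simp add: variation_def)
      qed
      then show "r *\<^sub>R z v t x = frechet_derivative y0 (at x) (r *\<^sub>R v) +
          integral {0..t} (\<lambda>s. variation f y (r *\<^sub>R v) s (x, r *\<^sub>R z v s x))"
        unfolding solves_eq[OF z_solves[OF x] t, of v]
        by (simp add: linear_scale[OF l0] scaleR_add_right)
    qed
  qed
qed

lemma z_bound:
  assumes x: "x \<in> N"
  shows "\<exists>Z\<ge>0. \<forall>t\<in>{0..1}. \<forall>v. norm (z v t x) \<le> Z * norm v"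
proof -
  have "\<exists>B. \<forall>t\<in>{0..1}. norm (z b t x) \<le> B" for b
  proof -
    have "bounded ((\<lambda>t. z b t x) ` {0..1})"
      by (intro compact_imp_bounded compact_continuous_image solves_continuous[OF z_solves[OF x]]) simp
    then show ?thesis by (auto simp: bounded_iff)
  qed
  then obtain B where B: "\<And>b t. t \<in> {0..1} \<Longrightarrow> norm (z b t x) \<le> B b" by metis
  show ?thesis
  proof (intro exI[of _ "\<Sum>b\<in>Basis. B b"] conjI ballI allI)
    show "0 \<le> (\<Sum>b\<in>Basis. B b)"
      by (intro sum_nonneg order_trans[OF norm_ge_zero B[of 0]]) auto
    fix t :: real and v assume t: "t \<in> {0..1}"
    have "z v t x = z (\<Sum>b\<in>Basis. (v \<bullet> b) *\<^sub>R b) t x" by (simp add: euclidean_representation)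
    also have "\<dots> = (\<Sum>b\<in>Basis. (v \<bullet> b) *\<^sub>R z b t x)"
      by (simp add: linear_sum[OF z_linear[OF x t]] linear_scale[OF z_linear[OF x t]])
    also have "norm \<dots> \<le> (\<Sum>b\<in>Basis. B b * norm v)"
    proof (rule sum_norm_le)
      fix b :: 'a assume "b \<in> Basis"
      then have "\<bar>v \<bullet> b\<bar> * norm (z b t x) \<le> norm v * B b"
        using B[OF t, of b] Basis_le_norm[of b v] by (intro mult_mono) auto
      then show "norm ((v \<bullet> b) *\<^sub>R z b t x) \<le> B b * norm v" by (simp add: mult.commute)
    qed
    finally show "norm (z v t x) \<le> (\<Sum>b\<in>Basis. B b) * norm v" by (simp add: sum_distrib_right)
  qed
qed

text \<open>Up to first order remainders, the error \<open>y t x' - y t x - z (x' - x) t x\<close>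
  satisfies the homogeneous linearised equation with small data. The remainder of \<open>f\<close>
  involves the error itself through the increment of \<open>y\<close>; \<open>half_bound\<close>
  absorbs this together with the linear term.\<close>

theorem y_has_derivative:
  assumes x: "x \<in> N" and t: "t \<in> {0..1}"
  shows "(y t has_derivative (\<lambda>v. z v t x)) (at x)"
  unfolding has_derivative_at_alt
proof (intro conjI allI impI)
  show "bounded_linear (\<lambda>v. z v t x)" using z_linear[OF x t] by (simp add: linear_conv_bounded_linear)
  fix e :: real assume e: "e > 0"
  obtain Z where Z: "Z \<ge> 0" "\<And>t v. t \<in> {0..1} \<Longrightarrow> norm (z v t x) \<le> Z * norm v"
    using z_bound[OF x] by blast
  \<comment> \<open>The cap \<open>1/4\<close>, added to the \<open>1/2\<close> of
    \<open>deriv_half\<close>, gives the factor \<open>3/4\<close> below. \<open>half_bound\<close>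
    then multiplies by 4, which the 8 outweighs; \<open>2 + Z\<close> counts the copies of
    \<open>\<eta> * norm k\<close> that the remainders contribute.\<close>
  define \<eta> where "\<eta> = min (1/4) (e / (8 * (2 + Z)))"
  have \<eta>: "\<eta> > 0" "\<eta> \<le> 1/4" "\<eta> * (2 + Z) \<le> e / 8"
  proof -
    show "\<eta> > 0" using e Z(1) by (auto simp: \<eta>_def)
    show "\<eta> \<le> 1/4" unfolding \<eta>_def by (rule min.cobounded1)
    have "\<eta> * (2 + Z) \<le> e / (8 * (2 + Z)) * (2 + Z)"
      using Z(1) by (intro mult_right_mono) (auto simp: \<eta>_def)
    also have "\<dots> = e / 8" using Z(1) by (simp add: field_simps)
    finally show "\<eta> * (2 + Z) \<le> e / 8" .
  qed
  have "\<exists>\<delta>>0. \<forall>s\<in>{0..1}. \<forall>h. norm h < \<delta> \<longrightarrow> (x, y s x) + h \<in> N \<times> UNIV \<and>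
    norm (f s ((x, y s x) + h) - f s (x, y s x) - frechet_derivative (f s) (at (x, y s x)) h) \<le> \<eta> * norm h"
    by (rule uniform_first_order[OF open_NU f_C1])
      (use x \<eta>(1) in \<open>auto intro!: continuous_intros y_cont\<close>)
  then obtain \<delta> where \<delta>: "\<delta> > 0" "\<And>s h. s \<in> {0..1} \<Longrightarrow> norm h < \<delta> \<Longrightarrow>
    norm (f s ((x, y s x) + h) - f s (x, y s x) - frechet_derivative (f s) (at (x, y s x)) h) \<le> \<eta> * norm h"
    by blast
  obtain d1 where d1: "d1 > 0" "\<And>x'. dist x' x < d1 \<Longrightarrow> x' \<in> N"
    "\<And>x' t. dist x' x < d1 \<Longrightarrow> t \<in> {0..1} \<Longrightarrow> norm (y t x' - y t x) \<le> \<delta> / 4"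
    using equicontinuous[OF x, of "\<delta> / 4"] \<delta>(1) by auto
  have "(y0 has_derivative frechet_derivative y0 (at x)) (at x)"
    using y0_diff[OF x] by (simp add: frechet_derivative_works)
  then obtain d2 where d2: "d2 > 0" "\<And>x'. norm (x' - x) < d2 \<Longrightarrow>
      norm (y0 x' - y0 x - frechet_derivative y0 (at x) (x' - x)) \<le> \<eta> * norm (x' - x)"
    using \<eta>(1) unfolding has_derivative_at_alt by blast
  show "\<exists>d>0. \<forall>x'. norm (x' - x) < d \<longrightarrow> norm (y t x' - y t x - z (x' - x) t x) \<le> e * norm (x' - x)"
  proof (intro exI[of _ "min (min d1 d2) (\<delta> / 2)"] conjI allI impI)
    show "0 < min (min d1 d2) (\<delta> / 2)" using d1(1) d2(1) \<delta>(1) by simp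
    fix x' assume x': "norm (x' - x) < min (min d1 d2) (\<delta> / 2)"
    define k where "k = x' - x"
    have k: "norm k < d1" "norm k < d2" "norm k < \<delta> / 2" using x' by (auto simp: k_def)
    have xN: "x' \<in> N" and xd: "dist x' x < d1" using d1(2)[of x'] k by (auto simp: k_def dist_norm)
    define E where "E s = y s x' - y s x - z k s x" for s
    have cont: "continuous_on {0..1} (\<lambda>s. f s (u, y s u))" if "u \<in> N" for u
      by (rule continuous_on_superpos[OF f_cont_slice[OF that] y_cont[OF that]]) auto
    have "norm (E t) \<le> (\<eta> * (2 + Z) * norm k) / (1 - 3/4)"
    proof (rule half_bound[where q = "3/4", OF _ _ _ t])
      show "continuous_on {0..1} (\<lambda>t. norm (E t))"
        unfolding E_def using y_cont[OF x] y_cont[OF xN] solves_continuous[OF z_solves[OF x]]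
        by (intro continuous_intros)
      fix t M assume t: "t \<in> {0..1::real}" and M: "\<And>s. s \<in> {0..1} \<Longrightarrow> norm (E s) \<le> M"
      have int: "g integrable_on {0..t}" if "continuous_on {0..1} g" for g :: "real \<Rightarrow> 'e"
        using that t by (intro integrable_continuous_interval) (auto elim: continuous_on_subset)
      have "E t = (y0 x' - y0 x - frechet_derivative y0 (at x) k) +
        integral {0..t} (\<lambda>s. f s (x', y s x') - f s (x, y s x) - variation f y k s (x, z k s x))"
        unfolding E_def solves_eq[OF sol[OF x] t] solves_eq[OF sol[OF xN] t] solves_eq[OF z_solves[OF x] t]
        by (subst integral_diff integral_diff;
            (intro int continuous_intros cont x xN z_superpos)?)+ simp
      also have "norm \<dots> \<le> \<eta> * norm k + (\<eta> * (1 + Z) * norm k + 3/4 * M)"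
      proof (rule norm_triangle_mono[OF _ integral_bound_01[OF _ t]])
        show "norm (y0 x' - y0 x - frechet_derivative y0 (at x) k) \<le> \<eta> * norm k"
          using d2(2)[of x'] k by (simp add: k_def)
        show "continuous_on {0..1} (\<lambda>s. f s (x', y s x') - f s (x, y s x) - variation f y k s (x, z k s x))"
          by (intro continuous_intros cont x xN z_superpos)
        fix s :: real assume s: "s \<in> {0..1}"
        define d where "d = y s x' - y s x"
        have "norm d \<le> \<delta> / 4" using d1(3)[OF xd s] by (simp add: d_def)
        moreover have nkd: "norm (k, d) \<le> norm k + norm d" by (rule norm_Pair_le)
        ultimately have "norm (k, d) < \<delta>" using k \<delta>(1) by linarith
        from \<delta>(2)[OF s this] have R: "norm (f s (x', y s x') - f s (x, y s x) -
            frechet_derivative (f s) (at (x, y s x)) (k, d)) \<le> \<eta> * norm (k, d)"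
          by (simp add: k_def d_def)
        have "norm d \<le> norm (E s) + norm (z k s x)"
          using norm_triangle_ineq[of "E s" "z k s x"] by (simp add: E_def d_def)
        then have "norm (k, d) \<le> norm k + M + Z * norm k"
          using nkd M[OF s] Z(2)[OF s, of k] by linarith
        then have "\<eta> * norm (k, d) \<le> \<eta> * (1 + Z) * norm k + \<eta> * M"
          using mult_left_mono[of "norm (k, d)" _ \<eta>] \<eta>(1) by (fastforce simp: algebra_simps)
        moreover have "\<eta> * M \<le> 1/4 * M"
          using \<eta>(2) order_trans[OF norm_ge_zero M[OF s]] by (intro mult_right_mono)
        ultimately have R': "norm (f s (x', y s x') - f s (x, y s x) -
            frechet_derivative (f s) (at (x, y s x)) (k, d)) \<le> \<eta> * (1 + Z) * norm k + 1/4 * M"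
          using R by linarith
        have dE: "d - z k s x = E s" by (simp add: d_def E_def)
        have "f s (x', y s x') - f s (x, y s x) - variation f y k s (x, z k s x) =
            (f s (x', y s x') - f s (x, y s x) - frechet_derivative (f s) (at (x, y s x)) (k, d)) +
            frechet_derivative (f s) (at (x, y s x)) (0, E s)"
          using deriv_split[OF s x, of "y s x" k d "z k s x"] by (simp add: variation_def dE)
        also have "norm \<dots> \<le> (\<eta> * (1 + Z) * norm k + 1/4 * M) + M / 2"
          using R' deriv_half[OF s x, of "y s x" "E s"] M[OF s]
          by (intro norm_triangle_mono) auto
        finally show "norm (f s (x', y s x') - f s (x, y s x) - variation f y k s (x, z k s x))
            \<le> \<eta> * (1 + Z) * norm k + 3/4 * M" by simp
      qed
      also have "\<dots> = \<eta> * (2 + Z) * norm k + 3/4 * M" by (simp add: algebra_simps)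
      finally show "norm (E t) \<le> \<eta> * (2 + Z) * norm k + 3/4 * M" .
    qed simp
    also have "\<dots> \<le> e * norm k"
    proof -
      have "\<eta> * (2 + Z) * norm k \<le> e / 8 * norm k" using \<eta>(3) by (intro mult_right_mono) auto
      moreover have "e * norm k \<ge> 0" using e by simp
      ultimately show ?thesis by simp
    qed
    finally show "norm (y t x' - y t x - z (x' - x) t x) \<le> e * norm (x' - x)"
      by (simp add: E_def k_def)
  qed
qed

end

text \<open>The induction hypothesis is used twice: for \<open>y\<close> itself, one order lower,
  and then for its directional derivatives \<open>z v\<close>, which solve a parametrised equation
  whose field is of class \<open>m\<close> because \<open>y\<close> is.\<close>

theorem Ck_fam_solution:
  fixes f :: "real \<Rightarrow> 'a::euclidean_space \<times> 'e::euclidean_space \<Rightarrow> 'e"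
  assumes "param_ode N f y0 y" "Ck_fam m (N \<times> UNIV) f" "Ck_fam m N (\<lambda>_. y0)"
  shows "Ck_fam m N y"
  using assms
proof (induction m arbitrary: f y0 y)
  case 0
  then show ?case using param_ode.y_Ck_0 by auto
next
  case (Suc m)
  interpret param_ode N f y0 y by fact
  interpret param_ode_C1 N f y0 y
  proof
    show "Ck_fam (Suc 0) (N \<times> UNIV) f" using Ck_fam_le[OF Suc.prems(2), of "Suc 0"] by simp
    show "y0 differentiable (at x)" if "x \<in> N" for x
      using Suc.prems(3) that by (auto dest!: spec bspec[of _ _ "0::real"])
  qed
  have ym: "Ck_fam m N y"
    by (rule Suc.IH[OF Suc.prems(1) Ck_fam_Suc_imp[OF Suc.prems(2)] Ck_fam_Suc_imp[OF Suc.prems(3)]])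
  show ?case
  proof (rule Ck_fam_SucI[OF open_N y_Ck_0 y_has_derivative])
    fix v
    have "Ck_fam m N (\<lambda>_ x. frechet_derivative y0 (at x) v)"
      using Ck_fam_derivative[OF Suc.prems(3)] .
    moreover have "continuous_on N (\<lambda>x. frechet_derivative y0 (at x) v)"
      by (rule continuous_on_compose2[of "{0..1} \<times> N" "\<lambda>p. frechet_derivative y0 (at (snd p)) v" N "\<lambda>x. (0::real, x)",
          simplified]) (use Ck_fam_continuous[OF Ck_fam_derivative[OF Suc.prems(3)]] in \<open>auto intro!: continuous_intros\<close>)
    then have "param_ode N (variation f y v) (\<lambda>x. frechet_derivative y0 (at x) v) (z v)"
      by unfold_locales (auto simp: open_N variation_lip z_solves variation_cont)
    ultimately show "Ck_fam m N (z v)"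
      using Suc.IH variation_Ck[OF Suc.prems(2) ym] by blast
  qed
qed

lemma smooth_param [smooth_intros]:
  assumes "open N" "continuous_on {0..1} g"
  shows "smooth_fam N (\<lambda>t _. g t)"
proof -
  have c: "continuous_on ({0..1} \<times> N) (\<lambda>p. g (fst p))"
    by (rule continuous_on_compose2[OF assms(2)]) (auto intro!: continuous_intros)
  have "Ck_fam m N (\<lambda>t _. g t)" for m
  proof (cases m)
    case (Suc l)
    show ?thesis unfolding Suc
      by (rule Ck_fam_SucI[OF assms(1) c]) (auto intro: has_derivative_const Ck_fam_const)
  qed (use c in simp)
  then show ?thesis using assms(1) by (simp add: smooth_fam_def)
qed

text \<open>Differentiation under the integral sign as a special case of dependence on parameters:
  the integral up to \<open>t\<close> solves an equation whose right-hand side does not involve the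
  unknown.\<close>

lemma smooth_integral:
  fixes G :: "real \<Rightarrow> 'a::euclidean_space \<Rightarrow> 'b::euclidean_space"
  assumes G: "smooth_fam N G"
  shows "smooth N (\<lambda>x. integral {0..1} (\<lambda>s. G s x))"
proof -
  have N: "open N" using G by (rule smooth_fam_open)
  have NU: "open (N \<times> (UNIV :: 'b set))" using N by (intro open_Times) auto
  have Gs: "smooth_fam (N \<times> (UNIV :: 'b set)) (\<lambda>t q. G t (fst q))"
    by (rule smooth_compose[OF G]) (auto intro!: smooth_intros NU)
  define y where "y t x = integral {0..t} (\<lambda>s. G s x)" for t x
  have cG: "continuous_on {0..1} (\<lambda>s. G s x)" if "x \<in> N" for x
    by (rule continuous_on_superpos[of N G, OF smooth_fam_continuous[OF G]]) (use that in auto)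
  have "param_ode N (\<lambda>t q. G t (fst q)) (\<lambda>_. 0) y"
  proof
    show "continuous_on ({0..1} \<times> N \<times> (UNIV :: 'b set)) (\<lambda>p. G (fst p) (fst (snd p)))"
      by (rule smooth_fam_continuous[OF Gs])
    show "solves (\<lambda>t u. G t (fst (x, u))) 0 (\<lambda>t. y t x)" if "x \<in> N" for x
      unfolding solves_def y_def using cG[OF that]
      by (auto intro!: indefinite_integral_continuous_1 integrable_continuous_interval)
  qed (auto simp: N half_lipschitz_def)
  then have "Ck_fam m N y" for m
    by (rule Ck_fam_solution) (rule smooth_fam_Ck[OF Gs], rule Ck_fam_const)
  then have "smooth_fam N y" using N by (simp add: smooth_fam_def)
  from smooth_fam_param[OF this, of 1] show ?thesis by (simp add: y_def[abs_def])
qed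

section \<open>Bump functions\<close>

text \<open>The factor \<open>1 / t ^ k\<close> makes the family closed under differentiation up to
  linear combinations, so that smoothness of the classical function \<open>flat 0\<close> becomes an
  induction for all \<open>k\<close> at once.\<close>

definition flat :: "nat \<Rightarrow> real \<Rightarrow> real" where
  "flat k t = (if t \<le> 0 then 0 else exp (- (1 / t)) / t ^ k)"

lemma flat_has_derivative:
  "(flat k has_real_derivative flat (k + 2) t - real k * flat (k + 1) t) (at t)"
proof -
  consider "t < 0" | "t > 0" | "t = 0" by linarith
  then show ?thesis
  proof cases
    case 1
    have "((\<lambda>t. 0) has_real_derivative 0) (at t)" by simp
    then have "(flat k has_real_derivative 0) (at t)"
      by (rule has_field_derivative_transform_within_open[where S = "{..<0}"]) (use 1 in \<open>auto simp: flat_def\<close>)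
    then show ?thesis using 1 by (simp add: flat_def)
  next
    case 2
    have "((\<lambda>t. exp (- (1 / t)) / t ^ k) has_real_derivative
        (exp (- (1 / t)) * (1 / t\<^sup>2) * t ^ k - exp (- (1 / t)) * (real k * t ^ (k - 1))) / (t ^ k * t ^ k)) (at t)"
      using 2 by (auto intro!: derivative_eq_intros simp: power2_eq_square field_simps)
    also have "(exp (- (1 / t)) * (1 / t\<^sup>2) * t ^ k - exp (- (1 / t)) * (real k * t ^ (k - 1))) / (t ^ k * t ^ k) =
        flat (k + 2) t - real k * flat (k + 1) t"
      using 2 by (cases k) (simp_all add: flat_def field_simps power2_eq_square)
    finally show ?thesis
      by (rule has_field_derivative_transform_within_open[where S = "{0<..}"]) (use 2 in \<open>auto simp: flat_def\<close>)
  next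
    case 3
    have "((\<lambda>h. flat k h / h) \<longlongrightarrow> 0) (at_right 0)"
    proof -
      \<comment> \<open>With \<open>s = 1 / h\<close> the difference quotient at 0 is
        \<open>s ^ (k + 1) / exp s\<close>.\<close>
      have "((\<lambda>h. inverse h ^ (k + 1) / exp (inverse h)) \<longlongrightarrow> (0::real)) (at_right 0)"
        by (rule filterlim_compose[OF tendsto_power_div_exp_0 filterlim_inverse_at_top_right])
      moreover have "\<forall>\<^sub>F h in at_right 0. inverse h ^ (k + 1) / exp (inverse h) = flat k h / h"
        using eventually_at_right_less[of 0]
        by eventually_elim (simp add: flat_def exp_minus field_simps)
      ultimately show ?thesis by (rule Lim_transform_eventually)
    qed
    moreover have "((\<lambda>h. flat k h / h) \<longlongrightarrow> 0) (at_left 0)"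
    proof (rule Lim_transform_eventually[of "\<lambda>_. 0"])
      show "\<forall>\<^sub>F h in at_left 0. 0 = flat k h / h"
        unfolding eventually_at_filter by (auto simp: flat_def)
    qed simp
    ultimately have "((\<lambda>h. flat k h / h) \<longlongrightarrow> 0) (at 0)"
      by (simp add: filterlim_split_at)
    then show ?thesis using 3 by (simp add: DERIV_def flat_def)
  qed
qed

lemma smooth_flat: "smooth UNIV (flat k)"
proof -
  have "Ck_fam m UNIV (\<lambda>_. flat k)" for m
  proof (induction m arbitrary: k)
    case 0
    have "continuous_on UNIV (flat k)"
      by (rule continuous_at_imp_continuous_on) (use DERIV_isCont flat_has_derivative in blast)
    then have "continuous_on ({0..1::real} \<times> UNIV) (flat k \<circ> snd)"
      by (intro continuous_on_compose continuous_intros) (auto elim: continuous_on_subset)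
    then show ?case by (simp add: o_def)
  next
    case (Suc m)
    show ?case
    proof (rule Ck_fam_SucI)
      show "continuous_on ({0..1} \<times> UNIV) (\<lambda>p::real \<times> real. flat k (snd p))"
        using Ck_fam_continuous[OF Suc] .
      show "(flat k has_derivative (\<lambda>v. (flat (k + 2) t - real k * flat (k + 1) t) * v)) (at t)" for t
        using flat_has_derivative[of k t] by (simp add: has_field_derivative_def)
      have "Ck_fam m UNIV (\<lambda>_ t::real. flat (k + 2) t + (- real k) * flat (k + 1) t)"
        by (intro Ck_fam_add Suc Ck_fam_linear[OF _ bounded_linear_mult_right]) auto
      then show "Ck_fam m UNIV (\<lambda>_ t. (flat (k + 2) t - real k * flat (k + 1) t) * v)" for v
        by (intro Ck_fam_linear[OF _ bounded_linear_mult_left]) auto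
    qed auto
  qed
  then show ?thesis by (simp add: smooth_fam_def)
qed

definition bump :: "'a::euclidean_space \<Rightarrow> real \<Rightarrow> 'a \<Rightarrow> real" where
  "bump p r x = flat 0 (r\<^sup>2 - (x - p) \<bullet> (x - p))"

lemma smooth_bump: "smooth UNIV (bump p r)"
  unfolding bump_def
  by (rule smooth_compose[OF smooth_flat]) (auto intro!: smooth_intros)

lemma bump_pos: "x \<in> ball p r \<Longrightarrow> bump p r x > 0"
  using power_strict_mono[of "norm (x - p)" r 2]
  by (auto simp: bump_def flat_def dist_norm norm_minus_commute[of p] power2_norm_eq_inner)

lemma bump_nonneg: "bump p r x \<ge> 0"
  by (simp add: bump_def flat_def)

lemma bump_zero:
  assumes "r > 0" "x \<notin> ball p r" shows "bump p r x = 0"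
  using assms power_mono[of r "norm (x - p)" 2]
  by (auto simp: bump_def flat_def dist_norm norm_minus_commute[of p] power2_norm_eq_inner)

lemma compact_ball_cover:
  fixes K :: "'a::euclidean_space set"
  assumes "compact K" "\<And>p. p \<in> K \<Longrightarrow> open (V p) \<and> p \<in> V p"
  obtains D r where "finite D" "D \<subseteq> K" "\<And>p. p \<in> D \<Longrightarrow> r p > (0::real)" "\<And>p. p \<in> D \<Longrightarrow> cball p (r p) \<subseteq> V p"
    "K \<subseteq> (\<Union>p\<in>D. ball p (r p))"
proof -
  have "\<forall>p\<in>K. \<exists>r>0. cball p r \<subseteq> V p" using assms(2) open_contains_cball by blast
  then obtain r where r: "\<And>p. p \<in> K \<Longrightarrow> r p > 0" "\<And>p. p \<in> K \<Longrightarrow> cball p (r p) \<subseteq> V p" by metis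
  have "K \<subseteq> (\<Union>p\<in>K. ball p (r p))" using r(1) by auto
  then obtain D where "D \<subseteq> K" "finite D" "K \<subseteq> (\<Union>p\<in>D. ball p (r p))"
    by (rule compactE_image[OF assms(1), of K "\<lambda>p. ball p (r p)", OF open_ball])
  then show thesis using that[of D r] r by blast
qed

text \<open>A finite sum of bumps exceeds some \<open>c > 0\<close> on \<open>K\<close>; a smooth
  step function of this sum is then equal to 1 on a whole neighborhood of \<open>K\<close>.\<close>

lemma smooth_cutoff:
  fixes K :: "'a::euclidean_space set"
  assumes K: "compact K" and "open S" "K \<subseteq> S"
  obtains \<psi> U C where "smooth UNIV \<psi>" "open U" "K \<subseteq> U" "\<And>x. x \<in> U \<Longrightarrow> \<psi> x = (1::real)"
    "compact C" "C \<subseteq> S" "\<And>x. x \<notin> C \<Longrightarrow> \<psi> x = 0"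
proof -
  obtain D r where D: "finite D" "\<And>p. p \<in> D \<Longrightarrow> r p > (0::real)" "\<And>p. p \<in> D \<Longrightarrow> cball p (r p) \<subseteq> S"
    "K \<subseteq> (\<Union>p\<in>D. ball p (r p))"
    using compact_ball_cover[OF K, of "\<lambda>_. S"] assms by (metis subset_iff)
  define \<sigma> where "\<sigma> x = (\<Sum>p\<in>D. bump p (r p) x)" for x
  have smooth_\<sigma>: "smooth UNIV \<sigma>"
    unfolding \<sigma>_def by (intro smooth_intros smooth_bump) auto
  then have cont: "continuous_on UNIV \<sigma>" by (rule smooth_continuous_on)
  have pos: "\<sigma> x > 0" if "x \<in> K" for x
  proof -
    obtain p where p: "p \<in> D" "x \<in> ball p (r p)" using D(4) \<open>x \<in> K\<close> by blast
    have "0 < bump p (r p) x" using p by (intro bump_pos)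
    also have "\<dots> \<le> \<sigma> x" unfolding \<sigma>_def by (rule member_le_sum) (use p D bump_nonneg in auto)
    finally show ?thesis .
  qed
  obtain c where c: "c > 0" "\<And>x. x \<in> K \<Longrightarrow> c < \<sigma> x"
  proof (cases "K = {}")
    case False
    then obtain x0 where "x0 \<in> K" "\<And>x. x \<in> K \<Longrightarrow> \<sigma> x0 \<le> \<sigma> x"
      using continuous_attains_inf[OF K _ continuous_on_subset[OF cont]] by blast
    then show thesis using that[of "\<sigma> x0 / 2"] pos[of x0] by fastforce
  qed (use that[of 1] in auto)
  \<comment> \<open>A step from 0 for \<open>s \<le> 0\<close> to 1 for \<open>s \<ge> c\<close>.
    The two terms of the denominator cannot vanish together because \<open>c > 0\<close>.\<close>
  define \<theta> where "\<theta> s = flat 0 s / (flat 0 s + flat 0 (c - s))" for s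
  have den: "flat 0 s + flat 0 (c - s) > 0" for s
    using c(1) by (auto simp: flat_def add_pos_pos)
  have s\<theta>: "smooth UNIV \<theta>"
    unfolding \<theta>_def
    by (intro smooth_intros smooth_flat smooth_compose[OF smooth_flat]) (use den in \<open>auto simp: less_imp_neq[symmetric]\<close>)
  show thesis
  proof (rule that[of "\<lambda>x. \<theta> (\<sigma> x)" "{x. c < \<sigma> x}" "\<Union>p\<in>D. cball p (r p)"])
    show "smooth UNIV (\<lambda>x. \<theta> (\<sigma> x))" by (rule smooth_compose[OF s\<theta> smooth_\<sigma>]) auto
    show "open {x. c < \<sigma> x}" using cont by (intro open_Collect_less continuous_intros)
    show "\<theta> (\<sigma> x) = 1" if "x \<in> {x. c < \<sigma> x}" for x using that c(1) by (simp add: \<theta>_def flat_def)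
    show "\<theta> (\<sigma> x) = 0" if x: "x \<notin> (\<Union>p\<in>D. cball p (r p))" for x
    proof -
      have "bump p (r p) x = 0" if "p \<in> D" for p
        using x that D(2) ball_subset_cball by (intro bump_zero) blast+
      then show ?thesis by (simp add: \<theta>_def \<sigma>_def flat_def)
    qed
  qed (use c D in auto)
qed

lemma smooth_zero_extension:
  fixes \<psi> :: "'a::euclidean_space \<Rightarrow> real" and F :: "'a \<Rightarrow> 'b::real_normed_vector"
  assumes "smooth UNIV \<psi>" "smooth V F" "closed C" "C \<subseteq> V" "\<And>x. x \<notin> C \<Longrightarrow> \<psi> x = 0"
  shows "smooth UNIV (\<lambda>x. if x \<in> V then \<psi> x *\<^sub>R F x else 0)"
proof -
  have "smooth V (\<lambda>x. \<psi> x *\<^sub>R F x)"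
    by (intro smooth_scaleR smooth_fam_subset[OF assms(1)] assms(2) smooth_fam_open[OF assms(2)]) simp
  then have "smooth V (\<lambda>x. if x \<in> V then \<psi> x *\<^sub>R F x else 0)"
    by (subst (asm) smooth_fam_cong) auto
  moreover have "smooth (- C) (\<lambda>_. 0 :: 'b)" using assms(3) by (intro smooth_intros) auto
  then have "smooth (- C) (\<lambda>x. if x \<in> V then \<psi> x *\<^sub>R F x else 0)"
    by (subst (asm) smooth_fam_cong) (use assms(5) in auto)
  ultimately have "smooth (V \<union> - C) (\<lambda>x. if x \<in> V then \<psi> x *\<^sub>R F x else 0)" by (rule smooth_Un)
  moreover have "V \<union> - C = UNIV" using assms(4) by auto
  ultimately show ?thesis by simp
qed

text \<open>Finitely many local extensions are averaged with bump weights, normalised by their sum.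
  At a point of \<open>T\<close> every extension that carries weight has the value of
  \<open>f\<close> there, hence so has the average.\<close>

lemma smooth_on_extension:
  fixes f :: "real^'n \<Rightarrow> real"
  assumes f: "smooth_on T f" and S: "compact S" "S \<subseteq> T"
  obtains W F where "S \<subseteq> W" "smooth W F" "\<And>x. x \<in> W \<inter> T \<Longrightarrow> F x = f x"
proof -
  have "\<forall>p\<in>S. \<exists>V F. p \<in> V \<and> smooth V F \<and> (\<forall>y\<in>V \<inter> T. F y = f y)"
    using f S(2) unfolding smooth_on_iff by blast
  then obtain V F where VF: "\<And>p. p \<in> S \<Longrightarrow> p \<in> V p" "\<And>p. p \<in> S \<Longrightarrow> smooth (V p) (F p)"
    "\<And>p y. p \<in> S \<Longrightarrow> y \<in> V p \<inter> T \<Longrightarrow> F p y = f y" by metis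
  obtain D r where D: "finite D" "D \<subseteq> S" "\<And>p. p \<in> D \<Longrightarrow> r p > (0::real)" "\<And>p. p \<in> D \<Longrightarrow> cball p (r p) \<subseteq> V p"
    "S \<subseteq> (\<Union>p\<in>D. ball p (r p))"
  proof (rule compact_ball_cover[OF S(1), of V])
    show "open (V p) \<and> p \<in> V p" if "p \<in> S" for p
      using VF(1)[OF that] smooth_fam_open[OF VF(2)[OF that]] by simp
  qed (rule that)
  define W where "W = (\<Union>p\<in>D. ball p (r p))"
  have W: "open W" by (auto simp: W_def)
  define g where "g p x = (if x \<in> V p then bump p (r p) x *\<^sub>R F p x else 0)" for p x
  have g: "smooth UNIV (g p)" if "p \<in> D" for p
    unfolding g_def[abs_def]
    by (rule smooth_zero_extension[OF smooth_bump VF(2), of p "cball p (r p)"])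
      (use that D in \<open>auto intro!: bump_zero\<close>)
  have pos: "(\<Sum>p\<in>D. bump p (r p) x) > 0" if xW: "x \<in> W" for x
  proof -
    obtain p where p: "p \<in> D" "x \<in> ball p (r p)" using xW unfolding W_def by blast
    have "0 < bump p (r p) x" using p by (intro bump_pos)
    also have "\<dots> \<le> (\<Sum>p\<in>D. bump p (r p) x)" by (rule member_le_sum) (use p D bump_nonneg in auto)
    finally show ?thesis .
  qed
  show thesis
  proof (rule that[of W "\<lambda>x. (\<Sum>p\<in>D. g p x) / (\<Sum>p\<in>D. bump p (r p) x)"])
    show "smooth W (\<lambda>x. (\<Sum>p\<in>D. g p x) / (\<Sum>p\<in>D. bump p (r p) x))"
      by (intro smooth_intros W smooth_fam_subset[OF g W] smooth_fam_subset[OF smooth_bump W])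
        (use pos in \<open>auto simp: less_imp_neq[symmetric]\<close>)
    fix x assume x: "x \<in> W \<inter> T"
    have "g p x = bump p (r p) x * f x" if "p \<in> D" for p
    proof (cases "x \<in> V p")
      case True
      then show ?thesis using VF(3)[of p x] x that D(2) by (auto simp: g_def)
    next
      case False
      then have "x \<notin> ball p (r p)" using D(4)[OF that] ball_subset_cball[of p "r p"] by blast
      then have "bump p (r p) x = 0" using D(3)[OF that] by (intro bump_zero)
      then show ?thesis by (simp add: g_def)
    qed
    then have "(\<Sum>p\<in>D. g p x) = (\<Sum>p\<in>D. bump p (r p) x) * f x" by (simp add: sum_distrib_right)
    then show "(\<Sum>p\<in>D. g p x) / (\<Sum>p\<in>D. bump p (r p) x) = f x" using pos[of x] x by simp
  qed (use D in \<open>auto simp: W_def\<close>)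
qed

section \<open>Hadamard's lemma on annuli\<close>

definition ann :: "real \<Rightarrow> 'a::euclidean_space set" where
  "ann \<delta> = {x. \<bar>norm x - 1\<bar> < \<delta>}"

lemma open_ann: "open (ann \<delta> :: 'a::euclidean_space set)"
  unfolding ann_def by (intro open_Collect_less continuous_intros)

lemma ann_nonzero: "\<delta> \<le> 1 \<Longrightarrow> x \<in> ann \<delta> \<Longrightarrow> x \<noteq> 0"
  by (auto simp: ann_def)

lemma ann_mono: "\<delta> \<le> \<epsilon> \<Longrightarrow> ann \<delta> \<subseteq> ann \<epsilon>"
  by (auto simp: ann_def)

lemma sphere_subset_ann: "\<delta> > 0 \<Longrightarrow> sphere 0 1 \<subseteq> ann \<delta>"
  by (auto simp: ann_def)

text \<open>Compactness of the sphere gives a uniform width; the cap \<open>1/2\<close> keeps the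
  annulus away from the origin, where the norm is not smooth.\<close>

lemma open_contains_ann:
  fixes W :: "'a::euclidean_space set"
  assumes "open W" "sphere 0 1 \<subseteq> W"
  obtains \<delta> where "\<delta> > 0" "\<delta> \<le> 1/2" "ann \<delta> \<subseteq> W"
proof -
  obtain e where e: "e > 0" "(\<Union>x\<in>sphere 0 1. ball x e) \<subseteq> W"
    using compact_subset_open_imp_ball_epsilon_subset[OF compact_sphere assms] .
  have "ann (min e (1/2)) \<subseteq> W"
  proof
    fix x :: 'a assume x: "x \<in> ann (min e (1/2))"
    then have "x \<noteq> 0" by (auto simp: ann_def)
    then have "x - x /\<^sub>R norm x = (norm x - 1) *\<^sub>R (x /\<^sub>R norm x)"
      by (simp add: algebra_simps)
    then have "dist (x /\<^sub>R norm x) x = \<bar>norm x - 1\<bar>"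
      using \<open>x \<noteq> 0\<close> by (simp add: dist_norm norm_minus_commute[of _ x] del: scaleR_scaleR)
    then have "x \<in> ball (x /\<^sub>R norm x) e" using x by (simp add: ann_def)
    moreover have "x /\<^sub>R norm x \<in> sphere 0 1" using \<open>x \<noteq> 0\<close> by simp
    ultimately show "x \<in> W" using e(2) by blast
  qed
  then show thesis using that[of "min e (1/2)"] e(1) by auto
qed

lemma smooth_norm_ann: "\<delta> \<le> 1 \<Longrightarrow> smooth (ann \<delta>) (norm :: 'a::euclidean_space \<Rightarrow> real)"
  by (intro smooth_intros open_ann) (auto simp: ann_nonzero)

text \<open>The quotient is the integral of the radial derivative of \<open>f\<close> along the
  segment from \<open>x /\<^sub>R norm x\<close> to \<open>x\<close>, which \<open>\<phi>\<close>
  parametrizes and which stays in the annulus.\<close>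

lemma hadamard:
  fixes f :: "'a::euclidean_space \<Rightarrow> real"
  assumes f: "smooth (ann \<delta>) f" and \<delta>: "\<delta> \<le> 1" and zero: "\<And>x. norm x = 1 \<Longrightarrow> f x = 0"
  obtains k where "smooth (ann \<delta>) k" "\<And>x. x \<in> ann \<delta> \<Longrightarrow> f x = (norm x - 1) * k x"
proof -
  define u where "u x = x /\<^sub>R norm x" for x :: 'a
  define \<phi> where "\<phi> s x = (1 + s * (norm x - 1)) *\<^sub>R u x" for s x
  have nu: "norm (u x) = 1" if "x \<in> ann \<delta>" for x
    using ann_nonzero[OF \<delta> that] by (simp add: u_def)
  have \<phi>: "\<phi> s x \<in> ann \<delta>" if "s \<in> {0..1}" "x \<in> ann \<delta>" for s x
  proof -
    have "\<bar>s * (norm x - 1)\<bar> \<le> \<bar>norm x - 1\<bar>"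
      using that by (simp add: abs_mult mult_left_le_one_le)
    moreover have "\<bar>norm x - 1\<bar> < \<delta>" using that by (simp add: ann_def)
    ultimately have "\<bar>s * (norm x - 1)\<bar> < \<delta>" by linarith
    moreover from this \<delta> have "norm (\<phi> s x) = 1 + s * (norm x - 1)"
      using nu[OF that(2)] by (simp add: \<phi>_def)
    ultimately show ?thesis by (simp add: ann_def)
  qed
  have su: "smooth (ann \<delta>) u"
    unfolding u_def by (intro smooth_intros open_ann) (use ann_nonzero[OF \<delta>] in auto)
  have s\<phi>: "smooth_fam (ann \<delta>) \<phi>"
    unfolding \<phi>_def[abs_def]
    by (intro smooth_intros open_ann su smooth_norm_ann[OF \<delta>] continuous_intros)
  define G where "G s x = frechet_derivative f (at (\<phi> s x)) (u x)" for s x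
  have sG: "smooth_fam (ann \<delta>) G"
    unfolding G_def[abs_def] by (intro smooth_frechet_derivative[OF f su s\<phi>] \<phi>)
  show thesis
  proof (rule that[of "\<lambda>x. integral {0..1} (\<lambda>s. G s x)"])
    show "smooth (ann \<delta>) (\<lambda>x. integral {0..1} (\<lambda>s. G s x))" by (rule smooth_integral[OF sG])
    fix x :: 'a assume x: "x \<in> ann \<delta>"
    have "((\<lambda>s. (norm x - 1) * G s x) has_integral f (\<phi> 1 x) - f (\<phi> 0 x)) {0..1}"
    proof (rule fundamental_theorem_of_calculus)
      fix s :: real assume s: "s \<in> {0..1}"
      have df: "(f has_derivative frechet_derivative f (at (\<phi> s x))) (at (\<phi> s x))"
        by (rule smooth_has_derivative[OF f \<phi>[OF s x]])
      have "((\<lambda>s. \<phi> s x) has_derivative (\<lambda>h. h *\<^sub>R ((norm x - 1) *\<^sub>R u x))) (at s within {0..1})"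
        unfolding \<phi>_def by (auto intro!: derivative_eq_intros)
      from has_derivative_compose[OF this df]
      have "((\<lambda>s. f (\<phi> s x)) has_derivative (\<lambda>h. frechet_derivative f (at (\<phi> s x)) (h *\<^sub>R ((norm x - 1) *\<^sub>R u x))))
          (at s within {0..1})" .
      then show "((\<lambda>s. f (\<phi> s x)) has_vector_derivative (norm x - 1) * G s x) (at s within {0..1})"
        using linear_scale[OF has_derivative_linear[OF df]]
        by (simp add: has_vector_derivative_def G_def mult.assoc)
    qed simp
    then have "integral {0..1} (\<lambda>s. (norm x - 1) * G s x) = f (\<phi> 1 x) - f (\<phi> 0 x)"
      by (rule integral_unique)
    moreover have "\<phi> 1 x = x" using ann_nonzero[OF \<delta> x] by (simp add: \<phi>_def u_def)
    moreover have "f (\<phi> 0 x) = 0" using zero nu[OF x] by (simp add: \<phi>_def)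
    ultimately show "f x = (norm x - 1) * integral {0..1} (\<lambda>s. G s x)" by simp
  qed
qed

lemma smooth_derivative_bounded:
  fixes f :: "'a::euclidean_space \<Rightarrow> 'b::real_normed_vector"
  assumes f: "smooth N f" and C: "compact C" "C \<subseteq> N"
  obtains B where "B \<ge> 0" "\<And>x v. x \<in> C \<Longrightarrow> norm (frechet_derivative f (at x) v) \<le> B * norm v"
proof -
  have "\<exists>B. \<forall>x\<in>C. norm (frechet_derivative f (at x) b) \<le> B" for b
  proof -
    have "smooth N (\<lambda>x. frechet_derivative f (at x) b)"
      by (intro smooth_intros f) (use f smooth_fam_open in auto)
    then have "bounded ((\<lambda>x. frechet_derivative f (at x) b) ` C)"
      using C by (intro compact_imp_bounded compact_continuous_image)
        (auto intro: continuous_on_subset dest: smooth_continuous_on)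
    then show ?thesis by (auto simp: bounded_iff)
  qed
  then obtain B where B: "\<And>b x. x \<in> C \<Longrightarrow> norm (frechet_derivative f (at x) b) \<le> B b" by metis
  show thesis
  proof (rule that[of "\<Sum>b\<in>Basis. \<bar>B b\<bar>"])
    show "0 \<le> (\<Sum>b\<in>Basis. \<bar>B b\<bar>)" by (intro sum_nonneg) auto
    fix x v assume x: "x \<in> C"
    then have d: "(f has_derivative frechet_derivative f (at x)) (at x)"
      using smooth_has_derivative[OF f] C by auto
    have "norm (\<Sum>b\<in>Basis. (v \<bullet> b) *\<^sub>R frechet_derivative f (at x) b) \<le> (\<Sum>b\<in>Basis. \<bar>B b\<bar> * norm v)"
    proof (rule sum_norm_le)
      fix b :: 'a assume b: "b \<in> Basis"
      have "\<bar>v \<bullet> b\<bar> * norm (frechet_derivative f (at x) b) \<le> norm v * \<bar>B b\<bar>"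
        by (rule mult_mono) (use B[OF x, of b] Basis_le_norm[OF b, of v] in auto)
      then show "norm ((v \<bullet> b) *\<^sub>R frechet_derivative f (at x) b) \<le> \<bar>B b\<bar> * norm v"
        by (simp add: mult.commute)
    qed
    then show "norm (frechet_derivative f (at x) v) \<le> (\<Sum>b\<in>Basis. \<bar>B b\<bar>) * norm v"
      by (subst has_derivative_Basis_sum[OF d]) (simp add: sum_distrib_right)
  qed
qed

lemma compact_closed_annulus: "compact {x::'a::euclidean_space. a \<le> norm x \<and> norm x \<le> b}"
proof -
  have "{x::'a. a \<le> norm x \<and> norm x \<le> b} = cball 0 b \<inter> {x. a \<le> norm x}" by auto
  moreover have "closed {x::'a. a \<le> norm x}" by (intro closed_Collect_le continuous_intros)
  ultimately show ?thesis by (simp add: compact_Int_closed)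
qed

lemma norm_has_derivative:
  "x \<noteq> 0 \<Longrightarrow> (norm has_derivative (\<lambda>v. (x \<bullet> v) / norm x)) (at (x::'a::real_inner))"
  using has_derivative_norm[of x] by (simp add: sgn_div_norm divide_inverse inner_commute mult.commute)

text \<open>In general a decay rate says nothing about derivatives; here \<open>f\<close> is smooth
  across the sphere, and exactly one power is lost. \<open>hadamard\<close> splits off one power at
  a time, and the product rule reduces the claim to the cofactor \<open>k\<close>, which decays one
  order less. The narrower annulus provides the compact set for the order 0 bound.\<close>

lemma flat_derivative:
  fixes f :: "'a::euclidean_space \<Rightarrow> real"
  assumes "smooth (ann \<delta>) f" "0 < \<delta>'" "\<delta>' < \<delta>" "\<delta> \<le> 1"
    "\<And>x. x \<in> ann \<delta>' \<Longrightarrow> norm x < 1 \<Longrightarrow> \<bar>f x\<bar> \<le> C * (1 - norm x) ^ Suc j"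
  shows "\<exists>B\<ge>0. \<forall>x\<in>ann \<delta>'. norm x < 1 \<longrightarrow> (\<forall>v. \<bar>frechet_derivative f (at x) v\<bar> \<le> B * (1 - norm x) ^ j * norm v)"
  using assms(1,5)
proof (induction j arbitrary: f C)
  case 0
  define C where "C = {x::'a. 1 - \<delta>' \<le> norm x \<and> norm x \<le> 1}"
  have "compact C" "C \<subseteq> ann \<delta>" using assms(2,3) compact_closed_annulus by (auto simp: C_def ann_def)
  from smooth_derivative_bounded[OF 0(1) this] obtain B where
    "B \<ge> 0" "\<And>x v. x \<in> C \<Longrightarrow> norm (frechet_derivative f (at x) v) \<le> B * norm v" by metis
  then show ?case by (intro exI[of _ B]) (auto simp: C_def ann_def)
next
  case (Suc j)
  have d: "0 < \<delta>" "\<delta> \<le> 1" using assms(2-4) by auto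
  \<comment> \<open>The bound is given inside the ball only; a radial limit shows that
    \<open>f\<close> vanishes on the sphere, as \<open>hadamard\<close> requires.\<close>
  have "f x = 0" if x: "norm x = 1" for x
  proof -
    have "((\<lambda>r. f (r *\<^sub>R x)) \<longlongrightarrow> f (1 *\<^sub>R x)) (at_left 1)"
    proof (rule isCont_tendsto_compose[of _ f])
      show "isCont f (1 *\<^sub>R x)"
        using smooth_has_derivative[OF Suc.prems(1), of x] has_derivative_continuous x d
        by (force simp: ann_def)
      show "((\<lambda>r. r *\<^sub>R x) \<longlongrightarrow> 1 *\<^sub>R x) (at_left 1)" by (intro tendsto_intros)
    qed
    moreover have "((\<lambda>r. f (r *\<^sub>R x)) \<longlongrightarrow> 0) (at_left 1)"
    proof (rule Lim_null_comparison)
      show "\<forall>\<^sub>F r in at_left 1. norm (f (r *\<^sub>R x)) \<le> C * (1 - r) ^ Suc (Suc j)"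
        unfolding eventually_at_left_field
      proof (intro exI[of _ "1 - \<delta>'"] conjI allI impI)
        fix r assume "1 - \<delta>' < r" "r < 1"
        then have "r *\<^sub>R x \<in> ann \<delta>'" "norm (r *\<^sub>R x) = r" using x assms d by (auto simp: ann_def)
        then show "norm (f (r *\<^sub>R x)) \<le> C * (1 - r) ^ Suc (Suc j)"
          using Suc.prems(2)[of "r *\<^sub>R x"] \<open>r < 1\<close> by simp
      qed (use assms in auto)
      show "((\<lambda>r. C * (1 - r) ^ Suc (Suc j)) \<longlongrightarrow> 0) (at_left 1)"
        by (auto intro!: tendsto_eq_intros)
    qed
    ultimately show ?thesis
      using tendsto_unique[of "at_left (1::real)"] by fastforce
  qed
  then obtain k where k: "smooth (ann \<delta>) k" "\<And>x. x \<in> ann \<delta> \<Longrightarrow> f x = (norm x - 1) * k x"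
    using hadamard[OF Suc.prems(1) d(2)] by blast
  have sub: "x \<in> ann \<delta>" if "x \<in> ann \<delta>'" for x :: 'a using ann_mono[of \<delta>' \<delta>] assms(3) that by auto
  have kb: "\<bar>k x\<bar> \<le> C * (1 - norm x) ^ Suc j" if "x \<in> ann \<delta>'" "norm x < 1" for x
  proof -
    have "(1 - norm x) * \<bar>k x\<bar> = \<bar>f x\<bar>" using k(2)[OF sub[OF that(1)]] that(2) by (simp add: abs_mult)
    also have "\<dots> \<le> (1 - norm x) * (C * (1 - norm x) ^ Suc j)"
      using Suc.prems(2)[OF that] by (simp add: mult_ac)
    finally show ?thesis using that(2) by (simp del: power_Suc)
  qed
  from Suc.IH[OF k(1) kb] obtain B where B: "B \<ge> 0" "\<And>x v. x \<in> ann \<delta>' \<Longrightarrow> norm x < 1 \<Longrightarrow>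
     \<bar>frechet_derivative k (at x) v\<bar> \<le> B * (1 - norm x) ^ j * norm v" by blast
  show ?case
  proof (intro exI[of _ "B + \<bar>C\<bar>"] conjI ballI impI allI)
    fix x v :: 'a assume x: "x \<in> ann \<delta>'" "norm x < 1"
    have x0: "x \<noteq> 0" using ann_nonzero[OF d(2) sub[OF x(1)]] .
    have "((\<lambda>x. (norm x - 1) * k x) has_derivative
       (\<lambda>v. (norm x - 1) * frechet_derivative k (at x) v + ((x \<bullet> v) / norm x) * k x)) (at x)"
      by (rule has_derivative_mult[OF has_derivative_diff[OF norm_has_derivative[OF x0] has_derivative_const, simplified]
            smooth_has_derivative[OF k(1) sub[OF x(1)]]])
    then have "(f has_derivative (\<lambda>v. (norm x - 1) * frechet_derivative k (at x) v + ((x \<bullet> v) / norm x) * k x)) (at x)"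
      by (rule has_derivative_transform_within_open[OF _ open_ann sub[OF x(1)]]) (simp add: k(2))
    then have "frechet_derivative f (at x) v = (norm x - 1) * frechet_derivative k (at x) v + ((x \<bullet> v) / norm x) * k x"
      by (simp add: frechet_derivative_eqI)
    also have "\<bar>\<dots>\<bar> \<le> (1 - norm x) * (B * (1 - norm x) ^ j * norm v) + norm v * (\<bar>C\<bar> * (1 - norm x) ^ Suc j)"
    proof (rule order_trans[OF abs_triangle_ineq add_mono])
      show "\<bar>(norm x - 1) * frechet_derivative k (at x) v\<bar> \<le> (1 - norm x) * (B * (1 - norm x) ^ j * norm v)"
        using B(2)[OF x, of v] x(2) by (simp add: abs_mult mult_left_mono)
      have "\<bar>(x \<bullet> v) / norm x\<bar> \<le> norm v"
        using Cauchy_Schwarz_ineq2[of x v] x0 by (simp add: abs_divide divide_le_eq mult.commute)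
      moreover have "C * (1 - norm x) ^ Suc j \<le> \<bar>C\<bar> * (1 - norm x) ^ Suc j"
        using x(2) by (intro mult_right_mono) auto
      ultimately show "\<bar>(x \<bullet> v) / norm x * k x\<bar> \<le> norm v * (\<bar>C\<bar> * (1 - norm x) ^ Suc j)"
        unfolding abs_mult using kb[OF x] by (intro mult_mono) auto
    qed
    also have "\<dots> = (B + \<bar>C\<bar>) * (1 - norm x) ^ Suc j * norm v" by (simp add: algebra_simps)
    finally show "\<bar>frechet_derivative f (at x) v\<bar> \<le> (B + \<bar>C\<bar>) * (1 - norm x) ^ Suc j * norm v" .
  qed (use B(1) in auto)
qed

text \<open>Interchange of the derivatives in time and in the parameter. With \<open>g s x\<close>
  taken as a field free of the unknown, the linearised equation is an integral formula for the
  parameter derivative, which can be differentiated in time.\<close>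

lemma mixed_derivative:
  fixes g :: "real \<Rightarrow> 'a::euclidean_space \<Rightarrow> 'e::euclidean_space"
  assumes g: "smooth_fam N g" and y0: "smooth N y0"
    and y: "\<And>x t. x \<in> N \<Longrightarrow> t \<in> {0..1} \<Longrightarrow> y t x = y0 x + integral {0..t} (\<lambda>s. g s x)"
    and x: "x \<in> N" and t: "t \<in> {0..1}"
  shows "((\<lambda>t. frechet_derivative (y t) (at x) v) has_vector_derivative
    frechet_derivative (g t) (at x) v) (at t within {0..1})"
proof -
  have N: "open N" using g by (rule smooth_fam_open)
  have NU: "open (N \<times> (UNIV :: 'e set))" using N by (intro open_Times) auto
  have gs: "smooth_fam (N \<times> (UNIV :: 'e set)) (\<lambda>t q. g t (fst q))"
    by (rule smooth_compose[OF g]) (auto intro!: smooth_intros NU)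
  have cg: "continuous_on {0..1} (\<lambda>s. g s x)" if "x \<in> N" for x
    by (rule continuous_on_superpos[of N g, OF smooth_fam_continuous[OF g]]) (use that in auto)
  interpret param_ode_C1 N "\<lambda>t q. g t (fst q)" y0 y
  proof
    show "continuous_on ({0..1} \<times> N \<times> (UNIV :: 'e set)) (\<lambda>p. g (fst p) (fst (snd p)))"
      by (rule smooth_fam_continuous[OF gs])
    show "solves (\<lambda>t u. g t (fst (x, u))) (y0 x) (\<lambda>t. y t x)" if "x \<in> N" for x
      unfolding solves_def
    proof (intro conjI ballI)
      have "continuous_on {0..1} (\<lambda>t. y0 x + integral {0..t} (\<lambda>s. g s x))"
        by (intro continuous_intros indefinite_integral_continuous_1 integrable_continuous_interval cg that)
      then show "continuous_on {0..1} (\<lambda>t. y t x)"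
        by (rule continuous_on_eq) (simp add: y that)
    qed (simp add: y that)
    show "Ck_fam (Suc 0) (N \<times> (UNIV :: 'e set)) (\<lambda>t q. g t (fst q))" by (rule smooth_fam_Ck[OF gs])
    show "y0 differentiable at x" if "x \<in> N" for x
      using smooth_has_derivative[OF y0 that] by (auto simp: differentiable_def)
  qed (use N smooth_continuous_on[OF y0] in \<open>auto simp: half_lipschitz_def\<close>)
  have var: "variation (\<lambda>t q. g t (fst q)) y v s (x, u) = frechet_derivative (g s) (at x) v"
    if "s \<in> {0..1}" for s u
  proof -
    have "((\<lambda>q. g s (fst q)) has_derivative (\<lambda>h. frechet_derivative (g s) (at x) (fst h))) (at (x, y s x))"
      by (rule has_derivative_compose[OF has_derivative_fst[OF has_derivative_ident]])
        (use smooth_fam_has_derivative[OF g that x] in simp)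
    then show ?thesis by (simp add: variation_def frechet_derivative_eqI)
  qed
  have dg: "continuous_on {0..1} (\<lambda>s. frechet_derivative (g s) (at x) v)"
  proof -
    have "smooth_fam N (\<lambda>s x. frechet_derivative (g s) (at x) v)"
      by (intro smooth_frechet_derivative[OF g] smooth_intros N)
    from smooth_fam_continuous[OF this] show ?thesis
      by (rule continuous_on_superpos) (use x in auto)
  qed
  have eq: "frechet_derivative (y t) (at x) v = frechet_derivative y0 (at x) v +
      integral {0..t} (\<lambda>s. frechet_derivative (g s) (at x) v)" if "t \<in> {0..1}" for t
  proof -
    have "frechet_derivative (y t) (at x) v = z v t x"
      using frechet_derivative_eqI[OF y_has_derivative[OF x that]] by simp
    also have "\<dots> = frechet_derivative y0 (at x) v +
        integral {0..t} (\<lambda>s. variation (\<lambda>t q. g t (fst q)) y v s (x, z v s x))"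
      by (rule solves_eq[OF z_solves[OF x] that])
    also have "integral {0..t} (\<lambda>s. variation (\<lambda>t q. g t (fst q)) y v s (x, z v s x)) =
        integral {0..t} (\<lambda>s. frechet_derivative (g s) (at x) v)"
      by (rule integral_cong) (use var that in auto)
    finally show ?thesis .
  qed
  have "((\<lambda>t. frechet_derivative y0 (at x) v + integral {0..t} (\<lambda>s. frechet_derivative (g s) (at x) v))
      has_vector_derivative 0 + frechet_derivative (g t) (at x) v) (at t within {0..1})"
    by (intro has_vector_derivative_add has_vector_derivative_const integral_has_vector_derivative dg t)
  then have "((\<lambda>t. frechet_derivative y0 (at x) v + integral {0..t} (\<lambda>s. frechet_derivative (g s) (at x) v))
      has_vector_derivative frechet_derivative (g t) (at x) v) (at t within {0..1})" by simp
  then show ?thesis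
    by (rule has_vector_derivative_transform[OF t, rotated]) (simp add: eq)
qed

text \<open>Since \<open>l\<close> vanishes on \<open>S\<close>, the field
  \<open>l x *\<^sub>R V\<close> is as slow as needed for \<open>x\<close> near \<open>S\<close>:
  unit time is short enough both for the Picard argument and for the orbit to stay near its starting
  point. A cutoff makes the field bounded and Lipschitz everywhere. The last conclusion says that
  \<open>l\<close> only sets the speed: of two parameters with equal initial value, the slower one
  runs through an initial piece of the orbit of the other.\<close>

lemma flow_exists:
  fixes V :: "'e::euclidean_space \<Rightarrow> 'e" and y0 :: "'a::euclidean_space \<Rightarrow> 'e" and l :: "'a \<Rightarrow> real"
  assumes V: "smooth \<Omega> V" and y0: "smooth N0 y0" and l: "smooth N0 l"
    and S: "compact S" "S \<subseteq> N0" "\<And>x. x \<in> S \<Longrightarrow> l x = 0" "y0 ` S \<subseteq> \<Omega>"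
  obtains N y C where "open N" "S \<subseteq> N" "N \<subseteq> N0" "smooth_fam N y" "compact C" "C \<subseteq> \<Omega>"
    "\<And>x t. x \<in> N \<Longrightarrow> t \<in> {0..1} \<Longrightarrow> y t x \<in> C"
    "\<And>x. x \<in> N \<Longrightarrow> y 0 x = y0 x"
    "\<And>x t. x \<in> N \<Longrightarrow> t \<in> {0..1} \<Longrightarrow>
      ((\<lambda>t. y t x) has_vector_derivative l x *\<^sub>R V (y t x)) (at t within {0..1})"
    "\<And>x t v. x \<in> N \<Longrightarrow> t \<in> {0..1} \<Longrightarrow>
      ((\<lambda>t. frechet_derivative (y t) (at x) v) has_vector_derivative
        frechet_derivative (\<lambda>x. l x *\<^sub>R V (y t x)) (at x) v) (at t within {0..1})"
    "\<And>x x' \<tau>. x \<in> N \<Longrightarrow> x' \<in> N \<Longrightarrow> \<tau> \<in> {0..1} \<Longrightarrow> y0 x' = y0 x \<Longrightarrow> l x' = \<tau> * l x \<Longrightarrow> y 1 x' = y \<tau> x"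
proof -
  have N0: "open N0" using l by (rule smooth_fam_open)
  have K: "compact (y0 ` S)"
    using S by (intro compact_continuous_image continuous_on_subset[OF smooth_continuous_on[OF y0]])
  obtain \<psi> U C where \<psi>: "smooth UNIV \<psi>" "open U" "y0 ` S \<subseteq> U" "\<And>u. u \<in> U \<Longrightarrow> \<psi> u = (1::real)"
    "compact C" "C \<subseteq> \<Omega>" "\<And>u. u \<notin> C \<Longrightarrow> \<psi> u = 0"
    using smooth_cutoff[OF K smooth_fam_open[OF V] S(4)] by blast
  define W where "W = (\<lambda>u. if u \<in> \<Omega> then \<psi> u *\<^sub>R V u else 0)"
  have sW: "smooth UNIV W"
    unfolding W_def using smooth_zero_extension[OF \<psi>(1) V] \<psi>(5-7) compact_imp_closed by blast
  have UC: "U \<subseteq> C" using \<psi>(4,7) by force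
  have WV: "W u = V u" if "u \<in> U" for u using that \<psi>(4,6) UC by (auto simp: W_def)
  have W0: "W u = 0" if "u \<notin> C" for u using that \<psi>(7) by (auto simp: W_def)
  have dW: "(W has_derivative frechet_derivative W (at u)) (at u)" for u
    by (rule smooth_has_derivative[OF sW]) simp
  obtain L where L: "L \<ge> 0" "\<And>u v. u \<in> C \<Longrightarrow> norm (frechet_derivative W (at u) v) \<le> L * norm v"
    using smooth_derivative_bounded[OF sW \<psi>(5)] by auto
  have L': "norm (frechet_derivative W (at u) v) \<le> L * norm v" for u v
  proof (cases "u \<in> C")
    case False
    have "open (- C)" using \<psi>(5) compact_imp_closed by (auto simp: open_Compl)
    then have "(W has_derivative (\<lambda>_. 0)) (at u)"
      using False W0 by (intro has_derivative_transform_within_open[of "\<lambda>_. 0" "\<lambda>_. 0" u _ "- C" W]) auto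
    then have "frechet_derivative W (at u) = (\<lambda>_. 0)" by (rule frechet_derivative_eqI)
    then show ?thesis using L(1) by simp
  qed (rule L)
  have lipW: "norm (W u - W u') \<le> L * norm (u - u')" for u u'
    by (rule differentiable_bound[of UNIV W "\<lambda>u. frechet_derivative W (at u)"])
      (auto intro!: dW onorm_le L')
  obtain M where M: "M \<ge> 0" "\<And>u. norm (W u) \<le> M"
  proof -
    have "bounded (W ` C)"
      by (intro compact_imp_bounded compact_continuous_image \<psi>(5)
          continuous_on_subset[OF smooth_continuous_on[OF sW]]) simp
    then obtain b where "b > 0" "\<And>u. u \<in> C \<Longrightarrow> norm (W u) \<le> b"
      unfolding bounded_pos by auto
    then have "norm (W u) \<le> b" for u using W0[of u] by (cases "u \<in> C") auto
    with \<open>b > 0\<close> show thesis using that[of b] by auto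
  qed
  \<comment> \<open>On this set the cut off field times \<open>l x\<close> has Lipschitz constant at
    most \<open>1/2\<close>.\<close>
  define N1 where "N1 = {x \<in> N0. \<bar>l x\<bar> * (L + 1) < 1/2}"
  have cl: "continuous_on N0 l" "continuous_on N0 y0" using l y0 by (auto intro: smooth_continuous_on)
  have N1: "open N1"
  proof -
    have "open (N0 \<inter> (\<lambda>x. \<bar>l x\<bar> * (L + 1)) -` {..<1/2})"
      by (intro continuous_open_preimage continuous_intros cl N0 open_lessThan)
    moreover have "N0 \<inter> (\<lambda>x. \<bar>l x\<bar> * (L + 1)) -` {..<1/2} = N1" by (auto simp: N1_def)
    ultimately show ?thesis by simp
  qed
  have N1U: "open (N1 \<times> (UNIV :: 'e set))" using N1 by (intro open_Times) auto
  have sl1: "smooth N1 l" "smooth N1 y0"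
    using l y0 N1 by (auto intro: smooth_fam_subset simp: N1_def)
  define f where "f t q = l (fst q) *\<^sub>R W (snd q)" for t :: real and q :: "'a \<times> 'e"
  have sf: "smooth_fam (N1 \<times> UNIV) f"
    unfolding f_def[abs_def]
    by (intro smooth_intros smooth_compose[OF sl1(1)] smooth_compose[OF sW] N1U) auto
  have fc: "continuous_on ({0..1} \<times> N1 \<times> UNIV) (\<lambda>p. f (fst p) (snd p))"
    by (rule smooth_fam_continuous[OF sf])
  have fl: "half_lipschitz (\<lambda>t u. f t (x, u))" if "x \<in> N1" for x
    unfolding half_lipschitz_def
  proof (intro ballI allI)
    fix t :: real and u v :: 'e
    have "norm (f t (x, u) - f t (x, v)) = \<bar>l x\<bar> * norm (W u - W v)"
      by (simp add: f_def flip: scaleR_diff_right)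
    also have "\<dots> \<le> \<bar>l x\<bar> * ((L + 1) * norm (u - v))"
      by (intro mult_left_mono order_trans[OF lipW]) (auto intro: mult_right_mono)
    also have "\<dots> \<le> 1/2 * norm (u - v)"
      unfolding mult.assoc[symmetric] using that by (intro mult_right_mono) (auto simp: N1_def)
    finally show "norm (f t (x, u) - f t (x, v)) \<le> norm (u - v) / 2" by simp
  qed
  have fcs: "continuous_on ({0..1} \<times> UNIV) (\<lambda>p. f (fst p) (x, snd p))" if "x \<in> N1" for x
  proof -
    have "continuous_on ({0..1} \<times> UNIV) ((\<lambda>p. f (fst p) (snd p)) \<circ> (\<lambda>p. (fst p, (x, snd p))))"
      by (rule continuous_on_compose)
        (use that in \<open>auto intro!: continuous_intros continuous_on_subset[OF fc]\<close>)
    then show ?thesis by (simp add: o_def)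
  qed
  have "\<exists>u. solves (\<lambda>t u. f t (x, u)) (y0 x) u" if "x \<in> N1" for x
    by (rule picard_existence[OF fcs[OF that] fl[OF that]])
  then obtain y' where y': "\<And>x. x \<in> N1 \<Longrightarrow> solves (\<lambda>t u. f t (x, u)) (y0 x) (y' x)" by metis
  define y where "y t x = y' x t" for t x
  have sol: "solves (\<lambda>t u. f t (x, u)) (y0 x) (\<lambda>t. y t x)" if "x \<in> N1" for x
    using y'[OF that] by (simp add: y_def)
  have "param_ode N1 f y0 y"
    by unfold_locales (use N1 fc fl sol smooth_continuous_on[OF sl1(2)] in auto)
  then have "Ck_fam m N1 y" for m
    by (rule Ck_fam_solution) (rule smooth_fam_Ck[OF sf], rule smooth_fam_Ck[OF sl1(2)])
  then have sy: "smooth_fam N1 y" using N1 by (simp add: smooth_fam_def)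
  define g where "g t x = l x *\<^sub>R W (y t x)" for t x
  have sg: "smooth_fam N1 g"
    unfolding g_def[abs_def] by (intro smooth_intros sl1 smooth_compose[OF sW sy]) auto
  have yeq: "y t x = y0 x + integral {0..t} (\<lambda>s. g s x)" if "x \<in> N1" "t \<in> {0..1}" for t x
    using solves_eq[OF sol[OF that(1)] that(2)] by (simp add: g_def f_def)
  have cg: "continuous_on {0..1} (\<lambda>s. g s x)" if "x \<in> N1" for x
    by (rule continuous_on_superpos[of N1 g, OF smooth_fam_continuous[OF sg]]) (use that in auto)
  obtain r where r: "r > 0" "(\<Union>u\<in>y0 ` S. ball u r) \<subseteq> U"
    using compact_subset_open_imp_ball_epsilon_subset[OF K \<psi>(2,3)] .
  define B where "B = (\<Union>u\<in>y0 ` S. ball u (r/2))"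
  \<comment> \<open>Starting within \<open>r / 2\<close> of an initial point of \<open>S\<close> and
    moving by less than \<open>r / 2\<close>, the orbit stays in \<open>U\<close>, where the cut off
    field still equals \<open>V\<close>.\<close>
  define N where "N = {x \<in> N1. y0 x \<in> B \<and> \<bar>l x\<bar> * M < r / 2}"
  have N: "open N"
  proof -
    have "open (N1 \<inter> (\<lambda>x. (y0 x, \<bar>l x\<bar> * M)) -` (B \<times> {..<r/2}))"
      using smooth_continuous_on[OF sl1(1)] smooth_continuous_on[OF sl1(2)]
      by (intro continuous_open_preimage continuous_intros N1 open_Times) (auto simp: B_def)
    moreover have "N1 \<inter> (\<lambda>x. (y0 x, \<bar>l x\<bar> * M)) -` (B \<times> {..<r/2}) = N" by (auto simp: N_def)
    ultimately show ?thesis by simp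
  qed
  have NN1: "x \<in> N1" if "x \<in> N" for x using that by (simp add: N_def)
  have yU: "y t x \<in> U" if x: "x \<in> N" and t: "t \<in> {0..1}" for x t
  proof -
    obtain u where u: "u \<in> y0 ` S" "dist u (y0 x) < r / 2" using x by (auto simp: N_def B_def)
    have "norm (integral {0..t} (\<lambda>s. g s x)) \<le> \<bar>l x\<bar> * M"
      by (rule integral_bound_01[OF cg[OF NN1[OF x]] t]) (simp add: g_def mult_left_mono M)
    then have "dist (y0 x) (y t x) < r / 2"
      using x yeq[OF NN1[OF x] t] by (simp add: N_def dist_norm)
    with u(2) have "dist u (y t x) < r" using dist_triangle[of u "y t x" "y0 x"] by linarith
    then have "y t x \<in> (\<Union>u\<in>y0 ` S. ball u r)" by (intro UN_I[OF u(1)]) simp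
    with r(2) show ?thesis by blast
  qed
  have gV: "g t x = l x *\<^sub>R V (y t x)" if "x \<in> N" "t \<in> {0..1}" for x t
    using WV[OF yU[OF that]] by (simp add: g_def)
  have vd: "((\<lambda>t. y t x) has_vector_derivative g t x) (at t within {0..1})"
    if "x \<in> N1" "t \<in> {0..1}" for x t
  proof -
    have "((\<lambda>t. y0 x + integral {0..t} (\<lambda>s. g s x)) has_vector_derivative 0 + g t x) (at t within {0..1})"
      by (intro has_vector_derivative_add has_vector_derivative_const integral_has_vector_derivative cg that)
    then have "((\<lambda>t. y0 x + integral {0..t} (\<lambda>s. g s x)) has_vector_derivative g t x) (at t within {0..1})"
      by simp
    then show ?thesis
      by (rule has_vector_derivative_transform[OF that(2), rotated]) (simp add: yeq that)
  qed
  show thesis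
  proof (rule that[of N y C])
    show "S \<subseteq> N"
    proof
      fix x assume x: "x \<in> S"
      then have "y0 x \<in> B" using r(1) unfolding B_def by (intro UN_I[of "y0 x"]) auto
      then show "x \<in> N" using x S r(1) by (auto simp: N_def N1_def)
    qed
    show "smooth_fam N y" by (rule smooth_fam_subset[OF sy N]) (use NN1 in auto)
    show "y t x \<in> C" if "x \<in> N" "t \<in> {0..1}" for x t using yU[OF that] UC by auto
    show "y 0 x = y0 x" if "x \<in> N" for x using yeq[OF NN1[OF that], of 0] by simp
    show "((\<lambda>t. y t x) has_vector_derivative l x *\<^sub>R V (y t x)) (at t within {0..1})"
      if "x \<in> N" "t \<in> {0..1}" for x t
      using vd[OF NN1[OF that(1)] that(2)] gV[OF that] by simp
    show "((\<lambda>t. frechet_derivative (y t) (at x) v) has_vector_derivative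
        frechet_derivative (\<lambda>x. l x *\<^sub>R V (y t x)) (at x) v) (at t within {0..1})"
      if x: "x \<in> N" and t: "t \<in> {0..1}" for x t v
    proof -
      have "(g t has_derivative D) (at x) \<longleftrightarrow> ((\<lambda>x. l x *\<^sub>R V (y t x)) has_derivative D) (at x)" for D
        using gV t has_derivative_transform_within_open[OF _ N x, of "g t" D UNIV "\<lambda>x. l x *\<^sub>R V (y t x)"]
          has_derivative_transform_within_open[OF _ N x, of "\<lambda>x. l x *\<^sub>R V (y t x)" D UNIV "g t"] by auto
      then have "frechet_derivative (\<lambda>x. l x *\<^sub>R V (y t x)) (at x) = frechet_derivative (g t) (at x)"
        by (simp add: frechet_derivative_def)
      then show ?thesis using mixed_derivative[OF sg sl1(2) yeq NN1[OF x] t] by simp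
    qed
    show "y 1 x' = y \<tau> x" if x: "x \<in> N" and x': "x' \<in> N" and \<tau>: "\<tau> \<in> {0..1}"
      and eq: "y0 x' = y0 x" "l x' = \<tau> * l x" for x x' \<tau>
    proof -
      \<comment> \<open>The orbit of \<open>x\<close>, slowed down by \<open>\<tau>\<close>, solves
        the equation belonging to \<open>x'\<close>; uniqueness identifies the two.\<close>
      define u where "u s = y (\<tau> * s) x" for s
      have \<tau>s: "\<tau> * s \<in> {0..1}" if "s \<in> {0..1}" for s
        using that \<tau> by (auto intro: mult_le_one)
      have du: "(u has_vector_derivative l x' *\<^sub>R W (u s)) (at s within {0..1})" if s: "s \<in> {0..1}" for s
      proof -
        have "((\<lambda>s. \<tau> * s) has_vector_derivative \<tau>) (at s within {0..1})"
          by (auto intro!: derivative_eq_intros)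
        moreover have "((\<lambda>t. y t x) has_vector_derivative g (\<tau> * s) x) (at (\<tau> * s) within (\<lambda>s. \<tau> * s) ` {0..1})"
          by (rule has_vector_derivative_within_subset[OF vd[OF NN1[OF x] \<tau>s[OF s]]]) (use \<tau>s in auto)
        ultimately have "((\<lambda>t. y t x) \<circ> (\<lambda>s. \<tau> * s) has_vector_derivative \<tau> *\<^sub>R g (\<tau> * s) x) (at s within {0..1})"
          by (rule vector_diff_chain_within)
        then show ?thesis by (simp add: u_def[abs_def] o_def g_def eq)
      qed
      have "solves (\<lambda>t v. f t (x', v)) (y0 x') u"
        unfolding solves_def
      proof (intro conjI ballI)
        show cu: "continuous_on {0..1} u"
          by (rule continuous_on_vector_derivative[OF du])
        fix t :: real assume t: "t \<in> {0..1}"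
        have "((\<lambda>s. l x' *\<^sub>R W (u s)) has_integral u t - u 0) {0..t}"
          by (rule fundamental_theorem_of_calculus)
            (use t in \<open>auto intro!: has_vector_derivative_within_subset[OF du]\<close>)
        then have "integral {0..t} (\<lambda>s. l x' *\<^sub>R W (u s)) = u t - u 0" by (rule integral_unique)
        moreover have "u 0 = y0 x'" using yeq[OF NN1[OF x], of 0] eq by (simp add: u_def)
        ultimately show "u t = y0 x' + integral {0..t} (\<lambda>s. f s (x', u s))" by (simp add: f_def)
      qed
      then have "y 1 x' = u 1"
        by (rule solves_unique[OF sol[OF NN1[OF x']] _ fcs[OF NN1[OF x']] fl[OF NN1[OF x']]]) simp
      then show ?thesis by (simp add: u_def)
    qed
  qed (use N \<psi>(5,6) in \<open>auto simp: N_def N1_def\<close>)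
qed

section \<open>The eikonal equation and its characteristics\<close>

lemma vector_derivative_bound_01:
  fixes f :: "real \<Rightarrow> 'a::real_normed_vector"
  assumes d: "\<And>s. s \<in> {0..1} \<Longrightarrow> (f has_vector_derivative f' s) (at s within {0..1})"
    and b: "\<And>s. s \<in> {0..1} \<Longrightarrow> norm (f' s) \<le> B" and t: "t \<in> {0..1}"
  shows "norm (f t - f 0) \<le> B"
proof -
  have "norm (f t - f 0) \<le> B * norm (t - 0)"
  proof (rule differentiable_bound[of "{0..1}" f "\<lambda>s h. h *\<^sub>R f' s"])
    show "(f has_derivative (\<lambda>h. h *\<^sub>R f' s)) (at s within {0..1})" if "s \<in> {0..1}" for s
      using d[OF that] by (simp add: has_vector_derivative_def)
    show "onorm (\<lambda>h. h *\<^sub>R f' s) \<le> B" if "s \<in> {0..1}" for s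
      by (rule onorm_le) (use b[OF that] in \<open>simp add: mult.commute[of B] mult_left_mono\<close>)
  qed (use t in auto)
  also have "\<dots> \<le> B"
    using t order_trans[OF norm_ge_zero b[of 0]] by (auto intro: mult_right_le_one_le)
  finally show ?thesis .
qed

lemma vector_derivative_zero_01:
  fixes f :: "real \<Rightarrow> 'a::real_normed_vector"
  assumes "\<And>s. s \<in> {0..1} \<Longrightarrow> (f has_vector_derivative 0) (at s within {0..1})" "t \<in> {0..1}"
  shows "f t = f 0"
  using vector_derivative_bound_01[of f "\<lambda>_. 0" 0 t] assms by simp

section \<open>The function Q and its gradient\<close>

definition hradius :: "real^'n \<Rightarrow> real" where
  "hradius x = (1 - norm x) / (1 + norm x)"

text \<open>On the sphere the value is \<open>- x / 2\<close>. That it is not zero there makes the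
  eikonal equation noncharacteristic at the sphere.\<close>

definition hradius_grad :: "real^'n \<Rightarrow> real^'n" where
  "hradius_grad x = (- 2 / (1 + norm x)\<^sup>2) *\<^sub>R (x /\<^sub>R norm x)"

lemma one_plus_norm [simp]: "1 + norm x \<noteq> 0" "1 + norm x > 0" "1 + norm x \<ge> 0"
  using norm_ge_zero[of x] by linarith+

lemma hradius_derivative:
  assumes "x \<noteq> 0"
  shows "(hradius has_derivative (\<lambda>v. hradius_grad x \<bullet> v)) (at x)"
proof -
  have "((\<lambda>x. (1 - norm x) / (1 + norm x)) has_derivative
     (\<lambda>v. (- ((x \<bullet> v) / norm x) * (1 + norm x) - (1 - norm x) * ((x \<bullet> v) / norm x)) / ((1 + norm x) * (1 + norm x)))) (at x)"
    by (rule has_derivative_divide'[of "\<lambda>x. 1 - norm x" "\<lambda>v. - ((x \<bullet> v) / norm x)"])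
      (auto intro!: derivative_eq_intros norm_has_derivative assms)
  also have "(\<lambda>v. (- ((x \<bullet> v) / norm x) * (1 + norm x) - (1 - norm x) * ((x \<bullet> v) / norm x)) / ((1 + norm x) * (1 + norm x))) =
     (\<lambda>v. hradius_grad x \<bullet> v)"
    by (rule ext) (simp add: hradius_grad_def divide_simps power2_eq_square assms; simp add: algebra_simps)
  finally show ?thesis by (simp add: hradius_def[abs_def])
qed

lemma smooth_hradius: "\<delta> \<le> 1 \<Longrightarrow> smooth (ann \<delta>) hradius"
  unfolding hradius_def by (intro smooth_intros open_ann) (auto simp: ann_nonzero)

lemma smooth_hradius_grad: "\<delta> \<le> 1 \<Longrightarrow> smooth (ann \<delta>) hradius_grad"
  unfolding hradius_grad_def by (intro smooth_intros open_ann) (auto simp: ann_nonzero)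

lemma hradius_sphere: "norm x = 1 \<Longrightarrow> hradius x = 0"
  by (simp add: hradius_def)

lemma hradius_pos: "hradius x > 0 \<longleftrightarrow> norm x < 1"
  by (simp add: hradius_def pos_less_divide_eq)

text \<open>The conversion between the conformal weight and \<open>hradius\<close>. It is the source
  of the factor \<open>(1 + norm x) ^ 4 / 4\<close> in \<open>K\<close> and of the quotient in
  \<open>\<sigma>\<close>.\<close>

lemma rho_hradius: "\<rho> x = (1 + norm x)\<^sup>2 / 2 * hradius x"
proof -
  have "(1 + norm x)\<^sup>2 / 2 * hradius x = (1 + norm x) / 2 * ((1 + norm x) * hradius x)"
    by (simp add: power2_eq_square)
  also have "(1 + norm x) * hradius x = 1 - norm x" by (simp add: hradius_def)
  finally have e: "(1 + norm x)\<^sup>2 / 2 * hradius x = (1 + norm x) / 2 * (1 - norm x)" .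
  show ?thesis unfolding e \<rho>_def by (simp add: power2_eq_square algebra_simps)
qed

lemma norm_hradius: "norm x = (1 - hradius x) / (1 + hradius x)"
proof -
  have "1 + hradius x = 2 / (1 + norm x)" "1 - hradius x = 2 * norm x / (1 + norm x)"
    by (simp_all add: hradius_def field_simps)
  then show ?thesis by simp
qed

section \<open>The rescaled metric near the sphere and its eikonal equation\<close>

text \<open>\<open>A\<close> stands for the matrix of \<open>\<rho>\<^sup>2 g\<close>, extended
  across the sphere so that everything takes place on an open annulus. Closeness to the identity is
  known in the closed ball only; there \<open>C0 * \<delta> \<le> 1/2\<close> makes \<open>A\<close>
  positive with inverse of norm at most 2.\<close>

locale normal_form =
  fixes \<delta> :: real and A :: "real^'n \<Rightarrow> real^'n^'n" and k :: nat and C0 :: real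
  assumes \<delta>: "0 < \<delta>" "\<delta> \<le> 1/2"
    and smooth_A: "\<And>i j. smooth (ann \<delta>) (\<lambda>x. A x $ i $ j)"
    and A_sym: "\<And>x. x \<in> ann \<delta> \<Longrightarrow> transpose (A x) = A x"
    and A_det: "\<And>x. x \<in> ann \<delta> \<Longrightarrow> det (A x) \<noteq> 0"
    and k: "k > 0"
    and C0: "0 \<le> C0" "C0 * \<delta> \<le> 1/2"
    and A_close: "\<And>x v. x \<in> ann \<delta> \<Longrightarrow> norm x \<le> 1 \<Longrightarrow> norm (A x *v v - v) \<le> C0 * (1 - norm x) ^ k * norm v"
begin

definition B :: "real^'n \<Rightarrow> real^'n \<Rightarrow> real^'n" where
  "B x v = matrix_inv (A x) *v v"

lemma AB: assumes "x \<in> ann \<delta>" shows "A x *v B x v = v" "B x (A x *v v) = v"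
proof -
  have "\<exists>A'. A x ** A' = mat 1 \<and> A' ** A x = mat 1"
    using A_det[OF assms] unfolding invertible_det_nz[symmetric] invertible_def .
  from someI_ex[OF this, folded matrix_inv_def] show "A x *v B x v = v" "B x (A x *v v) = v"
    by (simp_all add: B_def matrix_vector_mul_assoc)
qed

lemma B_linear: "linear (B x)"
  unfolding B_def by (rule matrix_vector_mul_linear)

lemma A_sym_inner: "x \<in> ann \<delta> \<Longrightarrow> (A x *v v) \<bullet> w = v \<bullet> (A x *v w)"
  using A_sym[of x] by (metis dot_lmul_matrix vector_transpose_matrix)

lemma B_sym: assumes "x \<in> ann \<delta>" shows "B x v \<bullet> w = v \<bullet> B x w"
  using A_sym_inner[OF assms, of "B x v" "B x w"] AB[OF assms] by metis

text \<open>Cramer's rule writes the inverse as quotients of determinants, which are polynomial in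
  the entries of \<open>A\<close>.\<close>

lemma smooth_B: "smooth (ann \<delta>) (\<lambda>x. B x v)"
proof -
  have "B x v $ l = det (\<chi> i j. if j = l then v $ i else A x $ i $ j) / det (A x)"
    if "x \<in> ann \<delta>" for x l
    using cramer[OF A_det[OF that], of "B x v" v] AB[OF that] by simp
  moreover have "smooth (ann \<delta>) (\<lambda>x. det (\<chi> i j. if j = l then v $ i else A x $ i $ j) / det (A x))" for l
  proof (intro smooth_divide smooth_det open_ann)
    show "smooth (ann \<delta>) (\<lambda>x. (\<chi> i j. if j = l then v $ i else A x $ i $ j) $ i $ j)" for i j
      by (cases "j = l") (auto intro: smooth_const open_ann smooth_A)
  qed (auto simp: A_det smooth_A)
  ultimately have "smooth (ann \<delta>) (\<lambda>x. B x v $ l)" for l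
    by (subst smooth_fam_cong) auto
  then show ?thesis
    by (intro iffD2[OF smooth_euclidean]) (auto simp: open_ann Basis_vec_def inner_axis)
qed

text \<open>The dual metric of \<open>g\<close> is \<open>(\<rho> x)\<^sup>2\<close> times
  \<open>B\<close>, and \<open>K\<close> is what remains of it after division by
  \<open>(hradius x)\<^sup>2\<close>. So the squared \<open>g\<close>-length of the differential of
  \<open>ln Q + w\<close> becomes the value of \<open>K\<close> on \<open>dQ + Q p\<close>, an
  expression that is smooth across the sphere.\<close>

definition K :: "real^'n \<Rightarrow> real^'n \<Rightarrow> real^'n" where
  "K x v = ((1 + norm x) ^ 4 / 4) *\<^sub>R B x v"

lemma K_linear: "linear (K x)"
  unfolding K_def by (intro linear_compose_scale_right B_linear)

lemma K_sym: "x \<in> ann \<delta> \<Longrightarrow> K x v \<bullet> w = v \<bullet> K x w"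
  by (simp add: K_def B_sym)

lemma smooth_K0: "smooth (ann \<delta>) (\<lambda>x. K x v)"
  unfolding K_def using \<delta> by (intro smooth_intros smooth_B smooth_norm_ann smooth_divide_const open_ann) auto

lemma smooth_K:
  fixes \<phi> :: "real \<Rightarrow> 'a::euclidean_space \<Rightarrow> real^'n"
  assumes \<phi>: "smooth_fam N \<phi>" "smooth_fam N v" and m: "\<And>t x. t \<in> {0..1} \<Longrightarrow> x \<in> N \<Longrightarrow> \<phi> t x \<in> ann \<delta>"
  shows "smooth_fam N (\<lambda>t x. K (\<phi> t x) (v t x))"
proof -
  have rep: "K x w = (\<Sum>b\<in>Basis. (w \<bullet> b) *\<^sub>R K x b)" for x w
  proof -
    have "K x w = K x (\<Sum>b\<in>Basis. (w \<bullet> b) *\<^sub>R b)" by (simp add: euclidean_representation)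
    also have "\<dots> = (\<Sum>b\<in>Basis. (w \<bullet> b) *\<^sub>R K x b)"
      by (simp add: linear_sum[OF K_linear] linear_scale[OF K_linear])
    finally show ?thesis .
  qed
  have "smooth_fam N (\<lambda>t x. \<Sum>b\<in>Basis. (v t x \<bullet> b) *\<^sub>R K (\<phi> t x) b)"
    by (intro smooth_intros smooth_fam_open[OF \<phi>(1)] \<phi> smooth_compose[OF smooth_K0 \<phi>(1)] m)
  then show ?thesis unfolding rep[symmetric] .
qed

lemma A_sphere: assumes "norm x = 1" shows "A x *v v = v"
  using A_close[of x v] assms k \<delta> by (simp add: ann_def power_0_left)

lemma B_sphere: assumes "norm x = 1" shows "B x v = v"
  using AB(2)[of x v] A_sphere[OF assms, of v] assms \<delta> by (simp add: ann_def)

text \<open>On the sphere \<open>B\<close> is the identity, the scalar factor of \<open>K\<close> is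
  4 and the gradient has length 1/2, so \<open>K\<close> takes the value 1 on it. The defect is thus
  divisible by \<open>norm x - 1\<close>, which equals
  \<open>- (1 + norm x) * hradius x\<close>.\<close>

lemma hadamard_quotient: "\<exists>a. smooth (ann \<delta>) a \<and>
    (\<forall>x\<in>ann \<delta>. K x (hradius_grad x) \<bullet> hradius_grad x = 1 + hradius x * a x)"
proof -
  define f where "f x = K x (hradius_grad x) \<bullet> hradius_grad x - 1" for x
  have \<delta>1: "\<delta> \<le> 1" using \<delta> by simp
  have "smooth (ann \<delta>) f"
    unfolding f_def
    by (intro smooth_intros open_ann smooth_hradius_grad \<delta>1 smooth_K) auto
  moreover have "f x = 0" if "norm x = 1" for x
    using that by (simp add: f_def K_def B_sphere hradius_grad_def power2_norm_eq_inner[symmetric])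
  ultimately obtain c where c: "smooth (ann \<delta>) c" "\<And>x. x \<in> ann \<delta> \<Longrightarrow> f x = (norm x - 1) * c x"
    using hadamard[of \<delta> f] \<delta>1 by blast
  show ?thesis
  proof (intro exI[of _ "\<lambda>x. - ((1 + norm x) * c x)"] conjI ballI)
    show "smooth (ann \<delta>) (\<lambda>x. - ((1 + norm x) * c x))"
      by (intro smooth_intros open_ann smooth_norm_ann \<delta>1 c)
    show "K x (hradius_grad x) \<bullet> hradius_grad x = 1 + hradius x * - ((1 + norm x) * c x)"
      if "x \<in> ann \<delta>" for x
    proof -
      have "hradius x * ((1 + norm x) * c x) = (1 - norm x) * c x" by (simp add: hradius_def)
      then show ?thesis using c(2)[OF that] by (simp add: f_def algebra_simps)
    qed
  qed
qed

definition a :: "real^'n \<Rightarrow> real" where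
  "a = (SOME a. smooth (ann \<delta>) a \<and> (\<forall>x\<in>ann \<delta>. K x (hradius_grad x) \<bullet> hradius_grad x = 1 + hradius x * a x))"

lemma a: "smooth (ann \<delta>) a"
  "x \<in> ann \<delta> \<Longrightarrow> K x (hradius_grad x) \<bullet> hradius_grad x = 1 + hradius x * a x"
  using someI_ex[OF hadamard_quotient] unfolding a_def[symmetric] by auto

text \<open>With \<open>p\<close> for the differential of \<open>w\<close>, the eikonal equation for \<open>Q * exp w\<close> reads \<open>K(dQ + Q p, dQ + Q p) = 1\<close>;
  \<open>F\<close> is the quotient of the difference of both sides by \<open>Q = hradius\<close>.\<close>

definition F :: "(real^'n) \<times> (real^'n) \<Rightarrow> real" where
  "F q = a (fst q) + 2 * (K (fst q) (hradius_grad (fst q)) \<bullet> snd q) + hradius (fst q) * (K (fst q) (snd q) \<bullet> snd q)"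

abbreviation dF where "dF q \<equiv> frechet_derivative F (at q)"

text \<open>Half the gradient of \<open>F\<close> in the covector variable, and at the same time the
  vector dual to \<open>dQ + Q p\<close> under \<open>K\<close>: the direction of the
  characteristics.\<close>

definition Z :: "(real^'n) \<times> (real^'n) \<Rightarrow> real^'n" where
  "Z q = K (fst q) (hradius_grad (fst q) + hradius (fst q) *\<^sub>R snd q)"

definition gradF :: "(real^'n) \<times> (real^'n) \<Rightarrow> real^'n" where
  "gradF q = (\<Sum>b\<in>Basis. dF q (b, 0) *\<^sub>R b)"

lemma \<delta>1: "\<delta> \<le> 1" using \<delta> by simp

lemma open_annU: "open (ann \<delta> \<times> UNIV)" by (intro open_Times open_ann open_UNIV)

lemma smooth_F: "smooth (ann \<delta> \<times> UNIV) F"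
  unfolding F_def
  by (intro smooth_intros smooth_K smooth_compose[OF a(1)] smooth_compose[OF smooth_hradius[OF \<delta>1]]
      smooth_compose[OF smooth_hradius_grad[OF \<delta>1]] open_annU) auto

lemma smooth_Z: "smooth (ann \<delta> \<times> UNIV) Z"
  unfolding Z_def
  by (intro smooth_intros smooth_K smooth_compose[OF smooth_hradius[OF \<delta>1]]
      smooth_compose[OF smooth_hradius_grad[OF \<delta>1]] open_annU) auto

lemma smooth_gradF: "smooth (ann \<delta> \<times> UNIV) gradF"
  unfolding gradF_def
  by (intro smooth_intros smooth_frechet_derivative[OF smooth_F] open_annU) auto

lemma F_derivative: "fst q \<in> ann \<delta> \<Longrightarrow> (F has_derivative dF q) (at q)"
  using smooth_has_derivative[OF smooth_F, of q] by (cases q) auto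

text \<open>In the covector variable \<open>F\<close> is a quadratic polynomial, so its derivative
  there is read off an exact expansion in \<open>h\<close>; symmetry of \<open>K\<close> merges the
  two mixed terms.\<close>

lemma dF_split:
  assumes q: "fst q \<in> ann \<delta>"
  shows "dF q (v, w) = gradF q \<bullet> v + 2 * (Z q \<bullet> w)"
proof -
  have l: "linear (dF q)" using has_derivative_linear[OF F_derivative[OF q]] .
  have "dF q (v, w) = dF q (v, 0) + dF q (0, w)" using linear_add[OF l, of "(v, 0)" "(0, w)"] by simp
  also have "dF q (v, 0) = gradF q \<bullet> v"
  proof -
    have "dF q (v, 0) = dF q (\<Sum>b\<in>Basis. (v \<bullet> b) *\<^sub>R (b, 0))"
    proof -
      have "(\<Sum>b\<in>Basis. (v \<bullet> b) *\<^sub>R (b, 0 :: real^'n)) = (\<Sum>b\<in>Basis. ((v \<bullet> b) *\<^sub>R b, 0))" by simp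
      also have "\<dots> = (v, 0)" by (simp add: sum_prod euclidean_representation)
      finally show ?thesis by simp
    qed
    also have "\<dots> = (\<Sum>b\<in>Basis. dF q ((v \<bullet> b) *\<^sub>R (b, 0)))" by (rule linear_sum[OF l])
    also have "\<dots> = (\<Sum>b\<in>Basis. (v \<bullet> b) * dF q (b, 0))"
      by (simp only: linear_scale[OF l] real_scaleR_def)
    also have "\<dots> = gradF q \<bullet> v"
      by (simp add: gradF_def inner_sum_left inner_commute[of v] mult.commute)
    finally show ?thesis .
  qed
  also have "dF q (0, w) = 2 * (Z q \<bullet> w)"
  proof -
    define x p where "x = fst q" and "p = snd q"
    have q': "q = (x, p)" by (simp add: x_def p_def)
    have "((\<lambda>h. F (x, p + h *\<^sub>R w)) has_real_derivative dF q (0, w)) (at 0)"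
    proof -
      have "((\<lambda>h. F (x, p + h *\<^sub>R w)) has_derivative (\<lambda>h. dF q (0, h *\<^sub>R w))) (at 0)"
        by (rule has_derivative_compose[of "\<lambda>h. (x, p + h *\<^sub>R w)" "\<lambda>h. (0, h *\<^sub>R w)" _ _ F "dF q"])
          (use F_derivative[OF q] in \<open>auto intro!: derivative_eq_intros simp: q'\<close>)
      moreover have "dF q (0, h *\<^sub>R w) = dF q (0, w) * h" for h
        using linear_scale[OF l, of h "(0, w)"] by simp
      ultimately show ?thesis by (simp add: has_field_derivative_def)
    qed
    moreover have "((\<lambda>h. F (x, p + h *\<^sub>R w)) has_real_derivative 2 * (Z q \<bullet> w)) (at 0)"
    proof -
      have Kl: "K x (u + h *\<^sub>R v) = K x u + h *\<^sub>R K x v" for u v h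
        by (simp add: linear_add[OF K_linear] linear_scale[OF K_linear])
      have s: "K x p \<bullet> w = K x w \<bullet> p" using K_sym[of x p w] q by (simp add: inner_commute x_def)
      have "F (x, p + h *\<^sub>R w) = F (x, p) + h * (2 * (Z q \<bullet> w)) + h\<^sup>2 * (hradius x * (K x w \<bullet> w))" for h
        by (simp add: F_def Z_def q' Kl inner_add_left inner_add_right s power2_eq_square algebra_simps)
      then show ?thesis by (auto intro!: derivative_eq_intros)
    qed
    ultimately show ?thesis by (rule DERIV_unique)
  qed
  finally show ?thesis .
qed

text \<open>The characteristic field of \<open>F\<close> on triples \<open>(x, p, w)\<close>, slowed down by \<open>exp (- w) / 2\<close> so that
  \<open>Q * exp w\<close> has unit speed along it.\<close>

definition V :: "(real^'n) \<times> (real^'n) \<times> real \<Rightarrow> (real^'n) \<times> (real^'n) \<times> real" where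
  "V u = (let q = (fst u, fst (snd u)); e = exp (- snd (snd u)) in
     (e *\<^sub>R Z q, (- (e / 2)) *\<^sub>R gradF q, e * (snd q \<bullet> Z q)))"

lemma smooth_V: "smooth (ann \<delta> \<times> UNIV) V"
proof -
  have o: "open (ann \<delta> \<times> (UNIV :: ((real^'n) \<times> real) set))" by (intro open_Times open_ann open_UNIV)
  show ?thesis
    unfolding V_def Let_def
    by (intro smooth_intros smooth_compose[OF smooth_Z] smooth_compose[OF smooth_gradF] o smooth_divide_const) auto
qed

text \<open>On the sphere \<open>w = 0\<close>, so \<open>p\<close> is radial and \<open>F = 0\<close> determines its length.\<close>

definition init :: "real^'n \<Rightarrow> (real^'n) \<times> (real^'n) \<times> real" where
  "init x = (let \<omega> = x /\<^sub>R norm x in (\<omega>, (a \<omega> / 4) *\<^sub>R \<omega>, 0))"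

lemma sphere_ann: "norm x = 1 \<Longrightarrow> x \<in> ann \<delta>"
  using \<delta> by (simp add: ann_def)

lemma smooth_unit: "smooth (ann \<delta>) (\<lambda>x. x /\<^sub>R norm x)"
  by (intro smooth_intros open_ann smooth_norm_ann \<delta>1) (auto simp: ann_nonzero[OF \<delta>1])

lemma norm_unit: "x \<in> ann \<delta> \<Longrightarrow> norm (x /\<^sub>R norm x) = 1"
  using ann_nonzero[OF \<delta>1, of x] by simp

lemma smooth_init: "smooth (ann \<delta>) init"
  unfolding init_def Let_def
proof (intro smooth_Pair smooth_const open_ann)
  have "smooth (ann \<delta>) (\<lambda>x. a (x /\<^sub>R norm x) / 4)"
    by (rule smooth_divide_const, rule smooth_compose[OF a(1) smooth_unit]) (rule sphere_ann, erule norm_unit)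
  then show "smooth (ann \<delta>) (\<lambda>x. (a (x /\<^sub>R norm x) / 4) *\<^sub>R (x /\<^sub>R norm x))"
    by (rule smooth_scaleR[OF _ smooth_unit])
qed (rule smooth_unit)

text \<open>On the sphere \<open>K\<close> is four times the identity, the gradient is
  \<open>- \<omega> / 2\<close> and the quadratic term vanishes, so \<open>F (\<omega>, p)\<close>
  reduces to \<open>a \<omega> - 4 * (\<omega> \<bullet> p)\<close>. Hence the coefficient
  \<open>a \<omega> / 4\<close> in \<open>init\<close>.\<close>

lemma F_init:
  assumes "norm \<omega> = 1" shows "F (\<omega>, (a \<omega> / 4) *\<^sub>R \<omega>) = 0"
  using assms by (simp add: F_def K_def B_sphere hradius_sphere hradius_grad_def
      linear_scale[OF B_linear] power2_norm_eq_inner[symmetric])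

end

text \<open>Time is rescaled by \<open>hradius x\<close>, so that the sought map is \<open>X 1\<close>; \<open>P\<close> and \<open>w\<close> are the
  differential and the value of the unknown function along the characteristic \<open>X\<close>.\<close>

locale characteristics = normal_form \<delta> A k C0
  for \<delta> and A :: "real^'n \<Rightarrow> real^'n^'n" and k C0 +
  fixes N :: "(real^'n) set" and y :: "real \<Rightarrow> real^'n \<Rightarrow> (real^'n) \<times> (real^'n) \<times> real" and R :: real
  assumes N: "open N" "N \<subseteq> ann \<delta>"
    and smooth_y: "smooth_fam N y"
    and y_bounded: "\<And>x t. x \<in> N \<Longrightarrow> t \<in> {0..1} \<Longrightarrow> fst (y t x) \<in> ann (\<delta> / 2)"
      "\<And>x t. x \<in> N \<Longrightarrow> t \<in> {0..1} \<Longrightarrow> norm (y t x) \<le> R"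
    and y_0: "\<And>x. x \<in> N \<Longrightarrow> y 0 x = init x"
    and y_ode: "\<And>x t. x \<in> N \<Longrightarrow> t \<in> {0..1} \<Longrightarrow>
      ((\<lambda>t. y t x) has_vector_derivative hradius x *\<^sub>R V (y t x)) (at t within {0..1})"
    and y_mixed: "\<And>x t v. x \<in> N \<Longrightarrow> t \<in> {0..1} \<Longrightarrow>
      ((\<lambda>t. frechet_derivative (y t) (at x) v) has_vector_derivative
        frechet_derivative (\<lambda>x. hradius x *\<^sub>R V (y t x)) (at x) v) (at t within {0..1})"
    and y_ray: "\<And>x x' \<tau>. x \<in> N \<Longrightarrow> x' \<in> N \<Longrightarrow> \<tau> \<in> {0..1} \<Longrightarrow> init x' = init x \<Longrightarrow>
      hradius x' = \<tau> * hradius x \<Longrightarrow> y 1 x' = y \<tau> x"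
begin

definition X where "X t x = fst (y t x)"
definition P where "P t x = fst (snd (y t x))"
definition w where "w t x = snd (snd (y t x))"

lemma y_eq: "y t x = (X t x, P t x, w t x)"
  by (simp add: X_def P_def w_def)

lemma X_ann: "x \<in> N \<Longrightarrow> t \<in> {0..1} \<Longrightarrow> X t x \<in> ann \<delta>"
  using y_bounded(1) ann_mono[of "\<delta> / 2" \<delta>] \<delta> by (auto simp: X_def)

lemma smooth_X: "smooth_fam N X" and smooth_P: "smooth_fam N P" and smooth_w: "smooth_fam N w"
  using smooth_y by (auto simp: X_def[abs_def] P_def[abs_def] w_def[abs_def] intro!: smooth_intros)

lemma V_y: "V (y t x) = (exp (- w t x) *\<^sub>R Z (X t x, P t x), (- (exp (- w t x) / 2)) *\<^sub>R gradF (X t x, P t x),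
    exp (- w t x) * (P t x \<bullet> Z (X t x, P t x)))"
  by (simp add: V_def Let_def X_def P_def w_def)

definition X' where "X' t x = (hradius x * exp (- w t x)) *\<^sub>R Z (X t x, P t x)"
definition P' where "P' t x = (- (hradius x * exp (- w t x) / 2)) *\<^sub>R gradF (X t x, P t x)"

lemma velocity_eq: "hradius x *\<^sub>R V (y t x) = (X' t x, P' t x, P t x \<bullet> X' t x)"
  by (simp add: V_y X'_def P'_def)

lemma vector_derivative_fst:
  "(f has_vector_derivative f') net \<Longrightarrow> ((\<lambda>t. fst (f t)) has_vector_derivative fst f') net"
  by (rule bounded_linear.has_vector_derivative[OF bounded_linear_fst])

lemma vector_derivative_snd:
  "(f has_vector_derivative f') net \<Longrightarrow> ((\<lambda>t. snd (f t)) has_vector_derivative snd f') net"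
  by (rule bounded_linear.has_vector_derivative[OF bounded_linear_snd])

lemma odes:
  assumes "x \<in> N" "t \<in> {0..1}"
  shows "((\<lambda>t. X t x) has_vector_derivative X' t x) (at t within {0..1})"
    "((\<lambda>t. P t x) has_vector_derivative P' t x) (at t within {0..1})"
    "((\<lambda>t. w t x) has_vector_derivative P t x \<bullet> X' t x) (at t within {0..1})"
  using vector_derivative_fst[OF y_ode[OF assms]]
    vector_derivative_fst[OF vector_derivative_snd[OF y_ode[OF assms]]]
    vector_derivative_snd[OF vector_derivative_snd[OF y_ode[OF assms]]]
  unfolding velocity_eq by (simp_all add: X_def P_def w_def)

lemma initial:
  assumes "x \<in> N"
  shows "X 0 x = x /\<^sub>R norm x" "P 0 x = (a (x /\<^sub>R norm x) / 4) *\<^sub>R (x /\<^sub>R norm x)" "w 0 x = 0"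
  using y_0[OF assms] by (simp_all add: X_def P_def w_def init_def Let_def)

lemma norm_unit_N: "x \<in> N \<Longrightarrow> norm (x /\<^sub>R norm x) = 1"
  using N(2) by (blast intro: norm_unit)

text \<open>The usual cancellation in Hamilton's equations, which a scalar factor in the speed does
  not disturb. At time 0 the value vanishes by the choice of \<open>init\<close>.\<close>

lemma energy:
  assumes x: "x \<in> N" and t: "t \<in> {0..1}"
  shows "F (X t x, P t x) = 0"
proof -
  have "F (X t x, P t x) = F (X 0 x, P 0 x)"
  proof (rule vector_derivative_zero_01[OF _ t, of "\<lambda>t. F (X t x, P t x)"])
    fix s :: real assume s: "s \<in> {0..1}"
    have "((\<lambda>t. (X t x, P t x)) has_vector_derivative (X' s x, P' s x)) (at s within {0..1})"
      by (intro has_vector_derivative_Pair odes x s)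
    then have "((\<lambda>t. F (X t x, P t x)) has_derivative (\<lambda>h. dF (X s x, P s x) (h *\<^sub>R (X' s x, P' s x)))) (at s within {0..1})"
      unfolding has_vector_derivative_def
      by (rule has_derivative_compose) (rule F_derivative, use X_ann[OF x s] in simp)
    moreover have "dF (X s x, P s x) (h *\<^sub>R (X' s x, P' s x)) = h *\<^sub>R 0" for h
      using dF_split[of "(X s x, P s x)"] X_ann[OF x s]
      by (simp add: X'_def P'_def inner_commute)
    ultimately show "((\<lambda>t. F (X t x, P t x)) has_vector_derivative 0) (at s within {0..1})"
      by (simp add: has_vector_derivative_def)
  qed
  then show ?thesis using F_init[OF norm_unit_N[OF x]] by (simp add: initial[OF x])
qed

text \<open>By the definition of \<open>a\<close> the left-hand side is identically
  \<open>1 + hradius x * F (x, p)\<close>; on the zero set of \<open>F\<close> the covector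
  \<open>dQ + Q p\<close> therefore has length one under \<open>K\<close>.\<close>

lemma unit_covector:
  assumes "x \<in> ann \<delta>" "F (x, p) = 0"
  shows "(hradius_grad x + hradius x *\<^sub>R p) \<bullet> Z (x, p) = 1"
proof -
  have s: "K x p \<bullet> hradius_grad x = K x (hradius_grad x) \<bullet> p"
    using K_sym[OF assms(1), of p] by (simp add: inner_commute)
  have Z: "Z (x, p) = K x (hradius_grad x) + hradius x *\<^sub>R K x p"
    by (simp add: Z_def linear_add[OF K_linear] linear_scale[OF K_linear])
  have "(hradius_grad x + hradius x *\<^sub>R p) \<bullet> Z (x, p) =
     Z (x, p) \<bullet> hradius_grad x + hradius x * (Z (x, p) \<bullet> p)"
    by (simp add: inner_commute[of _ "Z (x, p)"] inner_add_right)
  also have "\<dots> = K x (hradius_grad x) \<bullet> hradius_grad x +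
      hradius x * (2 * (K x (hradius_grad x) \<bullet> p) + hradius x * (K x p \<bullet> p))"
    unfolding Z by (simp add: inner_add_left s algebra_simps)
  also have "\<dots> = 1 + hradius x * F (x, p)"
    using a(2)[OF assms(1)] by (simp add: F_def algebra_simps)
  finally show ?thesis using assms(2) by simp
qed

text \<open>The time derivative of \<open>Q * exp w\<close> is \<open>exp w\<close> times the
  pairing of \<open>dQ + Q P\<close> with the velocity; \<open>unit_covector\<close> evaluates the
  pairing, and the factor \<open>exp (- w)\<close> of \<open>V\<close> cancels \<open>exp w\<close>.
  At time 1 this says that \<open>Q * exp w\<close> at \<open>X 1 x\<close> equals \<open>Q\<close>
  at \<open>x\<close>.\<close>

lemma hradius_X:
  assumes x: "x \<in> N" and t: "t \<in> {0..1}"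
  shows "hradius (X t x) * exp (w t x) = t * hradius x"
proof -
  have "hradius (X t x) * exp (w t x) - t * hradius x = hradius (X 0 x) * exp (w 0 x) - 0 * hradius x"
  proof (rule vector_derivative_zero_01[OF _ t, of "\<lambda>t. hradius (X t x) * exp (w t x) - t * hradius x"])
    fix s :: real assume s: "s \<in> {0..1}"
    let ?X = "X s x" and ?P = "P s x" and ?e = "exp (- w s x)"
    have e: "exp (w s x) * exp (- w s x) = 1" by (simp add: exp_minus)
    have X0: "?X \<noteq> 0" using ann_nonzero[OF \<delta>1 X_ann[OF x s]] .
    have "((\<lambda>t. hradius (X t x)) has_derivative (\<lambda>h. hradius_grad ?X \<bullet> (h *\<^sub>R X' s x))) (at s within {0..1})"
      using odes(1)[OF x s] unfolding has_vector_derivative_def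
      by (rule has_derivative_compose) (rule hradius_derivative[OF X0])
    then have 1: "((\<lambda>t. hradius (X t x)) has_real_derivative hradius_grad ?X \<bullet> X' s x) (at s within {0..1})"
      by (simp add: has_real_derivative_iff_has_vector_derivative has_vector_derivative_def)
    have 2: "((\<lambda>t. w t x) has_real_derivative ?P \<bullet> X' s x) (at s within {0..1})"
      using odes(3)[OF x s] by (simp add: has_real_derivative_iff_has_vector_derivative)
    have "((\<lambda>t. hradius (X t x) * exp (w t x) - t * hradius x) has_real_derivative
        (hradius_grad ?X \<bullet> X' s x) * exp (w s x) + (exp (w s x) * (?P \<bullet> X' s x)) * hradius ?X - hradius x) (at s within {0..1})"
      by (auto intro!: derivative_eq_intros 1 2)
    also have "(hradius_grad ?X \<bullet> X' s x) * exp (w s x) + (exp (w s x) * (?P \<bullet> X' s x)) * hradius ?X =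
        exp (w s x) * ((hradius_grad ?X + hradius ?X *\<^sub>R ?P) \<bullet> X' s x)"
      by (simp add: inner_add_left algebra_simps)
    also have "(hradius_grad ?X + hradius ?X *\<^sub>R ?P) \<bullet> X' s x = hradius x * ?e"
      using unit_covector[OF X_ann[OF x s] energy[OF x s]] by (simp add: X'_def)
    also have "exp (w s x) * (hradius x * ?e) - hradius x = 0" using e by (simp add: exp_minus)
    finally show "((\<lambda>t. hradius (X t x) * exp (w t x) - t * hradius x) has_vector_derivative 0) (at s within {0..1})"
      by (simp add: has_real_derivative_iff_has_vector_derivative)
  qed
  then show ?thesis using hradius_sphere[OF norm_unit_N[OF x]] by (simp add: initial[OF x])
qed

end

section \<open>Derivatives in the starting parameter and the Gauss lemma\<close>

context characteristics
begin

lemma smooth_hradius_N: "smooth N hradius"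
  using smooth_fam_subset[OF smooth_hradius[OF \<delta>1] N] .

lemma smooth_X': "smooth_fam N X'" and smooth_P': "smooth_fam N P'"
proof -
  have "smooth_fam N (\<lambda>t x. (X t x, P t x))" by (intro smooth_Pair smooth_X smooth_P)
  then have z: "smooth_fam N (\<lambda>t x. Z (X t x, P t x))" "smooth_fam N (\<lambda>t x. gradF (X t x, P t x))"
    by (rule smooth_compose[OF smooth_Z] smooth_compose[OF smooth_gradF], use X_ann in simp)+
  show "smooth_fam N X'" unfolding X'_def[abs_def]
    by (intro smooth_scaleR smooth_minus smooth_divide_const smooth_mult smooth_exp smooth_hradius_N smooth_w z)
  show "smooth_fam N P'" unfolding P'_def[abs_def]
    by (intro smooth_scaleR smooth_minus smooth_divide_const smooth_mult smooth_exp smooth_hradius_N smooth_w z)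
qed

abbreviation "DX t x \<equiv> frechet_derivative (X t) (at x)"
abbreviation "DP t x \<equiv> frechet_derivative (P t) (at x)"
abbreviation "Dw t x \<equiv> frechet_derivative (w t) (at x)"
abbreviation "DX' t x \<equiv> frechet_derivative (X' t) (at x)"

lemma derivatives:
  assumes "x \<in> N" "t \<in> {0..1}"
  shows "(X t has_derivative DX t x) (at x)" "(P t has_derivative DP t x) (at x)"
    "(w t has_derivative Dw t x) (at x)" "(X' t has_derivative DX' t x) (at x)"
    "(P' t has_derivative frechet_derivative (P' t) (at x)) (at x)"
  by (rule smooth_fam_has_derivative[OF smooth_X assms(2,1)] smooth_fam_has_derivative[OF smooth_P assms(2,1)]
      smooth_fam_has_derivative[OF smooth_w assms(2,1)] smooth_fam_has_derivative[OF smooth_X' assms(2,1)]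
      smooth_fam_has_derivative[OF smooth_P' assms(2,1)])+

lemma mixed_derivatives:
  assumes x: "x \<in> N" and t: "t \<in> {0..1}"
  shows "((\<lambda>t. DX t x v) has_vector_derivative DX' t x v) (at t within {0..1})"
    "((\<lambda>t. Dw t x v) has_vector_derivative DP t x v \<bullet> X' t x + P t x \<bullet> DX' t x v) (at t within {0..1})"
proof -
  have "((\<lambda>x. hradius x *\<^sub>R V (y t x)) has_derivative
     (\<lambda>v. (DX' t x v, frechet_derivative (P' t) (at x) v, P t x \<bullet> DX' t x v + DP t x v \<bullet> X' t x))) (at x)"
    unfolding velocity_eq
    by (intro has_derivative_Pair derivatives[OF x t] has_derivative_inner)
  then have g: "frechet_derivative (\<lambda>x. hradius x *\<^sub>R V (y t x)) (at x) v =
     (DX' t x v, frechet_derivative (P' t) (at x) v, P t x \<bullet> DX' t x v + DP t x v \<bullet> X' t x)"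
    by (simp add: frechet_derivative_eqI)
  have yd: "frechet_derivative (y t) (at x) v = (DX t x v, DP t x v, Dw t x v)" if "t \<in> {0..1}" for t
  proof -
    have "(y t has_derivative (\<lambda>v. (DX t x v, DP t x v, Dw t x v))) (at x)"
      using has_derivative_Pair[OF derivatives(1)[OF x that] has_derivative_Pair[OF derivatives(2,3)[OF x that]]]
      by (simp only: y_eq[symmetric])
    then show ?thesis by (simp add: frechet_derivative_eqI)
  qed
  have "((\<lambda>t. (DX t x v, DP t x v, Dw t x v)) has_vector_derivative
      (DX' t x v, frechet_derivative (P' t) (at x) v, P t x \<bullet> DX' t x v + DP t x v \<bullet> X' t x)) (at t within {0..1})"
    by (rule has_vector_derivative_transform[OF t _ y_mixed[OF x t, of v, unfolded g]]) (simp add: yd)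
  from vector_derivative_fst[OF this] vector_derivative_snd[OF vector_derivative_snd[OF this]]
  show "((\<lambda>t. DX t x v) has_vector_derivative DX' t x v) (at t within {0..1})"
    "((\<lambda>t. Dw t x v) has_vector_derivative DP t x v \<bullet> X' t x + P t x \<bullet> DX' t x v) (at t within {0..1})"
    by (simp_all add: add.commute)
qed

text \<open>The energy identity, differentiated in the starting parameter.\<close>

lemma energy_derivative:
  assumes x: "x \<in> N" and t: "t \<in> {0..1}"
  shows "gradF (X t x, P t x) \<bullet> DX t x v + 2 * (Z (X t x, P t x) \<bullet> DP t x v) = 0"
proof -
  have d1: "((\<lambda>x. F (X t x, P t x)) has_derivative (\<lambda>v. dF (X t x, P t x) (DX t x v, DP t x v))) (at x)"
    by (rule has_derivative_compose[OF has_derivative_Pair[OF derivatives(1,2)[OF x t]] F_derivative])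
      (use X_ann[OF x t] in simp)
  have d2: "((\<lambda>x. F (X t x, P t x)) has_derivative (\<lambda>_. 0)) (at x)"
    by (rule has_derivative_transform_within_open[OF has_derivative_const[of 0] N(1) x])
      (use energy t in simp)
  have "dF (X t x, P t x) (DX t x v, DP t x v) = 0"
    using fun_cong[OF has_derivative_unique[OF d1 d2], of v] .
  then show ?thesis using dF_split[of "(X t x, P t x)"] X_ann[OF x t] by simp
qed

text \<open>Conservation of the contact form along characteristics, which makes \<open>P\<close> the
  differential of \<open>w\<close> in the coordinates given by \<open>X\<close>. The time derivative
  of the difference is a multiple of the linearised energy identity. At time 0 both terms vanish:
  \<open>w\<close> is 0 there, and \<open>P\<close> is radial while \<open>X 0\<close> moves within
  the sphere.\<close>

lemma covector:
  assumes x: "x \<in> N" and t: "t \<in> {0..1}"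
  shows "Dw t x v = P t x \<bullet> DX t x v"
proof -
  have "Dw t x v - P t x \<bullet> DX t x v = Dw 0 x v - P 0 x \<bullet> DX 0 x v"
  proof (rule vector_derivative_zero_01[OF _ t, of "\<lambda>t. Dw t x v - P t x \<bullet> DX t x v"])
    fix s :: real assume s: "s \<in> {0..1}"
    have "((\<lambda>t. P t x \<bullet> DX t x v) has_vector_derivative P s x \<bullet> DX' s x v + P' s x \<bullet> DX s x v) (at s within {0..1})"
      by (rule bounded_bilinear.has_vector_derivative[OF bounded_bilinear_inner odes(2)[OF x s] mixed_derivatives(1)[OF x s]])
    from has_vector_derivative_diff[OF mixed_derivatives(2)[OF x s, of v] this]
    have "((\<lambda>t. Dw t x v - P t x \<bullet> DX t x v) has_vector_derivative DP s x v \<bullet> X' s x - P' s x \<bullet> DX s x v) (at s within {0..1})"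
      by simp
    also have "DP s x v \<bullet> X' s x - P' s x \<bullet> DX s x v =
        (hradius x * exp (- w s x) / 2) * (gradF (X s x, P s x) \<bullet> DX s x v + 2 * (Z (X s x, P s x) \<bullet> DP s x v))"
      by (simp add: X'_def P'_def inner_commute[of "DP s x v"] algebra_simps)
    also have "\<dots> = 0" using energy_derivative[OF x s] by simp
    finally show "((\<lambda>t. Dw t x v - P t x \<bullet> DX t x v) has_vector_derivative 0) (at s within {0..1})" .
  qed
  also have "Dw 0 x v = 0"
  proof -
    have "(w 0 has_derivative (\<lambda>_. 0)) (at x)"
      by (rule has_derivative_transform_within_open[OF has_derivative_const[of 0] N(1) x]) (simp add: initial)
    then show ?thesis by (simp add: frechet_derivative_eqI)
  qed
  also have "P 0 x \<bullet> DX 0 x v = 0"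
  proof -
    have d: "(X 0 has_derivative DX 0 x) (at x)" by (rule derivatives[OF x]) simp
    have d1: "((\<lambda>x. X 0 x \<bullet> X 0 x) has_derivative (\<lambda>v. X 0 x \<bullet> DX 0 x v + DX 0 x v \<bullet> X 0 x)) (at x)"
      by (intro has_derivative_inner d)
    have d2: "((\<lambda>x. X 0 x \<bullet> X 0 x) has_derivative (\<lambda>_. 0)) (at x)"
    proof (rule has_derivative_transform_within_open[OF has_derivative_const[of 1] N(1) x])
      show "1 = X 0 x \<bullet> X 0 x" if "x \<in> N" for x
        using norm_unit_N[OF that] by (simp add: initial(1)[OF that] power2_norm_eq_inner[symmetric] del: inner_scaleR_left inner_scaleR_right)
    qed
    have "X 0 x \<bullet> DX 0 x v + DX 0 x v \<bullet> X 0 x = 0"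
      using fun_cong[OF has_derivative_unique[OF d1 d2], of v] .
    then have "X 0 x \<bullet> DX 0 x v = 0" by (simp add: inner_commute)
    moreover have "P 0 x = (a (x /\<^sub>R norm x) / 4) *\<^sub>R X 0 x" using initial[OF x] by simp
    ultimately show ?thesis by simp
  qed
  finally show ?thesis by simp
qed

text \<open>Sliding \<open>x\<close> along its ray changes the speed but not the initial data. So
  \<open>X 1\<close> maps the ray of \<open>x\<close> into the characteristic through
  \<open>X 1 x\<close>, and its radial derivative is a multiple of the characteristic
  direction.\<close>

lemma ray_velocity:
  assumes x: "x \<in> N" and x1: "norm x < 1"
  shows "DX 1 x (x /\<^sub>R norm x) = (- 2 / (1 + norm x)\<^sup>2 * exp (- w 1 x)) *\<^sub>R Z (X 1 x, P 1 x)"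
proof -
  define \<omega> where "\<omega> = x /\<^sub>R norm x"
  define q where "q = hradius x"
  have x0: "x \<noteq> 0" using ann_nonzero[OF \<delta>1] x N(2) by auto
  have n\<omega>: "norm \<omega> = 1" using norm_unit_N[OF x] by (simp add: \<omega>_def)
  have q: "0 < q" "q < 1" using x1 x0 by (auto simp: q_def hradius_pos) (simp add: hradius_def pos_divide_less_eq)
  \<comment> \<open>The point on the ray of \<open>x\<close> whose \<open>hradius\<close> is
    \<open>\<tau> * q\<close>; its norm is given by \<open>norm_hradius\<close>.\<close>
  define c where "c \<tau> = ((1 - \<tau> * q) / (1 + \<tau> * q)) *\<^sub>R \<omega>" for \<tau>
  have c1: "c 1 = x"
  proof -
    have "(1 - 1 * q) / (1 + 1 * q) = norm x" using norm_hradius[of x] by (simp add: q_def)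
    then show ?thesis using x0 by (simp only: c_def \<omega>_def) simp
  qed
  have nc: "norm (c \<tau>) = (1 - \<tau> * q) / (1 + \<tau> * q)" "0 < (1 - \<tau> * q) / (1 + \<tau> * q)" "1 + \<tau> * q > 0" if "\<tau> \<in> {0..1}" for \<tau>
  proof -
    have "\<tau> * q \<le> 1 * q" by (rule mult_right_mono) (use that q in auto)
    then have "\<tau> * q < 1" using q(2) by linarith
    moreover have "0 \<le> \<tau> * q" using that q by simp
    ultimately have "\<tau> * q < 1" "0 \<le> \<tau> * q" by blast+
    then show "0 < (1 - \<tau> * q) / (1 + \<tau> * q)" "1 + \<tau> * q > 0"
      "norm (c \<tau>) = (1 - \<tau> * q) / (1 + \<tau> * q)" using n\<omega> by (auto simp: c_def)
  qed
  have hc: "hradius (c \<tau>) = \<tau> * hradius x" if "\<tau> \<in> {0..1}" for \<tau>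
    unfolding hradius_def[of "c \<tau>"] nc(1)[OF that] using nc(3)[OF that]
    by (simp add: q_def[symmetric] field_simps)
  have uc: "c \<tau> /\<^sub>R norm (c \<tau>) = \<omega>" if "\<tau> \<in> {0..1}" for \<tau>
  proof -
    define z where "z = (1 - \<tau> * q) / (1 + \<tau> * q)"
    have "c \<tau> = z *\<^sub>R \<omega>" "norm (c \<tau>) = z" "z > 0" using nc(1,2)[OF that] by (simp_all only: c_def z_def)
    then show ?thesis by simp
  qed
  have ic: "init (c \<tau>) = init x" if "\<tau> \<in> {0..1}" for \<tau>
    unfolding init_def Let_def uc[OF that] by (simp add: \<omega>_def)
  have dc: "(c has_vector_derivative (- 2 * q / (1 + q)\<^sup>2) *\<^sub>R \<omega>) (at 1 within {0..1})"
  proof -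
    have "((\<lambda>\<tau>. (1 - \<tau> * q) / (1 + \<tau> * q)) has_real_derivative - 2 * q / (1 + q)\<^sup>2) (at 1 within {0..1})"
      using q by (auto intro!: derivative_eq_intros simp: power2_eq_square field_simps)
    then show ?thesis
      unfolding c_def[abs_def] has_real_derivative_iff_has_vector_derivative
      by (rule bounded_linear.has_vector_derivative[OF bounded_linear_scaleR_left])
  qed
  have cc: "continuous (at 1 within {0..1}) c"
    by (rule has_vector_derivative_continuous[OF dc])
  have "\<forall>\<^sub>F \<tau> in at 1 within {0..1}. c \<tau> \<in> N"
    using cc N(1) x c1 unfolding continuous_within by (metis topological_tendstoD)
  \<comment> \<open>The comparison is available for \<open>\<tau> \<le> 1\<close> only. A one-sided
    derivative at the end point 1 still determines the velocity.\<close>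
  then have ev: "\<forall>\<^sub>F \<tau> in at 1 within {0..1}. X 1 (c \<tau>) = X \<tau> x"
    unfolding eventually_at_filter
  proof eventually_elim
    case (elim \<tau>)
    show ?case
    proof (intro impI)
      assume "\<tau> \<noteq> 1" "\<tau> \<in> {0..1}"
      with elim show "X 1 (c \<tau>) = X \<tau> x"
        using y_ray[OF x _ _ ic hc, of \<tau>] by (simp add: X_def)
    qed
  qed
  have hd: "((\<lambda>\<tau>. X 1 (c \<tau>)) has_derivative (\<lambda>h. DX 1 x (h *\<^sub>R ((- 2 * q / (1 + q)\<^sup>2) *\<^sub>R \<omega>)))) (at 1 within {0..1})"
    using dc unfolding has_vector_derivative_def
    by (rule has_derivative_compose) (use derivatives(1)[OF x, of 1] c1 in simp)
  have "((\<lambda>\<tau>. X \<tau> x) has_derivative (\<lambda>h. DX 1 x (h *\<^sub>R ((- 2 * q / (1 + q)\<^sup>2) *\<^sub>R \<omega>)))) (at 1 within {0..1})"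
    by (rule has_derivative_transform_eventually[OF hd ev]) (simp_all add: c1)
  moreover have l: "linear (DX 1 x)" using has_derivative_linear[OF derivatives(1)[OF x]] by simp
  ultimately have "((\<lambda>\<tau>. X \<tau> x) has_vector_derivative DX 1 x ((- 2 * q / (1 + q)\<^sup>2) *\<^sub>R \<omega>)) (at 1 within {0..1})"
    unfolding has_vector_derivative_def by (simp only: linear_scale[OF l])
  moreover have "at (1::real) within {0..1} \<noteq> bot"
    by (simp add: trivial_limit_within islimpt_Icc)
  ultimately have "DX 1 x ((- 2 * q / (1 + q)\<^sup>2) *\<^sub>R \<omega>) = X' 1 x"
    by (intro vector_derivative_unique_within[OF _ _ odes(1)[OF x]]) auto
  then have e1: "(- 2 * q / (1 + q)\<^sup>2) *\<^sub>R DX 1 x \<omega> = (q * exp (- w 1 x)) *\<^sub>R Z (X 1 x, P 1 x)"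
    by (simp only: linear_scale[OF l] X'_def q_def)
  have "1 + q = 2 / (1 + norm x)" by (simp add: q_def hradius_def field_simps)
  then have e2: "- 2 * q / (1 + q)\<^sup>2 = - (q * (1 + norm x)\<^sup>2 / 2)"
    by (simp add: power_divide power2_eq_square)
  have "(- 2 / (q * (1 + norm x)\<^sup>2)) *\<^sub>R ((- (q * (1 + norm x)\<^sup>2 / 2)) *\<^sub>R DX 1 x \<omega>) =
      (- 2 / (q * (1 + norm x)\<^sup>2)) *\<^sub>R ((q * exp (- w 1 x)) *\<^sub>R Z (X 1 x, P 1 x))"
    using e1 unfolding e2 by (rule arg_cong)
  then show ?thesis using q(1) by (simp add: \<omega>_def[symmetric])
qed

text \<open>The differential of \<open>hradius_X\<close> at time 1, with \<open>covector\<close>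
  inserted for the derivative of \<open>w\<close>.\<close>

lemma covector_transport:
  assumes x: "x \<in> N"
  shows "exp (w 1 x) * ((hradius_grad (X 1 x) + hradius (X 1 x) *\<^sub>R P 1 x) \<bullet> DX 1 x v) = hradius_grad x \<bullet> v"
proof -
  have one: "(1::real) \<in> {0..1}" by simp
  have X0: "X 1 x \<noteq> 0" using ann_nonzero[OF \<delta>1 X_ann[OF x]] by simp
  have x0: "x \<noteq> 0" using ann_nonzero[OF \<delta>1] x N(2) by auto
  have d1: "((\<lambda>x. hradius (X 1 x) * exp (w 1 x)) has_derivative
     (\<lambda>v. hradius (X 1 x) * (Dw 1 x v * exp (w 1 x)) + (hradius_grad (X 1 x) \<bullet> DX 1 x v) * exp (w 1 x))) (at x)"
    by (rule has_derivative_mult[OF has_derivative_compose[OF derivatives(1)[OF x one] hradius_derivative[OF X0]]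
       has_derivative_exp[OF derivatives(3)[OF x one]]])
  have d2: "((\<lambda>x. hradius (X 1 x) * exp (w 1 x)) has_derivative (\<lambda>v. hradius_grad x \<bullet> v)) (at x)"
    by (rule has_derivative_transform_within_open[OF hradius_derivative[OF x0] N(1) x])
      (simp add: hradius_X)
  have e: "hradius (X 1 x) * ((P 1 x \<bullet> DX 1 x v) * exp (w 1 x)) + (hradius_grad (X 1 x) \<bullet> DX 1 x v) * exp (w 1 x) =
      hradius_grad x \<bullet> v"
    using fun_cong[OF has_derivative_unique[OF d1 d2], of v] unfolding covector[OF x one] .
  show ?thesis unfolding e[symmetric] inner_add_left inner_scaleR_left by (simp only: distrib_left mult_ac add_ac)
qed

text \<open>The quotient \<open>\<rho> x / \<rho> (X 1 x)\<close>, rewritten by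
  \<open>hradius_X\<close> so that it has a meaning on the sphere and is smooth across it.\<close>

definition \<sigma> where "\<sigma> x = exp (w 1 x) * (1 + norm x)\<^sup>2 / (1 + norm (X 1 x))\<^sup>2"

text \<open>The pullback of \<open>g\<close>, rescaled by \<open>(\<rho> x)\<^sup>2\<close>, is
  \<open>(\<sigma> x)\<^sup>2\<close> times \<open>A\<close> on images under \<open>DX 1 x\<close>,
  so this is transversality of the pullback. The position vector is sent to a multiple of
  \<open>Z\<close>; its \<open>A\<close>-dual is \<open>dQ + Q P\<close> up to a scalar, and
  \<open>covector_transport\<close> brings this covector back to \<open>dQ\<close> at
  \<open>x\<close>, which is radial. All scalar factors cancel.\<close>

theorem transversality:
  assumes x: "x \<in> N" and x1: "norm x < 1"
  shows "(\<sigma> x)\<^sup>2 * ((A (X 1 x) *v DX 1 x x) \<bullet> DX 1 x v) = x \<bullet> v"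
proof -
  have one: "(1::real) \<in> {0..1}" by simp
  have x0: "x \<noteq> 0" using ann_nonzero[OF \<delta>1] x N(2) by auto
  have l: "linear (DX 1 x)" using has_derivative_linear[OF derivatives(1)[OF x]] by simp
  let ?\<zeta> = "hradius_grad (X 1 x) + hradius (X 1 x) *\<^sub>R P 1 x"
  have AZ: "A (X 1 x) *v Z (X 1 x, P 1 x) = ((1 + norm (X 1 x)) ^ 4 / 4) *\<^sub>R ?\<zeta>"
    using AB(1)[OF X_ann[OF x one], of ?\<zeta>] by (simp add: Z_def K_def matrix_vector_mult_scaleR)
  have "DX 1 x x = norm x *\<^sub>R DX 1 x (x /\<^sub>R norm x)"
    using x0 by (simp add: linear_scale[OF l])
  also have "\<dots> = (norm x * (- 2 / (1 + norm x)\<^sup>2 * exp (- w 1 x))) *\<^sub>R Z (X 1 x, P 1 x)"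
    unfolding ray_velocity[OF x x1] by simp
  finally have D: "DX 1 x x = (norm x * (- 2 / (1 + norm x)\<^sup>2 * exp (- w 1 x))) *\<^sub>R Z (X 1 x, P 1 x)" .
  have "(A (X 1 x) *v DX 1 x x) \<bullet> DX 1 x v =
      (norm x * (- 2 / (1 + norm x)\<^sup>2 * exp (- w 1 x))) * ((1 + norm (X 1 x)) ^ 4 / 4) * (?\<zeta> \<bullet> DX 1 x v)"
    unfolding D matrix_vector_mult_scaleR AZ inner_scaleR_left by (simp only: mult.assoc)
  also have "?\<zeta> \<bullet> DX 1 x v = exp (- w 1 x) * (exp (w 1 x) * (?\<zeta> \<bullet> DX 1 x v))"
    by (simp add: exp_minus)
  also have "exp (w 1 x) * (?\<zeta> \<bullet> DX 1 x v) = - 2 / (1 + norm x)\<^sup>2 * ((x \<bullet> v) / norm x)"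
    unfolding covector_transport[OF x] by (simp add: hradius_grad_def divide_inverse)
  finally have e: "(A (X 1 x) *v DX 1 x x) \<bullet> DX 1 x v =
      (norm x * (- 2 / (1 + norm x)\<^sup>2 * exp (- w 1 x))) * ((1 + norm (X 1 x)) ^ 4 / 4) *
      (exp (- w 1 x) * (- 2 / (1 + norm x)\<^sup>2 * ((x \<bullet> v) / norm x)))" .
  define E s r where "E = exp (w 1 x)" and "s = 1 + norm (X 1 x)" and "r = 1 + norm x"
  have pos: "E > 0" "s > 0" "r > 0" by (auto simp: E_def s_def r_def)
  have "(E * r\<^sup>2 / s\<^sup>2)\<^sup>2 * ((norm x * (- 2 / r\<^sup>2 * inverse E)) * (s ^ 4 / 4) *
      (inverse E * (- 2 / r\<^sup>2 * ((x \<bullet> v) / norm x)))) = x \<bullet> v"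
    using pos x0 by (simp add: field_simps eval_nat_numeral)
  then show ?thesis
    unfolding e \<sigma>_def by (simp add: exp_minus E_def s_def r_def)
qed

end

section \<open>Decay of the characteristics towards the sphere\<close>

text \<open>A radial limit extends to the sphere a bound known inside the ball. On the sphere it
  asserts vanishing if \<open>j > 0\<close> and mere boundedness if \<open>j = 0\<close>.\<close>

lemma closed_flat_bound:
  fixes f :: "'a::euclidean_space \<Rightarrow> real"
  assumes f: "continuous_on (ann \<delta>) f" and \<delta>: "0 < \<delta>'" "\<delta>' \<le> \<delta>" "\<delta> \<le> 1"
    and b: "\<And>x. x \<in> ann \<delta>' \<Longrightarrow> norm x < 1 \<Longrightarrow> \<bar>f x\<bar> \<le> C * (1 - norm x) ^ j"
    and x: "x \<in> ann \<delta>'" "norm x \<le> 1"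
  shows "\<bar>f x\<bar> \<le> C * (1 - norm x) ^ j"
proof (cases "norm x < 1")
  case False
  then have x1: "norm x = 1" using x by simp
  have "continuous (at (1 *\<^sub>R x)) f"
  proof -
    have "x \<in> ann \<delta>" using x1 \<delta> by (simp add: ann_def)
    then show ?thesis using f by (simp add: continuous_on_eq_continuous_at[OF open_ann])
  qed
  moreover have "((\<lambda>r. r *\<^sub>R x) \<longlongrightarrow> 1 *\<^sub>R x) (at_left 1)" by (intro tendsto_intros)
  ultimately have "((\<lambda>r. f (r *\<^sub>R x)) \<longlongrightarrow> f (1 *\<^sub>R x)) (at_left 1)"
    by (rule isCont_tendsto_compose)
  then have "((\<lambda>r. \<bar>f (r *\<^sub>R x)\<bar>) \<longlongrightarrow> \<bar>f (1 *\<^sub>R x)\<bar>) (at_left 1)" by (rule tendsto_rabs)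
  moreover have "((\<lambda>r. C * (1 - r) ^ j) \<longlongrightarrow> C * (1 - 1) ^ j) (at_left 1)" by (intro tendsto_intros)
  moreover have "\<forall>\<^sub>F r in at_left 1. \<bar>f (r *\<^sub>R x)\<bar> \<le> C * (1 - r) ^ j"
    unfolding eventually_at_left_field
  proof (intro exI[of _ "1 - \<delta>'"] conjI allI impI)
    fix r assume "1 - \<delta>' < r" "r < 1"
    then have "r *\<^sub>R x \<in> ann \<delta>'" "norm (r *\<^sub>R x) = r" using x1 \<delta> by (auto simp: ann_def)
    then show "\<bar>f (r *\<^sub>R x)\<bar> \<le> C * (1 - r) ^ j" using b[of "r *\<^sub>R x"] \<open>r < 1\<close> by simp
  qed (use \<delta> in auto)
  ultimately have "\<bar>f (1 *\<^sub>R x)\<bar> \<le> C * (1 - 1) ^ j"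
    by (intro tendsto_le[of "at_left (1::real)"]) auto
  then show ?thesis by (simp add: x1)
qed (use b x in auto)

context normal_form
begin

lemma one_minus_power_le:
  assumes "norm x \<le> 1" "x \<in> ann \<delta>" shows "(1 - norm x) ^ k \<le> \<delta>"
proof -
  have "(1 - norm x) ^ k \<le> (1 - norm x) ^ 1"
    using assms k by (intro power_decreasing) auto
  also have "\<dots> \<le> \<delta>" using assms by (simp add: ann_def)
  finally show ?thesis .
qed

text \<open>A perturbation argument: \<open>A\<close> differs from the identity by at most
  \<open>1/2\<close> in norm, so the inverse has norm at most 2 and differs from the identity by at
  most twice the bound for \<open>A\<close>.\<close>

lemma B_bound:
  assumes x: "x \<in> ann \<delta>" "norm x \<le> 1"
  shows "norm (B x v) \<le> 2 * norm v" "norm (B x v - v) \<le> 2 * C0 * (1 - norm x) ^ k * norm v"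
proof -
  have c: "norm (v - B x v) \<le> C0 * (1 - norm x) ^ k * norm (B x v)"
    using A_close[OF x, of "B x v"] AB(1)[OF x(1)] by simp
  have "C0 * (1 - norm x) ^ k \<le> C0 * \<delta>"
    using one_minus_power_le[OF x(2,1)] C0(1) by (rule mult_left_mono)
  then have "C0 * (1 - norm x) ^ k * norm (B x v) \<le> 1/2 * norm (B x v)"
    using C0(2) by (intro mult_right_mono) auto
  with c show b: "norm (B x v) \<le> 2 * norm v"
    using norm_triangle_ineq2[of "B x v" v] by (simp add: norm_minus_commute)
  have "C0 * (1 - norm x) ^ k * norm (B x v) \<le> C0 * (1 - norm x) ^ k * (2 * norm v)"
    using b C0(1) x(2) by (intro mult_left_mono) auto
  with c show "norm (B x v - v) \<le> 2 * C0 * (1 - norm x) ^ k * norm v"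
    by (simp add: norm_minus_commute)
qed

lemma K_bound:
  assumes x: "x \<in> ann \<delta>" "norm x \<le> 1"
  shows "norm (K x v) \<le> 8 * norm v"
proof -
  have "(1 + norm x) ^ 4 \<le> 2 ^ 4" using x by (intro power_mono) auto
  then have "(1 + norm x) ^ 4 / 4 * norm (B x v) \<le> 4 * (2 * norm v)"
    by (intro mult_mono B_bound x) auto
  then show ?thesis by (simp add: K_def)
qed

lemma hradius_le: assumes "norm x \<le> 1" shows "hradius x \<le> 1 - norm x" "1 - norm x \<le> 2 * hradius x" "0 \<le> hradius x"
proof -
  have e: "1 - norm x = hradius x * (1 + norm x)" by (simp add: hradius_def)
  show h: "0 \<le> hradius x" using assms by (simp add: hradius_def)
  have "hradius x * 1 \<le> hradius x * (1 + norm x)" using h by (intro mult_left_mono) auto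
  then show "hradius x \<le> 1 - norm x" unfolding e by simp
  have "hradius x * (1 + norm x) \<le> hradius x * 2" using h assms by (intro mult_left_mono) auto
  then show "1 - norm x \<le> 2 * hradius x" unfolding e by simp
qed

text \<open>The scalar factors of \<open>K\<close> and of the gradient cancel, so that
  \<open>hradius x * a x\<close> is the defect of \<open>B\<close> in the radial direction. Division
  by \<open>hradius\<close> costs the one power.\<close>

lemma a_bound_interior:
  assumes x: "x \<in> ann \<delta>" "norm x < 1"
  shows "\<bar>a x\<bar> \<le> 4 * C0 * (1 - norm x) ^ (k - 1)"
proof -
  define \<omega> where "\<omega> = x /\<^sub>R norm x"
  have \<omega>: "norm \<omega> = 1" using norm_unit[OF x(1)] by (simp add: \<omega>_def)
  define c where "c = - 2 / (1 + norm x)\<^sup>2"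
  have c: "(1 + norm x) ^ 4 / 4 * (c * c) = 1"
  proof -
    define r where "r = 1 + norm x"
    have "r > 0" by (simp add: r_def)
    then show ?thesis by (simp add: c_def r_def[symmetric] field_simps eval_nat_numeral)
  qed
  have "K x (hradius_grad x) \<bullet> hradius_grad x = ((1 + norm x) ^ 4 / 4 * (c * c)) * (B x \<omega> \<bullet> \<omega>)"
    unfolding K_def hradius_grad_def \<omega>_def[symmetric] c_def[symmetric] linear_scale[OF B_linear]
    by (simp add: mult_ac)
  then have "K x (hradius_grad x) \<bullet> hradius_grad x = B x \<omega> \<bullet> \<omega>" unfolding c by simp
  then have "hradius x * a x = (B x \<omega> - \<omega>) \<bullet> \<omega>"
    using a(2)[OF x(1)] \<omega> by (simp add: inner_diff_left power2_norm_eq_inner[symmetric])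
  then have "hradius x * \<bar>a x\<bar> \<le> norm (B x \<omega> - \<omega>)"
    using Cauchy_Schwarz_ineq2[of "B x \<omega> - \<omega>" \<omega>] \<omega> hradius_le[of x] x(2)
    by (metis abs_mult abs_of_nonneg less_imp_le mult.right_neutral)
  also have "\<dots> \<le> 2 * C0 * (1 - norm x) ^ k"
    using B_bound(2)[of x \<omega>] x \<omega> by simp
  also have "\<dots> = 2 * C0 * (1 - norm x) ^ (k - 1) * (1 - norm x)"
    using k by (cases k) auto
  also have "\<dots> \<le> 2 * C0 * (1 - norm x) ^ (k - 1) * (2 * hradius x)"
    using x(2) C0 hradius_le[of x] by (intro mult_left_mono) auto
  finally have "hradius x * \<bar>a x\<bar> \<le> hradius x * (4 * C0 * (1 - norm x) ^ (k - 1))" by (simp add: mult_ac)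
  then show ?thesis using hradius_pos[of x] x(2) by (simp add: mult_le_cancel_left_pos)
qed

lemma a_bound:
  assumes "x \<in> ann \<delta>" "norm x \<le> 1"
  shows "\<bar>a x\<bar> \<le> 4 * C0 * (1 - norm x) ^ (k - 1)"
  by (rule closed_flat_bound[OF smooth_continuous_on[OF a(1)] \<delta>(1) order_refl \<delta>1 a_bound_interior assms])

text \<open>At \<open>p = 0\<close> the gradient of \<open>F\<close> in \<open>x\<close> is that of
  \<open>a\<close>, of order \<open>k - 2\<close> by \<open>flat_derivative\<close>. The remaining
  part, \<open>m\<close>, vanishes at \<open>p = 0\<close> and is Lipschitz in \<open>p\<close> on
  compact sets.\<close>

lemma gradF_bound:
  assumes k2: "k \<ge> 2" and R: "R \<ge> 0"
  obtains C where "C \<ge> 0" "\<And>x p. x \<in> ann (\<delta> / 2) \<Longrightarrow> norm x \<le> 1 \<Longrightarrow> norm p \<le> R \<Longrightarrow>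
    norm (gradF (x, p)) \<le> C * ((1 - norm x) ^ (k - 2) + norm p)"
proof -
  obtain j where j: "k = Suc (Suc j)" using k2 by (metis Suc_le_D numeral_2_eq_2 Suc_le_mono)
  have sub: "x \<in> ann \<delta>" if "x \<in> ann (\<delta> / 2)" for x :: "real^'n" using ann_mono[of "\<delta> / 2" \<delta>] \<delta> that by auto
  obtain Ca where Ca: "Ca \<ge> 0" "\<And>x v. x \<in> ann (\<delta> / 2) \<Longrightarrow> norm x < 1 \<Longrightarrow>
      \<bar>frechet_derivative a (at x) v\<bar> \<le> Ca * (1 - norm x) ^ j * norm v"
    using flat_derivative[of \<delta> a "\<delta> / 2" "4 * C0" j] a(1) \<delta> a_bound sub j by auto
  have Da: "\<bar>frechet_derivative a (at x) b\<bar> \<le> Ca * (1 - norm x) ^ j"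
    if x: "x \<in> ann (\<delta> / 2)" "norm x \<le> 1" and b: "b \<in> Basis" for x b
  proof (rule closed_flat_bound[of \<delta> _ "\<delta> / 2"])
    have "smooth (ann \<delta>) (\<lambda>x. frechet_derivative a (at x) b)"
      by (intro smooth_frechet_derivative[OF a(1)] smooth_intros open_ann)
    then show "continuous_on (ann \<delta>) (\<lambda>x. frechet_derivative a (at x) b)" by (rule smooth_continuous_on)
  qed (use Ca(2)[of _ b] b x \<delta> in auto)
  define m where "m b q = dF q (b, 0) - frechet_derivative a (at (fst q)) b" for b q
  have sm: "smooth (ann \<delta> \<times> UNIV) (m b)" for b
    unfolding m_def
    by (intro smooth_diff smooth_frechet_derivative[OF smooth_F] smooth_frechet_derivative[OF a(1)] smooth_intros open_annU) auto
  have m0: "m b (x, 0) = 0" if x: "x \<in> ann \<delta>" for x b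
  proof -
    have "((\<lambda>x. F (x, 0)) has_derivative (\<lambda>b. dF (x, 0) (b, 0))) (at x)"
      by (rule has_derivative_compose[OF has_derivative_Pair[OF has_derivative_ident has_derivative_const] F_derivative])
        (simp add: x)
    moreover have "(\<lambda>x. F (x, 0)) = a" by (rule ext) (simp add: F_def linear_0[OF K_linear])
    ultimately show ?thesis by (simp add: m_def frechet_derivative_eqI)
  qed
  define CA where "CA = {x::real^'n. 1 - \<delta> / 2 \<le> norm x \<and> norm x \<le> 1}"
  have CA: "compact (CA \<times> cball (0::real^'n) R)" "CA \<times> cball 0 R \<subseteq> ann \<delta> \<times> UNIV" "CA \<subseteq> ann \<delta>"
    using \<delta> by (auto intro!: compact_Times compact_closed_annulus simp: CA_def ann_def)
  have "\<exists>M\<ge>0. \<forall>x\<in>CA. \<forall>p\<in>cball 0 R. \<bar>m b (x, p)\<bar> \<le> M * norm p" for b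
  proof -
    obtain M where M: "M \<ge> 0" "\<And>q v. q \<in> CA \<times> cball 0 R \<Longrightarrow> norm (frechet_derivative (m b) (at q) v) \<le> M * norm v"
      using smooth_derivative_bounded[OF sm CA(1,2)] by metis
    have "norm (m b (x, p) - m b (x, 0)) \<le> M * norm (p - 0)" if x: "x \<in> CA" and p: "p \<in> cball 0 R" for x p
    proof (rule differentiable_bound[of "cball 0 R" "\<lambda>p. m b (x, p)" "\<lambda>p v. frechet_derivative (m b) (at (x, p)) (0, v)"])
      fix p :: "real^'n" assume p: "p \<in> cball 0 R"
      have "((\<lambda>p. m b (x, p)) has_derivative (\<lambda>v. frechet_derivative (m b) (at (x, p)) (0, v))) (at p)"
        by (rule has_derivative_compose[OF has_derivative_Pair[OF has_derivative_const has_derivative_ident]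
              smooth_has_derivative[OF sm]]) (use x CA(3) in auto)
      then show "((\<lambda>p. m b (x, p)) has_derivative (\<lambda>v. frechet_derivative (m b) (at (x, p)) (0, v))) (at p within cball 0 R)"
        by (rule has_derivative_at_withinI)
      show "onorm (\<lambda>v. frechet_derivative (m b) (at (x, p)) (0, v)) \<le> M"
      proof (rule onorm_le)
        fix v :: "real^'n"
        have "norm (0::real^'n, v) = norm v" by (simp add: norm_Pair)
        then show "norm (frechet_derivative (m b) (at (x, p)) (0, v)) \<le> M * norm v"
          using M(2)[of "(x, p)" "(0, v)"] x p by simp
      qed
    qed (use p R in auto)
    then show ?thesis using M(1) m0 CA(3) by (intro exI[of _ M]) (auto simp: subset_iff)
  qed
  then obtain M where M: "\<And>b. M b \<ge> 0" "\<And>b x p. x \<in> CA \<Longrightarrow> p \<in> cball 0 R \<Longrightarrow> \<bar>m b (x, p)\<bar> \<le> M b * norm p"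
    by metis
  show thesis
  proof (rule that[of "\<Sum>b\<in>Basis. Ca + M b"])
    show "0 \<le> (\<Sum>b\<in>Basis. Ca + M b)" by (intro sum_nonneg add_nonneg_nonneg Ca M)
    fix x p :: "real^'n" assume x: "x \<in> ann (\<delta> / 2)" "norm x \<le> 1" and p: "norm p \<le> R"
    have xC: "x \<in> CA" using x by (auto simp: CA_def ann_def)
    define T where "T = (1 - norm x) ^ j + norm p"
    have "norm (gradF (x, p)) \<le> (\<Sum>b\<in>Basis. (Ca + M b) * T)"
      unfolding gradF_def
    proof (rule sum_norm_le)
      fix b :: "real^'n" assume b: "b \<in> Basis"
      have "\<bar>dF (x, p) (b, 0)\<bar> \<le> \<bar>frechet_derivative a (at x) b\<bar> + \<bar>m b (x, p)\<bar>"
        by (simp add: m_def)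
      also have "\<dots> \<le> Ca * (1 - norm x) ^ j + M b * norm p"
        using Da[OF x b] M(2)[OF xC, of p b] p by (intro add_mono) auto
      also have "\<dots> \<le> Ca * T + M b * T"
        unfolding T_def using Ca(1) M(1) x(2) by (intro add_mono mult_left_mono) auto
      finally show "norm (dF (x, p) (b, 0) *\<^sub>R b) \<le> (Ca + M b) * T"
        using b by (simp add: algebra_simps)
    qed
    then show "norm (gradF (x, p)) \<le> (\<Sum>b\<in>Basis. Ca + M b) * ((1 - norm x) ^ (k - 2) + norm p)"
      by (simp add: T_def j sum_distrib_right)
  qed
qed

end

lemma hradius_nonneg: "0 \<le> hradius x \<longleftrightarrow> norm x \<le> 1"
  by (simp add: hradius_def pos_le_divide_eq)

text \<open>Serves to split a velocity, less its radial speed in the fixed direction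
  \<open>w\<close>, into a multiple of the deviation of the position from that direction and a
  remainder. In \<open>X_close\<close> the first is absorbed and the second estimated.\<close>

lemma radial_split:
  fixes u w e :: "'a::real_vector"
  assumes "r \<noteq> 0"
  shows "m *\<^sub>R (c *\<^sub>R u + e) - (m * (c + d)) *\<^sub>R w = (m * c / r) *\<^sub>R (r *\<^sub>R u - r *\<^sub>R w) + m *\<^sub>R (e - d *\<^sub>R w)"
proof -
  have "(m * c / r) *\<^sub>R (r *\<^sub>R u - r *\<^sub>R w) = (m * c) *\<^sub>R u - (m * c) *\<^sub>R w"
    using assms by (simp add: scaleR_diff_right)
  then show ?thesis by (simp add: scaleR_add_right scaleR_diff_right scaleR_add_left distrib_left)
qed

lemma exp_minus_one_bound:
  fixes z :: real assumes "\<bar>z\<bar> \<le> r" shows "\<bar>exp z - 1\<bar> \<le> exp r * \<bar>z\<bar>"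
proof -
  have "norm (exp z - exp 0) \<le> exp r * norm (z - 0)"
    by (rule differentiable_bound[of "{-r..r}" exp "\<lambda>x v. v * exp x"])
      (use assms in \<open>auto intro!: derivative_eq_intros onorm_le simp: has_field_derivative_def abs_mult mult.commute mult_left_mono\<close>)
  then show ?thesis by simp
qed

context characteristics
begin

definition "E = exp R"

lemma R: assumes "x \<in> N" "t \<in> {0..1}" shows "norm (P t x) \<le> R" "\<bar>w t x\<bar> \<le> R" "0 \<le> R"
proof -
  have "norm (P t x) \<le> norm (snd (y t x))" "\<bar>w t x\<bar> \<le> norm (snd (y t x))"
    unfolding P_def w_def using norm_fst_le[of "fst (snd (y t x))" "snd (snd (y t x))"]
      norm_snd_le[of "snd (snd (y t x))" "fst (snd (y t x))"] by simp_all
  moreover have "norm (snd (y t x)) \<le> norm (y t x)"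
    using norm_snd_le[of "snd (y t x)" "fst (y t x)"] by simp
  ultimately show "norm (P t x) \<le> R" "\<bar>w t x\<bar> \<le> R" using y_bounded(2)[OF assms] by linarith+
  then show "0 \<le> R" using norm_ge_zero order_trans by blast
qed

lemma exp_w_bound: assumes "x \<in> N" "t \<in> {0..1}" shows "exp (- w t x) \<le> E" "exp (w t x) \<le> E" "E \<ge> 1"
  using R[OF assms] by (auto simp: E_def)

lemma hradius_X_eq: "x \<in> N \<Longrightarrow> t \<in> {0..1} \<Longrightarrow> hradius (X t x) = t * hradius x * exp (- w t x)"
  using hradius_X[of x t] by (simp add: exp_minus field_simps)

text \<open>By \<open>hradius_X\<close> the sign of \<open>hradius\<close> is preserved, so a
  characteristic with parameter in the closed ball remains there, where the decay estimates are
  available.\<close>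

lemma X_inside:
  assumes x: "x \<in> N" "norm x \<le> 1" and t: "t \<in> {0..1}"
  shows "norm (X t x) \<le> 1" "hradius (X t x) \<le> E * hradius x" "0 \<le> hradius (X t x)"
    "1 - norm (X t x) \<le> 2 * E * hradius x" "X t x \<in> ann (\<delta> / 2)"
proof -
  have h: "0 \<le> hradius x" using x by (simp add: hradius_nonneg)
  show h0: "0 \<le> hradius (X t x)" using hradius_X_eq[OF x(1) t] h t by simp
  then show n: "norm (X t x) \<le> 1" by (simp add: hradius_nonneg)
  have "t * hradius x * exp (- w t x) \<le> 1 * hradius x * E"
    by (intro mult_mono exp_w_bound[OF x(1) t]) (use h t in auto)
  then show hE: "hradius (X t x) \<le> E * hradius x" using hradius_X_eq[OF x(1) t] by (simp add: mult.commute)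
  show "1 - norm (X t x) \<le> 2 * E * hradius x" using hradius_le(2)[OF n] hE by simp
  show "X t x \<in> ann (\<delta> / 2)" using y_bounded(1)[OF x(1) t] by (simp add: X_def)
qed

text \<open>If \<open>k \<ge> 2\<close>, then \<open>a\<close> vanishes on the sphere and
  \<open>P\<close> starts at 0. Its velocity is at most a constant times \<open>hradius x\<close>
  times the sum of \<open>hradius x ^ (k - 2)\<close> and \<open>norm P\<close>; for small
  \<open>hradius x\<close> the last term is absorbed.\<close>

lemma P_small:
  obtains C \<eta> where "C \<ge> 0" "\<eta> > 0"
    "\<And>x t. x \<in> N \<Longrightarrow> norm x \<le> 1 \<Longrightarrow> hradius x \<le> \<eta> \<Longrightarrow> t \<in> {0..1} \<Longrightarrow> norm (P t x) \<le> C * hradius x ^ (k - 1)"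
proof (cases "k \<ge> 2 \<and> R \<ge> 0")
  \<comment> \<open>A point of \<open>N\<close> forces \<open>0 \<le> R\<close>, hence
    \<open>k = 1\<close> here; the exponent is then 0 and \<open>R\<close> itself bounds
    \<open>P\<close>.\<close>
  case False
  show thesis
  proof (rule that[of "\<bar>R\<bar>" 1])
    fix x t assume x: "x \<in> N" "t \<in> {0..1::real}"
    then have "k = 1" using False k R[OF x] by auto
    then show "norm (P t x) \<le> \<bar>R\<bar> * hradius x ^ (k - 1)" using R[OF x] by simp
  qed auto
next
  case True
  obtain C where C: "C \<ge> 0" "\<And>x p. x \<in> ann (\<delta> / 2) \<Longrightarrow> norm x \<le> 1 \<Longrightarrow> norm p \<le> R \<Longrightarrow>
    norm (gradF (x, p)) \<le> C * ((1 - norm x) ^ (k - 2) + norm p)"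
    using gradF_bound True by metis
  define D where "D = E * C"
  have E0: "E > 0" by (simp add: E_def)
  have D: "D \<ge> 0" using E0 C(1) by (simp add: D_def)
  show thesis
  \<comment> \<open>The second constant makes \<open>hradius x * D\<close> at most
    \<open>1/2\<close>; the leading 2 of the first is \<open>1 / (1 - 1/2)\<close> from
    \<open>half_bound\<close>.\<close>
  proof (rule that[of "2 * D * (2 * E) ^ (k - 2)" "1 / (2 * (D + 1))"])
    fix x t assume x: "x \<in> N" "norm x \<le> 1" and hx: "hradius x \<le> 1 / (2 * (D + 1))" and t: "t \<in> {0..1::real}"
    have h: "0 \<le> hradius x" using x by (simp add: hradius_nonneg)
    have P0: "P 0 x = 0"
    proof -
      have "\<bar>a (x /\<^sub>R norm x)\<bar> \<le> 4 * C0 * (1 - norm (x /\<^sub>R norm x)) ^ (k - 1)"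
        using norm_unit_N[OF x(1)] by (intro a_bound sphere_ann) auto
      moreover have "(1 - 1::real) ^ (k - 1) = 0" using True by (auto simp: power_0_left)
      ultimately have "a (x /\<^sub>R norm x) = 0" unfolding norm_unit_N[OF x(1)] by (simp only: mult_zero_right abs_le_zero_iff)
      then show ?thesis by (simp add: initial[OF x(1)])
    qed
    have "norm (P t x) \<le> (hradius x * D * (2 * E * hradius x) ^ (k - 2)) / (1 - 1/2)"
    proof (rule half_bound[where q = "1/2", OF _ _ _ t])
      have "continuous_on {0..1} (\<lambda>t. P t x)"
        by (rule continuous_on_vector_derivative[OF odes(2)[OF x(1)]])
      then show "continuous_on {0..1} (\<lambda>t. norm (P t x))" by (rule continuous_on_norm)
      fix t M assume t: "t \<in> {0..1::real}" and M: "\<And>s. s \<in> {0..1} \<Longrightarrow> norm (P s x) \<le> M"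
      have M0: "0 \<le> M" using order_trans[OF norm_ge_zero M[OF t]] .
      have "norm (P t x - P 0 x) \<le> hradius x * D * ((2 * E * hradius x) ^ (k - 2) + M)"
      proof (rule vector_derivative_bound_01[OF odes(2)[OF x(1)] _ t])
        fix s :: real assume s: "s \<in> {0..1}"
        note XI = X_inside[OF x s]
        have "norm (gradF (X s x, P s x)) \<le> C * ((1 - norm (X s x)) ^ (k - 2) + norm (P s x))"
          by (rule C(2)) (use XI R[OF x(1) s] in auto)
        also have "\<dots> \<le> C * ((2 * E * hradius x) ^ (k - 2) + M)"
          using XI M[OF s] C(1) by (intro mult_left_mono add_mono power_mono) auto
        finally have g: "norm (gradF (X s x, P s x)) \<le> C * ((2 * E * hradius x) ^ (k - 2) + M)" .
        have "norm (P' s x) = hradius x * (exp (- w s x) / 2 * norm (gradF (X s x, P s x)))"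
          using h by (simp add: P'_def)
        also have "\<dots> \<le> hradius x * (E * (C * ((2 * E * hradius x) ^ (k - 2) + M)))"
          using exp_w_bound(1)[OF x(1) s] h E0 g
          by (intro mult_left_mono mult_mono) (auto simp: field_simps intro: order_trans[of _ E])
        finally show "norm (P' s x) \<le> hradius x * D * ((2 * E * hradius x) ^ (k - 2) + M)"
          by (simp add: D_def mult_ac)
      qed
      also have "\<dots> = hradius x * D * (2 * E * hradius x) ^ (k - 2) + (hradius x * D) * M"
        by (simp add: algebra_simps)
      also have "(hradius x * D) * M \<le> 1/2 * M"
      proof (rule mult_right_mono[OF _ M0])
        have "hradius x * (2 * (D + 1)) \<le> 1" using hx D by (simp add: pos_le_divide_eq)
        then show "hradius x * D \<le> 1/2" using h by (simp add: algebra_simps)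
      qed
      finally show "norm (P t x) \<le> hradius x * D * (2 * E * hradius x) ^ (k - 2) + 1/2 * M"
        by (simp add: P0)
    qed simp
    also have "\<dots> = 2 * D * (2 * E) ^ (k - 2) * hradius x ^ Suc (k - 2)" by (simp add: power_mult_distrib)
    also have "Suc (k - 2) = k - 1" using True by linarith
    finally show "norm (P t x) \<le> 2 * D * (2 * E) ^ (k - 2) * hradius x ^ (k - 1)" .
  qed (use D E0 in auto)
qed

text \<open>\<open>w\<close> starts at 0, and its velocity \<open>P \<bullet> X'\<close> is
  \<open>hradius x\<close> times a term of order \<open>k - 1\<close>.\<close>

lemma w_small:
  obtains C \<eta> where "C \<ge> 0" "\<eta> > 0"
    "\<And>x t. x \<in> N \<Longrightarrow> norm x \<le> 1 \<Longrightarrow> hradius x \<le> \<eta> \<Longrightarrow> t \<in> {0..1} \<Longrightarrow> \<bar>w t x\<bar> \<le> C * hradius x ^ k"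
proof -
  obtain CP \<eta> where P: "CP \<ge> 0" "\<eta> > 0"
    "\<And>x t. x \<in> N \<Longrightarrow> norm x \<le> 1 \<Longrightarrow> hradius x \<le> \<eta> \<Longrightarrow> t \<in> {0..1} \<Longrightarrow> norm (P t x) \<le> CP * hradius x ^ (k - 1)"
    by (rule P_small) blast
  have E0: "E > 0" by (simp add: E_def)
  define D where "D = 4 * C0 * (2 * E) ^ (k - 1) + E * (8 * (CP * \<bar>R\<bar>))"
  have D: "D \<ge> 0" using C0 E0 P(1) by (simp add: D_def)
  show thesis
  proof (rule that[of "E * D" "min \<eta> 1"])
    fix x t assume x: "x \<in> N" "norm x \<le> 1" and hx: "hradius x \<le> min \<eta> 1" and t: "t \<in> {0..1::real}"
    have h: "0 \<le> hradius x" using x by (simp add: hradius_nonneg)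
    have "norm (w t x - w 0 x) \<le> hradius x * (E * (D * hradius x ^ (k - 1)))"
    proof (rule vector_derivative_bound_01[OF odes(3)[OF x(1)] _ t])
      fix s :: real assume s: "s \<in> {0..1}"
      note XI = X_inside[OF x s]
      have Xa: "X s x \<in> ann \<delta>" by (rule X_ann[OF x(1) s])
      \<comment> \<open>The identity \<open>F = 0\<close> replaces the term linear in
        \<open>P\<close> by \<open>a\<close>, to which \<open>a_bound\<close> applies.\<close>
      have "P s x \<bullet> Z (X s x, P s x) = (- a (X s x) + hradius (X s x) * (K (X s x) (P s x) \<bullet> P s x)) / 2"
        using energy[OF x(1) s]
        by (simp add: F_def Z_def linear_add[OF K_linear] linear_scale[OF K_linear] inner_add_right
            inner_commute[of "P s x"])
      then have "\<bar>P s x \<bullet> Z (X s x, P s x)\<bar> \<le> \<bar>a (X s x)\<bar> + hradius (X s x) * \<bar>K (X s x) (P s x) \<bullet> P s x\<bar>"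
        using XI(3) by (simp add: abs_mult abs_le_iff) (smt (verit) abs_ge_self abs_ge_minus_self mult_left_mono mult_minus_right)
      also have "\<dots> \<le> 4 * C0 * (2 * E * hradius x) ^ (k - 1) + (E * 1) * (8 * (CP * hradius x ^ (k - 1) * \<bar>R\<bar>))"
      proof (rule add_mono)
        have "\<bar>a (X s x)\<bar> \<le> 4 * C0 * (1 - norm (X s x)) ^ (k - 1)" by (rule a_bound[OF Xa XI(1)])
        also have "\<dots> \<le> 4 * C0 * (2 * E * hradius x) ^ (k - 1)"
          using XI C0 by (intro mult_left_mono power_mono) auto
        finally show "\<bar>a (X s x)\<bar> \<le> 4 * C0 * (2 * E * hradius x) ^ (k - 1)" .
        have "\<bar>K (X s x) (P s x) \<bullet> P s x\<bar> \<le> norm (K (X s x) (P s x)) * norm (P s x)"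
          by (rule Cauchy_Schwarz_ineq2)
        also have "\<dots> \<le> (8 * norm (P s x)) * norm (P s x)"
          by (intro mult_right_mono K_bound Xa XI) auto
        also have "\<dots> \<le> (8 * (CP * hradius x ^ (k - 1))) * \<bar>R\<bar>"
          using P(3)[OF x _ s] hx R[OF x(1) s] P(1) h by (intro mult_mono) auto
        finally have "\<bar>K (X s x) (P s x) \<bullet> P s x\<bar> \<le> 8 * (CP * hradius x ^ (k - 1) * \<bar>R\<bar>)" by simp
        moreover have "hradius (X s x) \<le> E * 1"
        proof -
          have "E * hradius x \<le> E * 1" by (rule mult_left_mono) (use hx E0 in auto)
          with XI(2) show ?thesis by linarith
        qed
        ultimately show "hradius (X s x) * \<bar>K (X s x) (P s x) \<bullet> P s x\<bar> \<le> (E * 1) * (8 * (CP * hradius x ^ (k - 1) * \<bar>R\<bar>))"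
          using E0 by (intro mult_mono) auto
      qed
      also have "\<dots> = D * hradius x ^ (k - 1)" by (simp add: D_def power_mult_distrib algebra_simps)
      finally have b: "\<bar>P s x \<bullet> Z (X s x, P s x)\<bar> \<le> D * hradius x ^ (k - 1)" .
      have "norm (P s x \<bullet> X' s x) = hradius x * (exp (- w s x) * \<bar>P s x \<bullet> Z (X s x, P s x)\<bar>)"
        using h by (simp add: X'_def abs_mult)
      also have "\<dots> \<le> hradius x * (E * (D * hradius x ^ (k - 1)))"
        using exp_w_bound(1)[OF x(1) s] h E0 b by (intro mult_left_mono mult_mono) auto
      finally show "norm (P s x \<bullet> X' s x) \<le> hradius x * (E * (D * hradius x ^ (k - 1)))" .
    qed
    also have "\<dots> = E * D * hradius x ^ k" using k by (cases k) (auto simp: mult_ac)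
    finally show "\<bar>w t x\<bar> \<le> E * D * hradius x ^ k" by (simp add: initial[OF x(1)])
  qed (use P D E0 in auto)
qed

text \<open>The displacement is split into an angular part, from \<open>X 1 x\<close> to the point
  of equal norm on the ray of \<open>x\<close>, and a radial part. The angular part obeys a linear
  inequality with a source of order \<open>k + 1\<close>; the radial part follows from the exact
  formula for \<open>hradius (X 1 x)\<close>.\<close>

lemma X_close:
  obtains C \<eta> where "C \<ge> 0" "\<eta> > 0"
    "\<And>x. x \<in> N \<Longrightarrow> norm x \<le> 1 \<Longrightarrow> hradius x \<le> \<eta> \<Longrightarrow> norm (X 1 x - x) \<le> C * hradius x ^ (k + 1)"
proof -
  obtain CP \<eta>P where P: "CP \<ge> 0" "\<eta>P > 0"
    "\<And>x t. x \<in> N \<Longrightarrow> norm x \<le> 1 \<Longrightarrow> hradius x \<le> \<eta>P \<Longrightarrow> t \<in> {0..1} \<Longrightarrow> norm (P t x) \<le> CP * hradius x ^ (k - 1)"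
    by (rule P_small) blast
  obtain Cw \<eta>w where w: "Cw \<ge> 0" "\<eta>w > 0"
    "\<And>x t. x \<in> N \<Longrightarrow> norm x \<le> 1 \<Longrightarrow> hradius x \<le> \<eta>w \<Longrightarrow> t \<in> {0..1} \<Longrightarrow> \<bar>w t x\<bar> \<le> Cw * hradius x ^ k"
    by (rule w_small) blast
  have E0: "E > 0" by (simp add: E_def)
  define CE where "CE = 2 * (2 * C0 * (2 * E) ^ k) + E * (8 * CP)"
  have CE: "CE \<ge> 0" using C0 E0 P(1) by (simp add: CE_def)
  \<comment> \<open>The bound \<open>1 / (8 * E)\<close> makes \<open>\<bar>m * c / r\<bar>\<close>
    at most \<open>1/2\<close> below, since \<open>m \<le> h * E\<close>,
    \<open>\<bar>c\<bar> \<le> 2\<close> and \<open>r \<ge> 1/2\<close>.\<close>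
  define \<eta> where "\<eta> = min (min \<eta>P \<eta>w) (1 / (8 * E))"
  show thesis
  proof (rule that[of "4 * E * CE + 2 * (E * Cw)" \<eta>])
    fix x assume x: "x \<in> N" "norm x \<le> 1" and hx: "hradius x \<le> \<eta>"
    define h where "h = hradius x"
    define \<omega> where "\<omega> = x /\<^sub>R norm x"
    have n\<omega>: "norm \<omega> = 1" using norm_unit_N[OF x(1)] by (simp add: \<omega>_def)
    have x0: "x \<noteq> 0" using ann_nonzero[OF \<delta>1] x N(2) by auto
    have h: "0 \<le> h" "h \<le> \<eta>P" "h \<le> \<eta>w" "h \<le> 1 / (8 * E)"
      using x hx by (auto simp: hradius_nonneg h_def \<eta>_def)
    have one: "(1::real) \<in> {0..1}" by simp
    have "norm (X 1 x - norm (X 1 x) *\<^sub>R \<omega>) \<le> (2 * (h * (E * (CE * h ^ k)))) / (1 - 1/2)"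
    proof (rule half_bound[where q = "1/2" and u = "\<lambda>t. norm (X t x - norm (X t x) *\<^sub>R \<omega>)", OF _ _ _ one])
      have "continuous_on {0..1} (\<lambda>t. X t x)"
        by (rule continuous_on_vector_derivative[OF odes(1)[OF x(1)]])
      then show "continuous_on {0..1} (\<lambda>t. norm (X t x - norm (X t x) *\<^sub>R \<omega>))" by (intro continuous_intros)
      fix t M assume t: "t \<in> {0..1::real}" and M: "\<And>s. s \<in> {0..1} \<Longrightarrow> norm (X s x - norm (X s x) *\<^sub>R \<omega>) \<le> M"
      have M0: "0 \<le> M" using order_trans[OF norm_ge_zero M[OF t]] .
      have "norm ((X t x - norm (X t x) *\<^sub>R \<omega>) - (X 0 x - norm (X 0 x) *\<^sub>R \<omega>)) \<le> 1/2 * M + 2 * (h * (E * (CE * h ^ k)))"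
      proof (rule vector_derivative_bound_01[OF _ _ t, of "\<lambda>t. X t x - norm (X t x) *\<^sub>R \<omega>"
            "\<lambda>s. X' s x - ((X s x \<bullet> X' s x) / norm (X s x)) *\<^sub>R \<omega>"])
        fix s :: real assume s: "s \<in> {0..1}"
        note XI = X_inside[OF x s]
        have Xa: "X s x \<in> ann \<delta>" by (rule X_ann[OF x(1) s])
        have X0: "X s x \<noteq> 0" using ann_nonzero[OF \<delta>1 Xa] .
        have "((\<lambda>t. norm (X t x)) has_derivative (\<lambda>h. (X s x \<bullet> (h *\<^sub>R X' s x)) / norm (X s x))) (at s within {0..1})"
          using odes(1)[OF x(1) s] unfolding has_vector_derivative_def
          by (rule has_derivative_compose) (rule norm_has_derivative[OF X0])
        then have "((\<lambda>t. norm (X t x)) has_vector_derivative (X s x \<bullet> X' s x) / norm (X s x)) (at s within {0..1})"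
          by (simp add: has_vector_derivative_def)
        from bounded_linear.has_vector_derivative[OF bounded_linear_scaleR_left this]
        show "((\<lambda>t. X t x - norm (X t x) *\<^sub>R \<omega>) has_vector_derivative
            X' s x - ((X s x \<bullet> X' s x) / norm (X s x)) *\<^sub>R \<omega>) (at s within {0..1})"
          by (intro has_vector_derivative_diff odes(1)[OF x(1) s])
        define r u where "r = norm (X s x)" and "u = X s x /\<^sub>R r"
        have r: "r > 0" "1/2 \<le> r" "r \<le> 1" using X0 XI(1) Xa \<delta> by (auto simp: r_def ann_def)
        have u: "norm u = 1" "X s x = r *\<^sub>R u" using r X0 by (simp_all add: u_def) (simp add: r_def)
        \<comment> \<open>For the hyperbolic metric with \<open>P = 0\<close> the vector
          \<open>Z\<close> would be exactly \<open>c *\<^sub>R u\<close>; \<open>e\<close> collects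
          the two deviations from this, both of order \<open>k\<close>.\<close>
        define c where "c = - (1 + r)\<^sup>2 / 2"
        define e where "e = c *\<^sub>R (B (X s x) u - u) + hradius (X s x) *\<^sub>R K (X s x) (P s x)"
        have Zs: "Z (X s x, P s x) = c *\<^sub>R u + e"
        proof -
          have "(1 + r) ^ 4 / 4 * (- 2 / (1 + r)\<^sup>2) = c"
          proof -
            have "z ^ 4 / 4 * (- 2 / z\<^sup>2) = - z\<^sup>2 / 2" if "z > 0" for z :: real
              using that by (simp add: field_simps eval_nat_numeral)
            then show ?thesis unfolding c_def using r by simp
          qed
          then have "K (X s x) (hradius_grad (X s x)) = c *\<^sub>R B (X s x) u"
            unfolding K_def hradius_grad_def r_def[symmetric] u_def[symmetric] linear_scale[OF B_linear]
            by (simp only: scaleR_scaleR)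
          then show ?thesis
            by (simp add: Z_def e_def linear_add[OF K_linear] linear_scale[OF K_linear] algebra_simps)
        qed
        have c: "\<bar>c\<bar> \<le> 2"
        proof -
          have "(1 + r)\<^sup>2 \<le> 2\<^sup>2" using r by (intro power_mono) auto
          then show ?thesis by (simp add: c_def abs_if)
        qed
        have "norm e \<le> 2 * (2 * C0 * (2 * E * h) ^ k) + (E * h) * (8 * (CP * h ^ (k - 1)))"
          unfolding e_def
        proof (rule norm_triangle_mono)
          have "norm (B (X s x) u - u) \<le> 2 * C0 * (1 - norm (X s x)) ^ k * norm u"
            by (rule B_bound(2)[OF Xa XI(1)])
          also have "\<dots> \<le> 2 * C0 * (2 * E * h) ^ k"
            using XI C0 u by (auto simp: h_def intro!: mult_left_mono power_mono)
          finally show "norm (c *\<^sub>R (B (X s x) u - u)) \<le> 2 * (2 * C0 * (2 * E * h) ^ k)"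
            unfolding norm_scaleR using c by (intro mult_mono) auto
          have "norm (K (X s x) (P s x)) \<le> 8 * norm (P s x)" by (rule K_bound[OF Xa XI(1)])
          also have "\<dots> \<le> 8 * (CP * h ^ (k - 1))" using P(3)[OF x _ s] h by (simp add: h_def)
          finally show "norm (hradius (X s x) *\<^sub>R K (X s x) (P s x)) \<le> (E * h) * (8 * (CP * h ^ (k - 1)))"
            using XI h E0 by (auto simp: h_def intro!: mult_mono)
        qed
        also have "\<dots> = CE * h ^ k"
          using k by (cases k) (auto simp: CE_def power_mult_distrib algebra_simps)
        finally have e: "norm e \<le> CE * h ^ k" .
        define m where "m = h * exp (- w s x)"
        have m: "0 \<le> m" "m \<le> h * E" using h exp_w_bound(1)[OF x(1) s] by (auto simp: m_def intro: mult_left_mono)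
        have X's: "X' s x = m *\<^sub>R (c *\<^sub>R u + e)" by (simp add: X'_def Zs m_def h_def)
        have uu: "u \<bullet> u = 1" using u(1) by (simp add: power2_norm_eq_inner[symmetric])
        have radial: "(X s x \<bullet> X' s x) / norm (X s x) = m * (c + u \<bullet> e)"
          using r unfolding X's r_def[symmetric] u(2) by (simp add: inner_add_right uu u(1) field_simps)
        have "X' s x - ((X s x \<bullet> X' s x) / norm (X s x)) *\<^sub>R \<omega> =
            (m * c / r) *\<^sub>R (r *\<^sub>R u - r *\<^sub>R \<omega>) + m *\<^sub>R (e - (u \<bullet> e) *\<^sub>R \<omega>)"
          unfolding radial unfolding X's by (rule radial_split) (use r(1) in simp)
        also have "norm \<dots> \<le> 1/2 * M + 2 * (h * (E * (CE * h ^ k)))"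
        proof (rule norm_triangle_mono)
          have "norm (r *\<^sub>R u - r *\<^sub>R \<omega>) \<le> M" using M[OF s] unfolding u(2)[symmetric] unfolding r_def .
          moreover have "\<bar>m * c / r\<bar> \<le> 1/2"
          proof -
            have "\<bar>m * c / r\<bar> = m * \<bar>c\<bar> / r" using m(1) r(1) by (simp add: abs_mult)
            also have "\<dots> \<le> m * 2 / (1/2)" using m(1) c r by (intro frac_le mult_left_mono) auto
            also have "\<dots> \<le> 1/2" using m(2) h(4) E0 by (simp add: field_simps)
            finally show ?thesis .
          qed
          ultimately show "norm ((m * c / r) *\<^sub>R (r *\<^sub>R u - r *\<^sub>R \<omega>)) \<le> 1/2 * M"
            unfolding norm_scaleR by (intro mult_mono) auto
          have "norm (e - (u \<bullet> e) *\<^sub>R \<omega>) \<le> norm e + \<bar>u \<bullet> e\<bar>"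
            using norm_triangle_ineq4[of e "(u \<bullet> e) *\<^sub>R \<omega>"] n\<omega> by simp
          also have "\<dots> \<le> 2 * (CE * h ^ k)" using Cauchy_Schwarz_ineq2[of u e] u(1) e by simp
          finally have "m * norm (e - (u \<bullet> e) *\<^sub>R \<omega>) \<le> (h * E) * (2 * (CE * h ^ k))"
            using m h E0 by (intro mult_mono) auto
          then show "norm (m *\<^sub>R (e - (u \<bullet> e) *\<^sub>R \<omega>)) \<le> 2 * (h * (E * (CE * h ^ k)))"
            using m(1) by (simp add: mult_ac)
        qed
        finally show "norm (X' s x - ((X s x \<bullet> X' s x) / norm (X s x)) *\<^sub>R \<omega>) \<le> 1/2 * M + 2 * (h * (E * (CE * h ^ k)))" .
      qed
      moreover have "X 0 x - norm (X 0 x) *\<^sub>R \<omega> = 0"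
        using initial(1)[OF x(1)] n\<omega> by (simp add: \<omega>_def[symmetric])
      ultimately show "norm (X t x - norm (X t x) *\<^sub>R \<omega>) \<le> 2 * (h * (E * (CE * h ^ k))) + 1/2 * M" by simp
    qed simp
    then have d1: "norm (X 1 x - norm (X 1 x) *\<^sub>R \<omega>) \<le> 4 * E * CE * h ^ (k + 1)" by (simp add: mult_ac)
    \<comment> \<open>Both norms are recovered from \<open>hradius\<close>, whose values at
      \<open>X 1 x\<close> and at \<open>x\<close> differ by the factor
      \<open>exp (- w 1 x)\<close>.\<close>
    have d2: "\<bar>norm (X 1 x) - norm x\<bar> \<le> 2 * (E * Cw) * h ^ (k + 1)"
    proof -
      define h1 where "h1 = hradius (X 1 x)"
      have h1: "0 \<le> h1" using X_inside[OF x one] by (simp add: h1_def)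
      have "norm (X 1 x) - norm x = 2 * (h - h1) / ((1 + h1) * (1 + h))"
        unfolding norm_hradius[of "X 1 x"] norm_hradius[of x] h_def[symmetric] h1_def[symmetric]
        using h(1) h1 by (simp add: divide_simps) (simp add: algebra_simps)
      then have "\<bar>norm (X 1 x) - norm x\<bar> = 2 * \<bar>h - h1\<bar> / ((1 + h1) * (1 + h))"
        using h(1) h1 by (simp only: abs_mult abs_divide)
      also have "\<dots> \<le> 2 * \<bar>h - h1\<bar> / 1"
        using h h1 mult_mono[of 1 "1 + h1" 1 "1 + h"] by (intro divide_left_mono) auto
      also have "h - h1 = - h * (exp (- w 1 x) - 1)"
        using hradius_X_eq[OF x(1) one] by (simp add: h1_def h_def algebra_simps)
      also have "2 * \<bar>- h * (exp (- w 1 x) - 1)\<bar> / 1 = 2 * h * \<bar>exp (- w 1 x) - 1\<bar>"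
        using h by (simp add: abs_mult)
      also have "\<dots> \<le> 2 * h * (E * (Cw * h ^ k))"
      proof (intro mult_left_mono)
        have "\<bar>exp (- w 1 x) - 1\<bar> \<le> E * \<bar>- w 1 x\<bar>"
          unfolding E_def by (rule exp_minus_one_bound) (use R[OF x(1) one] in simp)
        also have "\<dots> \<le> E * (Cw * h ^ k)"
          using w(3)[OF x _ one] h E0 by (simp add: h_def)
        finally show "\<bar>exp (- w 1 x) - 1\<bar> \<le> E * (Cw * h ^ k)" .
      qed (use h in auto)
      finally show ?thesis by (simp add: mult_ac)
    qed
    have "X 1 x - x = (X 1 x - norm (X 1 x) *\<^sub>R \<omega>) + (norm (X 1 x) - norm x) *\<^sub>R \<omega>"
      using x0 by (simp add: \<omega>_def algebra_simps)
    also have "norm \<dots> \<le> 4 * E * CE * h ^ (k + 1) + 2 * (E * Cw) * h ^ (k + 1)"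
      by (rule norm_triangle_mono[OF d1]) (use d2 n\<omega> in simp)
    finally show "norm (X 1 x - x) \<le> (4 * E * CE + 2 * (E * Cw)) * hradius x ^ (k + 1)"
      by (simp add: h_def distrib_right)
  qed (use CE E0 P w in \<open>auto simp: \<eta>_def\<close>)
qed

end

section \<open>Diffeomorphisms near the sphere\<close>

text \<open>Invariance of domain makes the image open. The derivative of the inverse
  \<open>g\<close> at \<open>y\<close> is the inverse matrix at \<open>g y\<close>, which is smooth
  in \<open>g y\<close> by Cramer's rule, so each order of smoothness of \<open>g\<close> yields the
  next.\<close>

lemma smooth_inv_into:
  fixes f :: "real^'n \<Rightarrow> real^'n"
  assumes f: "smooth N f" and inj: "inj_on f N"
    and D: "\<And>x v. x \<in> N \<Longrightarrow> frechet_derivative f (at x) v = 0 \<Longrightarrow> v = 0"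
  shows "open (f ` N)" "smooth (f ` N) (inv_into N f)"
proof -
  have N: "open N" using f by (rule smooth_fam_open)
  define g where "g = inv_into N f"
  have gf: "g (f x) = x" if "x \<in> N" for x using inj that by (simp add: g_def)
  have gN: "g y \<in> N" and fg: "f (g y) = y" if "y \<in> f ` N" for y
    using that by (auto simp: g_def inv_into_into f_inv_into_f)
  have df: "(f has_derivative frechet_derivative f (at x)) (at x)" if "x \<in> N" for x
    by (rule smooth_has_derivative[OF f that])
  have lin: "linear (frechet_derivative f (at x))" if "x \<in> N" for x
    using has_derivative_linear[OF df[OF that]] .
  have bijD: "bij (frechet_derivative f (at x))" if "x \<in> N" for x
  proof -
    have "inj (frechet_derivative f (at x))"
      using D[OF that] linear_injective_0[OF lin[OF that]] by blast
    then show ?thesis using linear_injective_imp_surjective[OF lin[OF that]] by (simp add: bij_def)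
  qed
  show op: "open (f ` N)"
    by (rule invariance_of_domain[OF smooth_continuous_on[OF f] N inj])
  have dg: "(g has_derivative inv (frechet_derivative f (at x))) (at (f x))" if x: "x \<in> N" for x
  proof (rule has_derivative_inverse_strong_x[of N g "f x" f])
    show "continuous_on N f" by (rule smooth_continuous_on[OF f])
    show "(f has_derivative frechet_derivative f (at x)) (at (g (f x)))" using df[OF x] gf[OF x] by simp
    show "frechet_derivative f (at x) \<circ> inv (frechet_derivative f (at x)) = id"
      by (rule surj_iff[THEN iffD1, OF bij_is_surj[OF bijD[OF x]]])
  qed (use N gf x in auto)
  define M where "M x = matrix (frechet_derivative f (at x))" for x
  have Mv: "M x *v v = frechet_derivative f (at x) v" if "x \<in> N" for x v
    using lin[OF that] by (simp add: M_def matrix_works)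
  have detM: "det (M x) \<noteq> 0" if "x \<in> N" for x
    using det_nz_iff_inj[OF lin[OF that]] bij_is_inj[OF bijD[OF that]] by (simp add: M_def)
  define I where "I v x = inv (frechet_derivative f (at x)) v" for v x
  have sI: "smooth N (I v)" for v
  proof -
    have "I v x $ l = det (\<chi> i j. if j = l then v $ i else M x $ i $ j) / det (M x)" if "x \<in> N" for x l
    proof -
      have "M x *v I v x = v" using bijD[OF that] by (simp add: Mv[OF that] I_def bij_is_surj surj_f_inv_f)
      then show ?thesis using cramer[OF detM[OF that], of "I v x" v] by simp
    qed
    moreover have sM: "smooth N (\<lambda>x. M x $ i $ j)" for i j
      unfolding M_def matrix_def
      by (simp) (intro smooth_vec_nth smooth_frechet_derivative[OF f] smooth_intros N)
    have "smooth N (\<lambda>x. det (\<chi> i j. if j = l then v $ i else M x $ i $ j) / det (M x))" for l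
    proof (intro smooth_divide smooth_det N)
      show "smooth N (\<lambda>x. (\<chi> i j. if j = l then v $ i else M x $ i $ j) $ i $ j)" for i j
        by (cases "j = l") (auto intro: smooth_const N sM)
    qed (auto simp: detM sM)
    ultimately have "smooth N (\<lambda>x. I v x $ l)" for l
      by (subst smooth_fam_cong) auto
    then show ?thesis
      by (intro iffD2[OF smooth_euclidean]) (auto simp: N Basis_vec_def inner_axis)
  qed
  have "Ck_fam m (f ` N) (\<lambda>_. g)" for m
  proof (induction m)
    case 0
    have "continuous_on (f ` N) g"
    proof (rule continuous_at_imp_continuous_on, rule ballI)
      fix y assume "y \<in> f ` N"
      then show "isCont g y" using has_derivative_continuous[OF dg[OF gN]] fg by metis
    qed
    then have "continuous_on ({0..1::real} \<times> f ` N) (g \<circ> snd)"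
      by (intro continuous_on_compose continuous_intros) (auto elim: continuous_on_subset)
    then show ?case by (simp add: o_def)
  next
    case (Suc m)
    show ?case
    proof (rule Ck_fam_SucI[OF op Ck_fam_continuous[OF Suc]])
      show "(g has_derivative (\<lambda>v. I v (g y))) (at y)" if "y \<in> f ` N" for y
        using dg[OF gN[OF that]] fg[OF that] by (simp add: I_def)
      show "Ck_fam m (f ` N) (\<lambda>_ y. I v (g y))" for v
        by (rule Ck_fam_compose[of "f ` N" N "\<lambda>_. g" m "\<lambda>_. I v", OF op N _ smooth_fam_Ck[OF sI] Suc])
          (rule gN)
    qed
  qed
  then show "smooth (f ` N) (inv_into N f)" using op by (simp add: smooth_fam_def g_def)
qed

text \<open>Near the sphere the difference of \<open>\<Psi>\<close> and the identity has derivative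
  at most \<open>1/2\<close>. An annulus is not convex, so the mean value inequality gives the
  Lipschitz bound for nearby points only; for distant ones it follows from the smallness of the
  difference itself. A map that differs from the identity by a \<open>1/2\<close>-Lipschitz map is
  injective.\<close>

lemma near_identity:
  fixes \<Psi> :: "real^'n \<Rightarrow> real^'n"
  assumes \<Psi>: "smooth (ann \<epsilon>) \<Psi>" and \<epsilon>: "0 < \<epsilon>" "\<epsilon> \<le> 1"
    and fix_sphere: "\<And>x. norm x = 1 \<Longrightarrow> \<Psi> x = x" "\<And>x v. norm x = 1 \<Longrightarrow> frechet_derivative \<Psi> (at x) v = v"
  obtains \<epsilon>' where "0 < \<epsilon>'" "\<epsilon>' \<le> \<epsilon>" "inj_on \<Psi> (ann \<epsilon>')"
    "\<And>x v. x \<in> ann \<epsilon>' \<Longrightarrow> norm (frechet_derivative \<Psi> (at x) v - v) \<le> norm v / 2"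
proof -
  define e where "e x = \<Psi> x - x" for x
  define D where "D x v = frechet_derivative \<Psi> (at x) v - v" for x v
  have de: "(e has_derivative D x) (at x)" if "x \<in> ann \<epsilon>" for x
    unfolding e_def[abs_def] D_def[abs_def]
    by (intro has_derivative_diff smooth_has_derivative[OF \<Psi> that] has_derivative_ident)
  have sD: "smooth (ann \<epsilon>) (\<lambda>x. D x v)" for v
    unfolding D_def by (intro smooth_diff smooth_frechet_derivative[OF \<Psi>] smooth_intros open_ann)
  define \<kappa> where "\<kappa> = 1 / (2 * real DIM(real^'n))"
  have \<kappa>: "\<kappa> > 0" by (simp add: \<kappa>_def)
  define W where "W = ann \<epsilon> \<inter> (\<Inter>b\<in>Basis. {x \<in> ann \<epsilon>. norm (D x b) < \<kappa>})"
  have "open {x \<in> ann \<epsilon>. norm (D x b) < \<kappa>}" for b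
  proof -
    have "open (ann \<epsilon> \<inter> (\<lambda>x. norm (D x b)) -` {..<\<kappa>})"
      by (intro continuous_open_preimage continuous_intros smooth_continuous_on[OF sD] open_ann open_lessThan)
    moreover have "ann \<epsilon> \<inter> (\<lambda>x. norm (D x b)) -` {..<\<kappa>} = {x \<in> ann \<epsilon>. norm (D x b) < \<kappa>}" by auto
    ultimately show ?thesis by simp
  qed
  then have "open W" unfolding W_def by (intro open_Int open_INT open_ann) auto
  moreover have "sphere 0 1 \<subseteq> W"
    using \<epsilon> \<kappa> fix_sphere(2) by (auto simp: W_def ann_def D_def)
  ultimately obtain \<epsilon>1 where \<epsilon>1: "0 < \<epsilon>1" "\<epsilon>1 \<le> 1/2" "ann \<epsilon>1 \<subseteq> W" by (rule open_contains_ann)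
  have Dh: "norm (D x v) \<le> norm v / 2" if x: "x \<in> ann \<epsilon>1" for x v
  proof -
    have xe: "x \<in> ann \<epsilon>" and b: "\<And>b. b \<in> Basis \<Longrightarrow> norm (D x b) < \<kappa>" using x \<epsilon>1(3) by (auto simp: W_def)
    have "norm (\<Sum>b\<in>Basis. (v \<bullet> b) *\<^sub>R D x b) \<le> (\<Sum>b\<in>(Basis::(real^'n) set). norm v * \<kappa>)"
    proof (rule sum_norm_le)
      fix b :: "real^'n" assume "b \<in> Basis"
      then show "norm ((v \<bullet> b) *\<^sub>R D x b) \<le> norm v * \<kappa>"
        using b[of b] Basis_le_norm[of b v] unfolding norm_scaleR by (intro mult_mono) auto
    qed
    also have "\<dots> = norm v / 2" by (simp add: \<kappa>_def)
    finally show ?thesis by (subst has_derivative_Basis_sum[OF de[OF xe]])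
  qed
  \<comment> \<open>The ball of radius \<open>\<epsilon>1 / 2\<close> around such a point lies in
    \<open>ann \<epsilon>1\<close>, which covers nearby pairs. At distance
    \<open>\<epsilon>1 / 2\<close> or more, the two values of \<open>e\<close> add up to at most
    \<open>\<epsilon>1 / 4\<close>, half the distance.\<close>
  define W2 where "W2 = {x \<in> ann (min \<epsilon> (\<epsilon>1 / 2)). norm (e x) < \<epsilon>1 / 8}"
  have "open W2"
  proof -
    have se: "smooth (ann (min \<epsilon> (\<epsilon>1/2))) e"
      unfolding e_def by (intro smooth_diff smooth_fam_subset[OF \<Psi>] smooth_intros open_ann ann_mono) simp
    have "open (ann (min \<epsilon> (\<epsilon>1 / 2)) \<inter> (\<lambda>x. norm (e x)) -` {..<\<epsilon>1 / 8})"
      by (intro continuous_open_preimage continuous_intros smooth_continuous_on[OF se] open_ann open_lessThan)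
    moreover have "ann (min \<epsilon> (\<epsilon>1 / 2)) \<inter> (\<lambda>x. norm (e x)) -` {..<\<epsilon>1 / 8} = W2" by (auto simp: W2_def)
    ultimately show ?thesis by simp
  qed
  moreover have "sphere 0 1 \<subseteq> W2"
    using \<epsilon> \<epsilon>1 fix_sphere(1) by (auto simp: W2_def ann_def e_def)
  ultimately obtain \<epsilon>2 where \<epsilon>2: "0 < \<epsilon>2" "\<epsilon>2 \<le> 1/2" "ann \<epsilon>2 \<subseteq> W2" by (rule open_contains_ann)
  have lip: "norm (e x - e y) \<le> norm (x - y) / 2" if x: "x \<in> ann \<epsilon>2" and y: "y \<in> ann \<epsilon>2" for x y
  proof (cases "norm (x - y) < \<epsilon>1 / 2")
    case True
    have sub: "ball x (\<epsilon>1 / 2) \<subseteq> ann \<epsilon>1"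
    proof
      fix z assume "z \<in> ball x (\<epsilon>1 / 2)"
      then have "\<bar>norm z - norm x\<bar> < \<epsilon>1 / 2"
        using norm_triangle_ineq3[of z x] by (simp add: dist_norm norm_minus_commute)
      moreover have "\<bar>norm x - 1\<bar> < \<epsilon>1 / 2" using x \<epsilon>2(3) by (auto simp: W2_def ann_def)
      ultimately have "\<bar>norm z - 1\<bar> < \<epsilon>1" by linarith
      then show "z \<in> ann \<epsilon>1" by (simp add: ann_def)
    qed
    have "norm (e x - e y) \<le> 1/2 * norm (x - y)"
    proof (rule differentiable_bound[of "ball x (\<epsilon>1 / 2)" e D])
      fix z assume z: "z \<in> ball x (\<epsilon>1 / 2)"
      then have zW: "z \<in> ann \<epsilon>1" using sub by auto
      then show "(e has_derivative D z) (at z within ball x (\<epsilon>1 / 2))"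
        using de[of z] \<epsilon>1(3) by (auto simp: W_def intro: has_derivative_at_withinI)
      show "onorm (D z) \<le> 1/2" by (rule onorm_le) (use Dh[OF zW] in simp)
    qed (use True \<epsilon>1 in \<open>auto simp: dist_norm\<close>)
    then show ?thesis by simp
  next
    case False
    have "norm (e x - e y) \<le> norm (e x) + norm (e y)" by (rule norm_triangle_ineq4)
    also have "\<dots> \<le> \<epsilon>1 / 4"
    proof -
      have "norm (e x) < \<epsilon>1 / 8" "norm (e y) < \<epsilon>1 / 8" using x y \<epsilon>2(3) by (auto simp: W2_def)
      then show ?thesis by simp
    qed
    finally show ?thesis using False by simp
  qed
  show thesis
  proof (rule that[of "min \<epsilon> (min \<epsilon>1 \<epsilon>2)"])
    show "inj_on \<Psi> (ann (min \<epsilon> (min \<epsilon>1 \<epsilon>2)))"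
    proof (rule inj_onI)
      fix x y assume xy: "x \<in> ann (min \<epsilon> (min \<epsilon>1 \<epsilon>2))" "y \<in> ann (min \<epsilon> (min \<epsilon>1 \<epsilon>2))" "\<Psi> x = \<Psi> y"
      then have "norm (e x - e y) \<le> norm (x - y) / 2" by (intro lip) (auto simp: ann_def)
      moreover have "norm (e x - e y) = norm (x - y)" using xy(3) by (simp add: e_def norm_minus_commute)
      ultimately show "x = y" by simp
    qed
    show "norm (frechet_derivative \<Psi> (at x) v - v) \<le> norm v / 2" if "x \<in> ann (min \<epsilon> (min \<epsilon>1 \<epsilon>2))" for x v
      using Dh[of x v] that by (auto simp: D_def ann_def)
  qed (use \<epsilon> \<epsilon>1 \<epsilon>2 in auto)
qed

text \<open>All that is needed of the time one map and of the conformal factor. The estimate of the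
  derivative comes from that of the displacement by \<open>flat_derivative\<close>, at the price of
  one order; as \<open>k > 0\<close>, the map is tangent to the identity on the sphere and
  \<open>near_identity\<close> applies.\<close>

theorem (in normal_form) normal_coordinates:
  obtains \<epsilon> \<Psi> \<sigma> C where "0 < \<epsilon>" "\<epsilon> \<le> \<delta>" "smooth (ann \<epsilon>) \<Psi>" "smooth (ann \<epsilon>) \<sigma>" "C \<ge> 0"
    "\<And>x. x \<in> ann \<epsilon> \<Longrightarrow> \<Psi> x \<in> ann \<delta>"
    "\<And>x. norm x = 1 \<Longrightarrow> \<Psi> x = x"
    "\<And>x. x \<in> ann \<epsilon> \<Longrightarrow> norm (\<Psi> x) < 1 \<longleftrightarrow> norm x < 1"
    "\<And>x. x \<in> ann \<epsilon> \<Longrightarrow> \<sigma> x > 0"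
    "\<And>x. x \<in> ann \<epsilon> \<Longrightarrow> \<rho> x = \<sigma> x * \<rho> (\<Psi> x)"
    "\<And>x. x \<in> ann \<epsilon> \<Longrightarrow> norm x \<le> 1 \<Longrightarrow> \<sigma> x \<le> C"
    "\<And>x. x \<in> ann \<epsilon> \<Longrightarrow> norm x \<le> 1 \<Longrightarrow> norm (\<Psi> x - x) \<le> C * (1 - norm x) ^ (k + 1)"
    "\<And>x v. x \<in> ann \<epsilon> \<Longrightarrow> norm x \<le> 1 \<Longrightarrow> norm (frechet_derivative \<Psi> (at x) v - v) \<le> C * (1 - norm x) ^ k * norm v"
    "\<And>x v. x \<in> ann \<epsilon> \<Longrightarrow> norm x < 1 \<Longrightarrow>
      (\<sigma> x)\<^sup>2 * ((A (\<Psi> x) *v frechet_derivative \<Psi> (at x) x) \<bullet> frechet_derivative \<Psi> (at x) v) = x \<bullet> v"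
    "inj_on \<Psi> (ann \<epsilon>)"
    "\<And>x v. x \<in> ann \<epsilon> \<Longrightarrow> norm (frechet_derivative \<Psi> (at x) v - v) \<le> norm v / 2"
proof -
  \<comment> \<open>The flow is confined to a narrower annulus because \<open>gradF_bound\<close>
    holds on \<open>ann (\<delta> / 2)\<close>.\<close>
  have sV: "smooth (ann (\<delta> / 2) \<times> UNIV) V"
    by (rule smooth_fam_subset[OF smooth_V])
      (use ann_mono[of "\<delta> / 2" \<delta>] \<delta> in \<open>auto intro!: open_Times open_ann\<close>)
  have i: "init ` sphere 0 1 \<subseteq> ann (\<delta> / 2) \<times> UNIV"
    using \<delta> by (auto simp: init_def Let_def ann_def)
  have h0: "hradius x = 0" if "x \<in> sphere 0 1" for x :: "real^'n"
    using that by (simp add: hradius_sphere)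
  obtain N y Y where y: "open N" "sphere 0 1 \<subseteq> N" "N \<subseteq> ann \<delta>" "smooth_fam N y" "compact Y" "Y \<subseteq> ann (\<delta> / 2) \<times> UNIV"
    "\<And>x t. x \<in> N \<Longrightarrow> t \<in> {0..1} \<Longrightarrow> y t x \<in> Y"
    "\<And>x. x \<in> N \<Longrightarrow> y 0 x = init x"
    "\<And>x t. x \<in> N \<Longrightarrow> t \<in> {0..1} \<Longrightarrow>
      ((\<lambda>t. y t x) has_vector_derivative hradius x *\<^sub>R V (y t x)) (at t within {0..1})"
    "\<And>x t v. x \<in> N \<Longrightarrow> t \<in> {0..1} \<Longrightarrow>
      ((\<lambda>t. frechet_derivative (y t) (at x) v) has_vector_derivative
        frechet_derivative (\<lambda>x. hradius x *\<^sub>R V (y t x)) (at x) v) (at t within {0..1})"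
    "\<And>x x' \<tau>. x \<in> N \<Longrightarrow> x' \<in> N \<Longrightarrow> \<tau> \<in> {0..1} \<Longrightarrow> init x' = init x \<Longrightarrow> hradius x' = \<tau> * hradius x \<Longrightarrow> y 1 x' = y \<tau> x"
    apply (rule flow_exists[OF sV smooth_init smooth_hradius[OF \<delta>1] compact_sphere sphere_subset_ann[OF \<delta>(1)] h0 i], assumption)
    subgoal premises p for N y Y
      by (rule p(1)[OF p(2-12)])
    done
  obtain R where R: "\<And>u. u \<in> Y \<Longrightarrow> norm u \<le> R"
    using compact_imp_bounded[OF y(5)] by (auto simp: bounded_iff)
  interpret characteristics \<delta> A k C0 N y R
  proof
    show "fst (y t x) \<in> ann (\<delta> / 2)" "norm (y t x) \<le> R" if "x \<in> N" "t \<in> {0..1}" for x t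
      using y(6) y(7)[OF that] R by (auto simp: mem_Times_iff)
  qed (use y in auto)
  have one: "(1::real) \<in> {0..1}" by simp
  obtain C1 \<eta> where C1: "C1 \<ge> 0" "\<eta> > 0"
    "\<And>x. x \<in> N \<Longrightarrow> norm x \<le> 1 \<Longrightarrow> hradius x \<le> \<eta> \<Longrightarrow> norm (X 1 x - x) \<le> C1 * hradius x ^ (k + 1)"
    by (rule X_close) blast
  obtain \<epsilon>0 where \<epsilon>0: "0 < \<epsilon>0" "\<epsilon>0 \<le> 1/2" "ann \<epsilon>0 \<subseteq> N" using open_contains_ann[OF y(1,2)] .
  define \<epsilon>1 where "\<epsilon>1 = min \<epsilon>0 (min \<eta> \<delta>)"
  have \<epsilon>1: "0 < \<epsilon>1" "\<epsilon>1 \<le> 1" "\<epsilon>1 \<le> \<delta>" using \<epsilon>0 C1 \<delta> by (auto simp: \<epsilon>1_def)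
  have sub1: "ann \<epsilon>1 \<subseteq> N" using \<epsilon>0(3) ann_mono[of \<epsilon>1 \<epsilon>0] by (auto simp: \<epsilon>1_def)
  have close: "norm (X 1 x - x) \<le> C1 * (1 - norm x) ^ (k + 1)" if x: "x \<in> ann \<epsilon>1" "norm x \<le> 1" for x
  proof -
    have "hradius x \<le> \<eta>" using hradius_le(1)[OF x(2)] x by (auto simp: ann_def \<epsilon>1_def)
    then have "norm (X 1 x - x) \<le> C1 * hradius x ^ (k + 1)" using sub1 x by (intro C1) auto
    also have "\<dots> \<le> C1 * (1 - norm x) ^ (k + 1)"
      using hradius_le[OF x(2)] C1(1) by (intro mult_left_mono power_mono) auto
    finally show ?thesis .
  qed
  have sX: "smooth (ann \<epsilon>1) (X 1)"
    by (rule smooth_fam_subset[OF smooth_fam_param[OF smooth_X one] open_ann sub1])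
  define e where "e x = X 1 x - x" for x
  have se: "smooth (ann \<epsilon>1) e" unfolding e_def by (intro smooth_diff sX smooth_id open_ann)
  have de: "(e has_derivative (\<lambda>v. DX 1 x v - v)) (at x)" if "x \<in> ann \<epsilon>1" for x
    unfolding e_def[abs_def] by (intro has_derivative_diff smooth_has_derivative[OF sX that] has_derivative_ident)
  \<comment> \<open>\<open>flat_derivative\<close> asks for a strictly narrower annulus.\<close>
  define \<epsilon>2 where "\<epsilon>2 = \<epsilon>1 / 2"
  have \<epsilon>2: "0 < \<epsilon>2" "\<epsilon>2 < \<epsilon>1" using \<epsilon>1 by (auto simp: \<epsilon>2_def)
  have sub2: "ann \<epsilon>2 \<subseteq> ann \<epsilon>1" using \<epsilon>2 by (intro ann_mono) simp
  have "\<exists>M\<ge>0. \<forall>x\<in>ann \<epsilon>2. norm x \<le> 1 \<longrightarrow> (\<forall>v. \<bar>(DX 1 x v - v) \<bullet> b\<bar> \<le> M * (1 - norm x) ^ k * norm v)"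
    if b: "b \<in> Basis" for b
  proof -
    have sb: "smooth (ann \<epsilon>1) (\<lambda>x. e x \<bullet> b)" by (intro smooth_inner se smooth_const open_ann)
    have eb: "\<bar>e x \<bullet> b\<bar> \<le> C1 * (1 - norm x) ^ Suc k" if "x \<in> ann \<epsilon>2" "norm x < 1" for x
      using order_trans[OF Basis_le_norm[OF b] close[of x]] sub2 that by (auto simp: e_def)
    obtain M where M: "M \<ge> 0" "\<And>x v. x \<in> ann \<epsilon>2 \<Longrightarrow> norm x < 1 \<Longrightarrow>
        \<bar>frechet_derivative (\<lambda>x. e x \<bullet> b) (at x) v\<bar> \<le> M * (1 - norm x) ^ k * norm v"
      using flat_derivative[OF sb \<epsilon>2 \<epsilon>1(2) eb] by auto
    have dd: "frechet_derivative (\<lambda>x. e x \<bullet> b) (at x) v = (DX 1 x v - v) \<bullet> b" if "x \<in> ann \<epsilon>1" for x v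
      using frechet_derivative_eqI[OF has_derivative_inner_left[OF de[OF that], of b]] by simp
    have "\<bar>(DX 1 x v - v) \<bullet> b\<bar> \<le> (M * norm v) * (1 - norm x) ^ k" if x: "x \<in> ann \<epsilon>2" "norm x \<le> 1" for x v
    proof (rule closed_flat_bound[of \<epsilon>1 "\<lambda>x. (DX 1 x v - v) \<bullet> b" \<epsilon>2])
      have "smooth (ann \<epsilon>1) (\<lambda>x. (DX 1 x v - v) \<bullet> b)"
        by (intro smooth_inner smooth_diff smooth_frechet_derivative[OF sX] smooth_intros open_ann)
      then show "continuous_on (ann \<epsilon>1) (\<lambda>x. (DX 1 x v - v) \<bullet> b)" by (rule smooth_continuous_on)
      show "\<bar>(DX 1 x v - v) \<bullet> b\<bar> \<le> (M * norm v) * (1 - norm x) ^ k" if "x \<in> ann \<epsilon>2" "norm x < 1" for x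
        using M(2)[OF that, of v] dd[of x v] sub2 that by (auto simp: mult_ac)
    qed (use \<epsilon>1 \<epsilon>2 x in auto)
    then show ?thesis using M(1) by (intro exI[of _ M]) (auto simp: mult_ac)
  qed
  then obtain M where M: "\<And>b. b \<in> Basis \<Longrightarrow> M b \<ge> 0"
    "\<And>b x v. b \<in> Basis \<Longrightarrow> x \<in> ann \<epsilon>2 \<Longrightarrow> norm x \<le> 1 \<Longrightarrow> \<bar>(DX 1 x v - v) \<bullet> b\<bar> \<le> M b * (1 - norm x) ^ k * norm v"
    by metis
  define C2 where "C2 = (\<Sum>b\<in>Basis. M b)"
  have C2: "C2 \<ge> 0" unfolding C2_def by (intro sum_nonneg M)
  have close': "norm (DX 1 x v - v) \<le> C2 * (1 - norm x) ^ k * norm v" if x: "x \<in> ann \<epsilon>2" "norm x \<le> 1" for x v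
  proof -
    have "norm (DX 1 x v - v) \<le> (\<Sum>b\<in>Basis. \<bar>(DX 1 x v - v) \<bullet> b\<bar>)" by (rule norm_le_l1)
    also have "\<dots> \<le> (\<Sum>b\<in>Basis. M b * (1 - norm x) ^ k * norm v)" by (intro sum_mono M x)
    finally show ?thesis by (simp add: C2_def sum_distrib_right)
  qed
  have fix1: "X 1 x = x" if "norm x = 1" for x
    using close[of x] that \<epsilon>1 by (simp add: ann_def)
  have fix2: "DX 1 x v = v" if "norm x = 1" for x v
    using close'[of x v] that \<epsilon>2 k by (simp add: ann_def power_0_left)
  have sX2: "smooth (ann \<epsilon>2) (X 1)" by (rule smooth_fam_subset[OF sX open_ann sub2])
  have \<epsilon>2_1: "\<epsilon>2 \<le> 1" using \<epsilon>2 \<epsilon>1 by simp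
  obtain \<epsilon> where \<epsilon>: "0 < \<epsilon>" "\<epsilon> \<le> \<epsilon>2" "inj_on (X 1) (ann \<epsilon>)"
    "\<And>x v. x \<in> ann \<epsilon> \<Longrightarrow> norm (DX 1 x v - v) \<le> norm v / 2"
    by (rule near_identity[OF sX2 \<epsilon>2(1) \<epsilon>2_1 fix1 fix2]) blast+
  have sub: "x \<in> N" "x \<in> ann \<epsilon>1" "x \<in> ann \<epsilon>2" if "x \<in> ann \<epsilon>" for x
    using that sub1 sub2 ann_mono[OF \<epsilon>(2)] by auto
  \<comment> \<open>\<open>4 * E\<close> is a bound for \<open>\<sigma>\<close>: its numerator is at
    most \<open>E * 2\<^sup>2\<close> and its denominator at least 1.\<close>
  define C where "C = max (4 * E) (max C1 C2)"
  have E0: "E > 0" by (simp add: E_def)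
  show thesis
  proof (rule that[of \<epsilon> "X 1" \<sigma> C])
    show "smooth (ann \<epsilon>) \<sigma>"
    proof -
      have "X 1 x \<noteq> 0" if "x \<in> N" for x using ann_nonzero[OF \<delta>1 X_ann[OF that one]] .
      then have "smooth N \<sigma>"
        unfolding \<sigma>_def[abs_def]
        by (intro smooth_divide smooth_mult smooth_power smooth_add smooth_exp smooth_norm smooth_const
            smooth_id smooth_fam_param[OF smooth_X one] smooth_fam_param[OF smooth_w one] y(1))
          (use ann_nonzero[OF \<delta>1] y(3) in auto)
      then show ?thesis by (rule smooth_fam_subset[OF _ open_ann]) (use sub in auto)
    qed
    show "norm (X 1 x) < 1 \<longleftrightarrow> norm x < 1" if "x \<in> ann \<epsilon>" for x
    proof -
      have "hradius (X 1 x) > 0 \<longleftrightarrow> hradius x > 0"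
        using hradius_X_eq[OF sub(1)[OF that] one] by (simp add: zero_less_mult_iff)
      then show ?thesis by (simp add: hradius_pos)
    qed
    show "\<sigma> x > 0" for x by (simp add: \<sigma>_def)
    show "\<rho> x = \<sigma> x * \<rho> (X 1 x)" if "x \<in> ann \<epsilon>" for x
    proof -
      have "\<sigma> x * \<rho> (X 1 x) = (1 + norm x)\<^sup>2 / 2 * (hradius (X 1 x) * exp (w 1 x))"
        by (simp add: \<sigma>_def rho_hradius)
      then show ?thesis using hradius_X[OF sub(1)[OF that] one] by (simp add: rho_hradius)
    qed
    show "\<sigma> x \<le> C" if "x \<in> ann \<epsilon>" "norm x \<le> 1" for x
    proof -
      have "(1 + norm x)\<^sup>2 \<le> 2\<^sup>2" using that by (intro power_mono) auto
      moreover have "1 \<le> (1 + norm (X 1 x))\<^sup>2" by (rule one_le_power) simp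
      ultimately have "\<sigma> x \<le> (E * 4) / 1"
        unfolding \<sigma>_def using exp_w_bound[OF sub(1)[OF that(1)] one] E0 by (intro frac_le mult_mono) auto
      then show ?thesis by (simp add: C_def)
    qed
    show "norm (X 1 x - x) \<le> C * (1 - norm x) ^ (k + 1)" if x: "x \<in> ann \<epsilon>" "norm x \<le> 1" for x
      using order_trans[OF close[OF sub(2)[OF x(1)] x(2)] mult_right_mono[of C1 C]] x by (simp add: C_def)
    show "norm (DX 1 x v - v) \<le> C * (1 - norm x) ^ k * norm v" if x: "x \<in> ann \<epsilon>" "norm x \<le> 1" for x v
    proof -
      have "C2 * (1 - norm x) ^ k * norm v \<le> C * (1 - norm x) ^ k * norm v"
        using x by (intro mult_right_mono) (auto simp: C_def)
      with close'[OF sub(3)[OF x(1)] x(2), of v] show ?thesis by linarith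
    qed
    show "(\<sigma> x)\<^sup>2 * ((A (X 1 x) *v DX 1 x x) \<bullet> DX 1 x v) = x \<bullet> v" if "x \<in> ann \<epsilon>" "norm x < 1" for x v
      by (rule transversality[OF sub(1)[OF that(1)] that(2)])
    show "smooth (ann \<epsilon>) (X 1)" by (rule smooth_fam_subset[OF sX2 open_ann]) (use sub in auto)
    show "X 1 x \<in> ann \<delta>" if "x \<in> ann \<epsilon>" for x using X_ann[OF sub(1)[OF that] one] .
  qed (use \<epsilon> \<epsilon>1 \<epsilon>2 fix1 C2 in \<open>auto simp: C_def\<close>)
qed

section \<open>Germs at infinity\<close>

lemma nbhd_infinity_iff:
  "nbhd_infinity U \<longleftrightarrow> open U \<and> U \<subseteq> ball 0 1 \<and> (\<exists>\<epsilon>>0. \<forall>x. 1 - \<epsilon> < norm x \<and> norm x < 1 \<longrightarrow> x \<in> U)"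
  unfolding nbhd_infinity_def by (auto simp: subset_iff)

lemma rho_bounds:
  assumes "norm x \<le> 1" shows "(1 - norm x) / 2 \<le> \<rho> x" "\<rho> x \<le> 1 - norm x"
proof -
  have e: "\<rho> x = (1 - norm x) * ((1 + norm x) / 2)" by (simp add: \<rho>_def power2_eq_square algebra_simps)
  have "(1 - norm x) * (1 / 2) \<le> (1 - norm x) * ((1 + norm x) / 2)" using assms by (intro mult_left_mono) auto
  then show "(1 - norm x) / 2 \<le> \<rho> x" unfolding e by simp
  have "(1 - norm x) * ((1 + norm x) / 2) \<le> (1 - norm x) * 1" using assms by (intro mult_left_mono) auto
  then show "\<rho> x \<le> 1 - norm x" unfolding e by simp
qed

text \<open>Inside the ball \<open>\<rho> x\<close> lies between half of \<open>1 - norm x\<close>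
  and all of it, so decay is measured by the latter from here on. The half accounts for the
  \<open>2 ^ m\<close> in the converse.\<close>

lemma bigo_near_infinityD:
  fixes f :: "real^'n \<Rightarrow> real"
  assumes "f \<in> O[near_infinity](\<lambda>x. \<rho> x ^ m)"
  obtains C \<epsilon> where "C \<ge> 0" "\<epsilon> > 0" "\<And>x. 1 - \<epsilon> < norm x \<Longrightarrow> norm x < 1 \<Longrightarrow> \<bar>f x\<bar> \<le> C * (1 - norm x) ^ m"
proof -
  obtain c where c: "c > 0" "\<forall>\<^sub>F x in near_infinity. norm (f x) \<le> c * norm (\<rho> x ^ m)"
    using landau_o.bigE[OF assms] by blast
  then obtain \<epsilon> where e: "\<epsilon> > 0" "\<And>x. x \<in> ball 0 1 - cball 0 (1 - \<epsilon>) \<Longrightarrow> norm (f x) \<le> c * norm (\<rho> x ^ m)"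
    unfolding eventually_near_infinity by blast
  show thesis
  proof (rule that[of c \<epsilon>])
    fix x :: "real^'n" assume x: "1 - \<epsilon> < norm x" "norm x < 1"
    have "\<bar>\<rho> x\<bar> ^ m \<le> (1 - norm x) ^ m"
      using rho_bounds[of x] x by (intro power_mono) auto
    then have "c * \<bar>\<rho> x\<bar> ^ m \<le> c * (1 - norm x) ^ m" using c(1) by (intro mult_left_mono) auto
    moreover have "\<bar>f x\<bar> \<le> c * \<bar>\<rho> x\<bar> ^ m" using e(2)[of x] x by (simp add: power_abs)
    ultimately show "\<bar>f x\<bar> \<le> c * (1 - norm x) ^ m" by linarith
  qed (use c e in auto)
qed

lemma bigo_near_infinityI:
  fixes f :: "real^'n \<Rightarrow> real"
  assumes "\<epsilon> > 0" "C \<ge> 0" "\<And>x. 1 - \<epsilon> < norm x \<Longrightarrow> norm x < 1 \<Longrightarrow> \<bar>f x\<bar> \<le> C * (1 - norm x) ^ m"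
  shows "f \<in> O[near_infinity](\<lambda>x. \<rho> x ^ m)"
proof (rule landau_o.bigI[of "C * 2 ^ m + 1"])
  show "\<forall>\<^sub>F x in near_infinity. norm (f x) \<le> (C * 2 ^ m + 1) * norm (\<rho> x ^ m)"
    unfolding eventually_near_infinity
  proof (intro exI[of _ \<epsilon>] conjI ballI)
    fix x :: "real^'n" assume "x \<in> ball 0 1 - cball 0 (1 - \<epsilon>)"
    then have x: "1 - \<epsilon> < norm x" "norm x < 1" by auto
    have "\<bar>f x\<bar> \<le> C * (1 - norm x) ^ m" using assms(3)[OF x] .
    also have "\<dots> \<le> C * (2 * \<rho> x) ^ m"
      using rho_bounds[of x] x assms(2) by (intro mult_left_mono power_mono) auto
    also have "\<dots> = (C * 2 ^ m) * \<rho> x ^ m" by (simp add: power_mult_distrib)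
    also have "\<dots> \<le> (C * 2 ^ m + 1) * \<rho> x ^ m"
      using rho_bounds[of x] x by (intro mult_right_mono) auto
    also have "\<rho> x ^ m = norm (\<rho> x ^ m)" using rho_bounds[of x] x by simp
    finally show "norm (f x) \<le> (C * 2 ^ m + 1) * norm (\<rho> x ^ m)" by simp
  qed (rule assms)
qed (use assms in \<open>simp add: add_nonneg_pos\<close>)

section \<open>Bilinear forms in coordinates\<close>

lemma bilinear_axis_expansion:
  assumes "bilinear (T :: real^'n \<Rightarrow> real^'n \<Rightarrow> real)"
  shows "T v w = (\<Sum>i\<in>UNIV. \<Sum>j\<in>UNIV. v $ i * w $ j * T (axis i 1) (axis j 1))"
proof -
  have e: "v = (\<Sum>i\<in>UNIV. v $ i *\<^sub>R axis i 1)" for v :: "real^'n"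
    using basis_expansion[of v] by (simp add: scalar_mult_eq_scaleR)
  have l: "linear (\<lambda>v. T v w)" "linear (T v)" for v w using assms by (auto simp: bilinear_def)
  have "T v w = T (\<Sum>i\<in>UNIV. v $ i *\<^sub>R axis i 1) w" using e[of v] by simp
  also have "\<dots> = (\<Sum>i\<in>UNIV. v $ i * T (axis i 1) w)"
    by (simp add: linear_sum[OF l(1)] linear_scale[OF l(1)])
  also have "\<dots> = (\<Sum>i\<in>UNIV. v $ i * (\<Sum>j\<in>UNIV. w $ j * T (axis i 1) (axis j 1)))"
  proof (rule sum.cong[OF refl])
    fix i :: 'n
    have "T (axis i 1) w = T (axis i 1) (\<Sum>j\<in>UNIV. w $ j *\<^sub>R axis j 1)" using e[of w] by simp
    also have "\<dots> = (\<Sum>j\<in>UNIV. w $ j * T (axis i 1) (axis j 1))"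
      by (simp add: linear_sum[OF l(2)] linear_scale[OF l(2)])
    finally show "v $ i * T (axis i 1) w = v $ i * (\<Sum>j\<in>UNIV. w $ j * T (axis i 1) (axis j 1))" by simp
  qed
  finally show ?thesis by (simp add: sum_distrib_left mult.assoc)
qed

lemma tensor2_norm_component:
  fixes T :: "'n::finite tensor2"
  shows "\<bar>T (axis i 1) (axis j 1)\<bar> \<le> tensor2_norm T"
proof -
  have "(T (axis i 1) (axis j 1))\<^sup>2 \<le> (\<Sum>v\<in>Basis. (T (axis i 1) v)\<^sup>2)"
    by (rule member_le_sum) (auto simp: axis_in_Basis_iff)
  also have "\<dots> \<le> (\<Sum>u\<in>Basis. \<Sum>v\<in>Basis. (T u v)\<^sup>2)"
    by (rule member_le_sum[of "axis i 1" Basis "\<lambda>u. \<Sum>v\<in>Basis. (T u v)\<^sup>2"]) (auto simp: axis_in_Basis_iff intro: sum_nonneg)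
  finally have "sqrt ((T (axis i 1) (axis j 1))\<^sup>2) \<le> tensor2_norm T"
    unfolding tensor2_norm_def by (rule real_sqrt_le_mono)
  then show ?thesis by simp
qed

lemma tensor2_norm_le:
  fixes T :: "'n::finite tensor2"
  assumes "c \<ge> 0" "\<And>u v. u \<in> Basis \<Longrightarrow> v \<in> Basis \<Longrightarrow> \<bar>T u v\<bar> \<le> c"
  shows "tensor2_norm T \<le> real CARD('n) * c"
proof -
  have "(\<Sum>u\<in>Basis. \<Sum>v\<in>Basis. (T u v)\<^sup>2) \<le> (\<Sum>u\<in>(Basis::(real^'n) set). \<Sum>v\<in>(Basis::(real^'n) set). c\<^sup>2)"
    by (intro sum_mono) (use assms in \<open>simp add: abs_le_square_iff[symmetric]\<close>)
  also have "\<dots> = (real CARD('n) * c)\<^sup>2" by (simp add: power2_eq_square)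
  finally have "tensor2_norm T \<le> sqrt ((real CARD('n) * c)\<^sup>2)"
    unfolding tensor2_norm_def by (rule real_sqrt_le_mono)
  then show ?thesis using assms(1) by simp
qed

lemma mult_vec_inner:
  "((M :: real^'n^'n) *v v) \<bullet> w = (\<Sum>i\<in>UNIV. \<Sum>j\<in>UNIV. v $ i * w $ j * M $ j $ i)"
proof -
  have "(M *v v) \<bullet> w = (\<Sum>j\<in>UNIV. \<Sum>i\<in>UNIV. v $ i * w $ j * M $ j $ i)"
    by (simp add: inner_vec_def matrix_vector_mult_def sum_distrib_left sum_distrib_right mult_ac)
  then show ?thesis by (subst sum.swap) 
qed

lemma metric_repsD:
  assumes "(U, g) \<in> metric_reps" "x \<in> U"
  shows "bilinear (g x)" "g x v w = g x w v" "v \<noteq> 0 \<Longrightarrow> g x v v > 0"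
  using assms by (auto simp: metric_reps_def riemannian_metric_on_def)

lemma metric_germs_reps: "\<gamma> \<in> metric_germs \<Longrightarrow> p \<in> \<gamma> \<Longrightarrow> p \<in> metric_reps"
  unfolding metric_germs_def using in_quotient_imp_subset[OF equiv_metric_germ_rel] by blast

lemma metric_germs_rel: "\<gamma> \<in> metric_germs \<Longrightarrow> p \<in> \<gamma> \<Longrightarrow> q \<in> \<gamma> \<Longrightarrow> (p, q) \<in> metric_germ_rel"
  unfolding metric_germs_def using in_quotient_imp_in_rel[OF equiv_metric_germ_rel] by blast

lemma metric_germs_closed: "\<gamma> \<in> metric_germs \<Longrightarrow> p \<in> \<gamma> \<Longrightarrow> (p, q) \<in> metric_germ_rel \<Longrightarrow> q \<in> \<gamma>"
  unfolding metric_germs_def using in_quotient_imp_closed[OF equiv_metric_germ_rel] by blast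

text \<open>The entries of the rescaled metric are smooth only up to the sphere; near it they are
  continued to the outside. On the sphere the decay of positive order forces the identity matrix, so
  invertibility persists on a thin annulus.\<close>

theorem metric_normal_form:
  fixes \<gamma> :: "'n::finite metric_germ"
  assumes \<gamma>: "\<gamma> \<in> G k" and k: "k > 0"
  obtains U g \<delta> A C0 where "(U, g) \<in> \<gamma>" "normal_form \<delta> A k C0"
    "\<And>x. x \<in> ann \<delta> \<Longrightarrow> norm x < 1 \<Longrightarrow> x \<in> U"
    "\<And>x v w. x \<in> ann \<delta> \<Longrightarrow> norm x < 1 \<Longrightarrow> (A x *v v) \<bullet> w = (\<rho> x)\<^sup>2 * g x v w"
proof -
  obtain U g h where Ug: "(U, g) \<in> \<gamma>" and h: "riemannian_metric_on (tilde U) h"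
    "\<And>x v w. x \<in> U \<Longrightarrow> h x v w = (\<rho> x)\<^sup>2 * g x v w"
    "(\<lambda>x. tensor2_norm (\<lambda>v w. (\<rho> x)\<^sup>2 * g x v w - euclidean_metric x v w)) \<in> O[near_infinity](\<lambda>x. \<rho> x ^ k)"
    using \<gamma> unfolding G_def by blast
  have \<gamma>m: "\<gamma> \<in> metric_germs" using \<gamma> by (simp add: G_def)
  have Um: "(U, g) \<in> metric_reps" by (rule metric_germs_reps[OF \<gamma>m Ug])
  obtain C \<epsilon>1 where C: "C \<ge> 0" "\<epsilon>1 > 0" "\<And>x. 1 - \<epsilon>1 < norm x \<Longrightarrow> norm x < 1 \<Longrightarrow>
      \<bar>tensor2_norm (\<lambda>v w. (\<rho> x)\<^sup>2 * g x v w - euclidean_metric x v w)\<bar> \<le> C * (1 - norm x) ^ k"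
    by (rule bigo_near_infinityD[OF h(3)]) blast
  obtain \<epsilon>2 where \<epsilon>2: "\<epsilon>2 > 0" "\<And>x. 1 - \<epsilon>2 < norm x \<Longrightarrow> norm x < 1 \<Longrightarrow> x \<in> U"
    using Um by (auto simp: metric_reps_def nbhd_infinity_iff)
  have sph: "sphere 0 1 \<subseteq> tilde U" by (auto simp: tilde_def)
  have "\<exists>W F. sphere 0 1 \<subseteq> W \<and> smooth W F \<and> (\<forall>x\<in>W \<inter> tilde U. F x = h x (axis i 1) (axis j 1))" for i j
    using smooth_on_extension[OF _ compact_sphere sph, of "\<lambda>x. h x (axis i 1) (axis j 1)"] h(1)
    unfolding riemannian_metric_on_def by metis
  then obtain W F where WF: "\<And>i j. sphere 0 1 \<subseteq> W i j" "\<And>i j. smooth (W i j) (F i j)"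
    "\<And>i j x. x \<in> W i j \<inter> tilde U \<Longrightarrow> F i j x = h x (axis i 1) (axis j 1)" by metis
  define W' where "W' = (\<Inter>i\<in>UNIV. \<Inter>j\<in>UNIV. W i j)"
  have "open W'" unfolding W'_def using smooth_fam_open[OF WF(2)] by (intro open_INT) auto
  moreover have "sphere 0 1 \<subseteq> W'" using WF(1) by (auto simp: W'_def)
  ultimately obtain \<epsilon>3 where \<epsilon>3: "0 < \<epsilon>3" "\<epsilon>3 \<le> 1/2" "ann \<epsilon>3 \<subseteq> W'" by (rule open_contains_ann)
  \<comment> \<open>The continuations of mirrored entries need not agree outside the ball; averaging
    restores symmetry and changes nothing on \<open>tilde U\<close>.\<close>
  define A where "A x = (\<chi> i j. (F i j x + F j i x) / 2)" for x
  define \<delta>0 where "\<delta>0 = min \<epsilon>1 (min \<epsilon>2 \<epsilon>3)"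
  have \<delta>0: "\<delta>0 > 0" "\<delta>0 \<le> 1/2" using C \<epsilon>2 \<epsilon>3 by (auto simp: \<delta>0_def)
  have sub: "ann \<delta>0 \<subseteq> W i j" for i j
  proof -
    have "ann \<delta>0 \<subseteq> (ann \<epsilon>3 :: (real^'n) set)" by (rule ann_mono) (simp add: \<delta>0_def)
    also note \<epsilon>3(3)
    also have "W' \<subseteq> W i j" by (auto simp: W'_def)
    finally show ?thesis .
  qed
  have sA: "smooth (ann \<delta>0) (\<lambda>x. A x $ i $ j)" for i j
    unfolding A_def using smooth_fam_subset[OF WF(2) open_ann sub]
    by simp (intro smooth_divide_const smooth_add; simp)
  have inU: "x \<in> U" "x \<in> tilde U" if "x \<in> ann \<delta>0" "norm x < 1" for x
    using \<epsilon>2(2)[of x] that by (auto simp: ann_def \<delta>0_def tilde_def)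
  have Ah: "A x $ i $ j = h x (axis i 1) (axis j 1)" if x: "x \<in> ann \<delta>0" "x \<in> tilde U" for x i j
  proof -
    have "F i j x = h x (axis i 1) (axis j 1)" "F j i x = h x (axis j 1) (axis i 1)"
      using WF(3) sub x by blast+
    moreover have "h x (axis j 1) (axis i 1) = h x (axis i 1) (axis j 1)"
      using h(1) x(2) by (auto simp: riemannian_metric_on_def)
    ultimately show ?thesis by (simp add: A_def)
  qed
  have Ag: "(A x *v v) \<bullet> w = (\<rho> x)\<^sup>2 * g x v w" if x: "x \<in> ann \<delta>0" "norm x < 1" for x v w
  proof -
    have b: "bilinear (h x)" using h(1) inU[OF x] by (auto simp: riemannian_metric_on_def)
    have "(A x *v v) \<bullet> w = (\<Sum>i\<in>UNIV. \<Sum>j\<in>UNIV. v $ i * w $ j * h x (axis i 1) (axis j 1))"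
      unfolding mult_vec_inner Ah[OF x(1) inU(2)[OF x]]
      using h(1) inU(2)[OF x] by (auto simp: riemannian_metric_on_def)
    also have "\<dots> = h x v w" by (rule bilinear_axis_expansion[OF b, symmetric])
    finally show ?thesis using h(2)[OF inU(1)[OF x]] by simp
  qed
  define D where "D x i j = A x $ i $ j - (if i = j then 1 else 0)" for x i j
  have Dc: "\<bar>D x i j\<bar> \<le> C * (1 - norm x) ^ k" if x: "x \<in> ann \<delta>0" "norm x < 1" for x i j
  proof -
    have "D x i j = (\<rho> x)\<^sup>2 * g x (axis i 1) (axis j 1) - euclidean_metric x (axis i 1) (axis j 1)"
      using h(2)[OF inU(1)[OF x]] Ah[OF x(1) inU(2)[OF x]]
      by (simp add: D_def euclidean_metric_def inner_axis_axis)
    then have "\<bar>D x i j\<bar> \<le> tensor2_norm (\<lambda>v w. (\<rho> x)\<^sup>2 * g x v w - euclidean_metric x v w)"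
      using tensor2_norm_component[of "\<lambda>v w. (\<rho> x)\<^sup>2 * g x v w - euclidean_metric x v w" i j] by simp
    also have "\<dots> \<le> C * (1 - norm x) ^ k"
      using C(3)[of x] x by (auto simp: ann_def \<delta>0_def)
    finally show ?thesis .
  qed
  have sD: "smooth (ann \<delta>0) (\<lambda>x. D x i j)" for i j
    unfolding D_def by (intro smooth_diff sA smooth_const open_ann)
  have Dc': "\<bar>D x i j\<bar> \<le> C * (1 - norm x) ^ k" if x: "x \<in> ann \<delta>0" "norm x \<le> 1" for x i j
    by (rule closed_flat_bound[OF smooth_continuous_on[OF sD] \<delta>0(1) order_refl _ Dc x]) (use \<delta>0 in auto)
  define C0 where "C0 = real CARD('n) * (real CARD('n) * C)"
  have C0: "C0 \<ge> 0" using C(1) by (simp add: C0_def)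
  have close: "norm (A x *v v - v) \<le> C0 * (1 - norm x) ^ k * norm v" if x: "x \<in> ann \<delta>0" "norm x \<le> 1" for x v
  proof -
    have "\<bar>(A x *v v - v) $ i\<bar> \<le> real CARD('n) * C * (1 - norm x) ^ k * norm v" for i
    proof -
      have "(A x *v v - v) $ i = (\<Sum>j\<in>UNIV. D x i j * v $ j)"
        by (simp add: matrix_vector_mult_def D_def left_diff_distrib sum_subtractf if_distrib[of "\<lambda>u. u * _"] cong: if_cong)
      also have "\<bar>\<dots>\<bar> \<le> (\<Sum>j\<in>(UNIV::'n set). C * (1 - norm x) ^ k * norm v)"
      proof (rule order_trans[OF sum_abs sum_mono])
        show "\<bar>D x i j * v $ j\<bar> \<le> C * (1 - norm x) ^ k * norm v" for j
          unfolding abs_mult using Dc'[OF x] component_le_norm_cart[of v j] C(1) x by (intro mult_mono) auto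
      qed
      finally show ?thesis by simp
    qed
    then have "(\<Sum>i\<in>UNIV. \<bar>(A x *v v - v) $ i\<bar>) \<le> (\<Sum>i\<in>(UNIV::'n set). real CARD('n) * C * (1 - norm x) ^ k * norm v)"
      by (rule sum_mono)
    then have "norm (A x *v v - v) \<le> (\<Sum>i\<in>(UNIV::'n set). real CARD('n) * C * (1 - norm x) ^ k * norm v)"
      using norm_le_l1_cart[of "A x *v v - v"] by linarith
    then show ?thesis by (simp add: C0_def mult_ac)
  qed
  have sdet: "smooth (ann \<delta>0) (\<lambda>x. det (A x))" by (intro smooth_det open_ann sA)
  have "open {x \<in> ann \<delta>0. det (A x) \<noteq> 0}"
  proof -
    have "open (ann \<delta>0 \<inter> (\<lambda>x. det (A x)) -` (- {0}))"
      by (intro continuous_open_preimage smooth_continuous_on[OF sdet] open_ann) auto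
    moreover have "ann \<delta>0 \<inter> (\<lambda>x. det (A x)) -` (- {0}) = {x \<in> ann \<delta>0. det (A x) \<noteq> 0}" by auto
    ultimately show ?thesis by simp
  qed
  moreover have "sphere 0 1 \<subseteq> {x \<in> ann \<delta>0. det (A x) \<noteq> 0}"
  proof
    fix x :: "real^'n" assume "x \<in> sphere 0 1"
    then have x: "norm x = 1" "x \<in> ann \<delta>0" using \<delta>0 by (auto simp: ann_def)
    have "A x *v v = v" for v using close[of x v] x k by (simp add: power_0_left)
    then have "A x = mat 1" by (simp add: matrix_eq)
    then show "x \<in> {x \<in> ann \<delta>0. det (A x) \<noteq> 0}" using x by simp
  qed
  ultimately obtain \<epsilon>4 where \<epsilon>4: "0 < \<epsilon>4" "\<epsilon>4 \<le> 1/2" "ann \<epsilon>4 \<subseteq> {x \<in> ann \<delta>0. det (A x) \<noteq> 0}"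
    by (rule open_contains_ann)
  \<comment> \<open>The last bound yields \<open>C0 * \<delta> \<le> 1/2\<close>; adding 1 to
    \<open>C0\<close> allows for \<open>C0 = 0\<close>.\<close>
  define \<delta> where "\<delta> = min (min \<delta>0 \<epsilon>4) (1 / (2 * (C0 + 1)))"
  have \<delta>: "0 < \<delta>" "\<delta> \<le> 1/2" using \<delta>0 \<epsilon>4 C0 by (auto simp: \<delta>_def)
  have subd: "x \<in> ann \<delta>0" "x \<in> ann \<epsilon>4" if "x \<in> ann \<delta>" for x :: "real^'n"
    using that by (auto simp: ann_def \<delta>_def)
  show thesis
  proof (rule that[of U g \<delta> A C0])
    show "normal_form \<delta> A k C0"
    proof
      show "smooth (ann \<delta>) (\<lambda>x. A x $ i $ j)" for i j
        by (rule smooth_fam_subset[OF sA open_ann]) (use subd in auto)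
      show "transpose (A x) = A x" for x by (simp add: A_def transpose_def vec_eq_iff add.commute)
      show "det (A x) \<noteq> 0" if "x \<in> ann \<delta>" for x using subd[OF that] \<epsilon>4(3) by auto
      have "C0 * \<delta> \<le> C0 * (1 / (2 * (C0 + 1)))" using C0 by (intro mult_left_mono) (auto simp: \<delta>_def)
      also have "\<dots> \<le> 1/2" using C0 by (simp add: field_simps)
      finally show "C0 * \<delta> \<le> 1/2" .
    qed (use \<delta> k C0 close subd in auto)
  qed (use Ug inU Ag subd in auto)
qed

lemma smooth_on_continuous:
  assumes "smooth_on S f" shows "continuous_on S (f :: real^'n \<Rightarrow> 'b::real_normed_vector)"
  unfolding continuous_on_eq_continuous_within
proof
  fix x assume x: "x \<in> S"
  obtain V F where V: "x \<in> V" "smooth V F" "\<And>y. y \<in> V \<inter> S \<Longrightarrow> F y = f y"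
    using bspec[OF assms[unfolded smooth_on_iff] x] by metis
  have "continuous (at x) F"
    using smooth_continuous_on[OF V(2)] V(1) smooth_fam_open[OF V(2)] by (simp add: continuous_on_eq_continuous_at)
  then have "continuous (at x within S) F" by (rule continuous_at_imp_continuous_within)
  then have "(F \<longlongrightarrow> f x) (at x within S)"
    using V(3)[of x] V(1) x by (simp add: continuous_within)
  moreover have "\<forall>\<^sub>F y in at x within S. F y = f y"
    unfolding eventually_at_topological using V(1,3) smooth_fam_open[OF V(2)] by (intro exI[of _ V]) simp
  ultimately show "continuous (at x within S) f"
    unfolding continuous_within by (rule Lim_transform_eventually)
qed

lemma smooth_on_subset:
  assumes "smooth_on S f" "T \<subseteq> S" shows "smooth_on T f"
  unfolding smooth_on_iff
proof
  fix x assume "x \<in> T"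
  with assms(2) have "x \<in> S" by blast
  from bspec[OF assms(1)[unfolded smooth_on_iff] this]
  obtain V F where "x \<in> V" "smooth V F" "\<forall>y\<in>V \<inter> S. F y = f y" by (elim exE conjE)
  then show "\<exists>V F. x \<in> V \<and> smooth V F \<and> (\<forall>y\<in>V \<inter> T. F y = f y)"
    using assms(2) by (intro exI[of _ V] exI[of _ F]) auto
qed

text \<open>\<open>f\<close> is uniformly continuous on a closed collar and fixes the sphere, so a
  point close to its radial projection is sent close to that projection.\<close>

lemma collar_image:
  fixes f :: "real^'n \<Rightarrow> real^'n"
  assumes V: "nbhd_infinity V" and f: "continuous_on (tilde V) f" and s: "\<And>x. norm x = 1 \<Longrightarrow> f x = x" and "\<epsilon> > 0"
  obtains d where "d > 0" "\<And>y. 1 - d < norm y \<Longrightarrow> norm y < 1 \<Longrightarrow> y \<in> V"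
    "\<And>y. 1 - d < norm y \<Longrightarrow> norm y < 1 \<Longrightarrow> norm (f y) > 1 - \<epsilon>"
proof -
  obtain \<eta> where \<eta>: "\<eta> > 0" "\<And>x. 1 - \<eta> < norm x \<Longrightarrow> norm x < 1 \<Longrightarrow> x \<in> V"
    using V by (auto simp: nbhd_infinity_iff)
  define C where "C = {x::real^'n. 1 - \<eta> / 2 \<le> norm x \<and> norm x \<le> 1}"
  have sub: "C \<subseteq> tilde V"
  proof
    fix x assume x: "x \<in> C"
    show "x \<in> tilde V"
    proof (cases "norm x = 1")
      case False
      then have "x \<in> V" using \<eta> x by (intro \<eta>(2)) (auto simp: C_def)
      then show ?thesis by (simp add: tilde_def)
    qed (simp add: tilde_def)
  qed
  have "compact C" unfolding C_def by (rule compact_closed_annulus)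
  then have "uniformly_continuous_on C f"
    using compact_uniformly_continuous continuous_on_subset[OF f sub] by blast
  then obtain d where d: "d > 0" "\<And>x y. x \<in> C \<Longrightarrow> y \<in> C \<Longrightarrow> dist y x < d \<Longrightarrow> dist (f y) (f x) < \<epsilon>"
    unfolding uniformly_continuous_on_def using \<open>\<epsilon> > 0\<close> by metis
  show thesis
  proof (rule that[of "min (min d (\<eta> / 2)) (1/2)"])
    fix y :: "real^'n" assume y: "1 - min (min d (\<eta> / 2)) (1/2) < norm y" "norm y < 1"
    then have y0: "norm y > 0" by linarith
    define u where "u = y /\<^sub>R norm y"
    have u: "norm u = 1" using y0 by (simp add: u_def)
    have "y - u = (norm y - 1) *\<^sub>R u" using y0 by (simp add: u_def algebra_simps)
    then have "dist y u = 1 - norm y" using u y by (simp add: dist_norm)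
    then have "dist y u < d" using y by linarith
    moreover have "y \<in> C" "u \<in> C" using y u \<eta> by (auto simp: C_def)
    ultimately have "norm (f y - u) < \<epsilon>" using d(2)[of u y] s[OF u] by (simp add: dist_norm)
    then show "norm (f y) > 1 - \<epsilon>" using norm_triangle_ineq2[of u "f y"] u by (simp add: norm_minus_commute)
    show "y \<in> V" using \<eta>(2)[of y] y \<eta>(1) by auto
  qed (use d \<eta> in auto)
qed

section \<open>Diffeomorphisms that fix the sphere pointwise\<close>

locale boundary_diffeo =
  fixes U :: "(real^'n::finite) set" and \<theta> :: "real^'n \<Rightarrow> real^'n"
  assumes rep: "(U, \<theta>) \<in> diffeo_reps" and sphere_fixed: "\<And>x. norm x = 1 \<Longrightarrow> \<theta> x = x"
begin

text \<open>The inverse relative to \<open>U\<close> is the one in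
  \<open>pushforward_metric\<close>, whereas regularity up to the sphere is stated for the inverse
  relative to \<open>tilde U\<close>; the two agree on the image of \<open>U\<close>.\<close>

definition "\<psi> = inv_into U \<theta>"

lemma nbhd_U: "nbhd_infinity U" and inj_tilde: "inj_on \<theta> (tilde U)"
  and smooth_on_\<theta>: "smooth_on (tilde U) \<theta>"
  using rep by (auto simp: diffeo_reps_def)

lemma U: "open U" "U \<subseteq> ball 0 1" using nbhd_U by (auto simp: nbhd_infinity_iff)

lemma inj_U: "inj_on \<theta> U"
  using inj_tilde by (rule inj_on_subset) (simp add: tilde_def)

lemma smooth_\<theta>: "smooth U \<theta>"
  using smooth_on_subset[OF smooth_on_\<theta>, of U] smooth_on_open[OF U(1)] by (auto simp: tilde_def)

text \<open>The image of \<open>tilde U\<close> is some \<open>tilde V\<close>. As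
  \<open>\<theta>\<close> is injective and maps the sphere onto itself, removing the sphere on both
  sides identifies \<open>V\<close> with the image of \<open>U\<close>.\<close>

lemma image_tilde: "nbhd_infinity (\<theta> ` U)" "\<theta> ` tilde U = tilde (\<theta> ` U)"
proof -
  obtain V where V: "nbhd_infinity V" "\<theta> ` tilde U = tilde V" using rep by (auto simp: diffeo_reps_def)
  have s: "\<theta> ` sphere 0 1 = sphere 0 1" using sphere_fixed by (force simp: image_iff)
  have "\<theta> ` U = \<theta> ` (tilde U - sphere 0 1)"
    using U(2) by (intro arg_cong[where f = "(`) \<theta>"]) (auto simp: tilde_def)
  also have "\<dots> = \<theta> ` tilde U - \<theta> ` sphere 0 1"
    by (rule inj_on_image_set_diff[OF inj_tilde]) (auto simp: tilde_def)
  also have "\<dots> = V" using V s by (auto simp: tilde_def nbhd_infinity_iff)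
  finally have "\<theta> ` U = V" .
  then show "nbhd_infinity (\<theta> ` U)" "\<theta> ` tilde U = tilde (\<theta> ` U)" using V by auto
qed

lemma V: "open (\<theta> ` U)" "\<theta> ` U \<subseteq> ball 0 1" using image_tilde(1) by (auto simp: nbhd_infinity_iff)

lemma \<psi>_\<theta>: "x \<in> U \<Longrightarrow> \<psi> (\<theta> x) = x"
  by (simp add: \<psi>_def inj_U)

lemma \<theta>_\<psi>: "y \<in> \<theta> ` U \<Longrightarrow> \<theta> (\<psi> y) = y"
  by (simp add: \<psi>_def f_inv_into_f)

lemma \<psi>_U: "y \<in> \<theta> ` U \<Longrightarrow> \<psi> y \<in> U"
  by (simp add: \<psi>_def inv_into_into)

lemma inv_tilde: "y \<in> \<theta> ` U \<Longrightarrow> inv_into (tilde U) \<theta> y = \<psi> y"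
  using \<psi>_\<theta> inv_into_f_f[OF inj_tilde] by (auto simp: tilde_def)

lemma inv_tilde_sphere: "norm y = 1 \<Longrightarrow> inv_into (tilde U) \<theta> y = y"
  using inv_into_f_f[OF inj_tilde, of y] sphere_fixed[of y] by (simp add: tilde_def)

lemma inv_tilde_smooth: "smooth_on (tilde (\<theta> ` U)) (inv_into (tilde U) \<theta>)"
  using rep image_tilde(2) by (auto simp: diffeo_reps_def)

lemma smooth_\<psi>: "smooth (\<theta> ` U) \<psi>"
proof -
  have "smooth (\<theta> ` U) (inv_into (tilde U) \<theta>)"
    using smooth_on_subset[OF inv_tilde_smooth, of "\<theta> ` U"] smooth_on_open[OF V(1)] by (auto simp: tilde_def)
  then show ?thesis by (subst (asm) smooth_fam_cong) (auto simp: inv_tilde)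
qed

lemma D\<psi>: "y \<in> \<theta> ` U \<Longrightarrow> (\<psi> has_derivative frechet_derivative \<psi> (at y)) (at y)"
  by (rule smooth_has_derivative[OF smooth_\<psi>])

lemma D\<theta>: "x \<in> U \<Longrightarrow> (\<theta> has_derivative frechet_derivative \<theta> (at x)) (at x)"
  by (rule smooth_has_derivative[OF smooth_\<theta>])

lemma D\<psi>_nonzero:
  assumes y: "y \<in> \<theta> ` U" and v: "v \<noteq> 0" shows "frechet_derivative \<psi> (at y) v \<noteq> 0"
proof
  assume 0: "frechet_derivative \<psi> (at y) v = 0"
  have d1: "((\<lambda>y. \<theta> (\<psi> y)) has_derivative (\<lambda>v. frechet_derivative \<theta> (at (\<psi> y)) (frechet_derivative \<psi> (at y) v))) (at y)"
    by (rule has_derivative_compose[OF D\<psi>[OF y] D\<theta>[OF \<psi>_U[OF y]]])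
  have d2: "((\<lambda>y. \<theta> (\<psi> y)) has_derivative (\<lambda>v. v)) (at y)"
    by (rule has_derivative_transform_within_open[OF has_derivative_ident V(1) y]) (simp add: \<theta>_\<psi>)
  have "frechet_derivative \<theta> (at (\<psi> y)) (frechet_derivative \<psi> (at y) v) = v"
    using fun_cong[OF has_derivative_unique[OF d1 d2], of v] .
  then show False
    using 0 v linear_0[OF has_derivative_linear[OF D\<theta>[OF \<psi>_U[OF y]]]] by simp
qed

lemma push_eq: "pushforward_metric U \<theta> g y v w =
    g (\<psi> y) (frechet_derivative \<psi> (at y) v) (frechet_derivative \<psi> (at y) w)"
  by (simp add: pushforward_metric_def \<psi>_def)

lemma push_metric_reps:
  assumes g: "(U, g) \<in> metric_reps"
  shows "(\<theta> ` U, pushforward_metric U \<theta> g) \<in> metric_reps"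
proof -
  have lin: "linear (frechet_derivative \<psi> (at y))" if "y \<in> \<theta> ` U" for y
    using has_derivative_linear[OF D\<psi>[OF that]] .
  have "bilinear (pushforward_metric U \<theta> g y)" if y: "y \<in> \<theta> ` U" for y
  proof -
    have b: "bilinear (g (\<psi> y))" using metric_repsD(1)[OF g \<psi>_U[OF y]] .
    show ?thesis
      unfolding bilinear_def push_eq[abs_def]
      using linear_compose[OF lin[OF y], of "\<lambda>v. g (\<psi> y) v _"] linear_compose[OF lin[OF y], of "g (\<psi> y) _"] b
      unfolding bilinear_def by (auto simp: o_def)
  qed
  moreover have "smooth_on (\<theta> ` U) (\<lambda>y. pushforward_metric U \<theta> g y v w)" for v w
  proof -
    have "smooth U (\<lambda>x. g x (axis i 1) (axis j 1))" for i j
      using g unfolding smooth_on_open[OF U(1), symmetric] by (simp add: metric_reps_def riemannian_metric_on_def)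
    from smooth_compose[OF this smooth_\<psi>]
    have s: "smooth (\<theta> ` U) (\<lambda>y. g (\<psi> y) (axis i 1) (axis j 1))" for i j by (simp add: \<psi>_U)
    have "smooth (\<theta> ` U) (\<lambda>y. frechet_derivative \<psi> (at y) v)" for v
      by (intro smooth_frechet_derivative[OF smooth_\<psi>] smooth_intros V)
    then have "smooth (\<theta> ` U) (\<lambda>y. \<Sum>i\<in>UNIV. \<Sum>j\<in>UNIV. frechet_derivative \<psi> (at y) v $ i *
        frechet_derivative \<psi> (at y) w $ j * g (\<psi> y) (axis i 1) (axis j 1))"
      by (intro smooth_sum smooth_mult smooth_vec_nth s V)
    moreover have "(\<Sum>i\<in>UNIV. \<Sum>j\<in>UNIV. frechet_derivative \<psi> (at y) v $ i *
        frechet_derivative \<psi> (at y) w $ j * g (\<psi> y) (axis i 1) (axis j 1)) = pushforward_metric U \<theta> g y v w"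
      if "y \<in> \<theta> ` U" for y
      unfolding push_eq by (rule bilinear_axis_expansion[OF metric_repsD(1)[OF g \<psi>_U[OF that]], symmetric])
    ultimately have "smooth (\<theta> ` U) (\<lambda>y. pushforward_metric U \<theta> g y v w)"
      by (subst (asm) smooth_fam_cong) auto
    then show ?thesis using smooth_on_open[OF V(1)] by blast
  qed
  ultimately show ?thesis
    unfolding metric_reps_def riemannian_metric_on_def
    using image_tilde(1) metric_repsD[OF g \<psi>_U] D\<psi>_nonzero by (auto simp: push_eq)
qed

lemma collar_\<psi>:
  assumes "\<epsilon> > 0"
  obtains d where "d > 0" "\<And>y. 1 - d < norm y \<Longrightarrow> norm y < 1 \<Longrightarrow> y \<in> \<theta> ` U"
    "\<And>y. 1 - d < norm y \<Longrightarrow> norm y < 1 \<Longrightarrow> norm (\<psi> y) > 1 - \<epsilon>"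
proof (rule collar_image[OF image_tilde(1) smooth_on_continuous[OF inv_tilde_smooth] inv_tilde_sphere assms], assumption)
  fix d assume d: "d > 0" "\<And>y. 1 - d < norm y \<Longrightarrow> norm y < 1 \<Longrightarrow> y \<in> \<theta> ` U"
    "\<And>y. 1 - d < norm y \<Longrightarrow> norm y < 1 \<Longrightarrow> norm (inv_into (tilde U) \<theta> y) > 1 - \<epsilon>"
  show thesis by (rule that[of d]) (use d inv_tilde in auto)
qed

lemma collar_\<theta>:
  assumes "\<epsilon> > 0"
  obtains d where "d > 0" "\<And>x. 1 - d < norm x \<Longrightarrow> norm x < 1 \<Longrightarrow> x \<in> U"
    "\<And>x. 1 - d < norm x \<Longrightarrow> norm x < 1 \<Longrightarrow> norm (\<theta> x) > 1 - \<epsilon>"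
  by (rule collar_image[OF nbhd_U smooth_on_continuous[OF smooth_on_\<theta>] sphere_fixed assms]) blast+

text \<open>The point is that the image of the smaller set still contains a collar; this is
  \<open>collar_\<psi>\<close>, continuity of the inverse up to the sphere. Restriction brings
  representatives of a map and of a metric to one domain.\<close>

lemma restrict:
  assumes W: "nbhd_infinity W" "W \<subseteq> U"
  shows "boundary_diffeo W \<theta>" "((U, \<theta>), (W, \<theta>)) \<in> diffeo_germ_rel"
proof -
  have "open (\<theta> ` W)"
  proof -
    have "open (\<theta> ` U \<inter> \<psi> -` W)"
      using W by (intro continuous_open_preimage smooth_continuous_on[OF smooth_\<psi>] V) (auto simp: nbhd_infinity_iff)
    moreover have "\<theta> ` U \<inter> \<psi> -` W = \<theta> ` W" using W(2) \<psi>_\<theta> by force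
    ultimately show ?thesis by simp
  qed
  moreover obtain \<epsilon> where \<epsilon>: "\<epsilon> > 0" "\<And>x. 1 - \<epsilon> < norm x \<Longrightarrow> norm x < 1 \<Longrightarrow> x \<in> W"
    using W(1) by (auto simp: nbhd_infinity_iff)
  obtain d where d: "d > 0" "\<And>y. 1 - d < norm y \<Longrightarrow> norm y < 1 \<Longrightarrow> y \<in> \<theta> ` U"
    "\<And>y. 1 - d < norm y \<Longrightarrow> norm y < 1 \<Longrightarrow> norm (\<psi> y) > 1 - \<epsilon>"
    by (rule collar_\<psi>[OF \<epsilon>(1)]) blast
  have "y \<in> \<theta> ` W" if y: "1 - d < norm y" "norm y < 1" for y
  proof -
    have yV: "y \<in> \<theta> ` U" "norm (\<psi> y) > 1 - \<epsilon>" using d(2,3)[OF y] by auto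
    then have "\<psi> y \<in> W" using \<psi>_U[OF yV(1)] U(2) by (intro \<epsilon>(2)) auto
    then show ?thesis using \<theta>_\<psi>[OF yV(1)] by (metis imageI)
  qed
  then have "\<exists>\<epsilon>>0. \<forall>x. 1 - \<epsilon> < norm x \<and> norm x < 1 \<longrightarrow> x \<in> \<theta> ` W" using d(1) by blast
  ultimately have nW: "nbhd_infinity (\<theta> ` W)"
    unfolding nbhd_infinity_iff using V(2) W(2) by blast
  have tW: "\<theta> ` tilde W = tilde (\<theta> ` W)"
    using sphere_fixed by (force simp: tilde_def image_Un)
  have sub: "tilde W \<subseteq> tilde U" "tilde (\<theta> ` W) \<subseteq> tilde (\<theta> ` U)" using W(2) by (auto simp: tilde_def)
  have inj: "inj_on \<theta> (tilde W)" using inj_tilde sub(1) by (rule inj_on_subset)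
  have inv: "inv_into (tilde U) \<theta> y = inv_into (tilde W) \<theta> y" if yW: "y \<in> \<theta> ` tilde W" for y
  proof -
    obtain x where "x \<in> tilde W" "y = \<theta> x" using yW by blast
    then show ?thesis using inv_into_f_f[OF inj] inv_into_f_f[OF inj_tilde] sub(1) by auto
  qed
  have "smooth_on (tilde (\<theta> ` W)) (inv_into (tilde U) \<theta>)" by (rule smooth_on_subset[OF inv_tilde_smooth sub(2)])
  then have "smooth_on (\<theta> ` tilde W) (inv_into (tilde W) \<theta>)"
    unfolding tW smooth_on_def using inv tW by (metis (no_types, lifting) IntD2)
  then have r: "(W, \<theta>) \<in> diffeo_reps"
    unfolding diffeo_reps_def using W nW tW inj smooth_on_subset[OF smooth_on_\<theta> sub(1)] by auto
  then show "boundary_diffeo W \<theta>" by unfold_locales (auto simp: sphere_fixed)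
  show "((U, \<theta>), (W, \<theta>)) \<in> diffeo_germ_rel"
    unfolding diffeo_germ_rel_def using r rep W by auto
qed

end

section \<open>Germs of diffeomorphisms and the pushforward\<close>

lemma diffeo_germs_reps: "\<Theta> \<in> diffeo_germs \<Longrightarrow> p \<in> \<Theta> \<Longrightarrow> p \<in> diffeo_reps"
  unfolding diffeo_germs_def using in_quotient_imp_subset[OF equiv_diffeo_germ_rel] by blast

lemma diffeo_germs_rel: "\<Theta> \<in> diffeo_germs \<Longrightarrow> p \<in> \<Theta> \<Longrightarrow> q \<in> \<Theta> \<Longrightarrow> (p, q) \<in> diffeo_germ_rel"
  unfolding diffeo_germs_def using in_quotient_imp_in_rel[OF equiv_diffeo_germ_rel] by blast

lemma diffeo_germs_closed: "\<Theta> \<in> diffeo_germs \<Longrightarrow> p \<in> \<Theta> \<Longrightarrow> (p, q) \<in> diffeo_germ_rel \<Longrightarrow> q \<in> \<Theta>"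
  unfolding diffeo_germs_def using in_quotient_imp_closed[OF equiv_diffeo_germ_rel] by blast

lemma diffeo_germs_eqI:
  assumes "\<Theta>1 \<in> diffeo_germs" "\<Theta>2 \<in> diffeo_germs" "p \<in> \<Theta>1" "q \<in> \<Theta>2" "(p, q) \<in> diffeo_germ_rel"
  shows "\<Theta>1 = \<Theta>2"
  using quotient_eqI[OF equiv_diffeo_germ_rel, of \<Theta>1 \<Theta>2 p q] assms by (simp add: diffeo_germs_def)

text \<open>The definition supplies the estimate for one representative; agreement near infinity
  transfers it to every other.\<close>

lemma I0_estimate:
  assumes \<Theta>: "\<Theta> \<in> I0 m" and rep: "(U, \<theta>) \<in> \<Theta>"
  obtains C \<epsilon> where "C \<ge> 0" "\<epsilon> > 0" "\<epsilon> \<le> 1" "\<And>x. 1 - \<epsilon> < norm x \<Longrightarrow> norm x < 1 \<Longrightarrow> x \<in> U"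
    "\<And>x. 1 - \<epsilon> < norm x \<Longrightarrow> norm x < 1 \<Longrightarrow> norm (\<theta> x - x) \<le> C * (1 - norm x) ^ m"
proof -
  obtain U0 \<theta>0 where r0: "(U0, \<theta>0) \<in> \<Theta>" "(\<lambda>x. norm (\<theta>0 x - x)) \<in> O[near_infinity](\<lambda>x. \<rho> x ^ m)"
    using \<Theta> unfolding I0_def by blast
  have "\<Theta> \<in> diffeo_germs" using \<Theta> by (simp add: I0_def)
  from diffeo_germs_rel[OF this rep r0(1)] obtain W where
    W: "nbhd_infinity W" "W \<subseteq> U \<inter> U0" "\<And>x. x \<in> tilde W \<Longrightarrow> \<theta> x = \<theta>0 x"
    unfolding diffeo_germ_rel_def by blast
  obtain \<epsilon>1 where \<epsilon>1: "\<epsilon>1 > 0" "\<And>x. 1 - \<epsilon>1 < norm x \<Longrightarrow> norm x < 1 \<Longrightarrow> x \<in> W"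
    using W(1) unfolding nbhd_infinity_iff by blast
  obtain C \<epsilon>2 where C: "C \<ge> 0" "\<epsilon>2 > 0"
    "\<And>x. 1 - \<epsilon>2 < norm x \<Longrightarrow> norm x < 1 \<Longrightarrow> \<bar>norm (\<theta>0 x - x)\<bar> \<le> C * (1 - norm x) ^ m"
    by (rule bigo_near_infinityD[OF r0(2)]) blast
  show thesis
  proof (rule that[of C "min 1 (min \<epsilon>1 \<epsilon>2)"])
    fix x :: "real^'a" assume x: "1 - min 1 (min \<epsilon>1 \<epsilon>2) < norm x" "norm x < 1"
    then have xW: "x \<in> W" by (intro \<epsilon>1) auto
    then show "x \<in> U" using W(2) by auto
    have "\<theta> x = \<theta>0 x" using W(3) xW by (simp add: tilde_def)
    then show "norm (\<theta> x - x) \<le> C * (1 - norm x) ^ m" using C(3)[of x] x by simp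
  qed (use C \<epsilon>1 in auto)
qed

text \<open>On the sphere \<open>\<theta> x\<close> is the limit of
  \<open>\<theta> (r *\<^sub>R x)\<close> as \<open>r\<close> tends to 1, and decay of the
  displacement, of positive order, identifies this limit with \<open>x\<close>.\<close>

lemma I0_boundary_diffeo:
  assumes \<Theta>: "\<Theta> \<in> I0 m" and m: "m > 0" and rep: "(U, \<theta>) \<in> \<Theta>"
  shows "boundary_diffeo U \<theta>"
proof
  show r: "(U, \<theta>) \<in> diffeo_reps" using diffeo_germs_reps \<Theta> rep unfolding I0_def by blast
  obtain C \<epsilon> where C: "C \<ge> 0" "\<epsilon> > 0" "\<epsilon> \<le> 1" "\<And>x. 1 - \<epsilon> < norm x \<Longrightarrow> norm x < 1 \<Longrightarrow> x \<in> U"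
    "\<And>x. 1 - \<epsilon> < norm x \<Longrightarrow> norm x < 1 \<Longrightarrow> norm (\<theta> x - x) \<le> C * (1 - norm x) ^ m"
    by (rule I0_estimate[OF \<Theta> rep]) blast
  have cont: "continuous_on (tilde U) \<theta>"
    using r by (auto simp: diffeo_reps_def intro: smooth_on_continuous)
  fix x :: "real^'a" assume x: "norm x = 1"
  have near: "\<forall>\<^sub>F r in at_left (1::real). 1 - \<epsilon> < r \<and> r < 1"
    unfolding eventually_at_left_field using C(2) by (intro exI[of _ "1 - \<epsilon>"]) auto
  have "continuous (at x within tilde U) \<theta>"
    using cont x by (simp add: continuous_on_eq_continuous_within tilde_def)
  moreover have "filterlim (\<lambda>r. r *\<^sub>R x) (at x within tilde U) (at_left 1)"
    unfolding filterlim_at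
  proof
    have "((\<lambda>r. r *\<^sub>R x) \<longlongrightarrow> 1 *\<^sub>R x) (at_left 1)" by (intro tendsto_intros)
    then show "((\<lambda>r. r *\<^sub>R x) \<longlongrightarrow> x) (at_left 1)" by simp
    show "\<forall>\<^sub>F r in at_left 1. r *\<^sub>R x \<in> tilde U \<and> r *\<^sub>R x \<noteq> x"
      using near
    proof eventually_elim
      case (elim r)
      then have n: "norm (r *\<^sub>R x) = r" using x C(3) by simp
      then have "r *\<^sub>R x \<in> U" using elim by (intro C(4)) auto
      moreover have "r *\<^sub>R x \<noteq> x" using n elim x by force
      ultimately show ?case by (simp add: tilde_def)
    qed
  qed
  ultimately have "((\<lambda>r. \<theta> (r *\<^sub>R x)) \<longlongrightarrow> \<theta> x) (at_left 1)"
    unfolding continuous_within by (rule filterlim_compose)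
  moreover have "((\<lambda>r. \<theta> (r *\<^sub>R x)) \<longlongrightarrow> x) (at_left 1)"
  proof -
    have "((\<lambda>r. \<theta> (r *\<^sub>R x) - r *\<^sub>R x) \<longlongrightarrow> 0) (at_left 1)"
    proof (rule Lim_null_comparison)
      show "\<forall>\<^sub>F r in at_left 1. norm (\<theta> (r *\<^sub>R x) - r *\<^sub>R x) \<le> C * (1 - r) ^ m"
        using near
      proof eventually_elim
        case (elim r)
        then have n: "norm (r *\<^sub>R x) = r" using x C(3) by simp
        show ?case using C(5)[of "r *\<^sub>R x"] elim unfolding n by blast
      qed
      have "((\<lambda>r. C * (1 - r) ^ m) \<longlongrightarrow> C * (1 - 1) ^ m) (at_left 1)" by (intro tendsto_intros)
      then show "((\<lambda>r. C * (1 - r) ^ m) \<longlongrightarrow> 0) (at_left (1::real))" using m by (simp add: power_0_left)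
    qed
    moreover have "((\<lambda>r. r *\<^sub>R x) \<longlongrightarrow> 1 *\<^sub>R x) (at_left 1)" by (intro tendsto_intros)
    ultimately have "((\<lambda>r. (\<theta> (r *\<^sub>R x) - r *\<^sub>R x) + r *\<^sub>R x) \<longlongrightarrow> 0 + 1 *\<^sub>R x) (at_left 1)" by (rule tendsto_add)
    then show ?thesis by simp
  qed
  ultimately show "\<theta> x = x" using tendsto_unique trivial_limit_at_left_real by blast
qed

lemma metric_restrict:
  assumes "(U, g) \<in> metric_reps" "nbhd_infinity W" "W \<subseteq> U"
  shows "((U, g), (W, g)) \<in> metric_germ_rel"
proof -
  have "(W, g) \<in> metric_reps"
    using assms smooth_on_subset unfolding metric_reps_def riemannian_metric_on_def by blast
  then show ?thesis using assms by (auto simp: metric_germ_rel_def)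
qed

text \<open>Both representatives remain in their germs when restricted to the intersection; this
  provides the pairs over which \<open>pushforward\<close> ranges.\<close>

lemma common_domain:
  assumes \<Theta>: "\<Theta> \<in> I0 m" "m > 0" and \<gamma>: "\<gamma> \<in> metric_germs"
    and r: "(U, \<theta>) \<in> \<Theta>" "(U', g) \<in> \<gamma>"
  shows "(U \<inter> U', \<theta>) \<in> \<Theta>" "(U \<inter> U', g) \<in> \<gamma>"
proof -
  interpret boundary_diffeo U \<theta> by (rule I0_boundary_diffeo[OF \<Theta> r(1)])
  have m: "(U', g) \<in> metric_reps" by (rule metric_germs_reps[OF \<gamma> r(2)])
  then have n: "nbhd_infinity (U \<inter> U')" using nbhd_U by (auto simp: metric_reps_def intro: nbhd_infinity_Int)
  show "(U \<inter> U', \<theta>) \<in> \<Theta>"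
    using diffeo_germs_closed[OF _ r(1) restrict(2)[OF n]] \<Theta> by (simp add: I0_def)
  show "(U \<inter> U', g) \<in> \<gamma>"
    using metric_germs_closed[OF \<gamma> r(2) metric_restrict[OF m n]] by simp
qed

text \<open>Independence of the representatives: on a common smaller domain the maps and hence their
  inverses agree, and since its image is open, so do the derivatives of the inverses.\<close>

lemma push_rel:
  assumes \<Theta>: "\<Theta> \<in> I0 m" "m > 0" and \<gamma>: "\<gamma> \<in> metric_germs"
    and r: "(U, \<theta>) \<in> \<Theta>" "(U, g) \<in> \<gamma>" and r': "(U', \<theta>') \<in> \<Theta>" "(U', g') \<in> \<gamma>"
  shows "((\<theta> ` U, pushforward_metric U \<theta> g), (\<theta>' ` U', pushforward_metric U' \<theta>' g')) \<in> metric_germ_rel"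
proof -
  interpret a: boundary_diffeo U \<theta> by (rule I0_boundary_diffeo[OF \<Theta> r(1)])
  interpret b: boundary_diffeo U' \<theta>' by (rule I0_boundary_diffeo[OF \<Theta> r'(1)])
  have "\<Theta> \<in> diffeo_germs" using \<Theta> by (simp add: I0_def)
  from diffeo_germs_rel[OF this r(1) r'(1)] obtain W1 where
    W1: "nbhd_infinity W1" "W1 \<subseteq> U \<inter> U'" "\<And>x. x \<in> tilde W1 \<Longrightarrow> \<theta> x = \<theta>' x"
    unfolding diffeo_germ_rel_def by blast
  from metric_germs_rel[OF \<gamma> r(2) r'(2)] obtain W2 where
    W2: "nbhd_infinity W2" "W2 \<subseteq> U \<inter> U'" "\<And>x. x \<in> W2 \<Longrightarrow> g x = g' x"
    unfolding metric_germ_rel_def by blast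
  define W where "W = W1 \<inter> W2"
  have W: "nbhd_infinity W" "W \<subseteq> U" "W \<subseteq> U'" "\<And>x. x \<in> W \<Longrightarrow> \<theta> x = \<theta>' x" "\<And>x. x \<in> W \<Longrightarrow> g x = g' x"
    using W1 W2 nbhd_infinity_Int by (auto simp: W_def tilde_def)
  interpret c: boundary_diffeo W \<theta> by (rule a.restrict(1)[OF W(1,2)])
  have im: "\<theta> ` W = \<theta>' ` W" using W(4) by (intro image_cong) auto
  have eq: "a.\<psi> y = b.\<psi> y" if yW: "y \<in> \<theta> ` W" for y
  proof -
    obtain x where x: "x \<in> W" "y = \<theta> x" using yW by blast
    then have "x \<in> U" "x \<in> U'" "y = \<theta>' x" using W by auto
    then show ?thesis using a.\<psi>_\<theta>[of x] b.\<psi>_\<theta>[of x] x(2) by simp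
  qed
  have "pushforward_metric U \<theta> g y = pushforward_metric U' \<theta>' g' y" if y: "y \<in> \<theta> ` W" for y
  proof -
    have "(a.\<psi> has_derivative frechet_derivative b.\<psi> (at y)) (at y)"
    proof (rule has_derivative_transform_within_open[OF _ c.V(1) y])
      show "(b.\<psi> has_derivative frechet_derivative b.\<psi> (at y)) (at y)"
        using y W(3) im by (intro b.D\<psi>) auto
    qed (simp add: eq)
    then have d: "frechet_derivative a.\<psi> (at y) = frechet_derivative b.\<psi> (at y)" by (rule frechet_derivative_eqI)
    have "a.\<psi> y \<in> W" using y a.\<psi>_\<theta> W(2) by auto
    then show ?thesis
      by (intro ext) (simp add: a.push_eq b.push_eq d eq[OF y, symmetric] W(5))
  qed
  moreover have "(\<theta> ` U, pushforward_metric U \<theta> g) \<in> metric_reps" "(\<theta>' ` U', pushforward_metric U' \<theta>' g') \<in> metric_reps"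
    using a.push_metric_reps b.push_metric_reps metric_germs_reps[OF \<gamma>] r r' by auto
  moreover have "\<theta> ` W \<subseteq> \<theta> ` U \<inter> \<theta>' ` U'"
    using image_mono[OF W(2), of \<theta>] image_mono[OF W(3), of \<theta>'] im by simp
  ultimately show ?thesis
    unfolding metric_germ_rel_def using c.image_tilde(1) by auto
qed

text \<open>By \<open>push_rel\<close> all classes in the defining union are equal.\<close>

lemma pushforward_eq:
  assumes \<Theta>: "\<Theta> \<in> I0 m" "m > 0" and \<gamma>: "\<gamma> \<in> metric_germs"
    and r: "(U, \<theta>) \<in> \<Theta>" "(U, g) \<in> \<gamma>"
  shows "pushforward \<Theta> \<gamma> = metric_germ_rel `` {(\<theta> ` U, pushforward_metric U \<theta> g)}"
proof -
  have "metric_germ_rel `` {(\<theta>' ` U', pushforward_metric U' \<theta>' g')} =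
      metric_germ_rel `` {(\<theta> ` U, pushforward_metric U \<theta> g)}"
    if "(U', \<theta>') \<in> \<Theta>" "(U', g') \<in> \<gamma>" for U' \<theta>' g'
    by (rule equiv_class_eq[OF equiv_metric_germ_rel push_rel[OF \<Theta> \<gamma> that r]])
  then show ?thesis unfolding pushforward_def using r by blast
qed

text \<open>The representative that witnesses transversality need not have the form
  \<open>pushforward_metric U \<theta> g\<close>; it agrees with one of that form on the smaller set
  \<open>W\<close>.\<close>

lemma transverse_pushforwardD:
  assumes \<Theta>: "\<Theta> \<in> I0 m" "m > 0" and \<gamma>: "\<gamma> \<in> metric_germs" and t: "transverse (pushforward \<Theta> \<gamma>)"
  obtains U \<theta> g W where "(U, \<theta>) \<in> \<Theta>" "(U, g) \<in> \<gamma>" "nbhd_infinity W" "W \<subseteq> \<theta> ` U"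
    "\<And>y v. y \<in> W \<Longrightarrow> pushforward_metric U \<theta> g y y v = (y \<bullet> v) / (\<rho> y)\<^sup>2"
proof -
  obtain Y \<kappa> where Y: "(Y, \<kappa>) \<in> pushforward \<Theta> \<gamma>"
    "\<And>x v. x \<in> Y \<Longrightarrow> \<kappa> x (position_field x) v = hyperbolic_metric x (position_field x) v"
    using t unfolding transverse_def by blast
  obtain U \<theta> g where r: "(U, \<theta>) \<in> \<Theta>" "(U, g) \<in> \<gamma>"
    "((\<theta> ` U, pushforward_metric U \<theta> g), (Y, \<kappa>)) \<in> metric_germ_rel"
    using Y(1) unfolding pushforward_def by blast
  obtain W where W: "nbhd_infinity W" "W \<subseteq> \<theta> ` U \<inter> Y" "\<And>x. x \<in> W \<Longrightarrow> pushforward_metric U \<theta> g x = \<kappa> x"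
    using r(3) unfolding metric_germ_rel_def by blast
  show thesis
    by (rule that[OF r(1,2) W(1)])
      (use W Y(2) in \<open>auto simp: position_field_def hyperbolic_metric_def euclidean_metric_def\<close>)
qed

section \<open>Uniqueness\<close>

text \<open>Positivity is evaluated at \<open>w - s *\<^sub>R v\<close>, with the \<open>s\<close>
  that minimises the length.\<close>

lemma positive_Cauchy_Schwarz:
  fixes T :: "real^'n \<Rightarrow> real^'n \<Rightarrow> real"
  assumes T: "bilinear T" "\<And>v w. T v w = T w v" "\<And>v. v \<noteq> 0 \<Longrightarrow> T v v > 0"
  shows "(T v w)\<^sup>2 \<le> T v v * T w w"
proof (cases "v = 0")
  case True
  then show ?thesis using T(1) by (simp add: bilinear_lzero)
next
  case False
  then have p: "T v v > 0" by (rule T(3))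
  define s where "s = T v w / T v v"
  have "0 \<le> T (w - s *\<^sub>R v) (w - s *\<^sub>R v)"
    using T(3)[of "w - s *\<^sub>R v"] bilinear_lzero[OF T(1)] by (cases "w - s *\<^sub>R v = 0") auto
  also have "\<dots> = T w w - 2 * s * T v w + s * (s * T v v)"
    using T(1) T(2)[of w v]
    by (simp add: bilinear_lsub bilinear_rsub bilinear_lmul bilinear_rmul algebra_simps)
  also have "s * T v v = T v w" using p by (simp add: s_def)
  finally have "s * T v w \<le> T w w" by simp
  then have "s * T v w * T v v \<le> T w w * T v v" using p by (intro mult_right_mono) auto
  moreover have "s * T v w * T v v = (T v w)\<^sup>2" using p by (simp add: s_def power2_eq_square)
  ultimately show ?thesis by (simp add: mult.commute)
qed

text \<open>The transition map \<open>\<Phi>\<close> between two transverse pushforwards of one metric, with differential \<open>D\<close>;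
  \<open>T y\<close> is the second pushforward at the point \<open>\<Phi> y\<close>.\<close>

locale transverse_map =
  fixes c C :: real and \<Phi> :: "real^'n \<Rightarrow> real^'n" and D :: "real^'n \<Rightarrow> real^'n \<Rightarrow> real^'n"
    and T :: "real^'n \<Rightarrow> real^'n \<Rightarrow> real^'n \<Rightarrow> real"
  assumes c: "0 < c" "c \<le> 1"
    and \<Phi>: "\<And>y. 1 - c < norm y \<Longrightarrow> norm y < 1 \<Longrightarrow> (\<Phi> has_derivative D y) (at y)"
      "\<And>y. 1 - c < norm y \<Longrightarrow> norm y < 1 \<Longrightarrow> norm (\<Phi> y) < 1"
      "\<And>y. 1 - c < norm y \<Longrightarrow> norm y < 1 \<Longrightarrow> \<Phi> y \<noteq> 0"
      "\<And>y. 1 - c < norm y \<Longrightarrow> norm y < 1 \<Longrightarrow> norm (\<Phi> y - y) \<le> C * (1 - norm y)\<^sup>2"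
    and T: "\<And>y. 1 - c < norm y \<Longrightarrow> norm y < 1 \<Longrightarrow> bilinear (T y)"
      "\<And>y v w. 1 - c < norm y \<Longrightarrow> norm y < 1 \<Longrightarrow> T y v w = T y w v"
      "\<And>y v. 1 - c < norm y \<Longrightarrow> norm y < 1 \<Longrightarrow> v \<noteq> 0 \<Longrightarrow> T y v v > 0"
    and transv: "\<And>y v. 1 - c < norm y \<Longrightarrow> norm y < 1 \<Longrightarrow> T y (\<Phi> y) v = (\<Phi> y \<bullet> v) / (\<rho> (\<Phi> y))\<^sup>2"
      "\<And>y. 1 - c < norm y \<Longrightarrow> norm y < 1 \<Longrightarrow> T y (D y y) (D y y) = (norm y)\<^sup>2 / (\<rho> y)\<^sup>2"
begin

lemma rho_pos: "norm (x::real^'m) < 1 \<Longrightarrow> \<rho> x > 0"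
  using rho_bounds(1)[of x] by simp

text \<open>In the second metric the image of the ray of \<open>\<omega>\<close> has the speed
  \<open>1 / \<rho>\<close> that the ray itself has in the first metric, by transversality of the
  first.\<close>

lemma ray:
  assumes \<omega>: "norm \<omega> = 1" and r: "1 - c < r" "r < 1"
  shows "norm (r *\<^sub>R \<omega>) = r" "0 < r"
    "((\<lambda>r. \<Phi> (r *\<^sub>R \<omega>)) has_vector_derivative D (r *\<^sub>R \<omega>) \<omega>) (at r)"
    "T (r *\<^sub>R \<omega>) (D (r *\<^sub>R \<omega>) \<omega>) (D (r *\<^sub>R \<omega>) \<omega>) = 1 / (\<rho> (r *\<^sub>R \<omega>))\<^sup>2"
proof -
  show r0: "0 < r" using r c by simp
  then show n: "norm (r *\<^sub>R \<omega>) = r" using \<omega> by simp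
  have d: "(\<Phi> has_derivative D (r *\<^sub>R \<omega>)) (at (r *\<^sub>R \<omega>))" using \<Phi>(1) n r by simp
  have lin: "linear (D (r *\<^sub>R \<omega>))" by (rule has_derivative_linear[OF d])
  have "((\<lambda>r. r *\<^sub>R \<omega>) has_derivative (\<lambda>h. h *\<^sub>R \<omega>)) (at r)" by (auto intro!: derivative_eq_intros)
  from has_derivative_compose[OF this d]
  show "((\<lambda>r. \<Phi> (r *\<^sub>R \<omega>)) has_vector_derivative D (r *\<^sub>R \<omega>) \<omega>) (at r)"
    by (simp add: has_vector_derivative_def linear_scale[OF lin])
  have b: "bilinear (T (r *\<^sub>R \<omega>))" using T(1) n r by simp
  have "T (r *\<^sub>R \<omega>) (D (r *\<^sub>R \<omega>) (r *\<^sub>R \<omega>)) (D (r *\<^sub>R \<omega>) (r *\<^sub>R \<omega>)) = r\<^sup>2 / (\<rho> (r *\<^sub>R \<omega>))\<^sup>2"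
    using transv(2)[of "r *\<^sub>R \<omega>"] n r by simp
  moreover have "D (r *\<^sub>R \<omega>) (r *\<^sub>R \<omega>) = r *\<^sub>R D (r *\<^sub>R \<omega>) \<omega>" by (rule linear_scale[OF lin])
  ultimately have "r\<^sup>2 * T (r *\<^sub>R \<omega>) (D (r *\<^sub>R \<omega>) \<omega>) (D (r *\<^sub>R \<omega>) \<omega>) = r\<^sup>2 * (1 / (\<rho> (r *\<^sub>R \<omega>))\<^sup>2)"
    by (simp add: bilinear_lmul[OF b] bilinear_rmul[OF b] power2_eq_square)
  then show "T (r *\<^sub>R \<omega>) (D (r *\<^sub>R \<omega>) \<omega>) (D (r *\<^sub>R \<omega>) \<omega>) = 1 / (\<rho> (r *\<^sub>R \<omega>))\<^sup>2"
    by (rule mult_left_cancel[THEN iffD1, rotated]) (use r0 in simp)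
qed

text \<open>Cauchy-Schwarz for position \<open>z\<close> and velocity \<open>z'\<close>;
  transversality turns \<open>T z z'\<close> and \<open>T z z\<close> into Euclidean products. The
  left-hand side is the rate of change of the hyperbolic distance from the origin to
  \<open>z\<close>.\<close>

lemma radial_speed:
  assumes \<omega>: "norm \<omega> = 1" and r: "1 - c < r" "r < 1"
  defines "z \<equiv> \<Phi> (r *\<^sub>R \<omega>)" and "z' \<equiv> D (r *\<^sub>R \<omega>) \<omega>"
  shows "(z \<bullet> z') / norm z / \<rho> z \<le> 1 / \<rho> (r *\<^sub>R \<omega>)"
proof -
  note R = ray[OF \<omega> r]
  have y: "1 - c < norm (r *\<^sub>R \<omega>)" "norm (r *\<^sub>R \<omega>) < 1" using R(1) r by auto
  have z: "norm z > 0" "\<rho> z > 0" "\<rho> (r *\<^sub>R \<omega>) > 0"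
    using \<Phi>(3)[OF y] rho_pos[OF \<Phi>(2)[OF y]] rho_pos[OF y(2)] by (auto simp only: z_def zero_less_norm_iff)
  have "(T (r *\<^sub>R \<omega>) z z')\<^sup>2 \<le> T (r *\<^sub>R \<omega>) z z * T (r *\<^sub>R \<omega>) z' z'"
    by (rule positive_Cauchy_Schwarz[OF T(1)[OF y] T(2)[OF y] T(3)[OF y]])
  then have "((z \<bullet> z') / (\<rho> z)\<^sup>2)\<^sup>2 \<le> (norm z)\<^sup>2 / (\<rho> z)\<^sup>2 * (1 / (\<rho> (r *\<^sub>R \<omega>))\<^sup>2)"
    using transv(1)[OF y] R(4) by (simp add: z_def z'_def power2_norm_eq_inner)
  then have "((z \<bullet> z') / (\<rho> z)\<^sup>2)\<^sup>2 \<le> (norm z / \<rho> z * (1 / \<rho> (r *\<^sub>R \<omega>)))\<^sup>2"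
    by (simp add: power_mult_distrib power_divide)
  then have "(z \<bullet> z') / (\<rho> z)\<^sup>2 \<le> norm z / \<rho> z * (1 / \<rho> (r *\<^sub>R \<omega>))"
    using z by (intro power2_le_imp_le[of "(z \<bullet> z') / (\<rho> z)\<^sup>2"]) auto
  then have "(z \<bullet> z') / (\<rho> z)\<^sup>2 * (\<rho> z / norm z) \<le> norm z / \<rho> z * (1 / \<rho> (r *\<^sub>R \<omega>)) * (\<rho> z / norm z)"
    using z by (intro mult_right_mono) auto
  then show ?thesis using z by (simp add: power2_eq_square field_simps)
qed

text \<open>\<open>- ln hradius\<close> is the hyperbolic distance to the origin, and its radial
  derivative is \<open>1 / \<rho>\<close>.\<close>

lemma hradius_log_derivative:
  fixes x :: "real^'m" assumes "x \<noteq> 0" "norm x < 1" shows "(hradius_grad x \<bullet> v) / hradius x = - ((x \<bullet> v) / norm x / \<rho> x)"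
proof -
  have p: "norm x > 0" "1 - norm x > 0" "1 + norm x > 0" using assms by auto
  have r: "\<rho> x = (1 - norm x) * (1 + norm x) / 2" by (simp add: \<rho>_def power2_eq_square algebra_simps)
  show ?thesis
    unfolding r hradius_def hradius_grad_def using p
    by (simp add: divide_simps power2_eq_square)
qed

text \<open>By \<open>radial_speed\<close>, \<open>ln hradius\<close> along the image minus
  \<open>ln hradius\<close> along the ray does not decrease. It tends to 0 at the sphere, since
  \<open>norm (\<Phi> y - y)\<close> is quadratic in \<open>1 - norm y\<close> while
  \<open>hradius\<close> vanishes to first order; so it is never positive.\<close>

lemma norm_nondecreasing:
  assumes y: "1 - c < norm y" "norm y < 1"
  shows "norm y \<le> norm (\<Phi> y)"
proof -
  define \<omega> where "\<omega> = y /\<^sub>R norm y"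
  have y0: "norm y > 0" using y c by linarith
  have \<omega>: "norm \<omega> = 1" "y = norm y *\<^sub>R \<omega>" using y0 by (auto simp: \<omega>_def)
  define f where "f r = ln (hradius (\<Phi> (r *\<^sub>R \<omega>))) - ln (hradius (r *\<^sub>R \<omega>))" for r
  have hp: "hradius x > 0" if "norm x < 1" for x :: "real^'n" using that hradius_pos by blast
  have sp: "norm (r *\<^sub>R \<omega>) < 1" "1 - c < norm (r *\<^sub>R \<omega>)" if "1 - c < r" "r < 1" for r
    using ray(1)[OF \<omega>(1) that] that by auto
  have df: "\<exists>f'. (f has_real_derivative f') (at r) \<and> 0 \<le> f'" if r: "1 - c < r" "r < 1" for r
  proof -
    note R = ray[OF \<omega>(1) r]
    define z z' where "z = \<Phi> (r *\<^sub>R \<omega>)" and "z' = D (r *\<^sub>R \<omega>) \<omega>"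
    have z: "z \<noteq> 0" "norm z < 1" using \<Phi>(2,3)[OF sp(2,1)[OF r]] by (auto simp: z_def)
    have r0: "r *\<^sub>R \<omega> \<noteq> 0" using R \<omega> by auto
    have 1: "((\<lambda>r. hradius (\<Phi> (r *\<^sub>R \<omega>))) has_real_derivative hradius_grad z \<bullet> z') (at r)"
      unfolding has_real_derivative_iff_has_vector_derivative has_vector_derivative_def
      using has_derivative_compose[OF R(3)[unfolded has_vector_derivative_def], of hradius "\<lambda>v. hradius_grad z \<bullet> v"]
        hradius_derivative[OF z(1)] by (simp add: z_def z'_def)
    have "((\<lambda>r. r *\<^sub>R \<omega>) has_derivative (\<lambda>h. h *\<^sub>R \<omega>)) (at r)" by (auto intro!: derivative_eq_intros)
    from has_derivative_compose[OF this hradius_derivative[OF r0]]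
    have 2: "((\<lambda>r. hradius (r *\<^sub>R \<omega>)) has_real_derivative hradius_grad (r *\<^sub>R \<omega>) \<bullet> \<omega>) (at r)"
      unfolding has_real_derivative_iff_has_vector_derivative has_vector_derivative_def by simp
    have "(f has_real_derivative (hradius_grad z \<bullet> z') / hradius z - (hradius_grad (r *\<^sub>R \<omega>) \<bullet> \<omega>) / hradius (r *\<^sub>R \<omega>)) (at r)"
      unfolding f_def
      using DERIV_ln_divide[THEN DERIV_chain2, OF hp 1] DERIV_ln_divide[THEN DERIV_chain2, OF hp 2] z sp[OF r]
      by (auto intro!: DERIV_diff simp: z_def)
    moreover have "(hradius_grad (r *\<^sub>R \<omega>) \<bullet> \<omega>) / hradius (r *\<^sub>R \<omega>) = - (1 / \<rho> (r *\<^sub>R \<omega>))"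
    proof -
      have "(r *\<^sub>R \<omega> \<bullet> \<omega>) / norm (r *\<^sub>R \<omega>) = 1"
        using R \<omega>(1) by (simp add: power2_norm_eq_inner[symmetric])
      then show ?thesis unfolding hradius_log_derivative[OF r0 sp(1)[OF r]] by simp
    qed
    moreover have "(hradius_grad z \<bullet> z') / hradius z \<ge> - (1 / \<rho> (r *\<^sub>R \<omega>))"
      unfolding hradius_log_derivative[OF z] using radial_speed[OF \<omega>(1) r] by (simp add: z_def z'_def)
    ultimately show ?thesis by (intro exI[of _ "(hradius_grad z \<bullet> z') / hradius z - (hradius_grad (r *\<^sub>R \<omega>) \<bullet> \<omega>) / hradius (r *\<^sub>R \<omega>)"]) auto
  qed
  have mono: "f (norm y) \<le> f r" if "norm y \<le> r" "r < 1" for r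
    using that(1)
  proof (rule DERIV_nonneg_imp_nondecreasing)
    show "\<exists>f'. (f has_real_derivative f') (at x) \<and> 0 \<le> f'" if "norm y \<le> x" "x \<le> r" for x
      using df[of x] that y \<open>r < 1\<close> by auto
  qed
  have "(f \<longlongrightarrow> 0) (at_left 1)"
  proof -
    define q where "q r = hradius (\<Phi> (r *\<^sub>R \<omega>)) / hradius (r *\<^sub>R \<omega>)" for r
    have C0: "C \<ge> 0"
      using order_trans[OF norm_ge_zero \<Phi>(4)[OF y]] y by (simp add: zero_le_mult_iff)
    have near: "\<forall>\<^sub>F r in at_left (1::real). 1 - c < r \<and> r < 1"
      unfolding eventually_at_left_field using c by (intro exI[of _ "1 - c"]) auto
    have "((\<lambda>r. q r - 1) \<longlongrightarrow> 0) (at_left 1)"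
    proof (rule Lim_null_comparison)
      show "\<forall>\<^sub>F r in at_left 1. norm (q r - 1) \<le> 4 * C * (1 - r)"
        using near
      proof eventually_elim
        case (elim r)
        then have r: "1 - c < r" "r < 1" by auto
        note R = ray[OF \<omega>(1) r]
        define z where "z = \<Phi> (r *\<^sub>R \<omega>)"
        have hr: "hradius (r *\<^sub>R \<omega>) = (1 - r) / (1 + r)" using R by (simp add: hradius_def)
        have "hradius z - hradius (r *\<^sub>R \<omega>) = 2 * (r - norm z) / ((1 + norm z) * (1 + r))"
          unfolding hr hradius_def[of z] using R(2) by (simp add: divide_simps) (simp add: algebra_simps)
        then have "\<bar>hradius z - hradius (r *\<^sub>R \<omega>)\<bar> = 2 * \<bar>r - norm z\<bar> / ((1 + norm z) * (1 + r))"
          using R(2) by (simp only: abs_divide abs_mult) simp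
        also have "\<dots> \<le> 2 * \<bar>r - norm z\<bar> / (1 * (1 + r))"
          using R(2) by (intro divide_left_mono mult_right_mono) auto
        also have "\<bar>r - norm z\<bar> \<le> C * (1 - r)\<^sup>2"
          using \<Phi>(4)[of "r *\<^sub>R \<omega>"] norm_triangle_ineq3[of z "r *\<^sub>R \<omega>"] R(1) r by (simp add: z_def)
        finally have d: "\<bar>hradius z - hradius (r *\<^sub>R \<omega>)\<bar> \<le> 2 * (C * (1 - r)\<^sup>2) / (1 + r)"
          using R(2) by (simp add: divide_right_mono)
        have "q r - 1 = (hradius z - hradius (r *\<^sub>R \<omega>)) / hradius (r *\<^sub>R \<omega>)"
          using hp[OF sp(1)[OF r]] by (simp add: q_def z_def diff_divide_distrib)
        then have "norm (q r - 1) = \<bar>hradius z - hradius (r *\<^sub>R \<omega>)\<bar> / hradius (r *\<^sub>R \<omega>)"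
          using hp[OF sp(1)[OF r]] by simp
        also have "\<dots> \<le> (2 * (C * (1 - r)\<^sup>2) / (1 + r)) / hradius (r *\<^sub>R \<omega>)"
          using d hp[OF sp(1)[OF r]] by (intro divide_right_mono) auto
        also have "\<dots> = 2 * C * (1 - r)"
          unfolding hr using r R(2) by (simp add: power2_eq_square)
        also have "\<dots> \<le> 4 * C * (1 - r)" using C0 r by (intro mult_right_mono) auto
        finally show ?case .
      qed
      have "((\<lambda>r. 4 * C * (1 - r)) \<longlongrightarrow> 4 * C * (1 - 1)) (at_left 1)" by (intro tendsto_intros)
      then show "((\<lambda>r. 4 * C * (1 - r)) \<longlongrightarrow> 0) (at_left 1)" by simp
    qed
    then have "(q \<longlongrightarrow> 1) (at_left 1)" by (simp add: LIM_zero_iff)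
    then have "((\<lambda>r. ln (q r)) \<longlongrightarrow> ln 1) (at_left 1)" by (rule tendsto_ln) simp
    moreover have "\<forall>\<^sub>F r in at_left 1. ln (q r) = f r"
      using near
    proof eventually_elim
      case (elim r)
      then have "hradius (\<Phi> (r *\<^sub>R \<omega>)) > 0" "hradius (r *\<^sub>R \<omega>) > 0"
        using hp sp[of r] \<Phi>(2)[of "r *\<^sub>R \<omega>"] by auto
      then show ?case by (simp add: q_def f_def ln_div)
    qed
    ultimately show ?thesis using Lim_transform_eventually by force
  qed
  moreover have "\<forall>\<^sub>F r in at_left 1. f (norm y) \<le> f r"
    unfolding eventually_at_left_field using mono y by (intro exI[of _ "norm y"]) auto
  ultimately have "f (norm y) \<le> 0"
    by (intro tendsto_lowerbound[of f 0 "at_left 1"]) auto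
  then have "hradius (\<Phi> y) \<le> hradius y"
    using hp[OF y(2)] hp[OF \<Phi>(2)[OF y]] \<omega>(2) by (simp add: f_def)
  then have "(1 - norm (\<Phi> y)) * (1 + norm y) \<le> (1 - norm y) * (1 + norm (\<Phi> y))"
    by (simp add: hradius_def divide_simps)
  then show ?thesis by (simp add: algebra_simps)
qed

text \<open>If norms are preserved, equality holds in Cauchy-Schwarz, so the velocity of the image
  of a ray is the multiple \<open>1 / r\<close> of its position. Hence the direction of the image
  point is constant along the ray, and the limit at the sphere shows that it is
  \<open>\<omega>\<close>.\<close>

lemma norm_preserving_imp_id:
  assumes eq: "\<And>y. 1 - c < norm y \<Longrightarrow> norm y < 1 \<Longrightarrow> norm (\<Phi> y) = norm y"
    and y: "1 - c < norm y" "norm y < 1"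
  shows "\<Phi> y = y"
proof -
  define \<omega> where "\<omega> = y /\<^sub>R norm y"
  have y0: "norm y > 0" using y c by linarith
  have \<omega>: "norm \<omega> = 1" "y = norm y *\<^sub>R \<omega>" using y0 by (auto simp: \<omega>_def)
  define I where "I = {1 - c<..<1::real}"
  define f where "f r = (1 / r) *\<^sub>R \<Phi> (r *\<^sub>R \<omega>)" for r
  have fd: "(f has_vector_derivative 0) (at r)" if rI: "r \<in> I" for r
  proof -
    have r: "1 - c < r" "r < 1" using rI by (auto simp: I_def)
    note R = ray[OF \<omega>(1) r]
    have yr: "1 - c < norm (r *\<^sub>R \<omega>)" "norm (r *\<^sub>R \<omega>) < 1" using R(1) r by auto
    define z z' where "z = \<Phi> (r *\<^sub>R \<omega>)" and "z' = D (r *\<^sub>R \<omega>) \<omega>"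
    have nz: "norm z = r" using eq[OF yr] R(1) by (simp add: z_def)
    have z0: "z \<noteq> 0" using \<Phi>(3)[OF yr] by (simp add: z_def)
    have "((\<lambda>r. norm (\<Phi> (r *\<^sub>R \<omega>))) has_derivative (\<lambda>h. (z \<bullet> (h *\<^sub>R z')) / norm z)) (at r)"
      using has_derivative_compose[OF R(3)[unfolded has_vector_derivative_def] norm_has_derivative] z0
      by (simp add: z_def z'_def)
    then have d1: "((\<lambda>r. norm (\<Phi> (r *\<^sub>R \<omega>))) has_real_derivative (z \<bullet> z') / norm z) (at r)"
      by (simp add: has_real_derivative_iff_has_vector_derivative has_vector_derivative_def)
    have d2: "((\<lambda>r. norm (\<Phi> (r *\<^sub>R \<omega>))) has_real_derivative 1) (at r)"
    proof (rule has_field_derivative_transform_within_open[of "\<lambda>r. r" 1 r I])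
      show "s = norm (\<Phi> (s *\<^sub>R \<omega>))" if "s \<in> I" for s
        using ray(1)[OF \<omega>(1), of s] eq[of "s *\<^sub>R \<omega>"] that by (simp add: I_def)
    qed (use rI in \<open>auto simp: I_def\<close>)
    have "(z \<bullet> z') / norm z = 1" using DERIV_unique[OF d1 d2] .
    then have zz': "z \<bullet> z' = r" using nz z0 by (simp add: field_simps)
    have \<rho>eq: "\<rho> z = \<rho> (r *\<^sub>R \<omega>)" using nz R(1) by (simp add: \<rho>_def)
    have \<rho>0: "\<rho> z > 0" using rho_pos[of z] nz r by simp
    have b: "bilinear (T (r *\<^sub>R \<omega>))" by (rule T(1)[OF yr])
    have t: "T (r *\<^sub>R \<omega>) z v = (z \<bullet> v) / (\<rho> z)\<^sup>2" for v using transv(1)[OF yr] by (simp add: z_def)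
    \<comment> \<open>The equality case made explicit: this vector has \<open>T\<close>-length
      zero.\<close>
    have "T (r *\<^sub>R \<omega>) (z' - (1/r) *\<^sub>R z) (z' - (1/r) *\<^sub>R z) =
        T (r *\<^sub>R \<omega>) z' z' - 2 / r * T (r *\<^sub>R \<omega>) z z' + 1 / r\<^sup>2 * T (r *\<^sub>R \<omega>) z z"
      using T(2)[OF yr, of z' z]
      by (simp add: bilinear_lsub[OF b] bilinear_rsub[OF b] bilinear_lmul[OF b] bilinear_rmul[OF b]
          power2_eq_square diff_divide_distrib)
    also have "\<dots> = 1 / (\<rho> z)\<^sup>2 - 2 / r * (r / (\<rho> z)\<^sup>2) + 1 / r\<^sup>2 * (r\<^sup>2 / (\<rho> z)\<^sup>2)"
    proof -
      have "T (r *\<^sub>R \<omega>) z' z' = 1 / (\<rho> z)\<^sup>2" using R(4) by (simp add: z'_def \<rho>eq)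
      moreover have "z \<bullet> z = r\<^sup>2" using nz by (simp add: power2_norm_eq_inner[symmetric])
      ultimately show ?thesis by (simp only: t zz')
    qed
    also have "\<dots> = 0" using R(2) \<rho>0 by (simp add: field_simps)
    finally have "z' = (1/r) *\<^sub>R z" using T(3)[OF yr, of "z' - (1/r) *\<^sub>R z"] by force
    moreover have "((\<lambda>r. 1 / r) has_real_derivative - (1 / r\<^sup>2)) (at r)"
      using R(2) by (auto intro!: derivative_eq_intros simp: power2_eq_square)
    from has_vector_derivative_scaleR[OF this R(3)]
    have "(f has_vector_derivative (1 / r) *\<^sub>R z' + (- (1 / r\<^sup>2)) *\<^sub>R z) (at r)"
      unfolding f_def z_def z'_def .
    ultimately show ?thesis by (simp add: power2_eq_square)
  qed
  have cI: "convex I" by (simp add: I_def convex_real_interval)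
  have fdI: "(f has_vector_derivative 0) (at r within I)" if "r \<in> I" for r
    using fd[OF that] by (rule has_vector_derivative_at_within)
  obtain u where u: "\<And>r. r \<in> I \<Longrightarrow> f r = u"
    by (rule has_vector_derivative_zero_constant[OF cI fdI]) blast+
  have near: "\<forall>\<^sub>F r in at_left (1::real). r \<in> I"
    unfolding eventually_at_left_field I_def using c by (intro exI[of _ "1 - c"]) auto
  have "((\<lambda>r. \<Phi> (r *\<^sub>R \<omega>) - r *\<^sub>R \<omega>) \<longlongrightarrow> 0) (at_left 1)"
  proof (rule Lim_null_comparison)
    show "\<forall>\<^sub>F r in at_left 1. norm (\<Phi> (r *\<^sub>R \<omega>) - r *\<^sub>R \<omega>) \<le> C * (1 - r)\<^sup>2"
      using near
    proof eventually_elim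
      case (elim r)
      then show ?case using \<Phi>(4)[of "r *\<^sub>R \<omega>"] ray(1)[OF \<omega>(1), of r] by (simp add: I_def)
    qed
    have "((\<lambda>r. C * (1 - r)\<^sup>2) \<longlongrightarrow> C * (1 - 1)\<^sup>2) (at_left 1)" by (intro tendsto_intros)
    then show "((\<lambda>r. C * (1 - r)\<^sup>2) \<longlongrightarrow> 0) (at_left 1)" by simp
  qed
  moreover have "\<forall>\<^sub>F r in at_left 1. \<Phi> (r *\<^sub>R \<omega>) - r *\<^sub>R \<omega> = r *\<^sub>R (u - \<omega>)"
    using near
  proof eventually_elim
    case (elim r)
    then have "r > 0" using c by (auto simp: I_def)
    then show ?case using u[OF elim] by (simp add: f_def algebra_simps flip: u[OF elim])
  qed
  ultimately have "((\<lambda>r. r *\<^sub>R (u - \<omega>)) \<longlongrightarrow> 0) (at_left 1)" by (rule Lim_transform_eventually)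
  moreover have "((\<lambda>r. r *\<^sub>R (u - \<omega>)) \<longlongrightarrow> 1 *\<^sub>R (u - \<omega>)) (at_left 1)" by (intro tendsto_intros)
  ultimately have "u = \<omega>" using tendsto_unique[OF trivial_limit_at_left_real] by fastforce
  moreover have "f (norm y) = u" by (rule u) (use y in \<open>auto simp: I_def\<close>)
  ultimately have "norm y *\<^sub>R f (norm y) = y" using \<omega>(2) by simp
  then show ?thesis using y0 \<omega>(2) by (simp add: f_def)
qed

end

lemma transverse_map_mono:
  assumes "transverse_map c C \<Phi> D T" "0 < c'" "c' \<le> c"
  shows "transverse_map c' C \<Phi> D T"
proof -
  interpret transverse_map c C \<Phi> D T by fact
  have sub: "1 - c < norm y" if "1 - c' < norm y" for y :: "real^'a" using that assms(3) by linarith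
  show ?thesis
    by unfold_locales
      (use assms(2,3) c(2) in \<open>simp_all add: \<Phi>[OF sub] T(1,3)[OF sub] transv[OF sub]\<close>, rule T(2)[OF sub])
qed

text \<open>Both maps displace by order at least 2, so the transition map does too. It pulls the
  second pushforward back to the first because both come from one metric. The many radii keep all
  points involved where the representatives agree and are transverse.\<close>

lemma transition_transverse:
  fixes \<gamma> :: "'n::finite metric_germ"
  assumes \<Theta>1: "\<Theta>1 \<in> I0 m" and \<Theta>2: "\<Theta>2 \<in> I0 m" and m: "m \<ge> 2" and \<gamma>: "\<gamma> \<in> metric_germs"
    and r1: "(U1, \<theta>1) \<in> \<Theta>1" "(U1, g1) \<in> \<gamma>" "nbhd_infinity W1" "W1 \<subseteq> \<theta>1 ` U1"
      "\<And>y v. y \<in> W1 \<Longrightarrow> pushforward_metric U1 \<theta>1 g1 y y v = (y \<bullet> v) / (\<rho> y)\<^sup>2"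
    and r2: "(U2, \<theta>2) \<in> \<Theta>2" "(U2, g2) \<in> \<gamma>" "nbhd_infinity W2" "W2 \<subseteq> \<theta>2 ` U2"
      "\<And>y v. y \<in> W2 \<Longrightarrow> pushforward_metric U2 \<theta>2 g2 y y v = (y \<bullet> v) / (\<rho> y)\<^sup>2"
  obtains c C where
    "transverse_map c C (\<lambda>y. \<theta>2 (inv_into U1 \<theta>1 y)) (\<lambda>y. frechet_derivative (\<lambda>y. \<theta>2 (inv_into U1 \<theta>1 y)) (at y))
      (\<lambda>y. pushforward_metric U2 \<theta>2 g2 (\<theta>2 (inv_into U1 \<theta>1 y)))"
    "\<And>y. 1 - c < norm y \<Longrightarrow> norm y < 1 \<Longrightarrow> y \<in> \<theta>1 ` U1"
    "\<And>y. 1 - c < norm y \<Longrightarrow> norm y < 1 \<Longrightarrow> inv_into U1 \<theta>1 y \<in> U2"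
proof -
  have m0: "m > 0" using m by simp
  interpret a: boundary_diffeo U1 \<theta>1 by (rule I0_boundary_diffeo[OF \<Theta>1 m0 r1(1)])
  interpret b: boundary_diffeo U2 \<theta>2 by (rule I0_boundary_diffeo[OF \<Theta>2 m0 r2(1)])
  obtain Wg where Wg: "nbhd_infinity Wg" "Wg \<subseteq> U1 \<inter> U2" "\<And>x. x \<in> Wg \<Longrightarrow> g1 x = g2 x"
    using metric_germs_rel[OF \<gamma> r1(2) r2(2)] unfolding metric_germ_rel_def by blast
  obtain \<epsilon>1 where \<epsilon>1: "\<epsilon>1 > 0" "\<And>x. 1 - \<epsilon>1 < norm x \<Longrightarrow> norm x < 1 \<Longrightarrow> x \<in> Wg"
    using Wg(1) unfolding nbhd_infinity_iff by blast
  obtain C1 \<epsilon>2 where C1: "C1 \<ge> 0" "\<epsilon>2 > 0" "\<epsilon>2 \<le> 1"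
    "\<And>x. 1 - \<epsilon>2 < norm x \<Longrightarrow> norm x < 1 \<Longrightarrow> norm (\<theta>1 x - x) \<le> C1 * (1 - norm x) ^ m"
    by (rule I0_estimate[OF \<Theta>1 r1(1)]) blast
  obtain C2 \<epsilon>3 where C2: "C2 \<ge> 0" "\<epsilon>3 > 0" "\<epsilon>3 \<le> 1"
    "\<And>x. 1 - \<epsilon>3 < norm x \<Longrightarrow> norm x < 1 \<Longrightarrow> norm (\<theta>2 x - x) \<le> C2 * (1 - norm x) ^ m"
    by (rule I0_estimate[OF \<Theta>2 r2(1)]) blast
  obtain e4 where e4: "e4 > 0" "\<And>x. 1 - e4 < norm x \<Longrightarrow> norm x < 1 \<Longrightarrow> x \<in> W2"
    using r2(3) unfolding nbhd_infinity_iff by blast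
  define \<epsilon>4 where "\<epsilon>4 = min e4 1"
  have \<epsilon>4: "\<epsilon>4 > 0" "\<epsilon>4 \<le> 1" "\<And>x. 1 - \<epsilon>4 < norm x \<Longrightarrow> norm x < 1 \<Longrightarrow> x \<in> W2"
    using e4 by (auto simp: \<epsilon>4_def)
  obtain \<epsilon>5 where \<epsilon>5: "\<epsilon>5 > 0" "\<And>x. 1 - \<epsilon>5 < norm x \<Longrightarrow> norm x < 1 \<Longrightarrow> norm (\<theta>2 x) > 1 - \<epsilon>4"
    by (rule b.collar_\<theta>[OF \<epsilon>4(1)]) blast
  \<comment> \<open>Makes \<open>C1 * t \<le> 1/2\<close> for
    \<open>t = 1 - norm x \<le> \<epsilon>6\<close>. Then \<open>y = \<theta>1 x\<close> satisfies
    \<open>t \<le> 2 * (1 - norm y)\<close>, and bounds in \<open>t\<close> become bounds in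
    \<open>1 - norm y\<close>.\<close>
  define \<epsilon>6 where "\<epsilon>6 = 1 / (2 * (C1 + 1))"
  define \<epsilon> where "\<epsilon> = min (min (min \<epsilon>1 \<epsilon>2) (min \<epsilon>3 \<epsilon>5)) \<epsilon>6"
  have \<epsilon>: "\<epsilon> > 0" "\<epsilon> \<le> \<epsilon>1" "\<epsilon> \<le> \<epsilon>2" "\<epsilon> \<le> \<epsilon>3" "\<epsilon> \<le> \<epsilon>5" "\<epsilon> \<le> \<epsilon>6"
    using \<epsilon>1 C1 C2 \<epsilon>5 by (auto simp: \<epsilon>_def \<epsilon>6_def)
  obtain d where d: "d > 0" "\<And>y. 1 - d < norm y \<Longrightarrow> norm y < 1 \<Longrightarrow> y \<in> \<theta>1 ` U1"
    "\<And>y. 1 - d < norm y \<Longrightarrow> norm y < 1 \<Longrightarrow> norm (a.\<psi> y) > 1 - \<epsilon>"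
    by (rule a.collar_\<psi>[OF \<epsilon>(1)]) blast
  obtain \<epsilon>7 where \<epsilon>7: "\<epsilon>7 > 0" "\<And>x. 1 - \<epsilon>7 < norm x \<Longrightarrow> norm x < 1 \<Longrightarrow> x \<in> W1"
    using r1(3) unfolding nbhd_infinity_iff by blast
  define c where "c = min 1 (min d \<epsilon>7)"
  define \<Phi> where "\<Phi> y = \<theta>2 (a.\<psi> y)" for y
  have m1: "(U1, g1) \<in> metric_reps" "(U2, g2) \<in> metric_reps" using metric_germs_reps[OF \<gamma>] r1 r2 by auto
  have near: "y \<in> \<theta>1 ` U1" "y \<in> W1" "a.\<psi> y \<in> Wg" "a.\<psi> y \<in> U1" "a.\<psi> y \<in> U2" "1 - \<epsilon> < norm (a.\<psi> y)" "norm (a.\<psi> y) < 1"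
      "\<Phi> y \<in> \<theta>2 ` U2" "\<Phi> y \<in> W2" "norm (\<Phi> y) < 1" "\<Phi> y \<noteq> 0"
    if y: "1 - c < norm y" "norm y < 1" for y
  proof -
    show yV: "y \<in> \<theta>1 ` U1" using d(2) y by (auto simp: c_def)
    show "y \<in> W1" using \<epsilon>7(2) y by (auto simp: c_def)
    show x: "a.\<psi> y \<in> U1" by (rule a.\<psi>_U[OF yV])
    show xe: "1 - \<epsilon> < norm (a.\<psi> y)" using d(3) y by (auto simp: c_def)
    show x1: "norm (a.\<psi> y) < 1" using x a.U by auto
    show xg: "a.\<psi> y \<in> Wg" using xe x1 \<epsilon>(2) by (intro \<epsilon>1(2)) auto
    then show x2: "a.\<psi> y \<in> U2" using Wg(2) by auto
    then show V2: "\<Phi> y \<in> \<theta>2 ` U2" by (simp add: \<Phi>_def)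
    then show n: "norm (\<Phi> y) < 1" using b.V by auto
    have n': "1 - \<epsilon>4 < norm (\<Phi> y)" using \<epsilon>5(2)[of "a.\<psi> y"] xe x1 \<epsilon>(5) by (simp add: \<Phi>_def)
    then show "\<Phi> y \<in> W2" using n by (intro \<epsilon>4(3))
    show "\<Phi> y \<noteq> 0" using n' \<epsilon>4(2) by auto
  qed
  have dPhi: "(\<Phi> has_derivative (\<lambda>v. frechet_derivative \<theta>2 (at (a.\<psi> y)) (frechet_derivative a.\<psi> (at y) v))) (at y)"
    if y: "1 - c < norm y" "norm y < 1" for y
    unfolding \<Phi>_def[abs_def]
    by (rule has_derivative_compose[OF a.D\<psi>[OF near(1)[OF y]] b.D\<theta>[OF near(5)[OF y]]])
  then have DPhi: "(\<Phi> has_derivative frechet_derivative \<Phi> (at y)) (at y)"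
    if y: "1 - c < norm y" "norm y < 1" for y
    using frechet_derivative_eqI that by metis
  have close: "norm (\<Phi> y - y) \<le> 4 * (C1 + C2) * (1 - norm y)\<^sup>2" if y: "1 - c < norm y" "norm y < 1" for y
  proof -
    define x where "x = a.\<psi> y"
    note n = near[OF y, folded x_def]
    have yx: "y = \<theta>1 x" using a.\<theta>_\<psi>[OF n(1)] by (simp add: x_def)
    define t where "t = 1 - norm x"
    have t: "0 < t" "t \<le> \<epsilon>6" "t \<le> 1" using n(6,7) \<epsilon> C1 by (auto simp: t_def)
    have pw: "t ^ m \<le> t\<^sup>2" using t m by (intro power_decreasing) auto
    have e1: "norm (\<theta>1 x - x) \<le> C1 * t\<^sup>2"
      using order_trans[OF C1(4)[of x] mult_left_mono[OF pw C1(1), unfolded t_def]] n(6,7) \<epsilon> by (auto simp: t_def)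
    have e2: "norm (\<theta>2 x - x) \<le> C2 * t\<^sup>2"
      using order_trans[OF C2(4)[of x] mult_left_mono[OF pw C2(1), unfolded t_def]] n(6,7) \<epsilon> by (auto simp: t_def)
    have "C1 * t\<^sup>2 = (C1 * t) * t" by (simp add: power2_eq_square)
    also have "\<dots> \<le> 1/2 * t"
    proof (rule mult_right_mono)
      have "C1 * t \<le> C1 * \<epsilon>6" using t C1(1) by (intro mult_left_mono) auto
      also have "\<dots> \<le> 1/2" using C1(1) by (simp add: \<epsilon>6_def field_simps)
      finally show "C1 * t \<le> 1/2" .
    qed (use t in simp)
    finally have "norm y \<le> norm x + 1/2 * t"
      using e1 norm_triangle_ineq2[of y x] yx by simp
    then have "t \<le> 2 * (1 - norm y)" using t_def by (simp add: field_simps)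
    then have "t\<^sup>2 \<le> (2 * (1 - norm y))\<^sup>2" using t by (intro power_mono) auto
    then have "t\<^sup>2 \<le> 4 * (1 - norm y)\<^sup>2" unfolding power_mult_distrib by simp
    then have t2: "(C1 + C2) * t\<^sup>2 \<le> (C1 + C2) * (4 * (1 - norm y)\<^sup>2)"
      using C1(1) C2(1) by (intro mult_left_mono) auto
    have "norm (\<Phi> y - y) = norm ((\<theta>2 x - x) - (\<theta>1 x - x))" by (simp add: \<Phi>_def x_def[symmetric] yx[symmetric])
    also have "\<dots> \<le> C2 * t\<^sup>2 + C1 * t\<^sup>2" using norm_triangle_ineq4 e1 e2 by (meson add_mono order_trans)
    finally show ?thesis using t2 by (simp add: algebra_simps)
  qed
  have chain: "frechet_derivative b.\<psi> (at (\<Phi> y)) (frechet_derivative \<Phi> (at y) v) = frechet_derivative a.\<psi> (at y) v"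
    if y: "1 - c < norm y" "norm y < 1" for y v
  proof -
    have d1: "((\<lambda>y. b.\<psi> (\<Phi> y)) has_derivative (\<lambda>v. frechet_derivative b.\<psi> (at (\<Phi> y)) (frechet_derivative \<Phi> (at y) v))) (at y)"
      by (rule has_derivative_compose[OF DPhi[OF y] b.D\<psi>[OF near(8)[OF y]]])
    have o: "open (\<theta>1 ` U1 \<inter> a.\<psi> -` U2)"
      by (intro continuous_open_preimage smooth_continuous_on[OF a.smooth_\<psi>] a.V b.U)
    have d2: "((\<lambda>y. b.\<psi> (\<Phi> y)) has_derivative frechet_derivative a.\<psi> (at y)) (at y)"
      by (rule has_derivative_transform_within_open[OF a.D\<psi>[OF near(1)[OF y]] o])
        (use near[OF y] in \<open>auto simp: \<Phi>_def b.\<psi>_\<theta>\<close>)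
    show ?thesis using fun_cong[OF has_derivative_unique[OF d1 d2], of v] .
  qed
  have tm: "transverse_map c (4 * (C1 + C2)) \<Phi> (\<lambda>y. frechet_derivative \<Phi> (at y)) (\<lambda>y. pushforward_metric U2 \<theta>2 g2 (\<Phi> y))"
  proof
    show "0 < c" "c \<le> 1" using d(1) \<epsilon>7(1) by (auto simp: c_def)
    fix y v w :: "real^'n" assume y: "1 - c < norm y" "norm y < 1"
    note n = near[OF y]
    show "(\<Phi> has_derivative frechet_derivative \<Phi> (at y)) (at y)" by (rule DPhi[OF y])
    show "norm (\<Phi> y) < 1" "\<Phi> y \<noteq> 0" by (rule n)+
    show "norm (\<Phi> y - y) \<le> 4 * (C1 + C2) * (1 - norm y)\<^sup>2" by (rule close[OF y])
    note rp = metric_repsD[OF b.push_metric_reps[OF m1(2)] n(8)]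
    show "bilinear (pushforward_metric U2 \<theta>2 g2 (\<Phi> y))" by (rule rp)
    show "pushforward_metric U2 \<theta>2 g2 (\<Phi> y) v w = pushforward_metric U2 \<theta>2 g2 (\<Phi> y) w v" by (rule rp)
    show "0 < pushforward_metric U2 \<theta>2 g2 (\<Phi> y) v v" if "v \<noteq> 0" by (rule rp(3)[OF that])
    show "pushforward_metric U2 \<theta>2 g2 (\<Phi> y) (\<Phi> y) v = (\<Phi> y \<bullet> v) / (\<rho> (\<Phi> y))\<^sup>2" by (rule r2(5)[OF n(9)])
    have "b.\<psi> (\<Phi> y) = a.\<psi> y" using b.\<psi>_\<theta>[OF n(5)] by (simp add: \<Phi>_def)
    then have "pushforward_metric U2 \<theta>2 g2 (\<Phi> y) (frechet_derivative \<Phi> (at y) y) (frechet_derivative \<Phi> (at y) y) =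
        pushforward_metric U1 \<theta>1 g1 y y y"
      by (simp add: a.push_eq b.push_eq chain[OF y] Wg(3)[OF n(3)])
    also have "\<dots> = (norm y)\<^sup>2 / (\<rho> y)\<^sup>2" using r1(5)[OF n(2)] by (simp add: power2_norm_eq_inner)
    finally show "pushforward_metric U2 \<theta>2 g2 (\<Phi> y) (frechet_derivative \<Phi> (at y) y) (frechet_derivative \<Phi> (at y) y) =
        (norm y)\<^sup>2 / (\<rho> y)\<^sup>2" .
  qed
  show thesis
    by (rule that[of c "4 * (C1 + C2)"])
      (use tm near(1,5) in \<open>auto simp: \<Phi>_def[abs_def] a.\<psi>_def\<close>)
qed

theorem transverse_unique:
  fixes \<gamma> :: "'n::finite metric_germ"
  assumes \<Theta>1: "\<Theta>1 \<in> I0 m" and \<Theta>2: "\<Theta>2 \<in> I0 m" and m: "m \<ge> 2" and \<gamma>: "\<gamma> \<in> metric_germs"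
    and t: "transverse (pushforward \<Theta>1 \<gamma>)" "transverse (pushforward \<Theta>2 \<gamma>)"
  shows "\<Theta>1 = \<Theta>2"
proof -
  have m0: "m > 0" using m by simp
  obtain U1 \<theta>1 g1 W1 where r1: "(U1, \<theta>1) \<in> \<Theta>1" "(U1, g1) \<in> \<gamma>" "nbhd_infinity W1" "W1 \<subseteq> \<theta>1 ` U1"
      "\<And>y v. y \<in> W1 \<Longrightarrow> pushforward_metric U1 \<theta>1 g1 y y v = (y \<bullet> v) / (\<rho> y)\<^sup>2"
    by (rule transverse_pushforwardD[OF \<Theta>1 m0 \<gamma> t(1)]) blast
  obtain U2 \<theta>2 g2 W2 where r2: "(U2, \<theta>2) \<in> \<Theta>2" "(U2, g2) \<in> \<gamma>" "nbhd_infinity W2" "W2 \<subseteq> \<theta>2 ` U2"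
      "\<And>y v. y \<in> W2 \<Longrightarrow> pushforward_metric U2 \<theta>2 g2 y y v = (y \<bullet> v) / (\<rho> y)\<^sup>2"
    by (rule transverse_pushforwardD[OF \<Theta>2 m0 \<gamma> t(2)]) blast
  interpret a: boundary_diffeo U1 \<theta>1 by (rule I0_boundary_diffeo[OF \<Theta>1 m0 r1(1)])
  interpret b: boundary_diffeo U2 \<theta>2 by (rule I0_boundary_diffeo[OF \<Theta>2 m0 r2(1)])
  obtain c1 C1 where t1:
    "transverse_map c1 C1 (\<lambda>y. \<theta>2 (a.\<psi> y)) (\<lambda>y. frechet_derivative (\<lambda>y. \<theta>2 (a.\<psi> y)) (at y))
      (\<lambda>y. pushforward_metric U2 \<theta>2 g2 (\<theta>2 (a.\<psi> y)))"
    "\<And>y. 1 - c1 < norm y \<Longrightarrow> norm y < 1 \<Longrightarrow> y \<in> \<theta>1 ` U1"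
    "\<And>y. 1 - c1 < norm y \<Longrightarrow> norm y < 1 \<Longrightarrow> a.\<psi> y \<in> U2"
    unfolding a.\<psi>_def by (rule transition_transverse[OF \<Theta>1 \<Theta>2 m \<gamma> r1 r2]) blast+
  obtain c2 C2 where t2:
    "transverse_map c2 C2 (\<lambda>y. \<theta>1 (b.\<psi> y)) (\<lambda>y. frechet_derivative (\<lambda>y. \<theta>1 (b.\<psi> y)) (at y))
      (\<lambda>y. pushforward_metric U1 \<theta>1 g1 (\<theta>1 (b.\<psi> y)))"
    unfolding b.\<psi>_def by (rule transition_transverse[OF \<Theta>2 \<Theta>1 m \<gamma> r2 r1]) blast+
  define c where "c = min c1 c2"
  have c: "0 < c" "c \<le> c1" "c \<le> c2"
    using transverse_map.c(1)[OF t1(1)] transverse_map.c(1)[OF t2(1)] by (auto simp: c_def)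
  interpret p: transverse_map c C1 "\<lambda>y. \<theta>2 (a.\<psi> y)" "\<lambda>y. frechet_derivative (\<lambda>y. \<theta>2 (a.\<psi> y)) (at y)"
      "\<lambda>y. pushforward_metric U2 \<theta>2 g2 (\<theta>2 (a.\<psi> y))"
    by (rule transverse_map_mono[OF t1(1) c(1,2)])
  have id: "\<theta>2 (a.\<psi> y) = y" if y: "1 - c < norm y" "norm y < 1" for y
  proof (rule p.norm_preserving_imp_id[OF _ y])
    fix y :: "real^'n" assume y: "1 - c < norm y" "norm y < 1"
    define z where "z = \<theta>2 (a.\<psi> y)"
    have le: "norm y \<le> norm z" unfolding z_def by (rule p.norm_nondecreasing[OF y])
    \<comment> \<open>As the transition map does not decrease norms, \<open>z\<close> lies
      automatically in the collar where its inverse is controlled.\<close>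
    have z: "1 - c2 < norm z" "norm z < 1" using le y c p.\<Phi>(2)[OF y] by (auto simp: z_def)
    have "norm z \<le> norm (\<theta>1 (b.\<psi> z))" by (rule transverse_map.norm_nondecreasing[OF t2(1) z])
    also have "b.\<psi> z = a.\<psi> y" using b.\<psi>_\<theta>[OF t1(3)[of y]] y c by (simp add: z_def)
    also have "\<theta>1 (a.\<psi> y) = y" using a.\<theta>_\<psi>[OF t1(2)[of y]] y c by simp
    finally show "norm (\<theta>2 (a.\<psi> y)) = norm y" using le by (simp add: z_def)
  qed
  obtain d where d: "d > 0" "\<And>x. 1 - d < norm x \<Longrightarrow> norm x < 1 \<Longrightarrow> x \<in> U1"
    "\<And>x. 1 - d < norm x \<Longrightarrow> norm x < 1 \<Longrightarrow> norm (\<theta>1 x) > 1 - c"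
    by (rule a.collar_\<theta>[OF c(1)]) blast
  define W where "W = ball 0 1 - cball (0::real^'n) (1 - d)"
  have W: "nbhd_infinity W" unfolding nbhd_infinity_def W_def using d(1) by auto
  have agree: "x \<in> U1 \<and> x \<in> U2 \<and> \<theta>1 x = \<theta>2 x" if "x \<in> W" for x
  proof -
    have x: "1 - d < norm x" "norm x < 1" using that by (auto simp: W_def)
    have xU: "x \<in> U1" by (rule d(2)[OF x])
    have y: "1 - c < norm (\<theta>1 x)" "norm (\<theta>1 x) < 1" using d(3)[OF x] a.V xU by auto
    have "a.\<psi> (\<theta>1 x) = x" by (rule a.\<psi>_\<theta>[OF xU])
    then show ?thesis using id[OF y] t1(3)[of "\<theta>1 x"] y c xU by auto
  qed
  have "((U1, \<theta>1), (U2, \<theta>2)) \<in> diffeo_germ_rel"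
    unfolding diffeo_germ_rel_def using a.rep b.rep W agree a.sphere_fixed b.sphere_fixed
    by (auto simp: tilde_def intro!: exI[of _ W])
  then show ?thesis
    using \<Theta>1 \<Theta>2 by (intro diffeo_germs_eqI[OF _ _ r1(1) r2(1)]) (auto simp: I0_def)
qed

section \<open>Existence\<close>

theorem transverse_exists:
  fixes \<gamma> :: "'n::finite metric_germ"
  assumes k: "k > 0" and \<gamma>: "\<gamma> \<in> G k"
  obtains \<Theta> where "\<Theta> \<in> I0 (k + 1)" "transverse (pushforward \<Theta> \<gamma>)" "pushforward \<Theta> \<gamma> \<in> G k"
proof -
  have \<gamma>m: "\<gamma> \<in> metric_germs" using \<gamma> by (simp add: G_def)
  obtain U0 g \<delta> A C0 where g: "(U0, g) \<in> \<gamma>" and nf: "normal_form \<delta> A k C0"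
    and inU0: "\<And>x. x \<in> ann \<delta> \<Longrightarrow> norm x < 1 \<Longrightarrow> x \<in> U0"
    and Ag: "\<And>x v w. x \<in> ann \<delta> \<Longrightarrow> norm x < 1 \<Longrightarrow> (A x *v v) \<bullet> w = (\<rho> x)\<^sup>2 * g x v w"
    by (rule metric_normal_form[OF \<gamma> k]) blast
  interpret normal_form \<delta> A k C0 by (rule nf)
  obtain \<epsilon> \<Psi> \<sigma> C where \<epsilon>: "0 < \<epsilon>" "\<epsilon> \<le> \<delta>" and sm: "smooth (ann \<epsilon>) \<Psi>" "smooth (ann \<epsilon>) \<sigma>" and C: "C \<ge> 0"
    and \<Psi>_ann: "\<And>x. x \<in> ann \<epsilon> \<Longrightarrow> \<Psi> x \<in> ann \<delta>"
    and \<Psi>_sphere: "\<And>x. norm x = 1 \<Longrightarrow> \<Psi> x = x"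
    and \<Psi>_in: "\<And>x. x \<in> ann \<epsilon> \<Longrightarrow> norm (\<Psi> x) < 1 \<longleftrightarrow> norm x < 1"
    and \<sigma>_pos: "\<And>x. x \<in> ann \<epsilon> \<Longrightarrow> \<sigma> x > 0"
    and \<rho>_\<Psi>: "\<And>x. x \<in> ann \<epsilon> \<Longrightarrow> \<rho> x = \<sigma> x * \<rho> (\<Psi> x)"
    and \<sigma>_le: "\<And>x. x \<in> ann \<epsilon> \<Longrightarrow> norm x \<le> 1 \<Longrightarrow> \<sigma> x \<le> C"
    and \<Psi>_close: "\<And>x. x \<in> ann \<epsilon> \<Longrightarrow> norm x \<le> 1 \<Longrightarrow> norm (\<Psi> x - x) \<le> C * (1 - norm x) ^ (k + 1)"
    and D_close: "\<And>x v. x \<in> ann \<epsilon> \<Longrightarrow> norm x \<le> 1 \<Longrightarrow> norm (frechet_derivative \<Psi> (at x) v - v) \<le> C * (1 - norm x) ^ k * norm v"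
    and transv: "\<And>x v. x \<in> ann \<epsilon> \<Longrightarrow> norm x < 1 \<Longrightarrow>
      (\<sigma> x)\<^sup>2 * ((A (\<Psi> x) *v frechet_derivative \<Psi> (at x) x) \<bullet> frechet_derivative \<Psi> (at x) v) = x \<bullet> v"
    and inj: "inj_on \<Psi> (ann \<epsilon>)"
    and D_half: "\<And>x v. x \<in> ann \<epsilon> \<Longrightarrow> norm (frechet_derivative \<Psi> (at x) v - v) \<le> norm v / 2"
    by (rule normal_coordinates) blast
  have \<epsilon>1: "\<epsilon> \<le> 1/2" using \<epsilon> \<delta> by simp
  let ?D = "\<lambda>x. frechet_derivative \<Psi> (at x)"
  have D_inj: "v = 0" if "x \<in> ann \<epsilon>" "?D x v = 0" for x v
    using D_half[OF that(1), of v] that(2) by simp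
  have inv: "open (\<Psi> ` ann \<epsilon>)" "smooth (\<Psi> ` ann \<epsilon>) (inv_into (ann \<epsilon>) \<Psi>)"
    by (rule smooth_inv_into[OF sm(1) inj]; rule D_inj; assumption)+
  define \<theta> where "\<theta> = inv_into (ann \<epsilon>) \<Psi>"
  have \<theta>_\<Psi>: "\<theta> (\<Psi> x) = x" if "x \<in> ann \<epsilon>" for x using inj that by (simp add: \<theta>_def)
  \<comment> \<open>\<open>\<Psi>\<close> lives on both sides of the sphere; only the part inside
    the ball enters the germ. By \<open>\<Psi>_in\<close> the image of this part is exactly the part
    of the image inside the ball.\<close>
  define S where "S = ann \<epsilon> \<inter> ball (0::real^'n) 1"
  define V where "V = \<Psi> ` S"
  have S: "open S" "S \<subseteq> ann \<epsilon>" "nbhd_infinity S" "tilde S \<subseteq> ann \<epsilon>"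
  proof -
    show "open S" "S \<subseteq> ann \<epsilon>" by (auto simp: S_def open_ann)
    then show "nbhd_infinity S"
      unfolding nbhd_infinity_iff using \<epsilon>(1) by (auto simp: S_def ann_def intro!: exI[of _ \<epsilon>])
    show "tilde S \<subseteq> ann \<epsilon>" using sphere_subset_ann[OF \<epsilon>(1)] by (auto simp: tilde_def S_def)
  qed
  have V_eq: "y \<in> V \<longleftrightarrow> y \<in> \<Psi> ` ann \<epsilon> \<and> norm y < 1" for y
    using \<Psi>_in by (auto simp: V_def S_def)
  have sV: "sphere 0 1 \<subseteq> \<Psi> ` ann \<epsilon>"
  proof
    fix x :: "real^'n" assume "x \<in> sphere 0 1"
    then have "x \<in> ann \<epsilon>" "\<Psi> x = x" using sphere_subset_ann[OF \<epsilon>(1)] \<Psi>_sphere by auto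
    then show "x \<in> \<Psi> ` ann \<epsilon>" by (metis imageI)
  qed
  have nV: "nbhd_infinity V"
  proof -
    obtain \<eta> where \<eta>: "0 < \<eta>" "\<eta> \<le> 1/2" "ann \<eta> \<subseteq> \<Psi> ` ann \<epsilon>" by (rule open_contains_ann[OF inv(1) sV])
    have "V = \<Psi> ` ann \<epsilon> \<inter> ball 0 1" by (intro set_eqI) (simp only: V_eq Int_iff mem_ball_0)
    then have "open V" "V \<subseteq> ball 0 1" using inv(1) by (simp_all add: open_Int)
    moreover have "x \<in> V" if "1 - \<eta> < norm x" "norm x < 1" for x
    proof -
      have "x \<in> ann \<eta>" using that by (simp add: ann_def)
      then show ?thesis using \<eta>(3) that(2) unfolding V_eq by blast
    qed
    ultimately show ?thesis unfolding nbhd_infinity_iff using \<eta>(1) by blast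
  qed
  have tV: "\<Psi> ` tilde S = tilde V"
    using \<Psi>_sphere by (force simp: tilde_def image_Un V_def)
  have \<theta>_img: "\<theta> ` tilde V = tilde S"
    unfolding tV[symmetric] image_image using \<theta>_\<Psi> S(4) by force
  have inj\<theta>: "inj_on \<theta> (tilde V)"
    unfolding tV[symmetric] by (rule inj_on_inverseI[of _ \<Psi>]) (metis \<theta>_\<Psi> S(4) imageE subsetD)
  have inv\<theta>: "inv_into (tilde V) \<theta> x = \<Psi> x" if "x \<in> tilde S" for x
  proof -
    have "\<Psi> x \<in> tilde V" using that tV by auto
    then show ?thesis using inv_into_f_f[OF inj\<theta>, of "\<Psi> x"] \<theta>_\<Psi> S(4) that by auto
  qed
  have rep: "(V, \<theta>) \<in> diffeo_reps"
  proof -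
    have "smooth_on (tilde V) \<theta>"
      by (rule smooth_on_smooth[OF inv(2)]) (use tV S(4) in \<open>auto simp: \<theta>_def\<close>)
    moreover have "smooth_on (\<theta> ` tilde V) (inv_into (tilde V) \<theta>)"
      unfolding \<theta>_img by (rule smooth_on_smooth[OF sm(1) S(4)]) (simp add: inv\<theta>)
    ultimately show ?thesis using nV \<theta>_img S(3) inj\<theta> by (auto simp: diffeo_reps_def)
  qed
  define \<Theta> where "\<Theta> = diffeo_germ_rel `` {(V, \<theta>)}"
  have \<Theta>: "\<Theta> \<in> diffeo_germs" "(V, \<theta>) \<in> \<Theta>"
    using rep equiv_class_self[OF equiv_diffeo_germ_rel rep] by (auto simp: \<Theta>_def diffeo_germs_def quotientI)
  have I: "\<Theta> \<in> I0 (k + 1)"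
  proof -
    obtain \<eta> where \<eta>: "\<eta> > 0" "\<And>y. 1 - \<eta> < norm y \<Longrightarrow> norm y < 1 \<Longrightarrow> y \<in> V"
      using nV unfolding nbhd_infinity_iff by blast
    have "(\<lambda>y. norm (\<theta> y - y)) \<in> O[near_infinity](\<lambda>y. \<rho> y ^ (k + 1))"
    \<comment> \<open>\<open>C\<close> bounds the ratio \<open>\<sigma>\<close> of the values of
      \<open>\<rho>\<close> at \<open>x\<close> and at \<open>y = \<Psi> x\<close>, whence
      \<open>1 - norm x \<le> 2 * C * (1 - norm y)\<close>. The power \<open>k + 1\<close> of this
      moves the estimate from \<open>x\<close> to \<open>y\<close>.\<close>
    proof (rule bigo_near_infinityI[OF \<eta>(1), of "C * (2 * C) ^ (k + 1)"])
      fix y :: "real^'n" assume y: "1 - \<eta> < norm y" "norm y < 1"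
      then obtain x where x: "x \<in> S" "y = \<Psi> x" using \<eta>(2)[OF y] by (auto simp: V_def)
      then have xa: "x \<in> ann \<epsilon>" "norm x < 1" by (auto simp: S_def)
      have "(1 - norm x) / 2 \<le> \<sigma> x * \<rho> y" using rho_bounds(1)[of x] \<rho>_\<Psi>[OF xa(1)] xa x by simp
      also have "\<dots> \<le> C * (1 - norm y)"
        using \<sigma>_le[OF xa(1)] \<sigma>_pos[OF xa(1)] rho_bounds[of y] y xa by (intro mult_mono) auto
      finally have b: "1 - norm x \<le> 2 * C * (1 - norm y)" by simp
      have "\<bar>norm (\<theta> y - y)\<bar> = norm (\<Psi> x - x)" using \<theta>_\<Psi>[OF xa(1)] x by (simp add: norm_minus_commute)
      also have "\<dots> \<le> C * (1 - norm x) ^ (k + 1)" using \<Psi>_close[OF xa(1)] xa by simp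
      also have "\<dots> \<le> C * (2 * C * (1 - norm y)) ^ (k + 1)"
        using b C xa by (intro mult_left_mono power_mono) auto
      finally show "\<bar>norm (\<theta> y - y)\<bar> \<le> C * (2 * C) ^ (k + 1) * (1 - norm y) ^ (k + 1)"
        by (simp only: power_mult_distrib mult.assoc)
    qed (use C in simp)
    then show ?thesis using \<Theta> unfolding I0_def by blast
  qed
  have k1: "k + 1 > 0" by simp
  define U where "U = V \<inter> U0"
  have r: "(U, \<theta>) \<in> \<Theta>" "(U, g) \<in> \<gamma>"
    using common_domain[OF I k1 \<gamma>m \<Theta>(2) g] by (auto simp: U_def)
  interpret b: boundary_diffeo U \<theta> by (rule I0_boundary_diffeo[OF I k1 r(1)])
  have m: "(U, g) \<in> metric_reps" by (rule metric_germs_reps[OF \<gamma>m r(2)])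
  have pf: "pushforward \<Theta> \<gamma> = metric_germ_rel `` {(\<theta> ` U, pushforward_metric U \<theta> g)}"
    by (rule pushforward_eq[OF I k1 \<gamma>m r])
  have pm: "(\<theta> ` U, pushforward_metric U \<theta> g) \<in> metric_reps" by (rule b.push_metric_reps[OF m])
  then have self: "(\<theta> ` U, pushforward_metric U \<theta> g) \<in> pushforward \<Theta> \<gamma>"
    unfolding pf by (rule equiv_class_self[OF equiv_metric_germ_rel])
  have img: "x \<in> S" "\<Psi> x \<in> U" if "x \<in> \<theta> ` U" for x
  proof -
    obtain y where y: "y \<in> U" "x = \<theta> y" using \<open>x \<in> \<theta> ` U\<close> by blast
    then obtain x' where "x' \<in> S" "y = \<Psi> x'" by (auto simp: U_def V_def)
    then show "x \<in> S" "\<Psi> x \<in> U" using y \<theta>_\<Psi>[of x'] S(2) by auto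
  qed
  have \<psi>: "b.\<psi> x = \<Psi> x" if "x \<in> \<theta> ` U" for x
    using b.\<psi>_\<theta>[OF img(2)[OF that]] \<theta>_\<Psi>[of x] img(1)[OF that] S(2) by auto
  have D\<psi>: "frechet_derivative b.\<psi> (at x) = ?D x" if x: "x \<in> \<theta> ` U" for x
  proof (rule frechet_derivative_eqI)
    have "x \<in> ann \<epsilon>" using img(1)[OF x] S(2) by auto
    then show "(b.\<psi> has_derivative ?D x) (at x)"
      by (intro has_derivative_transform_within_open[OF smooth_has_derivative[OF sm(1)] b.V(1) x]) (auto simp: \<psi>)
  qed
  have xin: "x \<in> ann \<epsilon>" "norm x < 1" "\<Psi> x \<in> ann \<delta>" "norm (\<Psi> x) < 1" "\<rho> (\<Psi> x) > 0" if "x \<in> \<theta> ` U" for x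
  proof -
    show x: "x \<in> ann \<epsilon>" "norm x < 1" using img(1)[OF that] by (auto simp: S_def)
    then show "\<Psi> x \<in> ann \<delta>" and n: "norm (\<Psi> x) < 1" using \<Psi>_ann \<Psi>_in by auto
    show "\<rho> (\<Psi> x) > 0" using rho_bounds(1)[of "\<Psi> x"] n by (simp add: field_simps)
  qed
  \<comment> \<open>\<open>\<rho>\<^sup>2\<close> times the pushforward, with
    \<open>\<sigma> x * \<rho> (\<Psi> x)\<close> in place of \<open>\<rho> x\<close> so that the
    singular factors cancel. The formula is smooth across the sphere and is the extension that
    \<open>G k\<close> demands.\<close>
  define h where "h x v w = (\<sigma> x)\<^sup>2 * ((A (\<Psi> x) *v ?D x v) \<bullet> ?D x w)" for x v w
  have h_push: "h x v w = (\<rho> x)\<^sup>2 * pushforward_metric U \<theta> g x v w" if x: "x \<in> \<theta> ` U" for x v w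
    unfolding b.push_eq \<psi>[OF x] D\<psi>[OF x] h_def
    using Ag[OF xin(3,4)[OF x]] \<rho>_\<Psi>[OF xin(1)[OF x]] by (simp add: power_mult_distrib)
  have trans: "transverse (pushforward \<Theta> \<gamma>)"
    unfolding transverse_def
  proof (rule bexI[OF _ self], clarify)
    fix u v assume u: "u \<in> U"
    then have x: "\<theta> u \<in> \<theta> ` U" by simp
    define x where "x = \<theta> u"
    have "(\<rho> x)\<^sup>2 * pushforward_metric U \<theta> g x x v = x \<bullet> v"
      unfolding h_push[OF x, folded x_def, symmetric] unfolding h_def using transv xin[OF x] by (simp add: x_def)
    moreover have "\<rho> x > 0" using rho_bounds(1)[of x] xin(2)[OF x] by (simp add: x_def)
    ultimately show "pushforward_metric U \<theta> g (\<theta> u) (position_field (\<theta> u)) v =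
        hyperbolic_metric (\<theta> u) (position_field (\<theta> u)) v"
      by (simp add: x_def[symmetric] position_field_def hyperbolic_metric_def euclidean_metric_def field_simps)
  qed
  have lin: "linear (?D x)" if "x \<in> ann \<epsilon>" for x
    using has_derivative_linear[OF smooth_has_derivative[OF sm(1) that]] .
  have tsub: "x \<in> ann \<epsilon>" "norm x \<le> 1" "\<Psi> x \<in> ann \<delta>" "norm (\<Psi> x) \<le> 1" if "x \<in> tilde (\<theta> ` U)" for x
  proof -
    show x: "x \<in> ann \<epsilon>" "norm x \<le> 1" using that xin(1,2)[of x] sphere_subset_ann[OF \<epsilon>(1)] by (auto simp: tilde_def)
    show "\<Psi> x \<in> ann \<delta>" by (rule \<Psi>_ann[OF x(1)])
    show "norm (\<Psi> x) \<le> 1" using that xin(4)[of x] \<Psi>_sphere[of x] by (auto simp: tilde_def)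
  qed
  \<comment> \<open>In the closed ball \<open>A\<close> differs from the identity by at most
    \<open>1/2\<close>; this gives positivity on the sphere as well, where \<open>g\<close> is not
    defined.\<close>
  have A_pos: "(A x *v v) \<bullet> v > 0" if x: "x \<in> ann \<delta>" "norm x \<le> 1" and v: "v \<noteq> 0" for x v
  proof -
    have "C0 * (1 - norm x) ^ k \<le> C0 * \<delta>"
      using one_minus_power_le[OF x(2,1)] C0(1) by (rule mult_left_mono)
    then have "C0 * (1 - norm x) ^ k * norm v \<le> 1/2 * norm v" using C0(2) by (intro mult_right_mono) auto
    then have "norm (A x *v v - v) \<le> 1/2 * norm v" using A_close[OF x, of v] by simp
    then have "\<bar>(A x *v v - v) \<bullet> v\<bar> \<le> 1/2 * norm v * norm v"
      using Cauchy_Schwarz_ineq2[of "A x *v v - v" v] mult_right_mono[of "norm (A x *v v - v)" "1/2 * norm v" "norm v"] by simp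
    moreover have "(A x *v v) \<bullet> v = (A x *v v - v) \<bullet> v + norm v * norm v"
      by (simp add: inner_diff_left power2_norm_eq_inner[symmetric] power2_eq_square)
    moreover have "norm v * norm v > 0" using v by simp
    ultimately show ?thesis by linarith
  qed
  have hR: "riemannian_metric_on (tilde (\<theta> ` U)) h"
    unfolding riemannian_metric_on_def
  proof (intro conjI ballI allI impI)
    fix x assume x: "x \<in> tilde (\<theta> ` U)"
    note X = tsub[OF x]
    show "bilinear (h x)"
      unfolding bilinear_def h_def
      by (auto intro!: linearI simp: linear_add[OF lin[OF X(1)]] linear_scale[OF lin[OF X(1)]]
          matrix_vector_right_distrib matrix_vector_mult_scaleR inner_add_left inner_add_right algebra_simps)
    show "h x v w = h x w v" for v w
      using A_sym_inner[OF X(3), of "?D x v" "?D x w"] by (simp add: h_def inner_commute)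
    show "0 < h x v v" if "v \<noteq> 0" for v
    proof -
      have "?D x v \<noteq> 0" using D_inj[OF X(1)] that by blast
      then show ?thesis using A_pos[OF X(3,4)] \<sigma>_pos[OF X(1)] by (simp add: h_def)
    qed
  next
    fix v w
    have sD: "smooth (ann \<epsilon>) (\<lambda>x. ?D x v)" for v by (intro smooth_frechet_derivative[OF sm(1)] smooth_intros open_ann)
    have "smooth (ann \<epsilon>) (\<lambda>x. (\<sigma> x)\<^sup>2 * (\<Sum>i\<in>UNIV. \<Sum>j\<in>UNIV. ?D x v $ i * ?D x w $ j * A (\<Psi> x) $ j $ i))"
      by (intro smooth_mult smooth_power smooth_sum smooth_vec_nth sm sD open_ann smooth_compose[OF smooth_A sm(1)] \<Psi>_ann)
    then have "smooth (ann \<epsilon>) (\<lambda>x. h x v w)" unfolding h_def mult_vec_inner .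
    then show "smooth_on (tilde (\<theta> ` U)) (\<lambda>x. h x v w)"
      by (rule smooth_on_smooth) (use tsub in auto)
  qed
  have bound: "(\<lambda>x. tensor2_norm (\<lambda>v w. (\<rho> x)\<^sup>2 * pushforward_metric U \<theta> g x v w - euclidean_metric x v w))
       \<in> O[near_infinity](\<lambda>x. \<rho> x ^ k)"
  proof -
    obtain \<eta> where \<eta>: "\<eta> > 0" "\<And>x. 1 - \<eta> < norm x \<Longrightarrow> norm x < 1 \<Longrightarrow> x \<in> \<theta> ` U"
      using b.image_tilde(1) unfolding nbhd_infinity_iff by blast
    \<comment> \<open>Two sources: \<open>(\<sigma> x)\<^sup>2 - 1\<close>, multiplied by the bound
      6 for \<open>L\<close>, and the difference of \<open>L\<close> and
      \<open>v \<bullet> w\<close>, to which \<open>A\<close>, \<open>v'\<close> and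
      \<open>w'\<close> each contribute a deviation of order \<open>k\<close>.\<close>
    define M1 where "M1 = 2 * C * C * (C + 1) * 6 + (C0 * (1 + C) ^ k * 2 + C) * 2 + C"
    have M1: "M1 \<ge> 0" using C C0 by (simp add: M1_def)
    show ?thesis
    proof (rule bigo_near_infinityI[OF \<eta>(1), of "real CARD('n) * M1"])
      fix x :: "real^'n" assume "1 - \<eta> < norm x" "norm x < 1"
      then have xU: "x \<in> \<theta> ` U" by (rule \<eta>(2))
      note X = xin[OF xU]
      define s where "s = (1 - norm x) ^ k"
      have s: "0 \<le> s" "s \<le> 1" using X by (auto simp: s_def intro!: power_le_one)
      \<comment> \<open>From \<open>\<rho> x = \<sigma> x * \<rho> (\<Psi> x)\<close>: the
        difference of the two values of \<open>\<rho>\<close> is of order \<open>k + 1\<close>, and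
        division by \<open>\<rho> (\<Psi> x)\<close>, which is at least a constant times
        \<open>1 - norm x\<close>, leaves order \<open>k\<close>.\<close>
      have \<sigma>1: "\<bar>\<sigma> x - 1\<bar> \<le> 2 * C * C * s"
      proof -
        have p: "\<rho> (\<Psi> x) > 0" by (rule X(5))
        have "\<sigma> x * \<rho> (\<Psi> x) - \<rho> (\<Psi> x) = \<rho> x - \<rho> (\<Psi> x)" using \<rho>_\<Psi>[OF X(1)] by simp
        also have "\<dots> = (norm (\<Psi> x) - norm x) * ((norm (\<Psi> x) + norm x) / 2)"
          by (simp add: \<rho>_def power2_eq_square field_simps)
        also have "\<bar>\<dots>\<bar> \<le> norm (\<Psi> x - x) * 1"
          unfolding abs_mult using X by (intro mult_mono norm_triangle_ineq3) auto
        also have "\<dots> \<le> C * (s * (1 - norm x))" using \<Psi>_close[OF X(1)] X by (simp add: s_def mult.commute)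
        also have "\<dots> \<le> C * (s * (2 * (C * \<rho> (\<Psi> x))))"
        proof (intro mult_left_mono)
          have "1 - norm x \<le> 2 * (\<sigma> x * \<rho> (\<Psi> x))" using rho_bounds(1)[of x] \<rho>_\<Psi>[OF X(1)] X by simp
          also have "\<dots> \<le> 2 * (C * \<rho> (\<Psi> x))" using \<sigma>_le[OF X(1)] X p by (intro mult_left_mono mult_right_mono) auto
          finally show "1 - norm x \<le> 2 * (C * \<rho> (\<Psi> x))" .
        qed (use C s in auto)
        finally have "\<bar>\<sigma> x * \<rho> (\<Psi> x) - \<rho> (\<Psi> x)\<bar> \<le> (2 * C * C * s) * \<rho> (\<Psi> x)"
          by (simp add: mult_ac)
        moreover have "\<sigma> x * \<rho> (\<Psi> x) - \<rho> (\<Psi> x) = (\<sigma> x - 1) * \<rho> (\<Psi> x)" by (simp add: left_diff_distrib)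
        ultimately have "\<bar>\<sigma> x - 1\<bar> * \<rho> (\<Psi> x) \<le> (2 * C * C * s) * \<rho> (\<Psi> x)"
          using p by (simp only: abs_mult abs_of_pos)
        then show ?thesis using p by simp
      qed
      have \<sigma>2: "\<bar>(\<sigma> x)\<^sup>2 - 1\<bar> \<le> 2 * C * C * s * (C + 1)"
      proof -
        have "\<bar>(\<sigma> x)\<^sup>2 - 1\<bar> = \<bar>\<sigma> x - 1\<bar> * (\<sigma> x + 1)"
          using \<sigma>_pos[OF X(1)] by (simp add: power2_eq_square square_diff_one_factored abs_mult)
        also have "\<dots> \<le> 2 * C * C * s * (C + 1)"
          using \<sigma>1 \<sigma>_le[OF X(1)] \<sigma>_pos[OF X(1)] X C s by (intro mult_mono) auto
        finally show ?thesis .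
      qed
      have "tensor2_norm (\<lambda>v w. (\<rho> x)\<^sup>2 * pushforward_metric U \<theta> g x v w - euclidean_metric x v w) \<le> real CARD('n) * (M1 * s)"
      proof (rule tensor2_norm_le)
        show "0 \<le> M1 * s" using M1 s by simp
        fix v w :: "real^'n" assume vw: "v \<in> Basis" "w \<in> Basis"
        define v' w' where "v' = ?D x v" and "w' = ?D x w"
        have nv: "norm v' \<le> 2" "norm w' \<le> 2"
          using D_half[OF X(1), of v] D_half[OF X(1), of w] norm_triangle_ineq2[of v' v] norm_triangle_ineq2[of w' w] vw
          by (auto simp: v'_def w'_def)
        have cv: "norm (v' - v) \<le> C * s" "norm (w' - w) \<le> C * s"
          using D_close[OF X(1), of v] D_close[OF X(1), of w] X vw by (auto simp: v'_def w'_def s_def)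
        have "1 - norm (\<Psi> x) \<le> (1 + C) * (1 - norm x)"
        proof -
          have "1 - norm (\<Psi> x) \<le> (1 - norm x) + norm (\<Psi> x - x)"
            using norm_triangle_ineq2[of x "\<Psi> x"] by (simp add: norm_minus_commute)
          also have "norm (\<Psi> x - x) \<le> C * (s * (1 - norm x))" using \<Psi>_close[OF X(1)] X by (simp add: s_def mult.commute)
          also have "\<dots> \<le> C * (1 * (1 - norm x))" using s C X by (intro mult_left_mono mult_right_mono) auto
          finally show ?thesis by (simp add: algebra_simps)
        qed
        then have "(1 - norm (\<Psi> x)) ^ k \<le> ((1 + C) * (1 - norm x)) ^ k" using X by (intro power_mono) auto
        then have pk: "(1 - norm (\<Psi> x)) ^ k \<le> (1 + C) ^ k * s" by (simp add: power_mult_distrib s_def)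
        have "norm (A (\<Psi> x) *v v' - v') \<le> C0 * (1 - norm (\<Psi> x)) ^ k * norm v'"
          using A_close[OF X(3)] X by simp
        also have "\<dots> \<le> C0 * ((1 + C) ^ k * s) * 2"
          using pk nv C0 C s X by (intro mult_mono mult_left_mono) auto
        finally have Av: "norm (A (\<Psi> x) *v v' - v) \<le> C0 * ((1 + C) ^ k * s) * 2 + C * s"
          using cv(1) norm_triangle_ineq[of "A (\<Psi> x) *v v' - v'" "v' - v"] by simp
        define L where "L = (A (\<Psi> x) *v v') \<bullet> w'"
        have "L - v \<bullet> w = (A (\<Psi> x) *v v' - v) \<bullet> w' + v \<bullet> (w' - w)"
          by (simp add: L_def inner_diff_left inner_diff_right)
        also have "\<bar>\<dots>\<bar> \<le> (C0 * ((1 + C) ^ k * s) * 2 + C * s) * 2 + C * s"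
        proof (rule order_trans[OF abs_triangle_ineq add_mono])
          show "\<bar>(A (\<Psi> x) *v v' - v) \<bullet> w'\<bar> \<le> (C0 * ((1 + C) ^ k * s) * 2 + C * s) * 2"
            using Av nv(2) C C0 s by (intro order_trans[OF Cauchy_Schwarz_ineq2] mult_mono) auto
          show "\<bar>v \<bullet> (w' - w)\<bar> \<le> C * s"
            using order_trans[OF Cauchy_Schwarz_ineq2[of v "w' - w"]] cv(2) vw by simp
        qed
        also have "\<dots> = ((C0 * (1 + C) ^ k * 2 + C) * 2 + C) * s" by (simp add: algebra_simps)
        finally have L1: "\<bar>L - v \<bullet> w\<bar> \<le> ((C0 * (1 + C) ^ k * 2 + C) * 2 + C) * s" .
        have L2: "\<bar>L\<bar> \<le> 6"
        proof -
          have "C0 * (1 - norm (\<Psi> x)) ^ k \<le> C0 * \<delta>"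
            using one_minus_power_le[OF _ X(3)] X C0(1) by (intro mult_left_mono) auto
          also have "\<dots> \<le> 1/2" using C0(2) by simp
          finally have "C0 * (1 - norm (\<Psi> x)) ^ k * norm v' \<le> 1/2 * 2"
            by (rule mult_mono) (use nv in simp_all)
          moreover have "norm (A (\<Psi> x) *v v' - v') \<le> C0 * (1 - norm (\<Psi> x)) ^ k * norm v'"
            using A_close[OF X(3), of v'] X by simp
          moreover have "norm (A (\<Psi> x) *v v') \<le> norm (A (\<Psi> x) *v v' - v') + norm v'"
            using norm_triangle_ineq[of "A (\<Psi> x) *v v' - v'" v'] by simp
          ultimately have "norm (A (\<Psi> x) *v v') \<le> 3" using nv by simp
          then have "norm (A (\<Psi> x) *v v') * norm w' \<le> 3 * 2" using nv by (intro mult_mono) auto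
          then show ?thesis using Cauchy_Schwarz_ineq2[of "A (\<Psi> x) *v v'" w'] by (simp add: L_def)
        qed
        have "(\<rho> x)\<^sup>2 * pushforward_metric U \<theta> g x v w - euclidean_metric x v w = ((\<sigma> x)\<^sup>2 - 1) * L + (L - v \<bullet> w)"
          unfolding h_push[OF xU, symmetric] by (simp add: h_def L_def v'_def w'_def euclidean_metric_def algebra_simps)
        also have "\<bar>\<dots>\<bar> \<le> (2 * C * C * s * (C + 1)) * 6 + ((C0 * (1 + C) ^ k * 2 + C) * 2 + C) * s"
        proof (rule order_trans[OF abs_triangle_ineq add_mono[OF _ L1]])
          show "\<bar>((\<sigma> x)\<^sup>2 - 1) * L\<bar> \<le> (2 * C * C * s * (C + 1)) * 6"
            unfolding abs_mult using C s by (intro mult_mono[OF \<sigma>2 L2]) auto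
        qed
        also have "\<dots> = M1 * s" by (simp add: M1_def algebra_simps)
        finally show "\<bar>(\<rho> x)\<^sup>2 * pushforward_metric U \<theta> g x v w - euclidean_metric x v w\<bar> \<le> M1 * s" .
      qed
      moreover have "tensor2_norm (\<lambda>v w. (\<rho> x)\<^sup>2 * pushforward_metric U \<theta> g x v w - euclidean_metric x v w) \<ge> 0"
        unfolding tensor2_norm_def by (intro real_sqrt_ge_zero sum_nonneg) auto
      ultimately show "\<bar>tensor2_norm (\<lambda>v w. (\<rho> x)\<^sup>2 * pushforward_metric U \<theta> g x v w - euclidean_metric x v w)\<bar>
          \<le> real CARD('n) * M1 * (1 - norm x) ^ k" by (simp add: s_def mult.assoc)
    qed (use M1 in simp)
  qed
  have "pushforward \<Theta> \<gamma> \<in> metric_germs"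
    unfolding pf metric_germs_def by (rule quotientI[OF pm])
  then have "pushforward \<Theta> \<gamma> \<in> G k"
    unfolding G_def using self hR h_push bound by blast
  with I trans show thesis by (rule that)
qed

lemma id_germ_I0: "id_germ \<in> (I0 m :: 'n::finite diffeo_germ set)"
  and id_germ_rep: "nbhd_infinity U \<Longrightarrow> (U, \<lambda>x. x) \<in> (id_germ :: 'n::finite diffeo_germ)"
proof -
  have n: "nbhd_infinity (ball (0::real^'n) 1)" unfolding nbhd_infinity_def by (auto intro: exI[of _ 1])
  have rep: "(U, \<lambda>x. x) \<in> diffeo_reps" if U: "nbhd_infinity U" for U :: "(real^'n) set"
  proof -
    have s: "smooth_on S (\<lambda>x. x)" for S :: "(real^'n) set"
      by (rule smooth_on_smooth[of UNIV "\<lambda>x. x"]) (auto intro: smooth_id)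
    have "smooth_on (tilde U) (inv_into (tilde U) (\<lambda>x. x))"
      by (rule smooth_on_smooth[of UNIV "\<lambda>x. x"]) (auto intro: smooth_id simp: inv_into_f_f[of "\<lambda>x. x", simplified])
    then show ?thesis using U s by (auto simp: diffeo_reps_def)
  qed
  have rel: "((ball 0 1, \<lambda>x. x), (U, \<lambda>x. x)) \<in> diffeo_germ_rel" if "nbhd_infinity U" for U :: "(real^'n) set"
    using rep[OF n] rep[OF that] that by (auto simp: diffeo_germ_rel_def nbhd_infinity_iff)
  then show mem: "(U, \<lambda>x. x) \<in> (id_germ :: 'n diffeo_germ)" if "nbhd_infinity U" for U
    using that by (simp add: id_germ_def)
  have "(id_germ :: 'n diffeo_germ) \<in> diffeo_germs"
    unfolding id_germ_def diffeo_germs_def by (rule quotientI[OF rep[OF n]])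
  moreover have "(\<lambda>x::real^'n. norm (x - x)) \<in> O[near_infinity](\<lambda>x. \<rho> x ^ m)" by simp
  ultimately show "id_germ \<in> (I0 m :: 'n diffeo_germ set)"
    unfolding I0_def by (intro CollectI conjI bexI[OF _ mem[OF n]]) simp_all
qed

text \<open>Turns transversality of a germ into transversality of its pushforward by
  \<open>id_germ\<close>, the form in which uniqueness can be applied.\<close>

lemma pushforward_id:
  assumes \<gamma>: "\<gamma> \<in> metric_germs"
  shows "pushforward id_germ \<gamma> = \<gamma>"
proof -
  obtain U g where m: "(U, g) \<in> metric_reps" and \<gamma>_eq: "\<gamma> = metric_germ_rel `` {(U, g)}"
    using \<gamma> unfolding metric_germs_def by (auto elim!: quotientE)
  have r: "(U, g) \<in> \<gamma>" unfolding \<gamma>_eq by (rule equiv_class_self[OF equiv_metric_germ_rel m])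
  have n: "nbhd_infinity U" using m by (simp add: metric_reps_def)
  have m1: "(1::nat) > 0" by simp
  interpret b: boundary_diffeo U "\<lambda>x. x" by (rule I0_boundary_diffeo[OF id_germ_I0 m1 id_germ_rep[OF n]])
  have "pushforward_metric U (\<lambda>x. x) g x = g x" if x: "x \<in> U" for x
  proof -
    have "(b.\<psi> has_derivative (\<lambda>v. v)) (at x)"
      by (rule has_derivative_transform_within_open[OF has_derivative_ident b.U(1) x]) (simp add: b.\<psi>_\<theta>)
    then have "frechet_derivative b.\<psi> (at x) = (\<lambda>v. v)" by (rule frechet_derivative_eqI)
    then show ?thesis by (intro ext) (simp add: b.push_eq b.\<psi>_\<theta>[OF x])
  qed
  then have "((U, pushforward_metric U (\<lambda>x. x) g), (U, g)) \<in> metric_germ_rel"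
    using b.push_metric_reps[OF m] m n by (auto simp: metric_germ_rel_def)
  then show ?thesis
    unfolding \<gamma>_eq using pushforward_eq[OF id_germ_I0 m1 \<gamma> id_germ_rep[OF n] r] equiv_class_eq[OF equiv_metric_germ_rel]
    by (simp add: \<gamma>_eq)
qed

text \<open>\<open>transverse_exists\<close> puts the pushforward into \<open>G k\<close> for the
  one germ it constructs; by uniqueness this covers every germ in question. The last clause is
  uniqueness against \<open>id_germ\<close>.\<close>

theorem proposition2p7:
  fixes k :: nat and g :: "'n::finite metric_germ"
  assumes "k > 0" and "g \<in> G k"
  shows "(\<exists>!\<Theta>. \<Theta> \<in> I0 (k + 1) \<and> transverse (pushforward \<Theta> g)) \<and>
    (\<forall>\<Theta>. \<Theta> \<in> I0 (k + 1) \<and> transverse (pushforward \<Theta> g) \<longrightarrow> pushforward \<Theta> g \<in> G k) \<and>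
    (transverse g \<longrightarrow>
      (\<forall>\<Theta>. \<Theta> \<in> I0 (k + 1) \<and> transverse (pushforward \<Theta> g) \<longleftrightarrow> \<Theta> = id_germ))"
proof -
  have g: "g \<in> metric_germs" using assms(2) by (simp add: G_def)
  obtain \<Theta> where \<Theta>: "\<Theta> \<in> I0 (k + 1)" "transverse (pushforward \<Theta> g)" "pushforward \<Theta> g \<in> G k"
    using transverse_exists[OF assms] by blast
  have unique: "\<Theta>1 = \<Theta>2" if "\<Theta>1 \<in> I0 (k + 1)" "\<Theta>2 \<in> I0 (k + 1)"
    "transverse (pushforward \<Theta>1 g)" "transverse (pushforward \<Theta>2 g)" for \<Theta>1 \<Theta>2
    by (rule transverse_unique[OF that(1,2) _ g that(3,4)]) (use assms(1) in simp)
  have ex1: "\<exists>!\<Theta>. \<Theta> \<in> I0 (k + 1) \<and> transverse (pushforward \<Theta> g)"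
    using \<Theta>(1,2) unique by blast
  moreover have "pushforward \<Theta>' g \<in> G k" if "\<Theta>' \<in> I0 (k + 1)" "transverse (pushforward \<Theta>' g)" for \<Theta>'
    using unique[OF that(1) \<Theta>(1) that(2) \<Theta>(2)] \<Theta>(3) by simp
  moreover have "\<Theta>' \<in> I0 (k + 1) \<and> transverse (pushforward \<Theta>' g) \<longleftrightarrow> \<Theta>' = id_germ"
    if t: "transverse g" for \<Theta>'
  proof -
    have i: "id_germ \<in> I0 (k + 1)" "transverse (pushforward id_germ g)"
      using t id_germ_I0 by (simp_all add: pushforward_id[OF g])
    then show ?thesis using unique[OF _ i(1) _ i(2)] by blast
  qed
  ultimately show ?thesis by blast
qed

end
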